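(* Let $p$ be a prime, let $X=\mathbb G_m^2=\mathrm{Spec}\,k[u^{\pm1},v^{\pm1}]$, and fix $a,b\in k^\times$. Let $A_u$ (resp. $A_v$) be the sheaf of $\mathcal O_X$-algebras generated by $x_u,y_u$ (resp. $x_v,y_v$) with relations $$x_u^p=u,\quad y_u^p=a,\quad y_ux_u=\zeta_px_uy_u,\qquad x_v^p=v,\quad y_v^p=b,\quad y_vx_v=\zeta_px_vy_v,$$ where $\zeta_p\in k$ is a primitive $p$-th root of unity, and let $A:=A_u\otimes_{\mathcal O_X}A_v$. Then $A$ is Azumaya of degree $p^2$ on $X$, and its Brauer class $\beta:=[A]\in\mathrm{Br}(X)$ satisfies $\beta\in\mathrm{Br}(X)[p]$. Moreover, $A$ admits a global $(p,p)$-subsystem structure. Hence its Brauer class $\beta$ lies in $\mathrm{Br}_{(p,p)}(X)$.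
   Context: $k$ is an algebraically closed field of characteristic $0$ (so $\mathrm{char}(k)\nmid p$ and $k$ contains a primitive $p$-th root of unity). $\mathrm{Br}(X):=H^2_{\mathrm{fppf}}(X,\mathbb G_m)_{\mathrm{tors}}$, and $\mathrm{Br}(X)[p]$ is its $p$-torsion. $G_{(p,p)}\subset\mathrm{PGL}_{p^2}$ is the scheme-theoretic stabilizer of the Segre variety $\mathbb P^{p-1}\times\mathbb P^{p-1}\subset\mathbb P(k^p\otimes k^p)=\mathbb P^{p^2-1}$. A degree-$p^2$ Azumaya algebra $A$ corresponds to a $\mathrm{PGL}_{p^2}$-torsor $P(A)\to X$ via $A\cong P(A)\times^{\mathrm{PGL}_{p^2}}M_{p^2}(\mathcal O_X)$; a $(p,p)$-subsystem structure on $A$ is a reduction of structure group of $P(A)$ to $G_{(p,p)}$. $\mathrm{Br}_{(p,p)}(X):=\mathrm{Im}\bigl(H^1(X,G_{(p,p)})\to H^1(X,\mathrm{PGL}_{p^2})\xrightarrow{\delta}\mathrm{Br}(X)\bigr)$ (fppf cohomology), with $\delta$ the connecting map of $1\to\mathbb G_m\to\mathrm{GL}_{p^2}\to\mathrm{PGL}_{p^2}\to1$. *)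

theory Defs
  imports
    "HOL-Algebra.Algebra"
    "HOL-Algebra.Free_Abelian_Groups"
    "HOL-Algebra.Algebraic_Closure_Type"
    "HOL-Library.Product_Plus"
    "HOL-Computational_Algebra.Polynomial"
begin

section \<open>Algebras over a commutative ring\<close>

text \<open>
  Throughout, \<open>X = Spec R\<close>, and a quasi-coherent sheaf of algebras on \<open>X\<close> is given by the
  \<open>R\<close>-algebra of its global sections. The locale \<^locale>\<open>algebra\<close> describes commutative algebras;
  the following is its not necessarily commutative version.
\<close>

definition is_algebra :: "('r, 'm) ring_scheme \<Rightarrow> ('r, 'a) module \<Rightarrow> bool" where
  "is_algebra R A \<longleftrightarrow> module R A \<and> ring A \<and>
     (\<forall>r\<in>carrier R. \<forall>x\<in>carrier A. \<forall>y\<in>carrier A.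
        (r \<odot>\<^bsub>A\<^esub> x) \<otimes>\<^bsub>A\<^esub> y = r \<odot>\<^bsub>A\<^esub> (x \<otimes>\<^bsub>A\<^esub> y) \<and>
        x \<otimes>\<^bsub>A\<^esub> (r \<odot>\<^bsub>A\<^esub> y) = r \<odot>\<^bsub>A\<^esub> (x \<otimes>\<^bsub>A\<^esub> y))"

definition alg_hom ::
  "('r, 'm) ring_scheme \<Rightarrow> ('r, 'a) module \<Rightarrow> ('r, 'b) module \<Rightarrow> ('a \<Rightarrow> 'b) set" where
  "alg_hom R A B = {h \<in> ring_hom A B \<inter> extensional (carrier A).
     \<forall>r\<in>carrier R. \<forall>x\<in>carrier A. h (r \<odot>\<^bsub>A\<^esub> x) = r \<odot>\<^bsub>B\<^esub> h x}"

definition alg_iso ::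
  "('r, 'm) ring_scheme \<Rightarrow> ('r, 'a) module \<Rightarrow> ('r, 'b) module \<Rightarrow> ('a \<Rightarrow> 'b) set" where
  "alg_iso R A B = {h \<in> alg_hom R A B. bij_betw h (carrier A) (carrier B)}"

definition self_algebra :: "('r, 'm) ring_scheme \<Rightarrow> ('r, 'r) module" where
  "self_algebra R = \<lparr>carrier = carrier R, monoid.mult = monoid.mult R, monoid.one = \<one>\<^bsub>R\<^esub>,
     ring.zero = \<zero>\<^bsub>R\<^esub>, ring.add = ring.add R, module.smult = monoid.mult R\<rparr>"

subsection \<open>Tensor products and base change\<close>

definition tensor_free ::
  "('r, 'm) module \<Rightarrow> ('r, 'n) module \<Rightarrow> ('m \<times> 'n \<Rightarrow>\<^sub>0 int) monoid" where
  "tensor_free M N = free_Abelian_group (carrier M \<times> carrier N)"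

definition tensor_relations ::
  "('r, 's) ring_scheme \<Rightarrow> ('r, 'm) module \<Rightarrow> ('r, 'n) module \<Rightarrow> ('m \<times> 'n \<Rightarrow>\<^sub>0 int) set" where
  "tensor_relations R M N = generate (tensor_free M N)
    ({frag_of (x \<oplus>\<^bsub>M\<^esub> x', y) - frag_of (x, y) - frag_of (x', y) | x x' y.
        x \<in> carrier M \<and> x' \<in> carrier M \<and> y \<in> carrier N} \<union>
     {frag_of (x, y \<oplus>\<^bsub>N\<^esub> y') - frag_of (x, y) - frag_of (x, y') | x y y'.
        x \<in> carrier M \<and> y \<in> carrier N \<and> y' \<in> carrier N} \<union>
     {frag_of (r \<odot>\<^bsub>M\<^esub> x, y) - frag_of (x, r \<odot>\<^bsub>N\<^esub> y) | r x y.
        r \<in> carrier R \<and> x \<in> carrier M \<and> y \<in> carrier N})"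

definition tensor_class ::
  "('r, 's) ring_scheme \<Rightarrow> ('r, 'm) module \<Rightarrow> ('r, 'n) module \<Rightarrow>
   ('m \<times> 'n \<Rightarrow>\<^sub>0 int) \<Rightarrow> ('m \<times> 'n \<Rightarrow>\<^sub>0 int) set" where
  "tensor_class R M N z = tensor_relations R M N #>\<^bsub>tensor_free M N\<^esub> z"

definition tensor_ring ::
  "('r, 's) ring_scheme \<Rightarrow> ('r, 'a) module \<Rightarrow> ('r, 'b) module \<Rightarrow> ('a \<times> 'b \<Rightarrow>\<^sub>0 int) set ring" where
  "tensor_ring R A B =
    \<lparr>carrier = carrier (tensor_free A B Mod tensor_relations R A B),
     monoid.mult = (\<lambda>U V. \<Union>x\<in>U. \<Union>y\<in>V. tensor_class R A B
       (frag_extend (\<lambda>(a, b). frag_extend (\<lambda>(a', b').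
          frag_of (a \<otimes>\<^bsub>A\<^esub> a', b \<otimes>\<^bsub>B\<^esub> b')) y) x)),
     monoid.one = tensor_class R A B (frag_of (\<one>\<^bsub>A\<^esub>, \<one>\<^bsub>B\<^esub>)),
     ring.zero = tensor_relations R A B,
     ring.add = monoid.mult (tensor_free A B Mod tensor_relations R A B)\<rparr>"

text \<open>\<open>A \<otimes>\<^sub>R B\<close> as an \<open>R\<close>-algebra.\<close>

definition tensor_algebra ::
  "('r, 's) ring_scheme \<Rightarrow> ('r, 'a) module \<Rightarrow> ('r, 'b) module \<Rightarrow>
   ('r, ('a \<times> 'b \<Rightarrow>\<^sub>0 int) set) module" where
  "tensor_algebra R A B = ring.extend (tensor_ring R A B)
     \<lparr>module.smult = (\<lambda>r U. \<Union>x\<in>U. tensor_class R A B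
        (frag_extend (\<lambda>(a, b). frag_of (r \<odot>\<^bsub>A\<^esub> a, b)) x))\<rparr>"

text \<open>\<open>T \<otimes>\<^sub>R A\<close> as a \<open>T\<close>-algebra, and the map induced by \<open>f : T \<rightarrow> T'\<close>.\<close>

definition base_change ::
  "('r, 's) ring_scheme \<Rightarrow> ('r, 't) module \<Rightarrow> ('r, 'a) module \<Rightarrow>
   ('t, ('t \<times> 'a \<Rightarrow>\<^sub>0 int) set) module" where
  "base_change R T A = ring.extend (tensor_ring R T A)
     \<lparr>module.smult = (\<lambda>t U. \<Union>x\<in>U. tensor_class R T A
        (frag_extend (\<lambda>(t', a). frag_of (t \<otimes>\<^bsub>T\<^esub> t', a)) x))\<rparr>"

definition base_change_map ::
  "('r, 's) ring_scheme \<Rightarrow> ('r, 't) module \<Rightarrow> ('r, 'a) module \<Rightarrow> ('t \<Rightarrow> 't) \<Rightarrow>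
   ('t \<times> 'a \<Rightarrow>\<^sub>0 int) set \<Rightarrow> ('t \<times> 'a \<Rightarrow>\<^sub>0 int) set" where
  "base_change_map R T' A f U = (\<Union>x\<in>U. tensor_class R T' A
     (frag_extend (\<lambda>(t, a). frag_of (f t, a)) x))"

subsection \<open>Matrix algebras\<close>

type_synonym 't matrix = "nat \<Rightarrow> nat \<Rightarrow> 't"

definition mat_alg :: "nat \<Rightarrow> ('t, 'm) ring_scheme \<Rightarrow> ('t, 't matrix) module" where
  "mat_alg n T =
    \<lparr>carrier = {..<n} \<rightarrow>\<^sub>E {..<n} \<rightarrow>\<^sub>E carrier T,
     monoid.mult = (\<lambda>M N. \<lambda>i\<in>{..<n}. \<lambda>j\<in>{..<n}. \<Oplus>\<^bsub>T\<^esub>l\<in>{..<n}. M i l \<otimes>\<^bsub>T\<^esub> N l j),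
     monoid.one = (\<lambda>i\<in>{..<n}. \<lambda>j\<in>{..<n}. if i = j then \<one>\<^bsub>T\<^esub> else \<zero>\<^bsub>T\<^esub>),
     ring.zero = (\<lambda>i\<in>{..<n}. \<lambda>j\<in>{..<n}. \<zero>\<^bsub>T\<^esub>),
     ring.add = (\<lambda>M N. \<lambda>i\<in>{..<n}. \<lambda>j\<in>{..<n}. M i j \<oplus>\<^bsub>T\<^esub> N i j),
     module.smult = (\<lambda>t M. \<lambda>i\<in>{..<n}. \<lambda>j\<in>{..<n}. t \<otimes>\<^bsub>T\<^esub> M i j)\<rparr>"

definition mat_map :: "nat \<Rightarrow> ('t \<Rightarrow> 't) \<Rightarrow> 't matrix \<Rightarrow> 't matrix" where
  "mat_map n f M = (\<lambda>i\<in>{..<n}. \<lambda>j\<in>{..<n}. f (M i j))"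

section \<open>The fppf site of \<open>Spec R\<close>\<close>

text \<open>
  The objects are commutative \<open>R\<close>-algebras whose carrier is a set of elements of the type of \<open>R\<close>.
  If that type is infinite and is the carrier of \<open>R\<close> (the only case that is used), then every
  \<open>R\<close>-algebra of finite presentation has at most the cardinality of \<open>R\<close>, hence an isomorphic copy
  among these objects.
\<close>

type_synonym 'r alg = "('r, 'r) module"

definition restrict_scalars :: "('r \<Rightarrow> 'r) \<Rightarrow> 'r alg \<Rightarrow> 'r alg" where
  "restrict_scalars f T' = T'\<lparr>module.smult := (\<lambda>t x. f t \<otimes>\<^bsub>T'\<^esub> x)\<rparr>"

text \<open>
  \<open>M \<otimes>\<^sub>T T' \<rightarrow> N \<otimes>\<^sub>T T'\<close> is injective for every injective \<open>T\<close>-linear map \<open>M \<rightarrow> N\<close>. Restricting the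
  carriers of \<open>M\<close> and \<open>N\<close> to subsets of the type of \<open>T\<close> is harmless: the inclusions \<open>I \<subseteq> T\<close> of
  ideals suffice to test flatness.
\<close>

definition flat_hom :: "'r alg \<Rightarrow> 'r alg \<Rightarrow> ('r \<Rightarrow> 'r) \<Rightarrow> bool" where
  "flat_hom T T' f \<longleftrightarrow>
    (\<forall>(M :: 'r alg) (N :: 'r alg) h.
       module T M \<and> module T N \<and> h \<in> carrier M \<rightarrow> carrier N \<and> inj_on h (carrier M) \<and>
       (\<forall>x\<in>carrier M. \<forall>y\<in>carrier M. h (x \<oplus>\<^bsub>M\<^esub> y) = h x \<oplus>\<^bsub>N\<^esub> h y) \<and>
       (\<forall>t\<in>carrier T. \<forall>x\<in>carrier M. h (t \<odot>\<^bsub>M\<^esub> x) = t \<odot>\<^bsub>N\<^esub> h x) \<longrightarrow>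
       (\<forall>z\<in>carrier (tensor_free M (restrict_scalars f T')).
          frag_extend (\<lambda>(x, t). frag_of (h x, t)) z
            \<in> tensor_relations T N (restrict_scalars f T') \<longrightarrow>
          z \<in> tensor_relations T M (restrict_scalars f T')))"

definition mpoly_ring :: "('r, 'm) ring_scheme \<Rightarrow> nat \<Rightarrow> ((nat \<Rightarrow>\<^sub>0 nat) \<Rightarrow> 'r) ring" where
  "mpoly_ring T n =
    \<lparr>carrier = {P. range P \<subseteq> carrier T \<and> finite {m. P m \<noteq> \<zero>\<^bsub>T\<^esub>} \<and>
       (\<forall>m. P m \<noteq> \<zero>\<^bsub>T\<^esub> \<longrightarrow> Poly_Mapping.keys m \<subseteq> {..<n})},
     monoid.mult = (\<lambda>P Q m. \<Oplus>\<^bsub>T\<^esub>d\<in>{d. fst d + snd d = m}. P (fst d) \<otimes>\<^bsub>T\<^esub> Q (snd d)),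
     monoid.one = (\<lambda>m. if m = 0 then \<one>\<^bsub>T\<^esub> else \<zero>\<^bsub>T\<^esub>),
     ring.zero = (\<lambda>m. \<zero>\<^bsub>T\<^esub>),
     ring.add = (\<lambda>P Q m. P m \<oplus>\<^bsub>T\<^esub> Q m)\<rparr>"

definition finitely_presented :: "'r alg \<Rightarrow> 'r alg \<Rightarrow> ('r \<Rightarrow> 'r) \<Rightarrow> bool" where
  "finitely_presented T T' f \<longleftrightarrow>
    (\<exists>n \<phi> F. \<phi> \<in> ring_hom (mpoly_ring T n) T' \<and>
       \<phi> ` carrier (mpoly_ring T n) = carrier T' \<and>
       (\<forall>t\<in>carrier T. \<phi> (\<lambda>m. if m = 0 then t else \<zero>\<^bsub>T\<^esub>) = f t) \<and>
       finite F \<and> F \<subseteq> carrier (mpoly_ring T n) \<and>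
       a_kernel (mpoly_ring T n) T' \<phi> = genideal (mpoly_ring T n) F)"

definition fppf_covering ::
  "('r, 'm) ring_scheme \<Rightarrow> 'r alg \<Rightarrow> ('r alg \<times> ('r \<Rightarrow> 'r)) set \<Rightarrow> bool" where
  "fppf_covering R T C \<longleftrightarrow> finite C \<and>
    (\<forall>(T', f)\<in>C. algebra R T' \<and> f \<in> alg_hom R T T' \<and> flat_hom T T' f \<and>
       finitely_presented T T' f) \<and>
    (\<forall>P. primeideal P T \<longrightarrow>
       (\<exists>(T', f)\<in>C. \<exists>Q. primeideal Q T' \<and> P = {t \<in> carrier T. f t \<in> Q}))"

text \<open>Coverings of \<open>X\<close> itself by a single affine scheme; these are cofinal.\<close>

definition cover_alg :: "('r, 'm) ring_scheme \<Rightarrow> 'r alg \<Rightarrow> bool" where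
  "cover_alg R S \<longleftrightarrow> (\<exists>f. fppf_covering R (self_algebra R) {(S, f)})"

section \<open>Presheaves of groups\<close>

record ('r, 'g) gpresheaf =
  sect :: "'r alg \<Rightarrow> 'g monoid"
  gres :: "'r alg \<Rightarrow> 'r alg \<Rightarrow> ('r \<Rightarrow> 'r) \<Rightarrow> 'g \<Rightarrow> 'g"

definition Gm :: "('r, 'r) gpresheaf" where
  "Gm = \<lparr>sect = (\<lambda>T. units_of T), gres = (\<lambda>T T' f. f)\<rparr>"

definition GL :: "nat \<Rightarrow> ('r, 'r matrix) gpresheaf" where
  "GL n = \<lparr>sect = (\<lambda>T. units_of (mat_alg n T)), gres = (\<lambda>T T' f. mat_map n f)\<rparr>"

text \<open>
  \<open>PGL\<^sub>n(T)\<close> is the group of \<open>T\<close>-algebra automorphisms of \<open>M\<^sub>n(T)\<close>. As an fppf sheaf it is the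
  quotient of \<open>GL\<^sub>n\<close> by \<open>\<G>\<^sub>m\<close> via \<^term>\<open>inner_aut\<close> below.
\<close>

definition PGL_res ::
  "nat \<Rightarrow> 'r alg \<Rightarrow> 'r alg \<Rightarrow> ('r \<Rightarrow> 'r) \<Rightarrow> ('r matrix \<Rightarrow> 'r matrix) \<Rightarrow> 'r matrix \<Rightarrow> 'r matrix" where
  "PGL_res n T T' f g = (THE g'. g' \<in> alg_iso T' (mat_alg n T') (mat_alg n T') \<and>
     (\<forall>M\<in>carrier (mat_alg n T). g' (mat_map n f M) = mat_map n f (g M)))"

definition PGL :: "nat \<Rightarrow> ('r, 'r matrix \<Rightarrow> 'r matrix) gpresheaf" where
  "PGL n =
    \<lparr>sect = (\<lambda>T. \<lparr>carrier = alg_iso T (mat_alg n T) (mat_alg n T),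
       monoid.mult = compose (carrier (mat_alg n T)),
       monoid.one = (\<lambda>M\<in>carrier (mat_alg n T). M)\<rparr>),
     gres = PGL_res n\<rparr>"

definition inner_aut :: "nat \<Rightarrow> 'r alg \<Rightarrow> 'r matrix \<Rightarrow> 'r matrix \<Rightarrow> 'r matrix" where
  "inner_aut n T c = (\<lambda>M\<in>carrier (mat_alg n T).
     c \<otimes>\<^bsub>mat_alg n T\<^esub> M \<otimes>\<^bsub>mat_alg n T\<^esub> inv\<^bsub>mat_alg n T\<^esub> c)"

subsection \<open>The stabilizer of the Segre variety\<close>

definition unimodular :: "('t, 'm) ring_scheme \<Rightarrow> nat \<Rightarrow> (nat \<Rightarrow> 't) \<Rightarrow> bool" where
  "unimodular T n z \<longleftrightarrow> z \<in> {..<n} \<rightarrow>\<^sub>E carrier T \<and>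
     (\<exists>c\<in>{..<n} \<rightarrow> carrier T. (\<Oplus>\<^bsub>T\<^esub>i\<in>{..<n}. c i \<otimes>\<^bsub>T\<^esub> z i) = \<one>\<^bsub>T\<^esub>)"

text \<open>
  A unimodular vector \<open>z\<close> of length \<open>n\<close> spans a rank one direct summand of \<open>T\<^sup>n\<close>, that is, a
  \<open>T\<close>-point of projective space, and every \<open>T\<close>-point is locally of this form. The basis vector
  \<open>e\<^sub>i \<otimes> e\<^sub>j\<close> of \<open>k\<^sup>p \<otimes> k\<^sup>p\<close> has index \<open>i * p + j\<close>. The point \<open>z\<close> lies in the image of the Segre
  embedding iff it is locally of the form \<open>v \<otimes> w\<close>: there are \<open>s\<^sub>1, \<dots>, s\<^sub>m\<close> generating the unit
  ideal such that over \<open>T[1/s\<^sub>i]\<close> the vector \<open>z\<close> is a pure tensor up to the unit \<open>s\<^sub>i\<close>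
  (denominators have been cleared).
\<close>

definition segre_cone :: "nat \<Rightarrow> ('t, 'm) ring_scheme \<Rightarrow> (nat \<Rightarrow> 't) set" where
  "segre_cone p T = {z. unimodular T (p * p) z \<and>
     (\<exists>m s v w. unimodular T m s \<and>
        (\<forall>i<m. v i \<in> {..<p} \<rightarrow> carrier T \<and> w i \<in> {..<p} \<rightarrow> carrier T \<and>
           (\<forall>l<p * p. s i \<otimes>\<^bsub>T\<^esub> z l = v i (l div p) \<otimes>\<^bsub>T\<^esub> w i (l mod p))))}"

definition mat_vec ::
  "('t, 'm) ring_scheme \<Rightarrow> nat \<Rightarrow> 't matrix \<Rightarrow> (nat \<Rightarrow> 't) \<Rightarrow> nat \<Rightarrow> 't" where
  "mat_vec T n M z = (\<lambda>i\<in>{..<n}. \<Oplus>\<^bsub>T\<^esub>j\<in>{..<n}. M i j \<otimes>\<^bsub>T\<^esub> z j)"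

text \<open>
  \<open>G\<^sub>(\<^sub>p\<^sub>,\<^sub>p\<^sub>)(T)\<close> consists of those \<open>g \<in> PGL\<^bsub>p\<^sup>2\<^esub>(T)\<close> that map the Segre variety over \<open>T\<close> onto itself.
  An element of \<open>PGL\<^bsub>p\<^sup>2\<^esub>\<close> acts on points of projective space through its local lifts to
  \<open>GL\<^bsub>p\<^sup>2\<^esub>\<close>, so the condition is imposed on all lifts over all \<open>T\<close>-algebras.
\<close>

definition G_pp :: "('r, 'm) ring_scheme \<Rightarrow> nat \<Rightarrow> ('r, 'r matrix \<Rightarrow> 'r matrix) gpresheaf" where
  "G_pp R p =
    \<lparr>sect = (\<lambda>T. (sect (PGL (p * p)) T)\<lparr>carrier :=
       {g \<in> carrier (sect (PGL (p * p)) T).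
          \<forall>T' f c. algebra R T' \<and> f \<in> alg_hom R T T' \<and>
            c \<in> carrier (sect (GL (p * p)) T') \<and>
            inner_aut (p * p) T' c = gres (PGL (p * p)) T T' f g \<longrightarrow>
            mat_vec T' (p * p) c ` segre_cone p T' = segre_cone p T'}\<rparr>),
     gres = gres (PGL (p * p))\<rparr>"

section \<open>Nonabelian \<open>H\<^sup>1\<close>\<close>

text \<open>
  By the Yoneda lemma, a section over the \<open>(m + 1)\<close>-fold fibre product of \<open>Spec S\<close> over \<open>X\<close> is a
  natural family indexed by the objects \<open>T\<close> and \<open>(m + 1)\<close>-tuples of homomorphisms \<open>S \<rightarrow> T\<close>. Cech
  cochains are given in this form. A class is represented by a pair \<open>(S, g)\<close> of a covering and a
  cocycle; cohomologous cocycles and the pullbacks to finer coverings are identified.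
\<close>

type_synonym ('r, 'g) cochain0 = "'r alg \<Rightarrow> ('r \<Rightarrow> 'r) \<Rightarrow> 'g"
type_synonym ('r, 'g) cochain1 = "'r alg \<Rightarrow> ('r \<Rightarrow> 'r) \<Rightarrow> ('r \<Rightarrow> 'r) \<Rightarrow> 'g"

definition is_cochain0 ::
  "('r, 'm) ring_scheme \<Rightarrow> ('r, 'g) gpresheaf \<Rightarrow> 'r alg \<Rightarrow> ('r, 'g) cochain0 \<Rightarrow> bool" where
  "is_cochain0 R G S b \<longleftrightarrow>
    (\<forall>T x. algebra R T \<and> x \<in> alg_hom R S T \<longrightarrow> b T x \<in> carrier (sect G T) \<and>
       (\<forall>T' f. algebra R T' \<and> f \<in> alg_hom R T T' \<longrightarrow>
          gres G T T' f (b T x) = b T' (compose (carrier S) f x)))"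

definition Z1 ::
  "('r, 'm) ring_scheme \<Rightarrow> ('r, 'g) gpresheaf \<Rightarrow> ('r alg \<times> ('r, 'g) cochain1) set" where
  "Z1 R G = {(S, g). cover_alg R S \<and>
    (\<forall>T. algebra R T \<longrightarrow>
      (\<forall>x\<in>alg_hom R S T. \<forall>y\<in>alg_hom R S T.
         g T x y \<in> carrier (sect G T) \<and>
         (\<forall>T' f. algebra R T' \<and> f \<in> alg_hom R T T' \<longrightarrow>
            gres G T T' f (g T x y)
              = g T' (compose (carrier S) f x) (compose (carrier S) f y)) \<and>
         (\<forall>z\<in>alg_hom R S T. g T x y \<otimes>\<^bsub>sect G T\<^esub> g T y z = g T x z)))}"

definition H1_step ::
  "('r, 'm) ring_scheme \<Rightarrow> ('r, 'g) gpresheaf \<Rightarrow>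
   (('r alg \<times> ('r, 'g) cochain1) \<times> ('r alg \<times> ('r, 'g) cochain1)) set" where
  "H1_step R G = {((S, g), (S', g')). (S, g) \<in> Z1 R G \<and> (S', g') \<in> Z1 R G \<and>
    (\<exists>h b. h \<in> alg_hom R S S' \<and> is_cochain0 R G S' b \<and>
      (\<forall>T. algebra R T \<longrightarrow> (\<forall>x\<in>alg_hom R S' T. \<forall>y\<in>alg_hom R S' T.
         g' T x y = inv\<^bsub>sect G T\<^esub> (b T x) \<otimes>\<^bsub>sect G T\<^esub>
           g T (compose (carrier S) x h) (compose (carrier S) y h) \<otimes>\<^bsub>sect G T\<^esub> b T y)))}"

definition H1_equiv ::
  "('r, 'm) ring_scheme \<Rightarrow> ('r, 'g) gpresheaf \<Rightarrow>
   (('r alg \<times> ('r, 'g) cochain1) \<times> ('r alg \<times> ('r, 'g) cochain1)) set" where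
  "H1_equiv R G = (H1_step R G \<union> (H1_step R G)\<inverse>)\<^sup>*"

definition H1 ::
  "('r, 'm) ring_scheme \<Rightarrow> ('r, 'g) gpresheaf \<Rightarrow> ('r alg \<times> ('r, 'g) cochain1) set set" where
  "H1 R G = Z1 R G // H1_equiv R G"

text \<open>
  The map \<open>H\<^sup>1(X, G) \<rightarrow> H\<^sup>1(X, G')\<close> for a subgroup sheaf \<open>G\<close> of \<open>G'\<close>: the class in \<open>H\<^sup>1(X, G')\<close> of
  the cocycles in the given class.
\<close>

definition H1_incl ::
  "('r, 'm) ring_scheme \<Rightarrow> ('r, 'g) gpresheaf \<Rightarrow>
   ('r alg \<times> ('r, 'g) cochain1) set \<Rightarrow> ('r alg \<times> ('r, 'g) cochain1) set" where
  "H1_incl R G' \<xi> = H1_equiv R G' `` \<xi>"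

section \<open>Abelian \<open>H\<^sup>2\<close> and the Brauer group\<close>

text \<open>
  Sheaf cohomology on a site is the colimit of the cohomology of hypercoverings (Verdier); for
  \<open>H\<^sup>2\<close> the hypercoverings that are 1-coskeletal suffice. Such a hypercovering is given by a covering
  \<open>K\<^sub>0 = Spec S\<close> of \<open>X\<close> and a presheaf \<open>K\<^sub>1\<close> over \<open>K\<^sub>0 \<times> K\<^sub>0\<close> for which \<open>K\<^sub>1 \<rightarrow> K\<^sub>0 \<times> K\<^sub>0\<close> is locally
  surjective; \<open>edges K T x y\<close> is the fibre of \<open>K\<^sub>1(T)\<close> over \<open>(x, y)\<close>. No degeneracies are required,
  since they play no role for the unnormalized cochain complex. Taking all fibres to be singletons
  gives the Cech complex of \<open>S\<close>.
\<close>

record ('r, 'e) hypercover =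
  verts :: "'r alg"
  edges :: "'r alg \<Rightarrow> ('r \<Rightarrow> 'r) \<Rightarrow> ('r \<Rightarrow> 'r) \<Rightarrow> 'e set"
  eres :: "'r alg \<Rightarrow> 'r alg \<Rightarrow> ('r \<Rightarrow> 'r) \<Rightarrow> 'e \<Rightarrow> 'e"

abbreviation vert_hom ::
  "('r, 'm) ring_scheme \<Rightarrow> ('r, 'e) hypercover \<Rightarrow> 'r alg \<Rightarrow> ('r \<Rightarrow> 'r) set" where
  "vert_hom R K T \<equiv> alg_hom R (verts K) T"

abbreviation vert_res ::
  "('r, 'e) hypercover \<Rightarrow> ('r \<Rightarrow> 'r) \<Rightarrow> ('r \<Rightarrow> 'r) \<Rightarrow> ('r \<Rightarrow> 'r)" where
  "vert_res K f x \<equiv> compose (carrier (verts K)) f x"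

definition is_hypercover :: "('r, 'm) ring_scheme \<Rightarrow> ('r, 'e) hypercover \<Rightarrow> bool" where
  "is_hypercover R K \<longleftrightarrow> cover_alg R (verts K) \<and>
    (\<forall>T. algebra R T \<longrightarrow> (\<forall>x\<in>vert_hom R K T. \<forall>y\<in>vert_hom R K T.
      (\<forall>T' f. algebra R T' \<and> f \<in> alg_hom R T T' \<longrightarrow>
         eres K T T' f \<in> edges K T x y \<rightarrow> edges K T' (vert_res K f x) (vert_res K f y)) \<and>
      (\<forall>e\<in>edges K T x y. eres K T T (\<lambda>t\<in>carrier T. t) e = e \<and>
         (\<forall>T' f T'' f'. algebra R T' \<and> f \<in> alg_hom R T T' \<and>
            algebra R T'' \<and> f' \<in> alg_hom R T' T'' \<longrightarrow>
            eres K T' T'' f' (eres K T T' f e) = eres K T T'' (compose (carrier T) f' f) e)) \<and>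
      (\<exists>C. fppf_covering R T C \<and>
         (\<forall>(T', f)\<in>C. edges K T' (vert_res K f x) (vert_res K f y) \<noteq> {}))))"

type_synonym ('r, 'e, 'g) ecochain1 =
  "'r alg \<Rightarrow> ('r \<Rightarrow> 'r) \<Rightarrow> ('r \<Rightarrow> 'r) \<Rightarrow> 'e \<Rightarrow> 'g"

type_synonym ('r, 'e, 'g) ecochain2 =
  "'r alg \<Rightarrow> ('r \<Rightarrow> 'r) \<Rightarrow> ('r \<Rightarrow> 'r) \<Rightarrow> ('r \<Rightarrow> 'r) \<Rightarrow> 'e \<Rightarrow> 'e \<Rightarrow> 'e \<Rightarrow> 'g"

text \<open>
  A triangle with vertices \<open>x\<close>, \<open>y\<close>, \<open>z\<close> has the edges \<open>a\<close> from \<open>x\<close> to \<open>y\<close>, \<open>b\<close> from \<open>y\<close> to \<open>z\<close> and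
  \<open>c\<close> from \<open>x\<close> to \<open>z\<close>, in this order.
\<close>

definition triangles ::
  "('r, 'm) ring_scheme \<Rightarrow> ('r, 'e) hypercover \<Rightarrow>
   ('r alg \<times> ('r \<Rightarrow> 'r) \<times> ('r \<Rightarrow> 'r) \<times> ('r \<Rightarrow> 'r) \<times> 'e \<times> 'e \<times> 'e) set" where
  "triangles R K = {(T, x, y, z, a, b, c). algebra R T \<and>
     x \<in> vert_hom R K T \<and> y \<in> vert_hom R K T \<and> z \<in> vert_hom R K T \<and>
     a \<in> edges K T x y \<and> b \<in> edges K T y z \<and> c \<in> edges K T x z}"

definition is_ecochain1 ::
  "('r, 'm) ring_scheme \<Rightarrow> ('r, 'g) gpresheaf \<Rightarrow> ('r, 'e) hypercover \<Rightarrow>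
   ('r, 'e, 'g) ecochain1 \<Rightarrow> bool" where
  "is_ecochain1 R F K w \<longleftrightarrow>
    (\<forall>T. algebra R T \<longrightarrow> (\<forall>x\<in>vert_hom R K T. \<forall>y\<in>vert_hom R K T. \<forall>a\<in>edges K T x y.
       w T x y a \<in> carrier (sect F T) \<and>
       (\<forall>T' f. algebra R T' \<and> f \<in> alg_hom R T T' \<longrightarrow>
          gres F T T' f (w T x y a)
            = w T' (vert_res K f x) (vert_res K f y) (eres K T T' f a))))"

definition Z2 ::
  "('r, 'm) ring_scheme \<Rightarrow> ('r, 'g) gpresheaf \<Rightarrow>
   (('r, 'e) hypercover \<times> ('r, 'e, 'g) ecochain2) set" where
  "Z2 R F = {(K, w). is_hypercover R K \<and>
    (\<forall>(T, x, y, z, a, b, c)\<in>triangles R K.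
       w T x y z a b c \<in> carrier (sect F T) \<and>
       (\<forall>T' f. algebra R T' \<and> f \<in> alg_hom R T T' \<longrightarrow>
          gres F T T' f (w T x y z a b c)
            = w T' (vert_res K f x) (vert_res K f y) (vert_res K f z)
                (eres K T T' f a) (eres K T T' f b) (eres K T T' f c))) \<and>
    (\<forall>T x0 x1 x2 x3 e01 e02 e03 e12 e13 e23.
       (T, x0, x1, x2, e01, e12, e02) \<in> triangles R K \<and>
       (T, x0, x1, x3, e01, e13, e03) \<in> triangles R K \<and>
       (T, x0, x2, x3, e02, e23, e03) \<in> triangles R K \<and>
       (T, x1, x2, x3, e12, e23, e13) \<in> triangles R K \<longrightarrow>
       w T x1 x2 x3 e12 e23 e13 \<otimes>\<^bsub>sect F T\<^esub> w T x0 x1 x3 e01 e13 e03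
         = w T x0 x2 x3 e02 e23 e03 \<otimes>\<^bsub>sect F T\<^esub> w T x0 x1 x2 e01 e12 e02)}"

definition is_coboundary2 ::
  "('r, 'm) ring_scheme \<Rightarrow> ('r, 'g) gpresheaf \<Rightarrow> ('r, 'e) hypercover \<Rightarrow>
   ('r, 'e, 'g) ecochain2 \<Rightarrow> bool" where
  "is_coboundary2 R F K w \<longleftrightarrow> (\<exists>u. is_ecochain1 R F K u \<and>
    (\<forall>(T, x, y, z, a, b, c)\<in>triangles R K.
       w T x y z a b c = u T y z b \<otimes>\<^bsub>sect F T\<^esub> inv\<^bsub>sect F T\<^esub> (u T x z c) \<otimes>\<^bsub>sect F T\<^esub> u T x y a))"

text \<open>\<open>w'\<close> is the pullback of \<open>w\<close> along some morphism of hypercoverings \<open>K' \<rightarrow> K\<close>.\<close>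

definition is_pullback2 ::
  "('r, 'm) ring_scheme \<Rightarrow> ('r, 'e) hypercover \<Rightarrow> ('r, 'e, 'g) ecochain2 \<Rightarrow>
   ('r, 'e) hypercover \<Rightarrow> ('r, 'e, 'g) ecochain2 \<Rightarrow> bool" where
  "is_pullback2 R K w K' w' \<longleftrightarrow>
    (\<exists>h \<epsilon>. h \<in> alg_hom R (verts K) (verts K') \<and>
      (\<forall>T. algebra R T \<longrightarrow> (\<forall>x\<in>vert_hom R K' T. \<forall>y\<in>vert_hom R K' T. \<forall>a\<in>edges K' T x y.
         \<epsilon> T x y a \<in> edges K T (vert_res K x h) (vert_res K y h) \<and>
         (\<forall>T' f. algebra R T' \<and> f \<in> alg_hom R T T' \<longrightarrow>
            eres K T T' f (\<epsilon> T x y a)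
              = \<epsilon> T' (vert_res K' f x) (vert_res K' f y) (eres K' T T' f a)))) \<and>
      (\<forall>(T, x, y, z, a, b, c)\<in>triangles R K'.
         w' T x y z a b c
           = w T (vert_res K x h) (vert_res K y h) (vert_res K z h)
               (\<epsilon> T x y a) (\<epsilon> T y z b) (\<epsilon> T x z c)))"

text \<open>
  \<open>H\<^sup>2(X, F)\<close>: the colimit, in abelian groups, of the groups of 2-cocycles modulo 2-coboundaries of
  the hypercoverings, presented by generators \<open>(K, w)\<close> and relations. The first set of relations makes
  \<open>w \<mapsto> (K, w)\<close> additive, the second kills coboundaries, the third identifies a cocycle with its
  pullbacks. The group is written multiplicatively.
\<close>

definition H2_free ::
  "('r, 'm) ring_scheme \<Rightarrow> ('r, 'g) gpresheaf \<Rightarrow>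
   (('r, 'e) hypercover \<times> ('r, 'e, 'g) ecochain2 \<Rightarrow>\<^sub>0 int) monoid" where
  "H2_free R F = free_Abelian_group (Z2 R F)"

definition H2_relations ::
  "('r, 'm) ring_scheme \<Rightarrow> ('r, 'g) gpresheaf \<Rightarrow>
   (('r, 'e) hypercover \<times> ('r, 'e, 'g) ecochain2 \<Rightarrow>\<^sub>0 int) set" where
  "H2_relations R F = generate (H2_free R F)
    ({frag_of (K, w'') - frag_of (K, w) - frag_of (K, w') | K w w' w''.
        (K, w) \<in> Z2 R F \<and> (K, w') \<in> Z2 R F \<and> (K, w'') \<in> Z2 R F \<and>
        (\<forall>(T, x, y, z, a, b, c)\<in>triangles R K.
           w'' T x y z a b c = w T x y z a b c \<otimes>\<^bsub>sect F T\<^esub> w' T x y z a b c)} \<union>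
     {frag_of (K, w) | K w. (K, w) \<in> Z2 R F \<and> is_coboundary2 R F K w} \<union>
     {frag_of (K', w') - frag_of (K, w) | K w K' w'.
        (K, w) \<in> Z2 R F \<and> (K', w') \<in> Z2 R F \<and> is_pullback2 R K w K' w'})"

definition H2 ::
  "('r, 'm) ring_scheme \<Rightarrow> ('r, 'g) gpresheaf \<Rightarrow>
   (('r, 'e) hypercover \<times> ('r, 'e, 'g) ecochain2 \<Rightarrow>\<^sub>0 int) set monoid" where
  "H2 R F = H2_free R F Mod H2_relations R F"

definition H2_class ::
  "('r, 'm) ring_scheme \<Rightarrow> ('r, 'g) gpresheaf \<Rightarrow> ('r, 'e) hypercover \<Rightarrow>
   ('r, 'e, 'g) ecochain2 \<Rightarrow> (('r, 'e) hypercover \<times> ('r, 'e, 'g) ecochain2 \<Rightarrow>\<^sub>0 int) set" where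
  "H2_class R F K w = H2_relations R F #>\<^bsub>H2_free R F\<^esub> frag_of (K, w)"

text \<open>
  The type of edges has to be chosen large enough for all hypercoverings by algebras of finite
  presentation to be representable. Matrices over \<open>R\<close> are convenient for the connecting map.
\<close>

type_synonym 'r H2Gm =
  "(('r, 'r matrix) hypercover \<times> ('r, 'r matrix, 'r) ecochain2 \<Rightarrow>\<^sub>0 int) set"

definition Br :: "('r, 'm) ring_scheme \<Rightarrow> 'r H2Gm monoid" where
  "Br R = (H2 R Gm)\<lparr>carrier :=
     {\<eta> \<in> carrier (H2 R Gm). \<exists>m::nat. m > 0 \<and> \<eta> [^]\<^bsub>H2 R Gm\<^esub> m = \<one>\<^bsub>H2 R Gm\<^esub>}\<rparr>"

definition Br_tors :: "('r, 'm) ring_scheme \<Rightarrow> nat \<Rightarrow> 'r H2Gm set" where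
  "Br_tors R m = {\<eta> \<in> carrier (Br R). \<eta> [^]\<^bsub>Br R\<^esub> m = \<one>\<^bsub>Br R\<^esub>}"

section \<open>The connecting map \<open>\<delta> : H\<^sup>1(X, PGL\<^sub>n) \<rightarrow> H\<^sup>2(X, \<G>\<^sub>m)\<close>\<close>

text \<open>
  For a \<open>PGL\<^sub>n\<close>-cocycle \<open>g\<close> on \<open>S\<close>, the lifts of \<open>g(x, y)\<close> to \<open>GL\<^sub>n\<close> form a hypercovering, on which
  \<open>a b c\<^sup>-\<^sup>1\<close> for lifts \<open>a\<close>, \<open>b\<close>, \<open>c\<close> of \<open>g(x, y)\<close>, \<open>g(y, z)\<close>, \<open>g(x, z)\<close> is a scalar.
\<close>

definition lift_hypercover :: "nat \<Rightarrow> 'r alg \<Rightarrow> ('r, 'r matrix \<Rightarrow> 'r matrix) cochain1 \<Rightarrow>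
   ('r, 'r matrix) hypercover" where
  "lift_hypercover n S g =
    \<lparr>verts = S,
     edges = (\<lambda>T x y. {a \<in> carrier (sect (GL n) T). inner_aut n T a = g T x y}),
     eres = gres (GL n)\<rparr>"

definition lift_cocycle :: "nat \<Rightarrow> ('r, 'r matrix, 'r) ecochain2" where
  "lift_cocycle n = (\<lambda>T x y z a b c. THE t. t \<in> carrier (sect Gm T) \<and>
     t \<odot>\<^bsub>mat_alg n T\<^esub> \<one>\<^bsub>mat_alg n T\<^esub>
       = a \<otimes>\<^bsub>sect (GL n) T\<^esub> b \<otimes>\<^bsub>sect (GL n) T\<^esub> inv\<^bsub>sect (GL n) T\<^esub> c)"

text \<open>The graph of \<open>\<delta>\<close>: \<open>\<eta>\<close> is the value of \<open>\<delta>\<close> at \<open>\<xi>\<close>, computed from a cocycle representing \<open>\<xi>\<close>.\<close>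

definition is_connecting ::
  "('r, 'm) ring_scheme \<Rightarrow> nat \<Rightarrow> ('r alg \<times> ('r, 'r matrix \<Rightarrow> 'r matrix) cochain1) set \<Rightarrow>
   'r H2Gm \<Rightarrow> bool" where
  "is_connecting R n \<xi> \<eta> \<longleftrightarrow> \<xi> \<in> H1 R (PGL n) \<and> \<eta> \<in> carrier (H2 R Gm) \<and>
    (\<exists>(S, g)\<in>\<xi>. \<eta> = H2_class R Gm (lift_hypercover n S g) (lift_cocycle n))"

definition Br_pp :: "('r, 'm) ring_scheme \<Rightarrow> nat \<Rightarrow> 'r H2Gm set" where
  "Br_pp R p = {\<eta> \<in> carrier (Br R).
     \<exists>\<xi>\<in>H1 R (G_pp R p). is_connecting R (p * p) (H1_incl R (PGL (p * p)) \<xi>) \<eta>}"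

section \<open>Azumaya algebras\<close>

text \<open>
  The torsor \<open>P(A)\<close> of a degree \<open>n\<close> Azumaya algebra \<open>A\<close>: its \<open>T\<close>-points are the isomorphisms
  \<open>M\<^sub>n(T) \<rightarrow> T \<otimes>\<^sub>R A\<close>, on which \<open>PGL\<^sub>n(T)\<close> acts on the right by composition.
\<close>

type_synonym ('r, 'a) triv = "'r matrix \<Rightarrow> ('r \<times> 'a \<Rightarrow>\<^sub>0 int) set"

definition torsor ::
  "('r, 'm) ring_scheme \<Rightarrow> nat \<Rightarrow> ('r, 'a) module \<Rightarrow> 'r alg \<Rightarrow> ('r, 'a) triv set" where
  "torsor R n A T = alg_iso T (mat_alg n T) (base_change R T A)"

definition torsor_res ::
  "('r, 'm) ring_scheme \<Rightarrow> nat \<Rightarrow> ('r, 'a) module \<Rightarrow> 'r alg \<Rightarrow> 'r alg \<Rightarrow> ('r \<Rightarrow> 'r) \<Rightarrow>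
   ('r, 'a) triv \<Rightarrow> ('r, 'a) triv" where
  "torsor_res R n A T T' f \<theta> = (THE \<theta>'. \<theta>' \<in> torsor R n A T' \<and>
     (\<forall>M\<in>carrier (mat_alg n T). \<theta>' (mat_map n f M) = base_change_map R T' A f (\<theta> M)))"

definition azumaya :: "('r, 'm) ring_scheme \<Rightarrow> nat \<Rightarrow> ('r, 'a) module \<Rightarrow> bool" where
  "azumaya R n A \<longleftrightarrow> is_algebra R A \<and>
     (\<exists>C. fppf_covering R (self_algebra R) C \<and> (\<forall>(T, f)\<in>C. torsor R n A T \<noteq> {}))"

text \<open>The class of \<open>P(A)\<close> in \<open>H\<^sup>1(X, PGL\<^sub>n)\<close>.\<close>

definition torsor_class ::
  "('r, 'm) ring_scheme \<Rightarrow> nat \<Rightarrow> ('r, 'a) module \<Rightarrow>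
   ('r alg \<times> ('r, 'r matrix \<Rightarrow> 'r matrix) cochain1) set" where
  "torsor_class R n A = H1_equiv R (PGL n) ``
    {(S, g) \<in> Z1 R (PGL n). \<exists>\<theta>\<in>torsor R n A S. \<forall>T. algebra R T \<longrightarrow>
       (\<forall>x\<in>alg_hom R S T. \<forall>y\<in>alg_hom R S T. \<forall>M\<in>carrier (mat_alg n T).
          torsor_res R n A S T x \<theta> (g T x y M) = torsor_res R n A S T y \<theta> M)}"

definition is_brauer_class ::
  "('r, 'm) ring_scheme \<Rightarrow> nat \<Rightarrow> ('r, 'a) module \<Rightarrow> 'r H2Gm \<Rightarrow> bool" where
  "is_brauer_class R n A \<beta> \<longleftrightarrow> is_connecting R n (torsor_class R n A) \<beta>"

text \<open>
  A \<open>(p, p)\<close>-subsystem structure on \<open>A\<close>: a reduction of the structure group of \<open>P(A)\<close> to \<open>G\<^sub>(\<^sub>p\<^sub>,\<^sub>p\<^sub>)\<close>,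
  that is, a subsheaf \<open>Q\<close> of \<open>P(A)\<close> that is a torsor under \<open>G\<^sub>(\<^sub>p\<^sub>,\<^sub>p\<^sub>)\<close>.
\<close>

definition is_subsystem_structure ::
  "('r, 'm) ring_scheme \<Rightarrow> nat \<Rightarrow> ('r, 'a) module \<Rightarrow> ('r alg \<Rightarrow> ('r, 'a) triv set) \<Rightarrow> bool" where
  "is_subsystem_structure R p A Q \<longleftrightarrow>
    (\<forall>T. algebra R T \<longrightarrow>
       Q T \<subseteq> torsor R (p * p) A T \<and>
       (\<forall>T' f. algebra R T' \<and> f \<in> alg_hom R T T' \<longrightarrow>
          torsor_res R (p * p) A T T' f \<in> Q T \<rightarrow> Q T') \<and>
       (\<forall>\<theta>\<in>torsor R (p * p) A T. \<forall>C. fppf_covering R T C \<and>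
          (\<forall>(T', f)\<in>C. torsor_res R (p * p) A T T' f \<theta> \<in> Q T') \<longrightarrow> \<theta> \<in> Q T) \<and>
       (\<forall>\<theta>\<in>Q T. \<forall>g\<in>carrier (sect (G_pp R p) T).
          compose (carrier (mat_alg (p * p) T)) \<theta> g \<in> Q T) \<and>
       (\<forall>\<theta>\<in>Q T. \<forall>\<theta>'\<in>Q T. \<exists>!g. g \<in> carrier (sect (G_pp R p) T) \<and>
          \<theta>' = compose (carrier (mat_alg (p * p) T)) \<theta> g)) \<and>
    (\<exists>C. fppf_covering R (self_algebra R) C \<and> (\<forall>(T, f)\<in>C. Q T \<noteq> {}))"

section \<open>Symbol algebras and the two-dimensional torus\<close>

text \<open>
  The free associative \<open>R\<close>-algebra on a set of letters consists of the finitely supported functions on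
  words.
\<close>

definition free_algebra :: "('r, 'm) ring_scheme \<Rightarrow> ('x list \<Rightarrow> 'r) ring" where
  "free_algebra R =
    \<lparr>carrier = {P. range P \<subseteq> carrier R \<and> finite {w. P w \<noteq> \<zero>\<^bsub>R\<^esub>}},
     monoid.mult = (\<lambda>P Q w. \<Oplus>\<^bsub>R\<^esub>i\<in>{..length w}. P (take i w) \<otimes>\<^bsub>R\<^esub> Q (drop i w)),
     monoid.one = (\<lambda>w. if w = [] then \<one>\<^bsub>R\<^esub> else \<zero>\<^bsub>R\<^esub>),
     ring.zero = (\<lambda>w. \<zero>\<^bsub>R\<^esub>),
     ring.add = (\<lambda>P Q w. P w \<oplus>\<^bsub>R\<^esub> Q w)\<rparr>"

definition free_gen :: "('r, 'm) ring_scheme \<Rightarrow> 'x \<Rightarrow> 'x list \<Rightarrow> 'r" where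
  "free_gen R l = (\<lambda>w. if w = [l] then \<one>\<^bsub>R\<^esub> else \<zero>\<^bsub>R\<^esub>)"

definition free_const :: "('r, 'm) ring_scheme \<Rightarrow> 'r \<Rightarrow> 'x list \<Rightarrow> 'r" where
  "free_const R r = (\<lambda>w. if w = [] then r else \<zero>\<^bsub>R\<^esub>)"

datatype letter = X_letter | Y_letter

text \<open>The \<open>R\<close>-algebra generated by \<open>x\<close>, \<open>y\<close> with relations \<open>x\<^sup>p = s\<close>, \<open>y\<^sup>p = t\<close>, \<open>y x = \<zeta> x y\<close>.\<close>

definition symbol_ideal ::
  "('r, 'm) ring_scheme \<Rightarrow> nat \<Rightarrow> 'r \<Rightarrow> 'r \<Rightarrow> 'r \<Rightarrow> (letter list \<Rightarrow> 'r) set" where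
  "symbol_ideal R p \<zeta> s t =
    (let E = free_algebra R; x = free_gen R X_letter; y = free_gen R Y_letter in
     genideal E
       {x [^]\<^bsub>E\<^esub> p \<ominus>\<^bsub>E\<^esub> free_const R s,
        y [^]\<^bsub>E\<^esub> p \<ominus>\<^bsub>E\<^esub> free_const R t,
        y \<otimes>\<^bsub>E\<^esub> x \<ominus>\<^bsub>E\<^esub> free_const R \<zeta> \<otimes>\<^bsub>E\<^esub> x \<otimes>\<^bsub>E\<^esub> y})"

definition symbol_algebra ::
  "('r, 'm) ring_scheme \<Rightarrow> nat \<Rightarrow> 'r \<Rightarrow> 'r \<Rightarrow> 'r \<Rightarrow> ('r, (letter list \<Rightarrow> 'r) set) module" where
  "symbol_algebra R p \<zeta> s t =
    (let E = free_algebra R; I = symbol_ideal R p \<zeta> s t in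
     ring.extend (E Quot I)
       \<lparr>module.smult = (\<lambda>r Z. (I +>\<^bsub>E\<^esub> free_const R r) \<otimes>\<^bsub>E Quot I\<^esub> Z)\<rparr>)"

text \<open>\<open>k[u\<^sup>\<plusminus>\<^sup>1, v\<^sup>\<plusminus>\<^sup>1]\<close> is the monoid algebra of \<open>\<int>\<^sup>2\<close>.\<close>

type_synonym 'k laurent2 = "int \<times> int \<Rightarrow>\<^sub>0 'k"

definition torus :: "('k::field) laurent2 ring" where
  "torus = ring_of_type_algebra"

definition coord_u :: "('k::field) laurent2" where
  "coord_u = Poly_Mapping.single (1, 0) 1"

definition coord_v :: "('k::field) laurent2" where
  "coord_v = Poly_Mapping.single (0, 1) 1"

definition laurent_const :: "'k \<Rightarrow> ('k::field) laurent2" where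
  "laurent_const c = Poly_Mapping.single 0 c"

end

theory Submission
  imports Defs
begin

text \<open>
  Since \<open>k\<close> is algebraically closed, \<open>a\<close> and \<open>b\<close> are \<open>p\<close>-th powers, so both symbol algebras are split
  over \<open>R\<close>: \<open>x\<close> acts as a cyclic shift weighted by \<open>u\<close>, and \<open>y\<close> as \<open>\<alpha>\<close> times the diagonal matrix of
  the powers of \<open>\<zeta>\<close>, where \<open>\<alpha>\<^sup>p = a\<close>. Hence \<open>A\<close> is isomorphic to the algebra of \<open>p\<^sup>2 \<times> p\<^sup>2\<close>-matrices, the
  trivial covering of \<open>Spec R\<close> splits \<open>A\<close>, and its Brauer class is trivial. A splitting identifies
  \<open>P(A)\<close> with \<open>PGL\<close>, and the points of \<open>P(A)\<close> that correspond to \<open>G\<^sub>(\<^sub>p\<^sub>,\<^sub>p\<^sub>)\<close> form the subsystem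
  structure.

  The substantial point is that the stabilizer of the Segre variety, defined by a condition over all
  base changes, is a subsheaf of groups. An automorphism of a matrix algebra is inner locally for the
  Zariski topology, which turns the condition into equations in the entries of the automorphism; here
  the Segre cone is cut out by the vanishing of \<open>2 \<times> 2\<close> minors.
\<close>

section \<open>Finite sums and matrix algebras\<close>

text \<open>The condition defining \<open>G_pp\<close> quantifies over lifts \<open>c\<close> over
  all base changes, but \<open>g\<close> need not have a lift where a statement about it is to be
  proved: a lift of a product is not given as a product of lifts, and the lifts that occur over a
  covering are not those that occur over the base. Such statements are therefore reduced to the
  vanishing of an element of a ring, which can be checked after localization or on a covering. Local
  lifts come from the diagonal entries of \<open>g(E_00)\<close>: their sum is the trace, which is
  \<open>1\<close> once \<open>p^2\<close> is invertible, so they generate the unit ideal. Base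
  change raises the opposite difficulty, since a vector of the Segre cone over \<open>T'\<close>
  need not come from \<open>T\<close>. The minors of the transformed vector are quadratic forms in
  each factor of a pure tensor, and where \<open>2\<close> is invertible such a form is determined
  by its values at the vectors \<open>e_a + e_a'\<close>, which are defined over the integers.
  Characteristic 0 supplies both inverses. The localizations have to be objects of the site, whose
  carriers lie in the type of \<open>R\<close>; the infinitude of that type makes room for
  them.\<close>

context abelian_monoid
begin

lemma finsum_swap:
  assumes "finite A" "finite B" "\<And>i j. i \<in> A \<Longrightarrow> j \<in> B \<Longrightarrow> f i j \<in> carrier G"
  shows "(\<Oplus>i\<in>A. \<Oplus>j\<in>B. f i j) = (\<Oplus>j\<in>B. \<Oplus>i\<in>A. f i j)"
  using assms(1,3)
proof (induction A rule: finite_induct)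
  case empty
  then show ?case by (simp add: finsum_zero)
next
  case (insert a A)
  then have "(\<Oplus>i\<in>insert a A. \<Oplus>j\<in>B. f i j) = (\<Oplus>j\<in>B. f a j) \<oplus> (\<Oplus>j\<in>B. \<Oplus>i\<in>A. f i j)"
    by (subst finsum_insert) (auto intro!: finsum_closed)
  also have "\<dots> = (\<Oplus>j\<in>B. f a j \<oplus> (\<Oplus>i\<in>A. f i j))"
    using insert by (subst finsum_addf) (auto intro!: finsum_closed)
  also have "\<dots> = (\<Oplus>j\<in>B. \<Oplus>i\<in>insert a A. f i j)"
    using insert by (intro finsum_cong') (auto intro!: finsum_closed simp: finsum_insert Pi_def)
  finally show ?case .
qed

lemma finsum_all_zero: "(\<And>i. i \<in> A \<Longrightarrow> f i = \<zero>) \<Longrightarrow> (\<Oplus>i\<in>A. f i) = \<zero>"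
  using finsum_cong'[of A A "\<lambda>_. \<zero>" f] by (simp add: finsum_zero)

lemma finsum_delta:
  assumes "finite A" "\<And>j. j \<in> A \<Longrightarrow> f j \<in> carrier G"
  shows "(\<Oplus>j\<in>A. if j = i then f j else \<zero>) = (if i \<in> A then f i else \<zero>)"
proof (cases "i \<in> A")
  case True
  have "(\<Oplus>j\<in>A. if j = i then f j else \<zero>) = (\<Oplus>j\<in>A. if i = j then f j else \<zero>)"
    using assms by (intro finsum_cong') auto
  then show ?thesis using True assms by (subst (asm) finsum_singleton) auto
next
  case False
  then have "(\<Oplus>j\<in>A. if j = i then f j else \<zero>) = (\<Oplus>j\<in>A. \<zero>)"
    by (intro finsum_cong') auto
  then show ?thesis using False by (simp add: finsum_zero)
qed

lemma finsum_delta':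
  assumes "finite A" "\<And>j. j \<in> A \<Longrightarrow> f j \<in> carrier G"
  shows "(\<Oplus>j\<in>A. if i = j then f j else \<zero>) = (if i \<in> A then f i else \<zero>)"
proof -
  have "(\<Oplus>j\<in>A. if i = j then f j else \<zero>) = (\<Oplus>j\<in>A. if j = i then f j else \<zero>)"
    using assms by (intro finsum_cong') auto
  then show ?thesis using assms by (simp add: finsum_delta)
qed

text \<open>The index \<open>l\<close> is split as quotient and remainder by \<open>p\<close>; the
  induction peels off the last block of length \<open>p\<close>. This is the summation rule behind
  block multiplication of matrices.\<close>

lemma finsum_blocks:
  fixes m p :: nat
  assumes "\<And>l. l < m * p \<Longrightarrow> f l \<in> carrier G"
  shows "(\<Oplus>l\<in>{..<m * p}. f l) = (\<Oplus>i\<in>{..<m}. \<Oplus>j\<in>{..<p}. f (i * p + j))"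
  using assms
proof (induction m)
  case 0
  then show ?case by simp
next
  case (Suc m)
  have eq: "{..<Suc m * p} = {..<m * p} \<union> (\<lambda>j. m * p + j) ` {..<p}"
    (is "?A = ?B")
  proof (rule equalityI; rule subsetI)
    fix x assume "x \<in> ?A"
    then show "x \<in> ?B"
      by (cases "x < m * p") (auto simp: image_iff intro!: bexI[of _ "x - m * p"])
  qed auto
  have cl: "f (i * p + j) \<in> carrier G" if "i < Suc m" "j < p" for i j
  proof -
    have "i * p + j < i * p + p" using that by simp
    also have "i * p + p = Suc i * p" by simp
    also have "\<dots> \<le> Suc m * p" using that by (intro mult_le_mono) auto
    finally show ?thesis using Suc.prems by simp
  qed
  have "(\<Oplus>l\<in>{..<Suc m * p}. f l)
      = (\<Oplus>l\<in>{..<m * p}. f l) \<oplus> (\<Oplus>l\<in>(\<lambda>j. m * p + j) ` {..<p}. f l)"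
    unfolding eq using Suc.prems by (intro finsum_Un_disjoint) auto
  also have "(\<Oplus>l\<in>(\<lambda>j. m * p + j) ` {..<p}. f l) = (\<Oplus>j\<in>{..<p}. f (m * p + j))"
    using Suc.prems by (intro finsum_reindex) auto
  also have "(\<Oplus>l\<in>{..<m * p}. f l) = (\<Oplus>i\<in>{..<m}. \<Oplus>j\<in>{..<p}. f (i * p + j))"
    using Suc by simp
  finally show ?case
    using cl by (simp add: lessThan_Suc finsum_insert Pi_def a_comm finsum_closed)
qed

end

section \<open>Entrywise description of matrix algebras, matrix units\<close>

lemma mat_carrier_iff:
  "M \<in> carrier (mat_alg n T) \<longleftrightarrow> M \<in> {..<n} \<rightarrow>\<^sub>E {..<n} \<rightarrow>\<^sub>E carrier T"
  by (simp add: mat_alg_def)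

lemma mat_entry_closed:
  "M \<in> carrier (mat_alg n T) \<Longrightarrow> i < n \<Longrightarrow> j < n \<Longrightarrow> M i j \<in> carrier T"
  by (auto simp: mat_alg_def)

text \<open>Members of the carriers are extensional functions, as are their rows, so nothing beyond
  the entries with indices below \<open>n\<close> can distinguish them. The two coefficient rings
  enter only through this extensionality.\<close>

lemma mat_eqI:
  assumes "M \<in> carrier (mat_alg n T)" "N \<in> carrier (mat_alg n T')"
    and "\<And>i j. i < n \<Longrightarrow> j < n \<Longrightarrow> M i j = N i j"
  shows "M = N"
proof (rule extensionalityI)
  show "M \<in> extensional {..<n}" "N \<in> extensional {..<n}"
    using assms by (auto simp: mat_alg_def PiE_def)
  fix i assume "i \<in> {..<n}"
  then have "M i \<in> extensional {..<n}" "N i \<in> extensional {..<n}"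
    using assms(1,2) \<open>i \<in> {..<n}\<close>
    by (auto simp: mat_alg_def PiE_def dest!: Pi_mem[of _ _ _ i])
  then show "M i = N i"
    using assms(3) \<open>i \<in> {..<n}\<close> by (intro extensionalityI) auto
qed

lemma mat_closedI [intro]:
  "(\<And>i j. i < n \<Longrightarrow> j < n \<Longrightarrow> f i j \<in> carrier T) \<Longrightarrow>
   (\<lambda>i\<in>{..<n}. \<lambda>j\<in>{..<n}. f i j) \<in> carrier (mat_alg n T)"
  by (simp add: mat_carrier_iff)

lemma mat_mult_eq:
  "M \<otimes>\<^bsub>mat_alg n T\<^esub> N =
    (\<lambda>i\<in>{..<n}. \<lambda>j\<in>{..<n}. \<Oplus>\<^bsub>T\<^esub>l\<in>{..<n}. M i l \<otimes>\<^bsub>T\<^esub> N l j)"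
  and mat_one_eq: "\<one>\<^bsub>mat_alg n T\<^esub> =
    (\<lambda>i\<in>{..<n}. \<lambda>j\<in>{..<n}. if i = j then \<one>\<^bsub>T\<^esub> else \<zero>\<^bsub>T\<^esub>)"
  and mat_zero_eq: "\<zero>\<^bsub>mat_alg n T\<^esub> = (\<lambda>i\<in>{..<n}. \<lambda>j\<in>{..<n}. \<zero>\<^bsub>T\<^esub>)"
  and mat_add_eq: "M \<oplus>\<^bsub>mat_alg n T\<^esub> N = (\<lambda>i\<in>{..<n}. \<lambda>j\<in>{..<n}. M i j \<oplus>\<^bsub>T\<^esub> N i j)"
  and mat_smult_eq: "t \<odot>\<^bsub>mat_alg n T\<^esub> M = (\<lambda>i\<in>{..<n}. \<lambda>j\<in>{..<n}. t \<otimes>\<^bsub>T\<^esub> M i j)"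
  by (simp_all add: mat_alg_def)

lemma mat_mult_entry:
  "i < n \<Longrightarrow> j < n \<Longrightarrow>
   (M \<otimes>\<^bsub>mat_alg n T\<^esub> N) i j = (\<Oplus>\<^bsub>T\<^esub>l\<in>{..<n}. M i l \<otimes>\<^bsub>T\<^esub> N l j)"
  and mat_one_entry:
  "i < n \<Longrightarrow> j < n \<Longrightarrow> \<one>\<^bsub>mat_alg n T\<^esub> i j = (if i = j then \<one>\<^bsub>T\<^esub> else \<zero>\<^bsub>T\<^esub>)"
  and mat_zero_entry: "i < n \<Longrightarrow> j < n \<Longrightarrow> \<zero>\<^bsub>mat_alg n T\<^esub> i j = \<zero>\<^bsub>T\<^esub>"
  and mat_add_entry:
  "i < n \<Longrightarrow> j < n \<Longrightarrow> (M \<oplus>\<^bsub>mat_alg n T\<^esub> N) i j = M i j \<oplus>\<^bsub>T\<^esub> N i j"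
  and mat_smult_entry:
  "i < n \<Longrightarrow> j < n \<Longrightarrow> (t \<odot>\<^bsub>mat_alg n T\<^esub> M) i j = t \<otimes>\<^bsub>T\<^esub> M i j"
  by (simp_all add: mat_alg_def)

lemmas mat_entry = mat_mult_entry mat_one_entry mat_zero_entry mat_add_entry mat_smult_entry

definition mat_unit :: "nat \<Rightarrow> ('t, 'm) ring_scheme \<Rightarrow> nat \<Rightarrow> nat \<Rightarrow> 't matrix" where
  "mat_unit n T i j =
    (\<lambda>k\<in>{..<n}. \<lambda>l\<in>{..<n}. if k = i \<and> l = j then \<one>\<^bsub>T\<^esub> else \<zero>\<^bsub>T\<^esub>)"

lemma mat_unit_entry [simp]:
  "k < n \<Longrightarrow> l < n \<Longrightarrow>
   mat_unit n T i j k l = (if k = i \<and> l = j then \<one>\<^bsub>T\<^esub> else \<zero>\<^bsub>T\<^esub>)"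
  by (simp add: mat_unit_def)

context ring
begin

lemma mat_entry_closed_ring [simp]:
  "M \<in> carrier (mat_alg n R) \<Longrightarrow> i < n \<Longrightarrow> j < n \<Longrightarrow> M i j \<in> carrier R"
  by (rule mat_entry_closed)

lemma mat_mult_closed:
  "M \<in> carrier (mat_alg n R) \<Longrightarrow> N \<in> carrier (mat_alg n R) \<Longrightarrow>
   M \<otimes>\<^bsub>mat_alg n R\<^esub> N \<in> carrier (mat_alg n R)"
  unfolding mat_mult_eq by (rule mat_closedI, rule finsum_closed) auto

lemma mat_add_closed:
  "M \<in> carrier (mat_alg n R) \<Longrightarrow> N \<in> carrier (mat_alg n R) \<Longrightarrow>
   M \<oplus>\<^bsub>mat_alg n R\<^esub> N \<in> carrier (mat_alg n R)"
  unfolding mat_add_eq by (rule mat_closedI) auto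

lemma mat_one_closed: "\<one>\<^bsub>mat_alg n R\<^esub> \<in> carrier (mat_alg n R)"
  unfolding mat_one_eq by (rule mat_closedI) auto

lemma mat_zero_closed: "\<zero>\<^bsub>mat_alg n R\<^esub> \<in> carrier (mat_alg n R)"
  unfolding mat_zero_eq by (rule mat_closedI) auto

lemma mat_smult_closed:
  "t \<in> carrier R \<Longrightarrow> M \<in> carrier (mat_alg n R) \<Longrightarrow>
   t \<odot>\<^bsub>mat_alg n R\<^esub> M \<in> carrier (mat_alg n R)"
  unfolding mat_smult_eq by (rule mat_closedI) auto

lemmas mat_closed = mat_mult_closed mat_add_closed mat_one_closed mat_zero_closed mat_smult_closed

lemma mat_unit_closed [simp]: "mat_unit n R i j \<in> carrier (mat_alg n R)"
  unfolding mat_unit_def by auto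

lemma mat_assoc:
  assumes "M \<in> carrier (mat_alg n R)" "N \<in> carrier (mat_alg n R)" "P \<in> carrier (mat_alg n R)"
  shows "M \<otimes>\<^bsub>mat_alg n R\<^esub> N \<otimes>\<^bsub>mat_alg n R\<^esub> P = M \<otimes>\<^bsub>mat_alg n R\<^esub> (N \<otimes>\<^bsub>mat_alg n R\<^esub> P)"
proof (rule mat_eqI)
  fix i j assume ij: "i < n" "j < n"
  have "(M \<otimes>\<^bsub>mat_alg n R\<^esub> N \<otimes>\<^bsub>mat_alg n R\<^esub> P) i j
      = (\<Oplus>l\<in>{..<n}. (\<Oplus>k\<in>{..<n}. M i k \<otimes> N k l) \<otimes> P l j)"
    using ij assms by (subst mat_mult_entry) (auto intro!: finsum_cong' finsum_closed simp: mat_entry)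
  also have "\<dots> = (\<Oplus>l\<in>{..<n}. \<Oplus>k\<in>{..<n}. M i k \<otimes> N k l \<otimes> P l j)"
    using ij assms by (intro finsum_cong' refl) (auto intro!: finsum_closed finsum_ldistr)
  also have "\<dots> = (\<Oplus>k\<in>{..<n}. \<Oplus>l\<in>{..<n}. M i k \<otimes> N k l \<otimes> P l j)"
    using ij assms by (intro finsum_swap) auto
  also have "\<dots> = (\<Oplus>k\<in>{..<n}. \<Oplus>l\<in>{..<n}. M i k \<otimes> (N k l \<otimes> P l j))"
    using ij assms by (intro finsum_cong' refl) (auto intro!: finsum_closed simp: m_assoc)
  also have "\<dots> = (\<Oplus>k\<in>{..<n}. M i k \<otimes> (\<Oplus>l\<in>{..<n}. N k l \<otimes> P l j))"
    using ij assms by (intro finsum_cong' refl) (auto intro!: finsum_closed finsum_rdistr[symmetric])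
  also have "\<dots> = (M \<otimes>\<^bsub>mat_alg n R\<^esub> (N \<otimes>\<^bsub>mat_alg n R\<^esub> P)) i j"
    using ij assms by (subst mat_mult_entry) (auto intro!: finsum_cong' finsum_closed simp: mat_entry)
  finally show "(M \<otimes>\<^bsub>mat_alg n R\<^esub> N \<otimes>\<^bsub>mat_alg n R\<^esub> P) i j = \<dots>" .
qed (use assms in \<open>auto intro!: mat_closed\<close>)

lemma mat_unit_sum_l:
  fixes n :: nat
  assumes "\<And>l. l < n \<Longrightarrow> f l \<in> carrier R"
  shows "(\<Oplus>l\<in>{..<n}. (if i = l then \<one> else \<zero>) \<otimes> f l) = (if i < n then f i else \<zero>)"
proof -
  have "(\<Oplus>l\<in>{..<n}. (if i = l then \<one> else \<zero>) \<otimes> f l) = (\<Oplus>l\<in>{..<n}. if i = l then f l else \<zero>)"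
    using assms by (intro finsum_cong') auto
  also have "\<dots> = (if i < n then f i else \<zero>)"
    using assms by (subst finsum_delta') auto
  finally show ?thesis .
qed

lemma mat_unit_sum_r:
  fixes n :: nat
  assumes "\<And>l. l < n \<Longrightarrow> f l \<in> carrier R"
  shows "(\<Oplus>l\<in>{..<n}. f l \<otimes> (if l = i then \<one> else \<zero>)) = (if i < n then f i else \<zero>)"
proof -
  have "(\<Oplus>l\<in>{..<n}. f l \<otimes> (if l = i then \<one> else \<zero>)) = (\<Oplus>l\<in>{..<n}. if l = i then f l else \<zero>)"
    using assms by (intro finsum_cong') auto
  also have "\<dots> = (if i < n then f i else \<zero>)"
    using assms by (subst finsum_delta) auto
  finally show ?thesis .
qed

lemma ring_mat_alg: "ring (mat_alg n R)"
proof (rule ringI)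
  show "abelian_group (mat_alg n R)"
  proof (rule abelian_groupI)
    fix M assume M: "M \<in> carrier (mat_alg n R)"
    let ?N = "\<lambda>i\<in>{..<n}. \<lambda>j\<in>{..<n}. \<ominus> M i j"
    have N: "?N \<in> carrier (mat_alg n R)" using M by auto
    have "?N \<oplus>\<^bsub>mat_alg n R\<^esub> M = \<zero>\<^bsub>mat_alg n R\<^esub>"
      by (rule mat_eqI[of _ n R _ R]) (use M N in \<open>auto intro!: mat_closed simp: mat_entry l_neg\<close>)
    with N show "\<exists>N\<in>carrier (mat_alg n R). N \<oplus>\<^bsub>mat_alg n R\<^esub> M = \<zero>\<^bsub>mat_alg n R\<^esub>" by blast
  qed (auto intro!: mat_closed mat_eqI[of _ n R _ R] simp: mat_entry a_ac)
  show "monoid (mat_alg n R)"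
  proof (rule monoidI)
    fix M assume M: "M \<in> carrier (mat_alg n R)"
    show "\<one>\<^bsub>mat_alg n R\<^esub> \<otimes>\<^bsub>mat_alg n R\<^esub> M = M"
    proof (rule mat_eqI)
      fix i j assume ij: "i < n" "j < n"
      have "(\<one>\<^bsub>mat_alg n R\<^esub> \<otimes>\<^bsub>mat_alg n R\<^esub> M) i j
          = (\<Oplus>l\<in>{..<n}. (if i = l then \<one> else \<zero>) \<otimes> M l j)"
        using ij M by (simp only: mat_mult_entry) (intro finsum_cong', auto simp: mat_one_entry)
      then show "(\<one>\<^bsub>mat_alg n R\<^esub> \<otimes>\<^bsub>mat_alg n R\<^esub> M) i j = M i j"
        using ij M by (simp only: mat_unit_sum_l mat_entry_closed_ring if_True)
    qed (use M in \<open>auto intro!: mat_closed\<close>)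
    show "M \<otimes>\<^bsub>mat_alg n R\<^esub> \<one>\<^bsub>mat_alg n R\<^esub> = M"
    proof (rule mat_eqI)
      fix i j assume ij: "i < n" "j < n"
      have "(M \<otimes>\<^bsub>mat_alg n R\<^esub> \<one>\<^bsub>mat_alg n R\<^esub>) i j
          = (\<Oplus>l\<in>{..<n}. M i l \<otimes> (if l = j then \<one> else \<zero>))"
        using ij M by (simp only: mat_mult_entry) (intro finsum_cong', auto simp: mat_one_entry)
      then show "(M \<otimes>\<^bsub>mat_alg n R\<^esub> \<one>\<^bsub>mat_alg n R\<^esub>) i j = M i j"
        using ij M by (simp only: mat_unit_sum_r mat_entry_closed_ring if_True)
    qed (use M in \<open>auto intro!: mat_closed\<close>)
  qed (auto intro!: mat_closed mat_assoc)
next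
  fix M N P
  assume c: "M \<in> carrier (mat_alg n R)" "N \<in> carrier (mat_alg n R)" "P \<in> carrier (mat_alg n R)"
  show "(M \<oplus>\<^bsub>mat_alg n R\<^esub> N) \<otimes>\<^bsub>mat_alg n R\<^esub> P
      = M \<otimes>\<^bsub>mat_alg n R\<^esub> P \<oplus>\<^bsub>mat_alg n R\<^esub> N \<otimes>\<^bsub>mat_alg n R\<^esub> P"
    using c
    by (intro mat_eqI[of _ n R _ R])
      (auto intro!: mat_closed finsum_cong' simp: mat_entry l_distr simp flip: finsum_addf)
  show "P \<otimes>\<^bsub>mat_alg n R\<^esub> (M \<oplus>\<^bsub>mat_alg n R\<^esub> N)
      = P \<otimes>\<^bsub>mat_alg n R\<^esub> M \<oplus>\<^bsub>mat_alg n R\<^esub> P \<otimes>\<^bsub>mat_alg n R\<^esub> N"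
    using c
    by (intro mat_eqI[of _ n R _ R])
      (auto intro!: mat_closed finsum_cong' simp: mat_entry r_distr simp flip: finsum_addf)
qed

lemma mat_finsum_entry:
  assumes "finite I" "\<And>x. x \<in> I \<Longrightarrow> F x \<in> carrier (mat_alg n R)" "i < n" "j < n"
  shows "(\<Oplus>\<^bsub>mat_alg n R\<^esub>x\<in>I. F x) i j = (\<Oplus>x\<in>I. F x i j)"
proof -
  interpret M: ring "mat_alg n R" by (rule ring_mat_alg)
  show ?thesis
    using assms
  proof (induction I rule: finite_induct)
    case (insert x I)
    then have F: "F y \<in> carrier (mat_alg n R)" if "y \<in> insert x I" for y
      using that by blast
    have "F y i j \<in> carrier R" if "y \<in> insert x I" for y
      by (rule mat_entry_closed[OF F[OF that] insert.prems(2,3)])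
    with insert show ?case
      by (simp add: mat_entry finsum_insert M.finsum_insert Pi_def)
  qed (simp add: mat_entry)
qed

lemma mat_unit_mult:
  assumes "i < n" "j < n" "k < n" "l < n"
  shows "mat_unit n R i j \<otimes>\<^bsub>mat_alg n R\<^esub> mat_unit n R k l
    = (if j = k then mat_unit n R i l else \<zero>\<^bsub>mat_alg n R\<^esub>)"
proof (rule mat_eqI[of _ n R _ R])
  fix a b assume ab: "a < n" "b < n"
  have "(\<Oplus>m\<in>{..<n}. mat_unit n R i j a m \<otimes> mat_unit n R k l m b)
      = (\<Oplus>m\<in>{..<n}. if m = j then (if a = i \<and> m = k \<and> b = l then \<one> else \<zero>) else \<zero>)"
    using ab by (intro finsum_cong') auto
  then show "(mat_unit n R i j \<otimes>\<^bsub>mat_alg n R\<^esub> mat_unit n R k l) a b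
      = (if j = k then mat_unit n R i l else \<zero>\<^bsub>mat_alg n R\<^esub>) a b"
    using ab assms by (simp add: mat_entry finsum_delta)
qed (auto intro!: mat_closed)

lemma mat_unit_sum_one: "(\<Oplus>\<^bsub>mat_alg n R\<^esub>i\<in>{..<n}. mat_unit n R i i) = \<one>\<^bsub>mat_alg n R\<^esub>"
proof -
  interpret M: ring "mat_alg n R" by (rule ring_mat_alg)
  show ?thesis
  proof (rule mat_eqI[of _ n R _ R])
    fix a b assume ab: "a < n" "b < n"
    have "(\<Oplus>i\<in>{..<n}. mat_unit n R i i a b)
      = (\<Oplus>i\<in>{..<n}. if i = a then (if a = b then \<one> else \<zero>) else \<zero>)"
      using ab by (intro finsum_cong') auto
    then show "(\<Oplus>\<^bsub>mat_alg n R\<^esub>i\<in>{..<n}. mat_unit n R i i) a b = \<one>\<^bsub>mat_alg n R\<^esub> a b"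
      using ab by (simp add: mat_finsum_entry mat_entry finsum_delta)
  qed (auto intro!: mat_closed M.finsum_closed)
qed

text \<open>The matrix units span, so a linear map out of the matrix algebra is determined by their
  images. Uniqueness and base change of algebra homomorphisms rest on this expansion.\<close>

lemma mat_expand:
  assumes "M \<in> carrier (mat_alg n R)"
  shows "M = (\<Oplus>\<^bsub>mat_alg n R\<^esub>i\<in>{..<n}. \<Oplus>\<^bsub>mat_alg n R\<^esub>j\<in>{..<n}.
    M i j \<odot>\<^bsub>mat_alg n R\<^esub> mat_unit n R i j)"
proof -
  interpret M: ring "mat_alg n R" by (rule ring_mat_alg)
  show ?thesis
  proof (rule mat_eqI[of _ n R _ R])
    fix a b assume ab: "a < n" "b < n"
    have cl: "M i j \<odot>\<^bsub>mat_alg n R\<^esub> mat_unit n R i j \<in> carrier (mat_alg n R)"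
      if "i < n" "j < n" for i j
      using that assms by (intro mat_closed) auto
    then have row: "(\<Oplus>\<^bsub>mat_alg n R\<^esub>j\<in>{..<n}. M i j \<odot>\<^bsub>mat_alg n R\<^esub> mat_unit n R i j)
        \<in> carrier (mat_alg n R)" if "i < n" for i
      using that by (intro M.finsum_closed) auto
    have row_entry: "(\<Oplus>\<^bsub>mat_alg n R\<^esub>j\<in>{..<n}. M i j \<odot>\<^bsub>mat_alg n R\<^esub> mat_unit n R i j) a b
        = (\<Oplus>j\<in>{..<n}. M i j \<otimes> mat_unit n R i j a b)" if "i < n" for i
    proof -
      have "(\<Oplus>\<^bsub>mat_alg n R\<^esub>j\<in>{..<n}. M i j \<odot>\<^bsub>mat_alg n R\<^esub> mat_unit n R i j) a b
        = (\<Oplus>j\<in>{..<n}. (M i j \<odot>\<^bsub>mat_alg n R\<^esub> mat_unit n R i j) a b)"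
        using ab cl that by (intro mat_finsum_entry) auto
      then show ?thesis using ab by (simp only: mat_smult_entry)
    qed
    have "(\<Oplus>i\<in>{..<n}. \<Oplus>j\<in>{..<n}. M i j \<otimes> mat_unit n R i j a b)
      = (\<Oplus>i\<in>{..<n}. if i = a then (\<Oplus>j\<in>{..<n}. if j = b then M i j else \<zero>) else \<zero>)"
      using ab assms
      by (intro finsum_cong') (auto intro!: finsum_cong' finsum_closed finsum_all_zero)
    also have "\<dots> = M a b"
      using ab assms by (subst finsum_delta; auto intro!: finsum_closed)+
    also have "(\<Oplus>i\<in>{..<n}. \<Oplus>j\<in>{..<n}. M i j \<otimes> mat_unit n R i j a b)
      = (\<Oplus>i\<in>{..<n}. (\<Oplus>\<^bsub>mat_alg n R\<^esub>j\<in>{..<n}. M i j \<odot>\<^bsub>mat_alg n R\<^esub> mat_unit n R i j) a b)"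
      using ab assms
      using row row_entry mat_entry_closed[OF row] ab by (intro finsum_cong') auto
    also have "\<dots> = (\<Oplus>\<^bsub>mat_alg n R\<^esub>i\<in>{..<n}. \<Oplus>\<^bsub>mat_alg n R\<^esub>j\<in>{..<n}.
        M i j \<odot>\<^bsub>mat_alg n R\<^esub> mat_unit n R i j) a b"
      using ab assms by (subst mat_finsum_entry) (auto intro!: mat_closed M.finsum_closed)
    finally show "M a b = \<dots>" by (rule sym)
  qed (use assms in \<open>auto intro!: mat_closed M.finsum_closed\<close>)
qed

end

lemma (in cring) mat_is_algebra: "is_algebra R (mat_alg n R)"
  unfolding is_algebra_def
proof (intro conjI ballI ring_mat_alg)
  interpret M: ring "mat_alg n R" by (rule ring_mat_alg)
  show "module R (mat_alg n R)"
    by (rule moduleI) (auto intro!: mat_closed mat_eqI[of _ n R _ R] is_cring M.is_abelian_group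
        simp: mat_entry l_distr r_distr m_assoc)
  fix r M N assume c: "r \<in> carrier R" "M \<in> carrier (mat_alg n R)" "N \<in> carrier (mat_alg n R)"
  show "r \<odot>\<^bsub>mat_alg n R\<^esub> M \<otimes>\<^bsub>mat_alg n R\<^esub> N = r \<odot>\<^bsub>mat_alg n R\<^esub> (M \<otimes>\<^bsub>mat_alg n R\<^esub> N)"
    using c by (intro mat_eqI[of _ n R _ R])
      (auto intro!: mat_closed finsum_cong' simp: mat_entry finsum_rdistr m_assoc)
  show "M \<otimes>\<^bsub>mat_alg n R\<^esub> (r \<odot>\<^bsub>mat_alg n R\<^esub> N) = r \<odot>\<^bsub>mat_alg n R\<^esub> (M \<otimes>\<^bsub>mat_alg n R\<^esub> N)"
    using c by (intro mat_eqI[of _ n R _ R])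
      (auto intro!: mat_closed finsum_cong' simp: mat_entry finsum_rdistr m_lcomm)
qed

section \<open>Tensor products\<close>

text \<open>For records such as the tensor product, whose operations are unions of cosets, a direct
  verification of the ring laws is laborious. They are pulled back instead from a known algebra
  along a bijection that respects the operations. Closure of the operations has to be assumed
  together with compatibility, because at this stage nothing else is known about
  \<open>B\<close>.\<close>

lemma is_algebra_transport:
  assumes M: "is_algebra R M" and bij: "bij_betw \<Psi> (carrier B) (carrier M)"
    and add: "\<And>x y. x \<in> carrier B \<Longrightarrow> y \<in> carrier B \<Longrightarrow>
      x \<oplus>\<^bsub>B\<^esub> y \<in> carrier B \<and> \<Psi> (x \<oplus>\<^bsub>B\<^esub> y) = \<Psi> x \<oplus>\<^bsub>M\<^esub> \<Psi> y"
    and mult: "\<And>x y. x \<in> carrier B \<Longrightarrow> y \<in> carrier B \<Longrightarrow>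
      x \<otimes>\<^bsub>B\<^esub> y \<in> carrier B \<and> \<Psi> (x \<otimes>\<^bsub>B\<^esub> y) = \<Psi> x \<otimes>\<^bsub>M\<^esub> \<Psi> y"
    and smult: "\<And>r x. r \<in> carrier R \<Longrightarrow> x \<in> carrier B \<Longrightarrow>
      r \<odot>\<^bsub>B\<^esub> x \<in> carrier B \<and> \<Psi> (r \<odot>\<^bsub>B\<^esub> x) = r \<odot>\<^bsub>M\<^esub> \<Psi> x"
    and zero: "\<zero>\<^bsub>B\<^esub> \<in> carrier B" "\<Psi> \<zero>\<^bsub>B\<^esub> = \<zero>\<^bsub>M\<^esub>"
    and one: "\<one>\<^bsub>B\<^esub> \<in> carrier B" "\<Psi> \<one>\<^bsub>B\<^esub> = \<one>\<^bsub>M\<^esub>"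
  shows "is_algebra R B"
proof -
  interpret M: ring M using M by (simp add: is_algebra_def)
  interpret Mm: module R M using M by (simp add: is_algebra_def)
  have c [simp]: "\<Psi> x \<in> carrier M" if "x \<in> carrier B" for x
    using bij that by (auto simp: bij_betw_def)
  have eqI: "x = y" if "\<Psi> x = \<Psi> y" "x \<in> carrier B" "y \<in> carrier B" for x y
    using bij that by (auto simp: bij_betw_def inj_on_def)
  have ab: "abelian_group B"
  proof (rule abelian_groupI)
    fix x assume x: "x \<in> carrier B"
    then have "\<ominus>\<^bsub>M\<^esub> \<Psi> x \<in> \<Psi> ` carrier B" using bij by (simp add: bij_betw_def)
    then obtain y where y: "y \<in> carrier B" "\<Psi> y = \<ominus>\<^bsub>M\<^esub> \<Psi> x" by (metis imageE)
    then have "y \<oplus>\<^bsub>B\<^esub> x = \<zero>\<^bsub>B\<^esub>" using x by (intro eqI) (simp_all add: add zero M.l_neg)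
    with y show "\<exists>y\<in>carrier B. y \<oplus>\<^bsub>B\<^esub> x = \<zero>\<^bsub>B\<^esub>" by blast
  qed (auto intro!: eqI simp: add zero M.a_ac)
  have ri: "ring B"
  proof (rule ringI[OF ab])
    show "monoid B"
      by (rule monoidI) (auto intro!: eqI simp: mult one M.m_assoc)
  qed (auto intro!: eqI simp: add mult M.l_distr M.r_distr)
  have mo: "module R B"
    by (rule moduleI[OF Mm.is_cring ab])
      (auto intro!: eqI simp: add smult Mm.smult_l_distr Mm.smult_r_distr Mm.smult_assoc1)
  have "(r \<odot>\<^bsub>B\<^esub> x) \<otimes>\<^bsub>B\<^esub> y = r \<odot>\<^bsub>B\<^esub> (x \<otimes>\<^bsub>B\<^esub> y) \<and>
        x \<otimes>\<^bsub>B\<^esub> (r \<odot>\<^bsub>B\<^esub> y) = r \<odot>\<^bsub>B\<^esub> (x \<otimes>\<^bsub>B\<^esub> y)"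
    if "r \<in> carrier R" "x \<in> carrier B" "y \<in> carrier B" for r x y
    using M that by (auto intro!: eqI simp: smult mult is_algebra_def)
  with ri mo show ?thesis by (simp add: is_algebra_def)
qed

lemma (in abelian_group) minus_solve:
  "a \<oplus> b = c \<Longrightarrow> a \<in> carrier G \<Longrightarrow> b \<in> carrier G \<Longrightarrow> a = c \<ominus> b"
  by (auto simp: minus_eq a_assoc r_neg)

lemma alg_homD:
  assumes "h \<in> alg_hom R A B"
  shows "x \<in> carrier A \<Longrightarrow> h x \<in> carrier B"
    and "x \<in> carrier A \<Longrightarrow> y \<in> carrier A \<Longrightarrow> h (x \<oplus>\<^bsub>A\<^esub> y) = h x \<oplus>\<^bsub>B\<^esub> h y"
    and "x \<in> carrier A \<Longrightarrow> y \<in> carrier A \<Longrightarrow> h (x \<otimes>\<^bsub>A\<^esub> y) = h x \<otimes>\<^bsub>B\<^esub> h y"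
    and "h \<one>\<^bsub>A\<^esub> = \<one>\<^bsub>B\<^esub>"
    and "r \<in> carrier R \<Longrightarrow> x \<in> carrier A \<Longrightarrow> h (r \<odot>\<^bsub>A\<^esub> x) = r \<odot>\<^bsub>B\<^esub> h x"
    and "h \<in> extensional (carrier A)"
  using assms by (auto simp: alg_hom_def ring_hom_def)

lemma alg_homI:
  assumes "\<And>x. x \<in> carrier A \<Longrightarrow> h x \<in> carrier B"
    and "\<And>x y. x \<in> carrier A \<Longrightarrow> y \<in> carrier A \<Longrightarrow> h (x \<oplus>\<^bsub>A\<^esub> y) = h x \<oplus>\<^bsub>B\<^esub> h y"
    and "\<And>x y. x \<in> carrier A \<Longrightarrow> y \<in> carrier A \<Longrightarrow> h (x \<otimes>\<^bsub>A\<^esub> y) = h x \<otimes>\<^bsub>B\<^esub> h y"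
    and "h \<one>\<^bsub>A\<^esub> = \<one>\<^bsub>B\<^esub>"
    and "\<And>r x. r \<in> carrier R \<Longrightarrow> x \<in> carrier A \<Longrightarrow> h (r \<odot>\<^bsub>A\<^esub> x) = r \<odot>\<^bsub>B\<^esub> h x"
    and "h \<in> extensional (carrier A)"
  shows "h \<in> alg_hom R A B"
  using assms by (auto simp: alg_hom_def ring_hom_def)

section \<open>The relations of a tensor product and its universal property\<close>

locale two_modules =
  fixes R :: "('r, 's) ring_scheme" and M :: "('r, 'm) module" and N :: "('r, 'n) module"
  assumes M: "module R M" and N: "module R N"
begin

abbreviation rel where "rel \<equiv> tensor_relations R M N"
abbreviation TF where "TF \<equiv> tensor_free M N"

sublocale M: module R M by (rule M)
sublocale N: module R N by (rule N)
sublocale TF: comm_group TF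
  unfolding tensor_free_def by (rule abelian_free_Abelian_group)

lemma TF_carrier: "z \<in> carrier TF \<longleftrightarrow> Poly_Mapping.keys z \<subseteq> carrier M \<times> carrier N"
  by (simp add: tensor_free_def)

lemma TF_simps [simp]: "x \<otimes>\<^bsub>TF\<^esub> y = x + y" "\<one>\<^bsub>TF\<^esub> = 0"
  by (simp_all add: tensor_free_def)

lemma TF_closed [simp]:
  "0 \<in> carrier TF"
  "x \<in> carrier TF \<Longrightarrow> y \<in> carrier TF \<Longrightarrow> x + y \<in> carrier TF"
  "x \<in> carrier TF \<Longrightarrow> y \<in> carrier TF \<Longrightarrow> x - y \<in> carrier TF"
  "m \<in> carrier M \<Longrightarrow> n \<in> carrier N \<Longrightarrow> frag_of (m, n) \<in> carrier TF"
  using keys_add[of x y] keys_diff[of x y] by (auto simp: TF_carrier)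

lemma TF_sum_closed: "(\<And>i. i \<in> I \<Longrightarrow> F i \<in> carrier TF) \<Longrightarrow> sum F I \<in> carrier TF"
  by (induction I rule: infinite_finite_induct) auto

lemma TF_inv [simp]: "x \<in> carrier TF \<Longrightarrow> inv\<^bsub>TF\<^esub> x = - x"
  by (simp add: tensor_free_def)

lemma TF_induct [consumes 1, case_names zero diff gen]:
  assumes "z \<in> carrier TF" "P 0"
    and "\<And>x y. x \<in> carrier TF \<Longrightarrow> y \<in> carrier TF \<Longrightarrow> P x \<Longrightarrow> P y \<Longrightarrow> P (x - y)"
    and "\<And>m n. m \<in> carrier M \<Longrightarrow> n \<in> carrier N \<Longrightarrow> P (frag_of (m, n))"
  shows "P z"
  using assms by (intro free_Abelian_group_induct[of z "carrier M \<times> carrier N" P])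
    (auto simp: TF_carrier)

lemma rel_subgroup: "subgroup rel TF"
  unfolding tensor_relations_def
  by (rule TF.generate_is_subgroup) (auto intro!: TF_closed)

lemma rel_carrier: "x \<in> rel \<Longrightarrow> x \<in> carrier TF"
  using subgroup.subset[OF rel_subgroup] by blast

lemma rel_0 [simp]: "0 \<in> rel"
  using subgroup.one_closed[OF rel_subgroup] by simp

lemma rel_add: "x \<in> rel \<Longrightarrow> y \<in> rel \<Longrightarrow> x + y \<in> rel"
  using subgroup.m_closed[OF rel_subgroup] by simp

lemma rel_minus: "x \<in> rel \<Longrightarrow> - x \<in> rel"
  using subgroup.m_inv_closed[OF rel_subgroup] rel_carrier by force

lemma rel_diff: "x \<in> rel \<Longrightarrow> y \<in> rel \<Longrightarrow> x - y \<in> rel"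
  using rel_add[of x "- y"] rel_minus by simp

lemma rel_sum: "(\<And>i. i \<in> I \<Longrightarrow> F i \<in> rel) \<Longrightarrow> sum F I \<in> rel"
  by (induction I rule: infinite_finite_induct) (auto intro: rel_add)

lemma rel_addl:
  assumes "x \<in> carrier M" "x' \<in> carrier M" "y \<in> carrier N"
  shows "frag_of (x \<oplus>\<^bsub>M\<^esub> x', y) - frag_of (x, y) - frag_of (x', y) \<in> rel"
  unfolding tensor_relations_def by (rule generate.incl) (use assms in blast)

lemma rel_addr:
  assumes "x \<in> carrier M" "y \<in> carrier N" "y' \<in> carrier N"
  shows "frag_of (x, y \<oplus>\<^bsub>N\<^esub> y') - frag_of (x, y) - frag_of (x, y') \<in> rel"
  unfolding tensor_relations_def by (rule generate.incl) (use assms in blast)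

lemma rel_smult:
  assumes "r \<in> carrier R" "x \<in> carrier M" "y \<in> carrier N"
  shows "frag_of (r \<odot>\<^bsub>M\<^esub> x, y) - frag_of (x, r \<odot>\<^bsub>N\<^esub> y) \<in> rel"
  unfolding tensor_relations_def by (rule generate.incl) (use assms in blast)

lemma rel_zerol: "y \<in> carrier N \<Longrightarrow> frag_of (\<zero>\<^bsub>M\<^esub>, y) \<in> rel"
  using rel_minus[OF rel_addl[of "\<zero>\<^bsub>M\<^esub>" "\<zero>\<^bsub>M\<^esub>" y]] by simp

lemma rel_zeror: "x \<in> carrier M \<Longrightarrow> frag_of (x, \<zero>\<^bsub>N\<^esub>) \<in> rel"
  using rel_minus[OF rel_addr[of x "\<zero>\<^bsub>N\<^esub>" "\<zero>\<^bsub>N\<^esub>"]] by simp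

lemma rel_diffl:
  assumes "x \<in> carrier M" "x' \<in> carrier M" "y \<in> carrier N"
  shows "frag_of (x, y) - frag_of (x', y) - frag_of (x \<ominus>\<^bsub>M\<^esub> x', y) \<in> rel"
proof -
  have "x \<ominus>\<^bsub>M\<^esub> x' \<oplus>\<^bsub>M\<^esub> x' = x"
    using assms by (simp add: M.minus_eq M.a_assoc M.l_neg)
  then show ?thesis
    using rel_addl[of "x \<ominus>\<^bsub>M\<^esub> x'" x' y] assms by (simp add: algebra_simps)
qed

lemma rel_finsum_r:
  assumes "finite S" "x \<in> carrier M" "\<And>s. s \<in> S \<Longrightarrow> F s \<in> carrier N"
  shows "frag_of (x, \<Oplus>\<^bsub>N\<^esub>s\<in>S. F s) - (\<Sum>s\<in>S. frag_of (x, F s)) \<in> rel"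
  using assms(1,3)
proof (induction S rule: finite_induct)
  case empty
  then show ?case using assms by (simp add: rel_zeror)
next
  case (insert s S)
  then have "frag_of (x, F s \<oplus>\<^bsub>N\<^esub> (\<Oplus>\<^bsub>N\<^esub>s\<in>S. F s)) - frag_of (x, F s) - frag_of (x, \<Oplus>\<^bsub>N\<^esub>s\<in>S. F s)
      + (frag_of (x, \<Oplus>\<^bsub>N\<^esub>s\<in>S. F s) - (\<Sum>s\<in>S. frag_of (x, F s))) \<in> rel"
    using assms by (intro rel_add rel_addr N.finsum_closed) auto
  then show ?case
    using insert by (simp add: N.finsum_insert Pi_def algebra_simps)
qed

text \<open>Expand the right factor in the generators and move the coefficients across the tensor
  sign; one term remains for each generator. With the single generator \<open>1\<close> this serves
  the flatness of the identity, with preimages of the matrix units it serves the injectivity of the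
  map to matrices.\<close>

lemma tensor_normal_form:
  assumes S: "finite S" "\<And>s. s \<in> S \<Longrightarrow> e s \<in> carrier N"
    and gen: "\<And>y. y \<in> carrier N \<Longrightarrow> \<exists>r\<in>S \<rightarrow> carrier R. y = (\<Oplus>\<^bsub>N\<^esub>s\<in>S. r s \<odot>\<^bsub>N\<^esub> e s)"
    and z: "z \<in> carrier TF"
  shows "\<exists>c\<in>S \<rightarrow> carrier M. z - (\<Sum>s\<in>S. frag_of (c s, e s)) \<in> rel"
  using z
proof (induction z rule: TF_induct)
  case zero
  have "0 - (\<Sum>s\<in>S. frag_of (\<zero>\<^bsub>M\<^esub>, e s)) \<in> rel"
    using S by (intro rel_diff rel_sum rel_zerol) auto
  then show ?case by (intro bexI[of _ "\<lambda>_. \<zero>\<^bsub>M\<^esub>"]) auto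
next
  case (diff x y)
  then obtain c d where c: "c \<in> S \<rightarrow> carrier M" "x - (\<Sum>s\<in>S. frag_of (c s, e s)) \<in> rel"
    and d: "d \<in> S \<rightarrow> carrier M" "y - (\<Sum>s\<in>S. frag_of (d s, e s)) \<in> rel" by blast
  have sum: "(\<Sum>s\<in>S. frag_of (c s, e s) - frag_of (d s, e s) - frag_of (c s \<ominus>\<^bsub>M\<^esub> d s, e s)) \<in> rel"
    by (rule rel_sum, rule rel_diffl) (use S c d in \<open>auto\<close>)
  have "x - (\<Sum>s\<in>S. frag_of (c s, e s)) - (y - (\<Sum>s\<in>S. frag_of (d s, e s)))
      + (\<Sum>s\<in>S. frag_of (c s, e s) - frag_of (d s, e s) - frag_of (c s \<ominus>\<^bsub>M\<^esub> d s, e s)) \<in> rel"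
    by (rule rel_add[OF rel_diff[OF c(2) d(2)] sum])
  then have "x - y - (\<Sum>s\<in>S. frag_of (c s \<ominus>\<^bsub>M\<^esub> d s, e s)) \<in> rel"
    by (simp add: sum_subtractf)
  then show ?case
    using c d by (intro bexI[of _ "\<lambda>s. c s \<ominus>\<^bsub>M\<^esub> d s"]) auto
next
  case (gen m n)
  then obtain r where r: "r \<in> S \<rightarrow> carrier R" and n: "n = (\<Oplus>\<^bsub>N\<^esub>s\<in>S. r s \<odot>\<^bsub>N\<^esub> e s)"
    using assms(3) by blast
  have "frag_of (m, n) - (\<Sum>s\<in>S. frag_of (m, r s \<odot>\<^bsub>N\<^esub> e s))
      - (\<Sum>s\<in>S. frag_of (r s \<odot>\<^bsub>M\<^esub> m, e s) - frag_of (m, r s \<odot>\<^bsub>N\<^esub> e s)) \<in> rel"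
    unfolding n using S r gen(1) by (intro rel_diff rel_sum rel_finsum_r rel_smult) auto
  then have "frag_of (m, n) - (\<Sum>s\<in>S. frag_of (r s \<odot>\<^bsub>M\<^esub> m, e s)) \<in> rel"
    by (simp add: sum_subtractf)
  then show ?case
    using r gen(1) by (intro bexI[of _ "\<lambda>s. r s \<odot>\<^bsub>M\<^esub> m"]) auto
qed

text \<open>First half of the universal property: a map on pairs extends additively to the free
  abelian group. That the map is balanced enters in \<open>balanced_rel\<close>, which makes the
  extension vanish on the relations.\<close>

lemma balanced_hom:
  assumes P: "abelian_group P"
    and cl: "\<And>x y. x \<in> carrier M \<Longrightarrow> y \<in> carrier N \<Longrightarrow> \<psi> x y \<in> carrier P"
  obtains h where "\<And>x y. x \<in> carrier M \<Longrightarrow> y \<in> carrier N \<Longrightarrow> h (frag_of (x, y)) = \<psi> x y"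
    and "\<And>z. z \<in> carrier TF \<Longrightarrow> h z \<in> carrier P"
    and "\<And>z w. z \<in> carrier TF \<Longrightarrow> w \<in> carrier TF \<Longrightarrow> h (z + w) = h z \<oplus>\<^bsub>P\<^esub> h w"
proof -
  interpret P: abelian_group P by (rule P)
  have "(\<lambda>(x, y). \<psi> x y) ` (carrier M \<times> carrier N) \<subseteq> carrier (add_monoid P)" using cl by auto
  from comm_group.free_Abelian_group_universal[OF P.a_comm_group this]
  obtain h where h: "h \<in> hom TF (add_monoid P)"
    "\<And>x. x \<in> carrier M \<times> carrier N \<Longrightarrow> h (frag_of x) = (\<lambda>(x, y). \<psi> x y) x"
    unfolding tensor_free_def by blast
  show thesis
    by (rule that[of h]) (use h in \<open>auto simp: hom_def Pi_def\<close>)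
qed

text \<open>The elements with \<open>h z = 0\<close> form a subgroup, and the three hypotheses on
  pure tensors put the generators of the relation subgroup into it.\<close>

lemma balanced_rel:
  assumes P: "abelian_group P"
    and cl: "\<And>z. z \<in> carrier TF \<Longrightarrow> h z \<in> carrier P"
    and add: "\<And>z w. z \<in> carrier TF \<Longrightarrow> w \<in> carrier TF \<Longrightarrow> h (z + w) = h z \<oplus>\<^bsub>P\<^esub> h w"
    and addl: "\<And>x x' y. x \<in> carrier M \<Longrightarrow> x' \<in> carrier M \<Longrightarrow> y \<in> carrier N \<Longrightarrow>
      h (frag_of (x \<oplus>\<^bsub>M\<^esub> x', y)) = h (frag_of (x, y)) \<oplus>\<^bsub>P\<^esub> h (frag_of (x', y))"
    and addr: "\<And>x y y'. x \<in> carrier M \<Longrightarrow> y \<in> carrier N \<Longrightarrow> y' \<in> carrier N \<Longrightarrow>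
      h (frag_of (x, y \<oplus>\<^bsub>N\<^esub> y')) = h (frag_of (x, y)) \<oplus>\<^bsub>P\<^esub> h (frag_of (x, y'))"
    and bal: "\<And>r x y. r \<in> carrier R \<Longrightarrow> x \<in> carrier M \<Longrightarrow> y \<in> carrier N \<Longrightarrow>
      h (frag_of (r \<odot>\<^bsub>M\<^esub> x, y)) = h (frag_of (x, r \<odot>\<^bsub>N\<^esub> y))"
    and z: "z \<in> rel"
  shows "h z = \<zero>\<^bsub>P\<^esub>"
proof -
  interpret P: abelian_group P by (rule P)
  have h0: "h 0 = \<zero>\<^bsub>P\<^esub>"
    using add[of 0 0] cl[of 0] by (metis P.add.r_cancel_one TF_closed(1) add.right_neutral)
  have diff: "h (z - w) = a_minus P (h z) (h w)" if "z \<in> carrier TF" "w \<in> carrier TF" for z w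
  proof -
    have "h (z - w) \<oplus>\<^bsub>P\<^esub> h w = h z" using add[of "z - w" w] that by simp
    then show ?thesis using cl that
      by (metis P.add.inv_solve_right TF_closed(3) a_minus_def)
  qed
  define K where "K = {z \<in> carrier TF. h z = \<zero>\<^bsub>P\<^esub>}"
  have "h (- x) = \<zero>\<^bsub>P\<^esub>" if "x \<in> K" for x
    using diff[of 0 x] that h0 by (simp add: K_def P.minus_eq)
  moreover have "- x \<in> carrier TF" if "x \<in> carrier TF" for x
    using TF_closed(3)[of 0 x] that by simp
  ultimately have "subgroup K TF"
    by (intro TF.subgroupI) (auto simp: K_def h0 add intro: exI[of _ 0])
  moreover have "a_minus P (a_minus P (u \<oplus>\<^bsub>P\<^esub> v) u) v = \<zero>\<^bsub>P\<^esub>"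
    if "u \<in> carrier P" "v \<in> carrier P" for u v
    using that P.r_neg[of "u \<oplus>\<^bsub>P\<^esub> v"] by (simp add: P.minus_eq P.minus_add P.a_assoc)
  moreover have self: "a_minus P u u = \<zero>\<^bsub>P\<^esub>" if "u \<in> carrier P" for u
    using that by (simp add: P.minus_eq P.r_neg)
  ultimately have "rel \<subseteq> K"
    unfolding tensor_relations_def
    by (intro TF.generate_subgroup_incl) (auto simp: K_def diff addl addr bal cl self)
  with z show ?thesis by (auto simp: K_def)
qed

lemma class_eq_iff:
  assumes "z \<in> carrier TF" "w \<in> carrier TF"
  shows "tensor_class R M N z = tensor_class R M N w \<longleftrightarrow> z - w \<in> rel"
proof
  assume "tensor_class R M N z = tensor_class R M N w"
  then have "z \<in> tensor_class R M N w"
    using TF.rcos_self[OF assms(1) rel_subgroup] by (simp add: tensor_class_def)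
  then show "z - w \<in> rel" by (auto simp: tensor_class_def r_coset_def)
next
  assume "z - w \<in> rel"
  then have "z \<in> rel #>\<^bsub>TF\<^esub> w" by (auto simp: r_coset_def intro!: bexI[of _ "z - w"])
  then show "tensor_class R M N z = tensor_class R M N w"
    unfolding tensor_class_def using TF.repr_independence[OF _ assms(2) rel_subgroup] by simp
qed

lemma class_mem: "z \<in> carrier TF \<Longrightarrow> z \<in> tensor_class R M N z"
  using TF.rcos_self[OF _ rel_subgroup] by (simp add: tensor_class_def)

lemma class_memD:
  assumes "z \<in> carrier TF" "w \<in> tensor_class R M N z"
  shows "w \<in> carrier TF" "w - z \<in> rel" "tensor_class R M N w = tensor_class R M N z"
proof -
  obtain x where x: "x \<in> rel" "w = x + z"
    using assms(2) by (auto simp: tensor_class_def r_coset_def)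
  then show w: "w \<in> carrier TF" "w - z \<in> rel" using assms rel_carrier by auto
  then show "tensor_class R M N w = tensor_class R M N z" using assms by (simp add: class_eq_iff)
qed

lemma TF_Mod_carrier: "carrier (TF Mod rel) = tensor_class R M N ` carrier TF"
  by (auto simp: FactGroup_def RCOSETS_def tensor_class_def)

lemma TF_Mod_mult:
  assumes "z \<in> carrier TF" "w \<in> carrier TF"
  shows "tensor_class R M N z \<otimes>\<^bsub>TF Mod rel\<^esub> tensor_class R M N w = tensor_class R M N (z + w)"
  using normal.rcos_sum[OF TF.subgroup_imp_normal[OF rel_subgroup] assms]
  by (simp add: FactGroup_def tensor_class_def)

end


text \<open>
  \<open>C \<otimes>\<^sub>R A \<cong> M\<^sub>n(C)\<close> when \<open>A\<close> is identified with \<open>M\<^sub>n(R)\<close> by \<open>\<phi>\<close>: the pure tensor \<open>c \<otimes> a\<close>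
  corresponds to the matrix with entries \<open>\<phi>(a)\<^sub>i\<^sub>j c\<close>.
\<close>

definition tensor_mat_pure ::
  "nat \<Rightarrow> ('a \<Rightarrow> 'r matrix) \<Rightarrow> ('r, 'c) module \<Rightarrow> 'c \<Rightarrow> 'a \<Rightarrow> 'c matrix" where
  "tensor_mat_pure n \<phi> C c a = (\<lambda>i\<in>{..<n}. \<lambda>j\<in>{..<n}. \<phi> a i j \<odot>\<^bsub>C\<^esub> c)"

text \<open>The additive extension of \<open>tensor_mat_pure\<close> to the free abelian group. The
  universal property yields only existence, hence the choice; on the carrier any two choices agree,
  because the pairs generate it.\<close>

definition tensor_mat_lift ::
  "nat \<Rightarrow> ('a \<Rightarrow> 'r matrix) \<Rightarrow> ('r, 'c) module \<Rightarrow> ('r, 'a) module \<Rightarrow>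
   ('c \<times> 'a \<Rightarrow>\<^sub>0 int) \<Rightarrow> 'c matrix" where
  "tensor_mat_lift n \<phi> C A = (SOME h.
     (\<forall>c\<in>carrier C. \<forall>a\<in>carrier A. h (frag_of (c, a)) = tensor_mat_pure n \<phi> C c a) \<and>
     (\<forall>z\<in>carrier (tensor_free C A). h z \<in> carrier (mat_alg n C)) \<and>
     (\<forall>z\<in>carrier (tensor_free C A). \<forall>w\<in>carrier (tensor_free C A).
        h (z + w) = h z \<oplus>\<^bsub>mat_alg n C\<^esub> h w))"

text \<open>The lift vanishes on the relations (\<open>h_rel\<close>), so it is constant on each
  coset and its image there is a singleton.\<close>

definition tensor_mat ::
  "nat \<Rightarrow> ('a \<Rightarrow> 'r matrix) \<Rightarrow> ('r, 'c) module \<Rightarrow> ('r, 'a) module \<Rightarrow>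
   ('c \<times> 'a \<Rightarrow>\<^sub>0 int) set \<Rightarrow> 'c matrix" where
  "tensor_mat n \<phi> C A U = the_elem (tensor_mat_lift n \<phi> C A ` U)"

text \<open>\<open>C\<close> is allowed to be noncommutative. In this way one computation covers
  both the base change to a commutative algebra \<open>T\<close> and the tensor product of two
  symbol algebras.\<close>

locale tensor_split =
  fixes R :: "('r, 's) ring_scheme" and C :: "('r, 'c) module" and A :: "('r, 'a) module"
    and n :: nat and \<phi> :: "'a \<Rightarrow> 'r matrix"
  assumes C: "is_algebra R C" and A: "is_algebra R A"
    and \<phi>: "\<phi> \<in> alg_iso R A (mat_alg n R)"
begin

sublocale two_modules R C A
  using C A by (intro two_modules.intro) (auto simp: is_algebra_def)

sublocale C: ring C using C by (simp add: is_algebra_def)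
sublocale A: ring A using A by (simp add: is_algebra_def)
sublocale MC: ring "mat_alg n C" by (rule C.ring_mat_alg)
sublocale MR: ring "mat_alg n R" by (rule M.R.ring_mat_alg)

abbreviation h where "h \<equiv> tensor_mat_lift n \<phi> C A"
abbreviation cls where "cls \<equiv> tensor_class R C A"

lemma \<phi>_hom: "\<phi> \<in> alg_hom R A (mat_alg n R)" and \<phi>_bij: "bij_betw \<phi> (carrier A) (carrier (mat_alg n R))"
  using \<phi> by (auto simp: alg_iso_def)

lemmas \<phi>h = alg_homD[OF \<phi>_hom]

lemma \<phi>_entry [simp]: "a \<in> carrier A \<Longrightarrow> i < n \<Longrightarrow> j < n \<Longrightarrow> \<phi> a i j \<in> carrier R"
  by (rule mat_entry_closed[OF \<phi>h(1)])

lemma smult_mult: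
  "r \<in> carrier R \<Longrightarrow> s \<in> carrier R \<Longrightarrow> x \<in> carrier C \<Longrightarrow> y \<in> carrier C \<Longrightarrow>
   (r \<odot>\<^bsub>C\<^esub> x) \<otimes>\<^bsub>C\<^esub> (s \<odot>\<^bsub>C\<^esub> y) = (r \<otimes>\<^bsub>R\<^esub> s) \<odot>\<^bsub>C\<^esub> (x \<otimes>\<^bsub>C\<^esub> y)"
  using C M.smult_assoc1[of s r "x \<otimes>\<^bsub>C\<^esub> y"] by (simp add: is_algebra_def M.R.m_comm)

lemma smult_finsum_l:
  assumes "finite I" "\<And>i. i \<in> I \<Longrightarrow> r i \<in> carrier R" "c \<in> carrier C"
  shows "(\<Oplus>\<^bsub>R\<^esub>i\<in>I. r i) \<odot>\<^bsub>C\<^esub> c = (\<Oplus>\<^bsub>C\<^esub>i\<in>I. r i \<odot>\<^bsub>C\<^esub> c)"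
  using assms
  by (induction I rule: finite_induct)
    (simp_all add: M.R.finsum_insert M.finsum_insert M.smult_l_distr Pi_def M.R.finsum_closed)

lemma pure_closed:
  "c \<in> carrier C \<Longrightarrow> a \<in> carrier A \<Longrightarrow> tensor_mat_pure n \<phi> C c a \<in> carrier (mat_alg n C)"
  unfolding tensor_mat_pure_def by (rule mat_closedI) auto

lemma h_ex:
  "(\<forall>c\<in>carrier C. \<forall>a\<in>carrier A. h (frag_of (c, a)) = tensor_mat_pure n \<phi> C c a) \<and>
   (\<forall>z\<in>carrier TF. h z \<in> carrier (mat_alg n C)) \<and>
   (\<forall>z\<in>carrier TF. \<forall>w\<in>carrier TF. h (z + w) = h z \<oplus>\<^bsub>mat_alg n C\<^esub> h w)"
proof -
  obtain h where "\<And>x y. x \<in> carrier C \<Longrightarrow> y \<in> carrier A \<Longrightarrow> h (frag_of (x, y)) = tensor_mat_pure n \<phi> C x y"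
    and "\<And>z. z \<in> carrier TF \<Longrightarrow> h z \<in> carrier (mat_alg n C)"
    and "\<And>z w. z \<in> carrier TF \<Longrightarrow> w \<in> carrier TF \<Longrightarrow> h (z + w) = h z \<oplus>\<^bsub>mat_alg n C\<^esub> h w"
    by (rule balanced_hom[OF MC.is_abelian_group pure_closed]) blast+
  then have "\<exists>h. (\<forall>c\<in>carrier C. \<forall>a\<in>carrier A. h (frag_of (c, a)) = tensor_mat_pure n \<phi> C c a) \<and>
   (\<forall>z\<in>carrier TF. h z \<in> carrier (mat_alg n C)) \<and>
   (\<forall>z\<in>carrier TF. \<forall>w\<in>carrier TF. h (z + w) = h z \<oplus>\<^bsub>mat_alg n C\<^esub> h w)"
    by (intro exI[of _ h]) blast
  from someI_ex[OF this] show ?thesis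
    unfolding tensor_mat_lift_def .
qed

lemma h_pure: "c \<in> carrier C \<Longrightarrow> a \<in> carrier A \<Longrightarrow> h (frag_of (c, a)) = tensor_mat_pure n \<phi> C c a"
  and h_closed [simp]: "z \<in> carrier TF \<Longrightarrow> h z \<in> carrier (mat_alg n C)"
  and h_add: "z \<in> carrier TF \<Longrightarrow> w \<in> carrier TF \<Longrightarrow> h (z + w) = h z \<oplus>\<^bsub>mat_alg n C\<^esub> h w"
  using h_ex by blast+

lemma h_0: "h 0 = \<zero>\<^bsub>mat_alg n C\<^esub>"
  using h_add[of 0 0] h_closed[of 0] by (metis MC.add.r_cancel_one TF_closed(1) add.right_neutral)

lemma h_diff: 
  assumes "z \<in> carrier TF" "w \<in> carrier TF"
  shows "h (z - w) = h z \<ominus>\<^bsub>mat_alg n C\<^esub> h w"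
proof -
  have "h (z - w) \<oplus>\<^bsub>mat_alg n C\<^esub> h w = h z" using h_add[of "z - w" w] assms by simp
  then show ?thesis using assms
    by (metis MC.add.inv_solve_right TF_closed(3) a_minus_def h_closed)
qed

lemma h_sum:
  assumes "finite I" "\<And>i. i \<in> I \<Longrightarrow> F i \<in> carrier TF"
  shows "h (sum F I) = (\<Oplus>\<^bsub>mat_alg n C\<^esub>i\<in>I. h (F i))"
  using assms
  by (induction I rule: finite_induct) (simp_all add: h_0 h_add MC.finsum_insert Pi_def TF_sum_closed)

definition \<epsilon> where "\<epsilon> ij = inv_into (carrier A) \<phi> (mat_unit n R (fst ij) (snd ij))"

abbreviation "I2 \<equiv> {..<n} \<times> {..<n}"

lemma \<epsilon>: "\<epsilon> ij \<in> carrier A" "\<phi> (\<epsilon> ij) = mat_unit n R (fst ij) (snd ij)"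
proof -
  have "mat_unit n R (fst ij) (snd ij) \<in> \<phi> ` carrier A"
    using \<phi>_bij by (simp add: bij_betw_def)
  then show "\<epsilon> ij \<in> carrier A" "\<phi> (\<epsilon> ij) = mat_unit n R (fst ij) (snd ij)"
    unfolding \<epsilon>_def by (auto simp: f_inv_into_f inv_into_into)
qed

lemma \<phi>_finsum:
  assumes "finite I" "\<And>i. i \<in> I \<Longrightarrow> F i \<in> carrier A"
  shows "\<phi> (\<Oplus>\<^bsub>A\<^esub>i\<in>I. F i) = (\<Oplus>\<^bsub>mat_alg n R\<^esub>i\<in>I. \<phi> (F i))"
proof -
  have "\<phi> \<zero>\<^bsub>A\<^esub> \<oplus>\<^bsub>mat_alg n R\<^esub> \<phi> \<zero>\<^bsub>A\<^esub> = \<phi> \<zero>\<^bsub>A\<^esub>" using \<phi>h(2)[of "\<zero>\<^bsub>A\<^esub>" "\<zero>\<^bsub>A\<^esub>"] by simp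
  then have 0: "\<phi> \<zero>\<^bsub>A\<^esub> = \<zero>\<^bsub>mat_alg n R\<^esub>" using \<phi>h(1)[of "\<zero>\<^bsub>A\<^esub>"] by (simp add: MR.add.r_cancel_one)
  show ?thesis using assms
    by (induction I rule: finite_induct)
      (simp_all add: 0 N.finsum_insert MR.finsum_insert Pi_def \<phi>h N.finsum_closed)
qed

lemma delta_pair:
  assumes "abelian_monoid G" "\<And>ij. ij \<in> I2 \<Longrightarrow> f ij \<in> carrier G" "a < n" "b < n"
  shows "(\<Oplus>\<^bsub>G\<^esub>ij\<in>I2. if a = fst ij \<and> b = snd ij then f ij else \<zero>\<^bsub>G\<^esub>) = f (a, b)"
proof -
  interpret G: abelian_monoid G by fact
  have "(\<Oplus>\<^bsub>G\<^esub>ij\<in>I2. if a = fst ij \<and> b = snd ij then f ij else \<zero>\<^bsub>G\<^esub>)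
      = (\<Oplus>\<^bsub>G\<^esub>ij\<in>I2. if ij = (a, b) then f ij else \<zero>\<^bsub>G\<^esub>)"
    using assms by (intro G.finsum_cong') auto
  also have "\<dots> = f (a, b)" using assms by (subst G.finsum_delta) auto
  finally show ?thesis .
qed

lemma A_expand:
  assumes "a \<in> carrier A"
  shows "a = (\<Oplus>\<^bsub>A\<^esub>ij\<in>I2. \<phi> a (fst ij) (snd ij) \<odot>\<^bsub>A\<^esub> \<epsilon> ij)" (is "_ = ?b")
proof -
  have cl: "\<phi> a (fst ij) (snd ij) \<odot>\<^bsub>A\<^esub> \<epsilon> ij \<in> carrier A" if "ij \<in> I2" for ij
    using that assms \<epsilon> by auto
  then have b: "?b \<in> carrier A" by (intro N.finsum_closed) auto
  have "\<phi> a = \<phi> ?b"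
  proof (rule mat_eqI)
    fix k l assume kl: "k < n" "l < n"
    have "\<phi> ?b k l = (\<Oplus>\<^bsub>R\<^esub>ij\<in>I2. \<phi> (\<phi> a (fst ij) (snd ij) \<odot>\<^bsub>A\<^esub> \<epsilon> ij) k l)"
      using cl kl \<phi>h(1) by (subst \<phi>_finsum, simp_all) (subst M.R.mat_finsum_entry, auto)
    also have "\<dots> = (\<Oplus>\<^bsub>R\<^esub>ij\<in>I2. if k = fst ij \<and> l = snd ij then \<phi> a (fst ij) (snd ij) else \<zero>\<^bsub>R\<^esub>)"
      using assms kl \<epsilon> by (intro M.R.finsum_cong') (auto simp: \<phi>h(5) mat_smult_entry)
    also have "\<dots> = \<phi> a k l"
      using assms kl by (subst delta_pair) (auto simp: M.R.abelian_monoid_axioms)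
    finally show "\<phi> a k l = \<phi> ?b k l" ..
  qed (use assms b \<phi>h(1) in auto)
  then show ?thesis using \<phi>_bij assms b by (auto simp: bij_betw_def inj_on_def)
qed

lemma h_\<epsilon>_sum:
  assumes "\<And>ij. ij \<in> I2 \<Longrightarrow> c ij \<in> carrier C" "k < n" "l < n"
  shows "h (\<Sum>ij\<in>I2. frag_of (c ij, \<epsilon> ij)) k l = c (k, l)"
proof -
  have "h (\<Sum>ij\<in>I2. frag_of (c ij, \<epsilon> ij)) k l = (\<Oplus>\<^bsub>C\<^esub>ij\<in>I2. h (frag_of (c ij, \<epsilon> ij)) k l)"
    using assms \<epsilon> by (subst h_sum, simp_all) (subst C.mat_finsum_entry, auto)
  also have "\<dots> = (\<Oplus>\<^bsub>C\<^esub>ij\<in>I2. if k = fst ij \<and> l = snd ij then c ij else \<zero>\<^bsub>C\<^esub>)"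
    using assms \<epsilon> by (intro M.finsum_cong') (auto simp: h_pure tensor_mat_pure_def)
  also have "\<dots> = c (k, l)"
    using assms by (subst delta_pair) (auto simp: M.abelian_monoid_axioms)
  finally show ?thesis .
qed

lemma h_rel: "z \<in> rel \<Longrightarrow> h z = \<zero>\<^bsub>mat_alg n C\<^esub>"
proof (rule balanced_rel[OF MC.is_abelian_group])
  fix x x' y assume c: "x \<in> carrier C" "x' \<in> carrier C" "y \<in> carrier A"
  show "h (frag_of (x \<oplus>\<^bsub>C\<^esub> x', y)) = h (frag_of (x, y)) \<oplus>\<^bsub>mat_alg n C\<^esub> h (frag_of (x', y))"
    using c by (intro mat_eqI[of _ n C _ C])
      (auto intro!: C.mat_closed simp: mat_entry h_pure tensor_mat_pure_def M.smult_r_distr)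
next
  fix x y y' assume c: "x \<in> carrier C" "y \<in> carrier A" "y' \<in> carrier A"
  show "h (frag_of (x, y \<oplus>\<^bsub>A\<^esub> y')) = h (frag_of (x, y)) \<oplus>\<^bsub>mat_alg n C\<^esub> h (frag_of (x, y'))"
    using c by (intro mat_eqI[of _ n C _ C])
      (auto intro!: C.mat_closed simp: mat_entry h_pure tensor_mat_pure_def M.smult_l_distr \<phi>h(2))
next
  fix r x y assume c: "r \<in> carrier R" "x \<in> carrier C" "y \<in> carrier A"
  show "h (frag_of (r \<odot>\<^bsub>C\<^esub> x, y)) = h (frag_of (x, r \<odot>\<^bsub>A\<^esub> y))"
    using c by (intro mat_eqI[of _ n C _ C])
      (auto intro!: C.mat_closed
        simp: mat_entry h_pure tensor_mat_pure_def \<phi>h(5) M.R.m_comm simp flip: M.smult_assoc1)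
qed (auto simp: h_add)

text \<open>Modulo the relations \<open>z\<close> is a sum of terms
  \<open>c s \<otimes> \<epsilon> s\<close>, and the entries of its image are exactly the
  coefficients \<open>c s\<close>. If the image is zero, every coefficient is zero. This is the
  injectivity of the map from \<open>C \<otimes> A\<close> to matrices over
  \<open>C\<close>.\<close>

lemma h_kernel:
  assumes z: "z \<in> carrier TF" and 0: "h z = \<zero>\<^bsub>mat_alg n C\<^esub>"
  shows "z \<in> rel"
proof -
  have "\<exists>c\<in>I2 \<rightarrow> carrier C. z - (\<Sum>s\<in>I2. frag_of (c s, \<epsilon> s)) \<in> rel"
  proof (rule tensor_normal_form[OF _ _ _ z])
    fix y assume "y \<in> carrier A"
    then show "\<exists>r\<in>I2 \<rightarrow> carrier R. y = (\<Oplus>\<^bsub>A\<^esub>s\<in>I2. r s \<odot>\<^bsub>A\<^esub> \<epsilon> s)"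
      using A_expand[of y] by (intro bexI[of _ "\<lambda>s. \<phi> y (fst s) (snd s)"]) auto
  qed (auto simp: \<epsilon>)
  then obtain c where c: "c \<in> I2 \<rightarrow> carrier C" and r: "z - (\<Sum>s\<in>I2. frag_of (c s, \<epsilon> s)) \<in> rel"
    by blast
  have s: "(\<Sum>s\<in>I2. frag_of (c s, \<epsilon> s)) \<in> carrier TF" using c \<epsilon> by (intro TF_sum_closed TF_closed(4)) auto
  have hz: "h z = h (\<Sum>s\<in>I2. frag_of (c s, \<epsilon> s))"
    using h_rel[OF r] z s by (simp add: h_diff MC.r_right_minus_eq)
  have "c (k, l) = \<zero>\<^bsub>C\<^esub>" if "k < n" "l < n" for k l
  proof -
    have "h (\<Sum>s\<in>I2. frag_of (c s, \<epsilon> s)) k l = c (k, l)"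
      by (rule h_\<epsilon>_sum) (use c that in auto)
    then show ?thesis using mat_zero_entry[OF that, of C] hz 0 by simp
  qed
  then have "(\<Sum>s\<in>I2. frag_of (c s, \<epsilon> s)) \<in> rel"
    by (intro rel_sum) (auto simp: \<epsilon> intro!: rel_zerol)
  from rel_add[OF r this] show ?thesis by simp
qed

lemma tensor_mat_class: "z \<in> carrier TF \<Longrightarrow> tensor_mat n \<phi> C A (cls z) = h z"
proof -
  assume z: "z \<in> carrier TF"
  have *: "h w = h z" if "w \<in> cls z" for w
    using class_memD[OF z that] h_rel[of "w - z"] z by (simp add: h_diff MC.r_right_minus_eq)
  have "h ` cls z = {h z}"
  proof (intro equalityI subsetI)
    fix M assume "M \<in> h ` cls z"
    then show "M \<in> {h z}" using * by (metis imageE singletonI)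
  next
    fix M assume "M \<in> {h z}"
    then show "M \<in> h ` cls z" using class_mem[OF z] by (metis imageI singletonD)
  qed
  then show ?thesis by (simp add: tensor_mat_def)
qed

lemma tensor_ring_carrier: "carrier (tensor_ring R C A) = cls ` carrier TF"
  by (simp add: tensor_ring_def TF_Mod_carrier)

lemma tensor_mat_bij:
  "bij_betw (tensor_mat n \<phi> C A) (carrier (tensor_ring R C A)) (carrier (mat_alg n C))"
  unfolding bij_betw_def
proof
  show "inj_on (tensor_mat n \<phi> C A) (carrier (tensor_ring R C A))"
  proof (rule inj_onI)
    fix U V assume "U \<in> carrier (tensor_ring R C A)" "V \<in> carrier (tensor_ring R C A)"
      and eq: "tensor_mat n \<phi> C A U = tensor_mat n \<phi> C A V"
    then obtain z w where zw: "z \<in> carrier TF" "w \<in> carrier TF" "U = cls z" "V = cls w"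
      by (auto simp: tensor_ring_carrier)
    then have "h (z - w) = \<zero>\<^bsub>mat_alg n C\<^esub>"
      using eq by (simp add: h_diff tensor_mat_class MC.r_right_minus_eq)
    then show "U = V" using zw h_kernel[of "z - w"] by (simp add: class_eq_iff)
  qed
  have "N \<in> tensor_mat n \<phi> C A ` carrier (tensor_ring R C A)" if N: "N \<in> carrier (mat_alg n C)" for N
  proof -
    let ?z = "\<Sum>ij\<in>I2. frag_of (N (fst ij) (snd ij), \<epsilon> ij)"
    have z: "?z \<in> carrier TF" using N \<epsilon> by (intro TF_sum_closed TF_closed(4)) auto
    have "h ?z = N"
      using z N
      by (intro mat_eqI[of _ n C _ C]) (simp_all, subst h_\<epsilon>_sum[of "\<lambda>ij. N (fst ij) (snd ij)"], auto)
    then show ?thesis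
      using z tensor_mat_class[OF z] by (auto simp: tensor_ring_carrier intro!: image_eqI[of _ _ "cls ?z"])
  qed
  then show "tensor_mat n \<phi> C A ` carrier (tensor_ring R C A) = carrier (mat_alg n C)"
    by (auto simp: tensor_ring_carrier tensor_mat_class)
qed

lemma tensor_mat_closed:
  "U \<in> carrier (tensor_ring R C A) \<Longrightarrow> tensor_mat n \<phi> C A U \<in> carrier (mat_alg n C)"
  by (auto simp: tensor_ring_carrier tensor_mat_class)

lemma tensor_mat_add:
  assumes "U \<in> carrier (tensor_ring R C A)" "V \<in> carrier (tensor_ring R C A)"
  shows "U \<oplus>\<^bsub>tensor_ring R C A\<^esub> V \<in> carrier (tensor_ring R C A)"
    and "tensor_mat n \<phi> C A (U \<oplus>\<^bsub>tensor_ring R C A\<^esub> V)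
      = tensor_mat n \<phi> C A U \<oplus>\<^bsub>mat_alg n C\<^esub> tensor_mat n \<phi> C A V"
proof -
  from assms obtain z w where zw: "z \<in> carrier TF" "w \<in> carrier TF" "U = cls z" "V = cls w"
    by (auto simp: tensor_ring_carrier)
  then have eq: "U \<oplus>\<^bsub>tensor_ring R C A\<^esub> V = cls (z + w)"
    using TF_Mod_mult[of z w] by (simp add: tensor_ring_def)
  show "U \<oplus>\<^bsub>tensor_ring R C A\<^esub> V \<in> carrier (tensor_ring R C A)"
    unfolding eq tensor_ring_carrier using zw by simp
  show "tensor_mat n \<phi> C A (U \<oplus>\<^bsub>tensor_ring R C A\<^esub> V)
      = tensor_mat n \<phi> C A U \<oplus>\<^bsub>mat_alg n C\<^esub> tensor_mat n \<phi> C A V"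
    unfolding eq using zw by (simp add: tensor_mat_class h_add)
qed

lemma tensor_mat_zero:
  "\<zero>\<^bsub>tensor_ring R C A\<^esub> \<in> carrier (tensor_ring R C A)"
  "tensor_mat n \<phi> C A \<zero>\<^bsub>tensor_ring R C A\<^esub> = \<zero>\<^bsub>mat_alg n C\<^esub>"
proof -
  have eq: "\<zero>\<^bsub>tensor_ring R C A\<^esub> = cls 0"
    using TF.coset_mult_one[OF subgroup.subset[OF rel_subgroup]]
    by (simp add: tensor_ring_def tensor_class_def)
  show "\<zero>\<^bsub>tensor_ring R C A\<^esub> \<in> carrier (tensor_ring R C A)"
    "tensor_mat n \<phi> C A \<zero>\<^bsub>tensor_ring R C A\<^esub> = \<zero>\<^bsub>mat_alg n C\<^esub>"
    unfolding eq by (auto simp: tensor_ring_carrier tensor_mat_class h_0)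
qed

lemma tensor_mat_one:
  "\<one>\<^bsub>tensor_ring R C A\<^esub> \<in> carrier (tensor_ring R C A)"
  "tensor_mat n \<phi> C A \<one>\<^bsub>tensor_ring R C A\<^esub> = \<one>\<^bsub>mat_alg n C\<^esub>"
proof -
  have eq: "\<one>\<^bsub>tensor_ring R C A\<^esub> = cls (frag_of (\<one>\<^bsub>C\<^esub>, \<one>\<^bsub>A\<^esub>))"
    by (simp add: tensor_ring_def)
  show "\<one>\<^bsub>tensor_ring R C A\<^esub> \<in> carrier (tensor_ring R C A)"
    unfolding eq by (auto simp: tensor_ring_carrier)
  show "tensor_mat n \<phi> C A \<one>\<^bsub>tensor_ring R C A\<^esub> = \<one>\<^bsub>mat_alg n C\<^esub>"
    unfolding eq
    by (rule mat_eqI[of _ n C _ C])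
      (auto simp: tensor_mat_class h_pure tensor_mat_pure_def \<phi>h(4) mat_entry intro!: C.mat_closed)
qed

definition mult_lift where
  "mult_lift x y = frag_extend (\<lambda>(a, b). frag_extend (\<lambda>(a', b').
     frag_of (a \<otimes>\<^bsub>C\<^esub> a', b \<otimes>\<^bsub>A\<^esub> b')) y) x"

lemma pure_mult:
  assumes "c \<in> carrier C" "c' \<in> carrier C" "a \<in> carrier A" "a' \<in> carrier A"
  shows "tensor_mat_pure n \<phi> C (c \<otimes>\<^bsub>C\<^esub> c') (a \<otimes>\<^bsub>A\<^esub> a')
    = tensor_mat_pure n \<phi> C c a \<otimes>\<^bsub>mat_alg n C\<^esub> tensor_mat_pure n \<phi> C c' a'"
proof (rule mat_eqI)
  fix i j assume ij: "i < n" "j < n"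
  have "tensor_mat_pure n \<phi> C (c \<otimes>\<^bsub>C\<^esub> c') (a \<otimes>\<^bsub>A\<^esub> a') i j
      = (\<Oplus>\<^bsub>R\<^esub>l\<in>{..<n}. \<phi> a i l \<otimes>\<^bsub>R\<^esub> \<phi> a' l j) \<odot>\<^bsub>C\<^esub> (c \<otimes>\<^bsub>C\<^esub> c')"
    using ij assms by (simp add: tensor_mat_pure_def \<phi>h(3) mat_mult_entry)
  also have "\<dots> = (\<Oplus>\<^bsub>C\<^esub>l\<in>{..<n}. (\<phi> a i l \<otimes>\<^bsub>R\<^esub> \<phi> a' l j) \<odot>\<^bsub>C\<^esub> (c \<otimes>\<^bsub>C\<^esub> c'))"
    using ij assms by (intro smult_finsum_l) auto
  also have "\<dots> = (tensor_mat_pure n \<phi> C c a \<otimes>\<^bsub>mat_alg n C\<^esub> tensor_mat_pure n \<phi> C c' a') i j"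
    using ij assms unfolding mat_mult_entry[OF ij]
    by (intro M.finsum_cong') (auto simp: tensor_mat_pure_def smult_mult)
  finally show "tensor_mat_pure n \<phi> C (c \<otimes>\<^bsub>C\<^esub> c') (a \<otimes>\<^bsub>A\<^esub> a') i j = \<dots>" .
qed (use assms in \<open>auto intro!: pure_closed C.mat_closed\<close>)

lemma mult_lift_gen:
  assumes "c \<in> carrier C" "a \<in> carrier A" "y \<in> carrier TF"
  shows "mult_lift (frag_of (c, a)) y \<in> carrier TF \<and>
    h (mult_lift (frag_of (c, a)) y) = h (frag_of (c, a)) \<otimes>\<^bsub>mat_alg n C\<^esub> h y"
  using assms(3)
proof (induction y rule: TF_induct)
  case zero
  then show ?case using assms by (simp add: mult_lift_def h_0)
next
  case (diff x y)
  have "mult_lift (frag_of (c, a)) (x - y) = mult_lift (frag_of (c, a)) x - mult_lift (frag_of (c, a)) y"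
    by (simp add: mult_lift_def frag_extend_diff)
  then show ?case
    using diff assms by (simp add: h_diff MC.minus_eq MC.r_distr MC.r_minus)
next
  case (gen m n)
  then show ?case using assms by (simp add: mult_lift_def h_pure pure_mult)
qed

lemma mult_lift:
  assumes "x \<in> carrier TF" "y \<in> carrier TF"
  shows "mult_lift x y \<in> carrier TF \<and> h (mult_lift x y) = h x \<otimes>\<^bsub>mat_alg n C\<^esub> h y"
  using assms(1)
proof (induction x rule: TF_induct)
  case zero
  then show ?case using assms by (simp add: mult_lift_def h_0)
next
  case (diff z w)
  have "mult_lift (z - w) y = mult_lift z y - mult_lift w y"
    by (simp add: mult_lift_def frag_extend_diff)
  then show ?case
    using diff assms by (simp add: h_diff MC.minus_eq MC.l_distr MC.l_minus)
next
  case (gen m n)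
  then show ?case using assms mult_lift_gen by blast
qed

lemma tensor_mat_mult:
  assumes "U \<in> carrier (tensor_ring R C A)" "V \<in> carrier (tensor_ring R C A)"
  shows "U \<otimes>\<^bsub>tensor_ring R C A\<^esub> V \<in> carrier (tensor_ring R C A)"
    and "tensor_mat n \<phi> C A (U \<otimes>\<^bsub>tensor_ring R C A\<^esub> V)
      = tensor_mat n \<phi> C A U \<otimes>\<^bsub>mat_alg n C\<^esub> tensor_mat n \<phi> C A V"
proof -
  from assms obtain z w where zw: "z \<in> carrier TF" "w \<in> carrier TF" "U = cls z" "V = cls w"
    by (auto simp: tensor_ring_carrier)
  \<comment> \<open>The product in \<open>tensor_ring\<close> is a union over all representatives of
    both cosets. It collapses to one coset: all these products have the same image under
    \<open>h\<close>, and \<open>h\<close> is injective modulo the relations.\<close>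
  have cl: "cls (mult_lift z' w') = cls (mult_lift z w)" if "z' \<in> cls z" "w' \<in> cls w" for z' w'
  proof -
    have c: "z' \<in> carrier TF" "w' \<in> carrier TF" using class_memD that zw by blast+
    have "h z' = h z" "h w' = h w"
      using class_memD(3)[OF zw(1) that(1)] class_memD(3)[OF zw(2) that(2)] zw c
      by (metis tensor_mat_class)+
    then have "mult_lift z' w' - mult_lift z w \<in> rel"
      using mult_lift[OF c] mult_lift[OF zw(1,2)] MC.m_closed[of "h z" "h w"] zw
      by (intro h_kernel) (simp_all add: h_diff MC.r_right_minus_eq)
    then show ?thesis using mult_lift[OF c] mult_lift[OF zw(1,2)] by (simp add: class_eq_iff)
  qed
  have "U \<otimes>\<^bsub>tensor_ring R C A\<^esub> V = (\<Union>x\<in>cls z. \<Union>y\<in>cls w. cls (mult_lift x y))"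
    by (simp add: tensor_ring_def mult_lift_def zw)
  also have "\<dots> = cls (mult_lift z w)"
    using cl class_mem zw by blast
  finally have eq: "U \<otimes>\<^bsub>tensor_ring R C A\<^esub> V = cls (mult_lift z w)" .
  show "U \<otimes>\<^bsub>tensor_ring R C A\<^esub> V \<in> carrier (tensor_ring R C A)"
    unfolding eq using mult_lift[OF zw(1,2)] by (simp add: tensor_ring_carrier)
  show "tensor_mat n \<phi> C A (U \<otimes>\<^bsub>tensor_ring R C A\<^esub> V)
      = tensor_mat n \<phi> C A U \<otimes>\<^bsub>mat_alg n C\<^esub> tensor_mat n \<phi> C A V"
    unfolding eq using mult_lift[OF zw(1,2)] zw by (simp add: tensor_mat_class)
qed

end

section \<open>Linear maps on the left factor; base change of a split algebra\<close>

lemma mat_map_entry: "i < n \<Longrightarrow> j < n \<Longrightarrow> mat_map n f M i j = f (M i j)"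
  by (simp add: mat_map_def)

lemma mat_map_closed:
  assumes "\<And>x. x \<in> carrier T \<Longrightarrow> f x \<in> carrier T'" "M \<in> carrier (mat_alg n T)"
  shows "mat_map n f M \<in> carrier (mat_alg n T')"
  unfolding mat_map_def by (rule mat_closedI, rule assms(1), rule mat_entry_closed[OF assms(2)])

text \<open>Three operations are linear maps on the left factor: the map induced by
  \<open>T \<rightarrow> T'\<close>, multiplication by an element of \<open>T\<close> on a base
  change, and multiplication by a scalar of \<open>R\<close> on a tensor product. Stating the lemma
  for an arbitrary \<open>R\<close>-linear \<open>f\<close> shows for all three at once that they
  are well defined on cosets and act entrywise on the corresponding matrices.\<close>

lemma tensor_mat_left_map:
  assumes "tensor_split R C A n \<phi>" "tensor_split R C' A n \<phi>"
    and f: "\<And>x. x \<in> carrier C \<Longrightarrow> f x \<in> carrier C'"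
    "\<And>x y. x \<in> carrier C \<Longrightarrow> y \<in> carrier C \<Longrightarrow> f (x \<oplus>\<^bsub>C\<^esub> y) = f x \<oplus>\<^bsub>C'\<^esub> f y"
    "\<And>r x. r \<in> carrier R \<Longrightarrow> x \<in> carrier C \<Longrightarrow> f (r \<odot>\<^bsub>C\<^esub> x) = r \<odot>\<^bsub>C'\<^esub> f x"
    and U: "U \<in> carrier (tensor_ring R C A)"
  defines "V \<equiv> (\<Union>x\<in>U. tensor_class R C' A (frag_extend (\<lambda>(c, a). frag_of (f c, a)) x))"
  shows "V \<in> carrier (tensor_ring R C' A)"
    and "tensor_mat n \<phi> C' A V = mat_map n f (tensor_mat n \<phi> C A U)"
proof -
  interpret S: tensor_split R C A n \<phi> by fact
  interpret S': tensor_split R C' A n \<phi> by fact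
  let ?F = "frag_extend (\<lambda>(c, a). frag_of (f c, a))"
  let ?m = "mat_map n f"
  have f0: "f \<zero>\<^bsub>C\<^esub> = \<zero>\<^bsub>C'\<^esub>"
    using f(1)[of "\<zero>\<^bsub>C\<^esub>"] f(2)[of "\<zero>\<^bsub>C\<^esub>" "\<zero>\<^bsub>C\<^esub>"] by (simp add: S'.M.add.r_cancel_one')
  have fm: "f (\<ominus>\<^bsub>C\<^esub> x) = \<ominus>\<^bsub>C'\<^esub> f x" if "x \<in> carrier C" for x
    using f(2)[of "\<ominus>\<^bsub>C\<^esub> x" x] f(1) f0 that
    by (simp add: S.M.l_neg S'.M.minus_equality)
  have mcl: "?m M \<in> carrier (mat_alg n C')" if "M \<in> carrier (mat_alg n C)" for M
    by (rule mat_map_closed[OF _ that]) (rule f(1))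
  have m_diff: "?m (M \<ominus>\<^bsub>mat_alg n C\<^esub> N) = ?m M \<ominus>\<^bsub>mat_alg n C'\<^esub> ?m N"
    if "M \<in> carrier (mat_alg n C)" "N \<in> carrier (mat_alg n C)" for M N
  proof -
    have "?m (M \<ominus>\<^bsub>mat_alg n C\<^esub> N) \<oplus>\<^bsub>mat_alg n C'\<^esub> ?m N = ?m ((M \<ominus>\<^bsub>mat_alg n C\<^esub> N) \<oplus>\<^bsub>mat_alg n C\<^esub> N)"
      using that mat_entry_closed[OF S.MC.minus_closed[OF that]]
      by (intro mat_eqI[of _ n C' _ C'])
        (auto simp: mat_entry f mat_map_entry intro!: S'.C.mat_closed mcl)
    also have "(M \<ominus>\<^bsub>mat_alg n C\<^esub> N) \<oplus>\<^bsub>mat_alg n C\<^esub> N = M"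
      using that by (simp add: S.MC.minus_eq S.MC.a_assoc S.MC.l_neg)
    finally show ?thesis
      by (rule S'.MC.minus_solve[OF _ mcl[OF S.MC.minus_closed[OF that]] mcl[OF that(2)]])
  qed
  have F: "?F z \<in> carrier S'.TF \<and> S'.h (?F z) = ?m (S.h z)" if "z \<in> carrier S.TF" for z
    using that
  proof (induction z rule: S.TF_induct)
    case zero
    then show ?case
      using mcl[OF S.MC.zero_closed]
      by (simp add: S.h_0 S'.h_0)
        (rule mat_eqI[of _ n C' _ C'], simp_all add: mat_map_entry mat_entry f0 S'.C.mat_closed)
  next
    case (diff x y)
    then show ?case by (simp add: frag_extend_diff S.h_diff S'.h_diff m_diff)
  next
    case (gen c a)
    then have "tensor_mat_pure n \<phi> C' (f c) a = ?m (tensor_mat_pure n \<phi> C c a)"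
      by (intro mat_eqI[of _ n C' _ C'] S'.pure_closed mcl S.pure_closed)
        (auto simp: tensor_mat_pure_def mat_map_entry f)
    then show ?case using gen f by (simp add: S.h_pure S'.h_pure)
  qed
  obtain z where z: "z \<in> carrier S.TF" "U = tensor_class R C A z"
    using U by (auto simp: S.tensor_ring_carrier)
  have "tensor_class R C' A (?F w) = tensor_class R C' A (?F z)" if w: "w \<in> U" for w
  proof -
    have c: "w \<in> carrier S.TF" "S.h w = S.h z"
      using S.class_memD[OF z(1)] w z by (auto simp: S.tensor_mat_class[symmetric])
    have "?F w - ?F z \<in> S'.rel"
      using F[OF c(1)] F[OF z(1)] c S'.h_closed[of "?F z"]
      by (intro S'.h_kernel) (simp_all add: S'.h_diff S'.MC.r_right_minus_eq)
    then show ?thesis using F c z by (simp add: S'.class_eq_iff)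
  qed
  then have V: "V = tensor_class R C' A (?F z)"
    unfolding V_def using S.class_mem[OF z(1)] z(2) by blast
  show "V \<in> carrier (tensor_ring R C' A)" unfolding V using F[OF z(1)] by (simp add: S'.tensor_ring_carrier)
  show "tensor_mat n \<phi> C' A V = ?m (tensor_mat n \<phi> C A U)"
    unfolding V z(2) using F[OF z(1)] z(1) by (simp add: S'.tensor_mat_class S.tensor_mat_class)
qed

lemma algebra_imp_is_algebra:
  assumes "algebra R T"
  shows "is_algebra R T"
proof -
  interpret T: cring T by (rule algebra.M_cring[OF assms])
  note smult_assoc2 = algebra.smult_assoc2[OF assms] and module = algebra.module[OF assms]
    and smult_closed = module.smult_closed[OF algebra.module[OF assms]]
  have "x \<otimes>\<^bsub>T\<^esub> (r \<odot>\<^bsub>T\<^esub> y) = r \<odot>\<^bsub>T\<^esub> (x \<otimes>\<^bsub>T\<^esub> y)"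
    if "r \<in> carrier R" "x \<in> carrier T" "y \<in> carrier T" for r x y
    using that smult_assoc2[of r y x] smult_closed[of r y] by (simp add: T.m_comm)
  then show ?thesis
    unfolding is_algebra_def using module T.ring_axioms smult_assoc2 by blast
qed

lemma algebraD:
  assumes "algebra R T"
  shows "cring R" "cring T" "ring T" "is_algebra R T" "module R T"
proof -
  interpret algebra R T by fact
  show "cring R" "cring T" "ring T" "module R T"
    using R_cring M_cring cring.axioms(1)[OF M_cring] module by blast+
qed (rule algebra_imp_is_algebra[OF assms])

lemma alg_isoI:
  "h \<in> alg_hom R A B \<Longrightarrow> bij_betw h (carrier A) (carrier B) \<Longrightarrow> h \<in> alg_iso R A B"
  by (simp add: alg_iso_def)

lemma base_change_simps:
  "carrier (base_change R T A) = carrier (tensor_ring R T A)"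
  "x \<otimes>\<^bsub>base_change R T A\<^esub> y = x \<otimes>\<^bsub>tensor_ring R T A\<^esub> y"
  "x \<oplus>\<^bsub>base_change R T A\<^esub> y = x \<oplus>\<^bsub>tensor_ring R T A\<^esub> y"
  "\<one>\<^bsub>base_change R T A\<^esub> = \<one>\<^bsub>tensor_ring R T A\<^esub>"
  "\<zero>\<^bsub>base_change R T A\<^esub> = \<zero>\<^bsub>tensor_ring R T A\<^esub>"
  "t \<odot>\<^bsub>base_change R T A\<^esub> U = (\<Union>x\<in>U. tensor_class R T A
        (frag_extend (\<lambda>(t', a). frag_of (t \<otimes>\<^bsub>T\<^esub> t', a)) x))"
  by (simp_all add: base_change_def ring.defs)

lemma tensor_algebra_simps:
  "carrier (tensor_algebra R T A) = carrier (tensor_ring R T A)"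
  "x \<otimes>\<^bsub>tensor_algebra R T A\<^esub> y = x \<otimes>\<^bsub>tensor_ring R T A\<^esub> y"
  "x \<oplus>\<^bsub>tensor_algebra R T A\<^esub> y = x \<oplus>\<^bsub>tensor_ring R T A\<^esub> y"
  "\<one>\<^bsub>tensor_algebra R T A\<^esub> = \<one>\<^bsub>tensor_ring R T A\<^esub>"
  "\<zero>\<^bsub>tensor_algebra R T A\<^esub> = \<zero>\<^bsub>tensor_ring R T A\<^esub>"
  "r \<odot>\<^bsub>tensor_algebra R T A\<^esub> U = (\<Union>x\<in>U. tensor_class R T A
        (frag_extend (\<lambda>(t', a). frag_of (r \<odot>\<^bsub>T\<^esub> t', a)) x))"
  by (simp_all add: tensor_algebra_def ring.defs)

text \<open>The restriction to the carrier is there because \<open>alg_hom\<close> consists of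
  extensional functions.\<close>

definition base_change_mat ::
  "('r, 's) ring_scheme \<Rightarrow> nat \<Rightarrow> ('a \<Rightarrow> 'r matrix) \<Rightarrow> ('r, 'a) module \<Rightarrow> 'r alg \<Rightarrow>
   ('r \<times> 'a \<Rightarrow>\<^sub>0 int) set \<Rightarrow> 'r matrix" where
  "base_change_mat R n \<phi> A T = restrict (tensor_mat n \<phi> T A) (carrier (base_change R T A))"

context
  fixes R :: "('r, 's) ring_scheme" and A :: "('r, 'a) module" and n and \<phi> :: "'a \<Rightarrow> 'r matrix"
  assumes A: "is_algebra R A" and \<phi>: "\<phi> \<in> alg_iso R A (mat_alg n R)"
begin

lemma tensor_splitI: "algebra R T \<Longrightarrow> tensor_split R T A n \<phi>"
  using A \<phi> by (simp add: tensor_split_def algebra_imp_is_algebra)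

lemma base_change_smult:
  assumes T: "algebra R T" and t: "t \<in> carrier T" and U: "U \<in> carrier (base_change R T A)"
  shows "t \<odot>\<^bsub>base_change R T A\<^esub> U \<in> carrier (base_change R T A)"
    and "tensor_mat n \<phi> T A (t \<odot>\<^bsub>base_change R T A\<^esub> U) = t \<odot>\<^bsub>mat_alg n T\<^esub> tensor_mat n \<phi> T A U"
proof -
  interpret T: cring T by (rule algebraD(2)[OF T])
  have S: "r \<odot>\<^bsub>T\<^esub> (t \<otimes>\<^bsub>T\<^esub> x) = t \<otimes>\<^bsub>T\<^esub> (r \<odot>\<^bsub>T\<^esub> x)" if "r \<in> carrier R" "x \<in> carrier T" for r x
    using algebraD(4)[OF T] that t by (simp add: is_algebra_def)
  note L = tensor_mat_left_map[OF tensor_splitI[OF T] tensor_splitI[OF T], where f = "\<lambda>x. t \<otimes>\<^bsub>T\<^esub> x", OF _ _ _ U[unfolded base_change_simps]]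
  show "t \<odot>\<^bsub>base_change R T A\<^esub> U \<in> carrier (base_change R T A)"
    unfolding base_change_simps by (rule L(1)) (auto simp: t T.r_distr S)
  have "tensor_mat n \<phi> T A (t \<odot>\<^bsub>base_change R T A\<^esub> U) = mat_map n (\<lambda>x. t \<otimes>\<^bsub>T\<^esub> x) (tensor_mat n \<phi> T A U)"
    unfolding base_change_simps by (rule L(2)) (auto simp: t T.r_distr S)
  also have "\<dots> = t \<odot>\<^bsub>mat_alg n T\<^esub> tensor_mat n \<phi> T A U"
    by (simp add: mat_map_def mat_smult_eq)
  finally show "tensor_mat n \<phi> T A (t \<odot>\<^bsub>base_change R T A\<^esub> U) = t \<odot>\<^bsub>mat_alg n T\<^esub> tensor_mat n \<phi> T A U" .
qed

lemma base_change_algebra: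
  assumes T: "algebra R T"
  shows "is_algebra T (base_change R T A)"
proof -
  interpret tensor_split R T A n \<phi> by (rule tensor_splitI[OF T])
  interpret T: cring T by (rule algebraD(2)[OF T])
  show ?thesis
  proof (rule is_algebra_transport[OF T.mat_is_algebra, where \<Psi> = "tensor_mat n \<phi> T A"])
    show "bij_betw (tensor_mat n \<phi> T A) (carrier (base_change R T A)) (carrier (mat_alg n T))"
      using tensor_mat_bij by (simp add: base_change_simps)
  qed (use base_change_smult[OF T] in
      \<open>auto simp: base_change_simps(1-5) tensor_mat_add tensor_mat_mult tensor_mat_zero tensor_mat_one\<close>)
qed

lemma base_change_mat_iso:
  assumes T: "algebra R T"
  shows "base_change_mat R n \<phi> A T \<in> alg_iso T (base_change R T A) (mat_alg n T)"
proof -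
  interpret tensor_split R T A n \<phi> by (rule tensor_splitI[OF T])
  interpret B: ring "base_change R T A"
    using base_change_algebra[OF T] by (simp add: is_algebra_def)
  show ?thesis
  proof (intro alg_isoI alg_homI)
    show "bij_betw (base_change_mat R n \<phi> A T) (carrier (base_change R T A)) (carrier (mat_alg n T))"
      using tensor_mat_bij
      by (simp add: base_change_mat_def base_change_simps(1) bij_betw_def inj_on_def)
  qed (use base_change_smult[OF T] in
      \<open>auto simp: base_change_mat_def base_change_simps(1-5) tensor_mat_add tensor_mat_mult
        tensor_mat_zero tensor_mat_one tensor_mat_closed\<close>)
qed

text \<open>Naturality of the trivialization in \<open>T\<close>. It is what later identifies
  restriction of points of \<open>P(A)\<close> with restriction of automorphisms of matrix
  algebras.\<close>

lemma base_change_mat_natural: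
  assumes T: "algebra R T" and T': "algebra R T'" and f: "f \<in> alg_hom R T T'"
    and U: "U \<in> carrier (base_change R T A)"
  shows "base_change_map R T' A f U \<in> carrier (base_change R T' A)"
    and "base_change_mat R n \<phi> A T' (base_change_map R T' A f U)
      = mat_map n f (base_change_mat R n \<phi> A T U)"
proof -
  note f = alg_homD[OF f]
  note L = tensor_mat_left_map[OF tensor_splitI[OF T] tensor_splitI[OF T'], where f = f, OF f(1) f(2) f(5) U[unfolded base_change_simps]]
  show *: "base_change_map R T' A f U \<in> carrier (base_change R T' A)"
    using L(1) by (simp add: base_change_map_def base_change_simps)
  show "base_change_mat R n \<phi> A T' (base_change_map R T' A f U)
      = mat_map n f (base_change_mat R n \<phi> A T U)"
    using L(2) * U by (simp add: base_change_mat_def) (simp add: base_change_map_def)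
qed

end

section \<open>Block matrices and the tensor product of two split algebras\<close>

definition mat_emb :: "nat \<Rightarrow> ('a \<Rightarrow> 'b) \<Rightarrow> 'a matrix \<Rightarrow> 'b matrix" where
  "mat_emb n f M = (\<lambda>i\<in>{..<n}. \<lambda>j\<in>{..<n}. f (M i j))"

lemma mat_emb_entry: "i < n \<Longrightarrow> j < n \<Longrightarrow> mat_emb n f M i j = f (M i j)"
  by (simp add: mat_emb_def)

lemma mat_emb_closed:
  assumes "\<And>x. x \<in> carrier T \<Longrightarrow> f x \<in> carrier T'" "M \<in> carrier (mat_alg n T)"
  shows "mat_emb n f M \<in> carrier (mat_alg n T')"
  unfolding mat_emb_def by (rule mat_closedI, rule assms(1), rule mat_entry_closed[OF assms(2)])

text \<open>The identification of matrices of matrices with larger matrices: the position of the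
  block is the quotient by \<open>m\<close>, the position inside the block the remainder, as in
  \<open>finsum_blocks\<close>.\<close>

definition mat_flat :: "nat \<Rightarrow> nat \<Rightarrow> 'r matrix matrix \<Rightarrow> 'r matrix" where
  "mat_flat n m M = (\<lambda>i\<in>{..<n * m}. \<lambda>j\<in>{..<n * m}. M (i div m) (j div m) (i mod m) (j mod m))"

lemma mat_flat_entry:
  "i < n * m \<Longrightarrow> j < n * m \<Longrightarrow> mat_flat n m M i j = M (i div m) (j div m) (i mod m) (j mod m)"
  by (simp add: mat_flat_def)

lemma block_index: "i < n * m \<Longrightarrow> i div m < n \<and> i mod m < m" for i n m :: nat
  by (metis less_mult_imp_div_less mod_less_divisor mult_0_right not_gr_zero not_less_zero)

lemma block_index': "a < n \<Longrightarrow> b < m \<Longrightarrow> a * m + b < n * m" for a n b m :: nat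
proof -
  assume "a < n" "b < m"
  then have "a * m + b < Suc a * m" by simp
  also have "\<dots> \<le> n * m" using \<open>a < n\<close> by (intro mult_le_mono) auto
  finally show ?thesis .
qed

context cring
begin

lemma mat_flat_closed:
  "M \<in> carrier (mat_alg n (mat_alg m R)) \<Longrightarrow> mat_flat n m M \<in> carrier (mat_alg (n * m) R)"
  unfolding mat_flat_def using block_index
  by (intro mat_closedI) (metis mat_entry_closed)

lemma mat_flat_mult:
  assumes M: "M \<in> carrier (mat_alg n (mat_alg m R))" and N: "N \<in> carrier (mat_alg n (mat_alg m R))"
  shows "mat_flat n m (M \<otimes>\<^bsub>mat_alg n (mat_alg m R)\<^esub> N)
    = mat_flat n m M \<otimes>\<^bsub>mat_alg (n * m) R\<^esub> mat_flat n m N"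
proof (rule mat_eqI)
  interpret Mm: ring "mat_alg m R" by (rule ring_mat_alg)
  interpret MM: ring "mat_alg n (mat_alg m R)" by (rule Mm.ring_mat_alg)
  show "mat_flat n m (M \<otimes>\<^bsub>mat_alg n (mat_alg m R)\<^esub> N) \<in> carrier (mat_alg (n * m) R)"
    "mat_flat n m M \<otimes>\<^bsub>mat_alg (n * m) R\<^esub> mat_flat n m N \<in> carrier (mat_alg (n * m) R)"
    using M N by (auto intro!: mat_flat_closed mat_closed)
  fix i j assume ij: "i < n * m" "j < n * m"
  note b = block_index[OF ij(1)] block_index[OF ij(2)]
  have cM: "M a l \<in> carrier (mat_alg m R)" "N a l \<in> carrier (mat_alg m R)" if "a < n" "l < n" for a l
    using M N that by auto
  have cM': "M a l c d \<in> carrier R" "N a l c d \<in> carrier R"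
    if "a < n" "l < n" "c < m" "d < m" for a l c d
    using cM[OF that(1,2)] that(3,4) by (auto intro: mat_entry_closed)
  have "mat_flat n m (M \<otimes>\<^bsub>mat_alg n (mat_alg m R)\<^esub> N) i j
      = (\<Oplus>\<^bsub>mat_alg m R\<^esub>l\<in>{..<n}. M (i div m) l \<otimes>\<^bsub>mat_alg m R\<^esub> N l (j div m)) (i mod m) (j mod m)"
    using ij b by (simp add: mat_flat_entry mat_mult_entry)
  also have "\<dots> = (\<Oplus>l\<in>{..<n}. (M (i div m) l \<otimes>\<^bsub>mat_alg m R\<^esub> N l (j div m)) (i mod m) (j mod m))"
    using b cM by (intro mat_finsum_entry) auto
  also have "\<dots> = (\<Oplus>l\<in>{..<n}. \<Oplus>k\<in>{..<m}. M (i div m) l (i mod m) k \<otimes> N l (j div m) k (j mod m))"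
    using b by (simp only: mat_mult_entry)
  also have "\<dots> = (\<Oplus>l\<in>{..<n}. \<Oplus>k\<in>{..<m}. mat_flat n m M i (l * m + k) \<otimes> mat_flat n m N (l * m + k) j)"
    using ij b cM' by (intro finsum_cong' finsum_closed)
      (auto intro!: finsum_cong' finsum_closed simp: mat_flat_entry block_index')
  also have "\<dots> = (\<Oplus>l\<in>{..<n * m}. mat_flat n m M i l \<otimes> mat_flat n m N l j)"
    using ij mat_flat_closed[OF M] mat_flat_closed[OF N] by (intro finsum_blocks[symmetric]) auto
  also have "\<dots> = (mat_flat n m M \<otimes>\<^bsub>mat_alg (n * m) R\<^esub> mat_flat n m N) i j"
    using ij by (simp only: mat_mult_entry)
  finally show "mat_flat n m (M \<otimes>\<^bsub>mat_alg n (mat_alg m R)\<^esub> N) i j = \<dots>" .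
qed

lemma mat_flat_bij:
  "bij_betw (mat_flat n m) (carrier (mat_alg n (mat_alg m R))) (carrier (mat_alg (n * m) R))"
proof (rule bij_betw_byWitness[where f' = "\<lambda>N. \<lambda>a\<in>{..<n}. \<lambda>b\<in>{..<n}. \<lambda>c\<in>{..<m}. \<lambda>d\<in>{..<m}. N (a * m + c) (b * m + d)"])
  show "mat_flat n m ` carrier (mat_alg n (mat_alg m R)) \<subseteq> carrier (mat_alg (n * m) R)"
    using mat_flat_closed by blast
  show bk: "(\<lambda>N. \<lambda>a\<in>{..<n}. \<lambda>b\<in>{..<n}. \<lambda>c\<in>{..<m}. \<lambda>d\<in>{..<m}. N (a * m + c) (b * m + d)) `
    carrier (mat_alg (n * m) R) \<subseteq> carrier (mat_alg n (mat_alg m R))"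
    using block_index' by (intro subsetI) (auto intro!: mat_closedI)
  show "\<forall>M\<in>carrier (mat_alg n (mat_alg m R)).
     (\<lambda>a\<in>{..<n}. \<lambda>b\<in>{..<n}. \<lambda>c\<in>{..<m}. \<lambda>d\<in>{..<m}. mat_flat n m M (a * m + c) (b * m + d)) = M"
  proof
    fix M assume M: "M \<in> carrier (mat_alg n (mat_alg m R))"
    show "(\<lambda>a\<in>{..<n}. \<lambda>b\<in>{..<n}. \<lambda>c\<in>{..<m}. \<lambda>d\<in>{..<m}. mat_flat n m M (a * m + c) (b * m + d)) = M"
    proof (rule mat_eqI[of _ n "mat_alg m R" _ "mat_alg m R"])
      show "(\<lambda>a\<in>{..<n}. \<lambda>b\<in>{..<n}. \<lambda>c\<in>{..<m}. \<lambda>d\<in>{..<m}. mat_flat n m M (a * m + c) (b * m + d))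
          \<in> carrier (mat_alg n (mat_alg m R))"
        using bk mat_flat_closed[OF M] by blast
      fix a b assume ab: "a < n" "b < n"
      show "(\<lambda>a\<in>{..<n}. \<lambda>b\<in>{..<n}. \<lambda>c\<in>{..<m}. \<lambda>d\<in>{..<m}. mat_flat n m M (a * m + c) (b * m + d)) a b = M a b"
        using ab mat_flat_closed[OF M] mat_entry_closed[OF M ab]
        by (intro mat_eqI[of _ m R _ R]) (auto simp: mat_flat_entry block_index' intro!: mat_closedI)
    qed (rule M)
  qed
  show "\<forall>N\<in>carrier (mat_alg (n * m) R). mat_flat n m
      (\<lambda>a\<in>{..<n}. \<lambda>b\<in>{..<n}. \<lambda>c\<in>{..<m}. \<lambda>d\<in>{..<m}. N (a * m + c) (b * m + d)) = N"
  proof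
    fix N assume N: "N \<in> carrier (mat_alg (n * m) R)"
    show "mat_flat n m (\<lambda>a\<in>{..<n}. \<lambda>b\<in>{..<n}. \<lambda>c\<in>{..<m}. \<lambda>d\<in>{..<m}. N (a * m + c) (b * m + d)) = N"
      using bk N block_index
      by (intro mat_eqI[of _ "n * m" R _ R] mat_flat_closed) (auto simp: mat_flat_entry)
  qed
qed

end

text \<open>The isomorphism is the composite of three bijections: from \<open>C \<otimes> A\<close>
  to matrices over \<open>C\<close> by the splitting of \<open>A\<close>, then to matrices of
  matrices by applying \<open>\<phi>'\<close> to each entry, then to matrices of size
  \<open>n * m\<close> by removing the block structure. The laws of \<open>tensor_algebra\<close>
  are pulled back along the composite.\<close>

lemma tensor_algebra_split:
  assumes C: "is_algebra R C" and \<phi>': "\<phi>' \<in> alg_iso R C (mat_alg m R)"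
    and A: "is_algebra R A" and \<phi>: "\<phi> \<in> alg_iso R A (mat_alg n R)"
  shows "is_algebra R (tensor_algebra R C A) \<and>
    alg_iso R (tensor_algebra R C A) (mat_alg (n * m) R) \<noteq> {}"
proof -
  let ?B = "tensor_algebra R C A" and ?M = "mat_alg (n * m) R"
  interpret tensor_split R C A n \<phi> using C A \<phi> by unfold_locales
  interpret Mm: ring "mat_alg m R" by (rule M.R.ring_mat_alg)
  have p: "\<phi>' \<in> alg_hom R C (mat_alg m R)" and pb: "bij_betw \<phi>' (carrier C) (carrier (mat_alg m R))"
    using \<phi>' by (auto simp: alg_iso_def)
  note p = alg_homD[OF p]
  have p_fin: "\<phi>' (\<Oplus>\<^bsub>C\<^esub>i\<in>I. F i) = (\<Oplus>\<^bsub>mat_alg m R\<^esub>i\<in>I. \<phi>' (F i))"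
    if "finite I" "\<And>i. i \<in> I \<Longrightarrow> F i \<in> carrier C" for I :: "nat set" and F
  proof -
    have "\<phi>' \<zero>\<^bsub>C\<^esub> \<oplus>\<^bsub>mat_alg m R\<^esub> \<phi>' \<zero>\<^bsub>C\<^esub> = \<phi>' \<zero>\<^bsub>C\<^esub>" using p(2)[of "\<zero>\<^bsub>C\<^esub>" "\<zero>\<^bsub>C\<^esub>"] by simp
    then have 0: "\<phi>' \<zero>\<^bsub>C\<^esub> = \<zero>\<^bsub>mat_alg m R\<^esub>" using p(1)[of "\<zero>\<^bsub>C\<^esub>"] by (simp add: Mm.add.r_cancel_one)
    show ?thesis using that
      by (induction I rule: finite_induct)
        (simp_all add: 0 M.finsum_insert Mm.finsum_insert Pi_def p M.finsum_closed)
  qed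
  define \<Psi> where "\<Psi> U = mat_flat n m (mat_emb n \<phi>' (tensor_mat n \<phi> C A U))" for U
  have map_closed: "mat_emb n \<phi>' M \<in> carrier (mat_alg n (mat_alg m R))" if "M \<in> carrier (mat_alg n C)" for M
    by (rule mat_emb_closed[OF _ that]) (rule p(1))
  have map_bij: "bij_betw (mat_emb n \<phi>') (carrier (mat_alg n C)) (carrier (mat_alg n (mat_alg m R)))"
  proof (rule bij_betw_byWitness[where f' = "mat_emb n (inv_into (carrier C) \<phi>')"])
    have inv: "inv_into (carrier C) \<phi>' y \<in> carrier C" "\<phi>' (inv_into (carrier C) \<phi>' y) = y"
      if "y \<in> carrier (mat_alg m R)" for y
      using that pb by (auto simp: bij_betw_def inv_into_into f_inv_into_f)
    have inv': "inv_into (carrier C) \<phi>' (\<phi>' x) = x" if "x \<in> carrier C" for x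
      using that pb by (simp add: bij_betw_inv_into_left)
    have cl: "mat_emb n (inv_into (carrier C) \<phi>') N \<in> carrier (mat_alg n C)"
      if "N \<in> carrier (mat_alg n (mat_alg m R))" for N
      by (rule mat_emb_closed[OF _ that]) (rule inv(1))
    show "mat_emb n \<phi>' ` carrier (mat_alg n C) \<subseteq> carrier (mat_alg n (mat_alg m R))"
      "mat_emb n (inv_into (carrier C) \<phi>') ` carrier (mat_alg n (mat_alg m R)) \<subseteq> carrier (mat_alg n C)"
      using map_closed cl by blast+
    show "\<forall>M\<in>carrier (mat_alg n C). mat_emb n (inv_into (carrier C) \<phi>') (mat_emb n \<phi>' M) = M"
      using cl map_closed
      by (intro ballI mat_eqI[of _ n C _ C]) (auto simp: mat_emb_entry inv' mat_entry_closed)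
    show "\<forall>M\<in>carrier (mat_alg n (mat_alg m R)). mat_emb n \<phi>' (mat_emb n (inv_into (carrier C) \<phi>') M) = M"
      using cl map_closed
      by (intro ballI mat_eqI[of _ n "mat_alg m R" _ "mat_alg m R"])
        (auto simp: mat_emb_entry inv mat_entry_closed)
  qed
  have bij: "bij_betw \<Psi> (carrier ?B) (carrier ?M)"
    using bij_betw_trans[OF bij_betw_trans[OF tensor_mat_bij map_bij] M.R.mat_flat_bij]
    by (simp add: tensor_algebra_simps(1) \<Psi>_def[abs_def] comp_def)
  have ent: "\<Psi> U i j = \<phi>' (tensor_mat n \<phi> C A U (i div m) (j div m)) (i mod m) (j mod m)"
    if "i < n * m" "j < n * m" for U i j
    using that block_index[OF that(1)] block_index[OF that(2)]
    by (simp add: \<Psi>_def mat_flat_entry mat_emb_entry)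
  have tc: "tensor_mat n \<phi> C A U a b \<in> carrier C" if "U \<in> carrier ?B" "a < n" "b < n" for U a b
    using tensor_mat_closed[of U] that by (simp add: tensor_algebra_simps(1))
  have \<Psi>c: "\<Psi> U \<in> carrier ?M" if "U \<in> carrier ?B" for U
    using bij that by (auto simp: bij_betw_def)
  have add: "U \<oplus>\<^bsub>?B\<^esub> V \<in> carrier ?B \<and> \<Psi> (U \<oplus>\<^bsub>?B\<^esub> V) = \<Psi> U \<oplus>\<^bsub>?M\<^esub> \<Psi> V"
    if UV: "U \<in> carrier ?B" "V \<in> carrier ?B" for U V
  proof
    show c: "U \<oplus>\<^bsub>?B\<^esub> V \<in> carrier ?B" using UV by (simp add: tensor_algebra_simps(1-5) tensor_mat_add)
    show "\<Psi> (U \<oplus>\<^bsub>?B\<^esub> V) = \<Psi> U \<oplus>\<^bsub>?M\<^esub> \<Psi> V"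
    proof (rule mat_eqI[OF \<Psi>c[OF c] M.R.mat_add_closed[OF \<Psi>c[OF UV(1)] \<Psi>c[OF UV(2)]]])
      fix i j assume ij: "i < n * m" "j < n * m"
      note b = block_index[OF ij(1)] block_index[OF ij(2)]
      have "tensor_mat n \<phi> C A (U \<oplus>\<^bsub>?B\<^esub> V) (i div m) (j div m)
          = tensor_mat n \<phi> C A U (i div m) (j div m) \<oplus>\<^bsub>C\<^esub> tensor_mat n \<phi> C A V (i div m) (j div m)"
        using UV b by (simp add: tensor_algebra_simps(1-5) tensor_mat_add mat_add_entry)
      then show "\<Psi> (U \<oplus>\<^bsub>?B\<^esub> V) i j = (\<Psi> U \<oplus>\<^bsub>?M\<^esub> \<Psi> V) i j"
        using ij b tc UV by (simp add: ent mat_add_entry p(2))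
    qed
  qed
  have mult: "U \<otimes>\<^bsub>?B\<^esub> V \<in> carrier ?B \<and> \<Psi> (U \<otimes>\<^bsub>?B\<^esub> V) = \<Psi> U \<otimes>\<^bsub>?M\<^esub> \<Psi> V"
    if UV: "U \<in> carrier ?B" "V \<in> carrier ?B" for U V
  proof
    show c: "U \<otimes>\<^bsub>?B\<^esub> V \<in> carrier ?B" using UV by (simp add: tensor_algebra_simps(1-5) tensor_mat_mult)
    let ?U = "tensor_mat n \<phi> C A U" and ?V = "tensor_mat n \<phi> C A V"
    have Uc: "?U \<in> carrier (mat_alg n C)" "?V \<in> carrier (mat_alg n C)"
      using UV by (auto simp: tensor_algebra_simps(1) tensor_mat_closed)
    have "mat_emb n \<phi>' (?U \<otimes>\<^bsub>mat_alg n C\<^esub> ?V)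
        = mat_emb n \<phi>' ?U \<otimes>\<^bsub>mat_alg n (mat_alg m R)\<^esub> mat_emb n \<phi>' ?V"
    proof (rule mat_eqI[OF map_closed[OF C.mat_mult_closed[OF Uc]]
          Mm.mat_mult_closed[OF map_closed[OF Uc(1)] map_closed[OF Uc(2)]]])
      fix a b assume ab: "a < n" "b < n"
      have "\<phi>' (\<Oplus>\<^bsub>C\<^esub>l\<in>{..<n}. ?U a l \<otimes>\<^bsub>C\<^esub> ?V l b)
          = (\<Oplus>\<^bsub>mat_alg m R\<^esub>l\<in>{..<n}. \<phi>' (?U a l \<otimes>\<^bsub>C\<^esub> ?V l b))"
        using ab UV tc by (intro p_fin) auto
      also have "\<dots> = (\<Oplus>\<^bsub>mat_alg m R\<^esub>l\<in>{..<n}. mat_emb n \<phi>' ?U a l \<otimes>\<^bsub>mat_alg m R\<^esub> mat_emb n \<phi>' ?V l b)"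
        using ab UV tc p(1) by (intro Mm.finsum_cong') (auto simp: mat_emb_entry p(3))
      finally show "mat_emb n \<phi>' (?U \<otimes>\<^bsub>mat_alg n C\<^esub> ?V) a b
          = (mat_emb n \<phi>' ?U \<otimes>\<^bsub>mat_alg n (mat_alg m R)\<^esub> mat_emb n \<phi>' ?V) a b"
        using ab by (simp add: mat_emb_entry mat_mult_entry)
    qed
    then show "\<Psi> (U \<otimes>\<^bsub>?B\<^esub> V) = \<Psi> U \<otimes>\<^bsub>?M\<^esub> \<Psi> V"
      using UV map_closed[OF Uc(1)] map_closed[OF Uc(2)]
      by (simp add: \<Psi>_def tensor_algebra_simps(1-5) tensor_mat_mult M.R.mat_flat_mult)
  qed
  have smult: "r \<odot>\<^bsub>?B\<^esub> U \<in> carrier ?B \<and> \<Psi> (r \<odot>\<^bsub>?B\<^esub> U) = r \<odot>\<^bsub>?M\<^esub> \<Psi> U"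
    if r: "r \<in> carrier R" and U: "U \<in> carrier ?B" for r U
  proof -
    note L = tensor_mat_left_map[where f = "\<lambda>x. r \<odot>\<^bsub>C\<^esub> x", OF tensor_split_axioms tensor_split_axioms _ _ _ U[unfolded tensor_algebra_simps]]
    have c: "r \<odot>\<^bsub>?B\<^esub> U \<in> carrier ?B"
      unfolding tensor_algebra_simps
      by (rule L(1)) (use r in \<open>auto simp: M.smult_r_distr M.R.m_comm simp flip: M.smult_assoc1\<close>)
    moreover have t: "tensor_mat n \<phi> C A (r \<odot>\<^bsub>?B\<^esub> U) = mat_map n (\<lambda>x. r \<odot>\<^bsub>C\<^esub> x) (tensor_mat n \<phi> C A U)"
      unfolding tensor_algebra_simps
      by (rule L(2)) (use r in \<open>auto simp: M.smult_r_distr M.R.m_comm simp flip: M.smult_assoc1\<close>)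
    moreover have "\<Psi> (r \<odot>\<^bsub>?B\<^esub> U) = r \<odot>\<^bsub>?M\<^esub> \<Psi> U"
    proof (rule mat_eqI[OF \<Psi>c[OF c] M.R.mat_smult_closed[OF r \<Psi>c[OF U]]])
      fix i j assume ij: "i < n * m" "j < n * m"
      note b = block_index[OF ij(1)] block_index[OF ij(2)]
      show "\<Psi> (r \<odot>\<^bsub>?B\<^esub> U) i j = (r \<odot>\<^bsub>?M\<^esub> \<Psi> U) i j"
        using ij b tc U r by (simp add: ent mat_smult_entry t mat_map_entry p(5))
    qed
    ultimately show ?thesis by blast
  qed
  have one: "\<one>\<^bsub>?B\<^esub> \<in> carrier ?B" "\<Psi> \<one>\<^bsub>?B\<^esub> = \<one>\<^bsub>?M\<^esub>"
  proof -
    show c: "\<one>\<^bsub>?B\<^esub> \<in> carrier ?B" by (simp add: tensor_algebra_simps(1-5) tensor_mat_one)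
    show "\<Psi> \<one>\<^bsub>?B\<^esub> = \<one>\<^bsub>?M\<^esub>"
    proof (rule mat_eqI[OF \<Psi>c[OF c] M.R.mat_one_closed])
      fix i j assume ij: "i < n * m" "j < n * m"
      note b = block_index[OF ij(1)] block_index[OF ij(2)]
      have "\<phi>' \<zero>\<^bsub>C\<^esub> = \<zero>\<^bsub>mat_alg m R\<^esub>" using p_fin[of "{}"] by simp
      moreover have "i = j \<longleftrightarrow> i div m = j div m \<and> i mod m = j mod m"
        by (metis div_mult_mod_eq)
      ultimately show "\<Psi> \<one>\<^bsub>?B\<^esub> i j = \<one>\<^bsub>?M\<^esub> i j"
        using ij b by (simp add: ent tensor_algebra_simps(1-5) tensor_mat_one mat_entry p(4))
    qed
  qed
  have zero: "\<zero>\<^bsub>?B\<^esub> \<in> carrier ?B" "\<Psi> \<zero>\<^bsub>?B\<^esub> = \<zero>\<^bsub>?M\<^esub>"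
  proof -
    show c: "\<zero>\<^bsub>?B\<^esub> \<in> carrier ?B" by (simp add: tensor_algebra_simps(1-5) tensor_mat_zero)
    show "\<Psi> \<zero>\<^bsub>?B\<^esub> = \<zero>\<^bsub>?M\<^esub>"
    proof (rule mat_eqI[OF \<Psi>c[OF c] M.R.mat_zero_closed])
      fix i j assume ij: "i < n * m" "j < n * m"
      note b = block_index[OF ij(1)] block_index[OF ij(2)]
      have "\<phi>' \<zero>\<^bsub>C\<^esub> = \<zero>\<^bsub>mat_alg m R\<^esub>" using p_fin[of "{}"] by simp
      then show "\<Psi> \<zero>\<^bsub>?B\<^esub> i j = \<zero>\<^bsub>?M\<^esub> i j"
        using ij b by (simp add: ent tensor_algebra_simps(1-5) tensor_mat_zero mat_entry)
    qed
  qed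
  have B: "is_algebra R ?B"
    by (rule is_algebra_transport[OF M.R.mat_is_algebra bij add mult smult zero one])
  have "restrict \<Psi> (carrier ?B) \<in> alg_iso R ?B ?M"
  proof (intro alg_isoI alg_homI)
    show "bij_betw (restrict \<Psi> (carrier ?B)) (carrier ?B) (carrier ?M)"
      using bij by (simp add: bij_betw_def inj_on_def)
  qed (use add mult smult one \<Psi>c in auto)
  with B show ?thesis by blast
qed

section \<open>Symbol algebras\<close>

text \<open>The coordinate ring of the torus is the ring of a type. For such rings the sums of the
  algebra library turn into ordinary sums, so that symbol algebras can be treated with type class
  arithmetic.\<close>

abbreviation type_ring :: "'r::comm_ring_1 ring" where
  "type_ring \<equiv> ring_of_type_algebra"

lemma type_ring_simps [simp]:
  "carrier type_ring = UNIV" "x \<otimes>\<^bsub>type_ring\<^esub> y = x * y" "x \<oplus>\<^bsub>type_ring\<^esub> y = x + y"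
  "\<one>\<^bsub>type_ring\<^esub> = 1" "\<zero>\<^bsub>type_ring\<^esub> = 0"
  by (simp_all add: ring_of_type_algebra_def)

lemma cring_type_ring: "cring (type_ring :: 'r::comm_ring_1 ring)"
  by (rule cring_from_type_algebra)

lemma type_ring_finsum [simp]:
  "finite A \<Longrightarrow> (\<Oplus>\<^bsub>type_ring :: 'r::comm_ring_1 ring\<^esub>i\<in>A. f i) = (\<Sum>i\<in>A. f i)"
proof (induction A rule: finite_induct)
  interpret cring "type_ring :: 'r ring" by (rule cring_type_ring)
  case empty
  then show ?case by simp
next
  interpret cring "type_ring :: 'r ring" by (rule cring_type_ring)
  case (insert x F)
  then show ?case by (simp add: finsum_insert)
qed

section \<open>The free associative algebra over the ring of a type\<close>

context
begin

abbreviation FA :: "('x list \<Rightarrow> 'r::comm_ring_1) ring" where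
  "FA \<equiv> free_algebra type_ring"

definition mon :: "'r::comm_ring_1 \<Rightarrow> 'x list \<Rightarrow> 'x list \<Rightarrow> 'r" where
  "mon r u = (\<lambda>w. if w = u then r else 0)"

lemma FA_carrier [simp]: "P \<in> carrier FA \<longleftrightarrow> finite {w. P w \<noteq> 0}"
  by (simp add: free_algebra_def)

lemma FA_add: "P \<oplus>\<^bsub>FA\<^esub> Q = (\<lambda>w. P w + Q w)"
  and FA_zero: "\<zero>\<^bsub>FA\<^esub> = (\<lambda>w. 0)"
  and FA_one: "\<one>\<^bsub>FA\<^esub> = mon 1 []"
  and FA_mult: "P \<otimes>\<^bsub>FA\<^esub> Q = (\<lambda>w. \<Sum>i\<le>length w. P (take i w) * Q (drop i w))"
  by (simp_all add: free_algebra_def mon_def fun_eq_iff)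

text \<open>The definition of the product sums over the cuts of \<open>w\<close>. Here the same
  product is a sum over pairs of words from finite sets containing the supports, independent of
  \<open>w\<close>; this is the form in which products can be evaluated and rearranged.\<close>

lemma FA_mult_sum:
  fixes P Q :: "'x list \<Rightarrow> 'r::comm_ring_1"
  assumes "finite U" "\<And>u. u \<notin> U \<Longrightarrow> P u = 0" "finite V" "\<And>v. v \<notin> V \<Longrightarrow> Q v = 0"
  shows "(P \<otimes>\<^bsub>FA\<^esub> Q) w = (\<Sum>u\<in>U. \<Sum>v\<in>V. if u @ v = w then P u * Q v else 0)"
proof -
  have "(\<Sum>u\<in>U. \<Sum>v\<in>V. if u @ v = w then P u * Q v else 0)
      = (\<Sum>uv\<in>U \<times> V. if fst uv @ snd uv = w then P (fst uv) * Q (snd uv) else 0)"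
    by (simp add: sum.cartesian_product case_prod_beta)
  also have "\<dots> = (\<Sum>uv\<in>{uv \<in> U \<times> V. fst uv @ snd uv = w}. P (fst uv) * Q (snd uv))"
    using assms by (subst sum.inter_filter[symmetric]) auto
  also have "\<dots> = (\<Sum>uv\<in>(\<lambda>i. (take i w, drop i w)) ` {..length w}. P (fst uv) * Q (snd uv))"
  proof (rule sum.mono_neutral_left)
    show "{uv \<in> U \<times> V. fst uv @ snd uv = w} \<subseteq> (\<lambda>i. (take i w, drop i w)) ` {..length w}"
    proof
      fix uv assume "uv \<in> {uv \<in> U \<times> V. fst uv @ snd uv = w}"
      then show "uv \<in> (\<lambda>i. (take i w, drop i w)) ` {..length w}"
        by (intro image_eqI[of _ _ "length (fst uv)"]) auto
    qed
    show "\<forall>uv\<in>(\<lambda>i. (take i w, drop i w)) ` {..length w} - {uv \<in> U \<times> V. fst uv @ snd uv = w}.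
       P (fst uv) * Q (snd uv) = 0"
      using assms by force
  qed simp
  also have "\<dots> = (\<Sum>i\<le>length w. P (take i w) * Q (drop i w))"
  proof (subst sum.reindex)
    show "inj_on (\<lambda>i. (take i w, drop i w)) {..length w}"
    proof (rule inj_onI)
      fix i j assume "i \<in> {..length w}" "j \<in> {..length w}" "(take i w, drop i w) = (take j w, drop j w)"
      then show "i = j" by (metis Pair_inject atMost_iff length_take min.absorb2)
    qed
  qed simp
  finally show ?thesis by (simp add: FA_mult)
qed

lemma FA_mult_closed:
  assumes "P \<in> carrier FA" "Q \<in> carrier FA"
  shows "P \<otimes>\<^bsub>FA\<^esub> Q \<in> carrier FA"
proof -
  have "{w. (P \<otimes>\<^bsub>FA\<^esub> Q) w \<noteq> 0} \<subseteq> (\<lambda>(u, v). u @ v) ` ({u. P u \<noteq> 0} \<times> {v. Q v \<noteq> 0})"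
  proof
    fix w assume "w \<in> {w. (P \<otimes>\<^bsub>FA\<^esub> Q) w \<noteq> 0}"
    then obtain i where "P (take i w) * Q (drop i w) \<noteq> 0"
      unfolding FA_mult by (metis (mono_tags, lifting) mem_Collect_eq sum.neutral)
    then have "P (take i w) \<noteq> 0" "Q (drop i w) \<noteq> 0" by auto
    then show "w \<in> (\<lambda>(u, v). u @ v) ` ({u. P u \<noteq> 0} \<times> {v. Q v \<noteq> 0})"
      by (intro image_eqI[of _ _ "(take i w, drop i w)"]) auto
  qed
  moreover have "finite ((\<lambda>(u, v). u @ v) ` ({u. P u \<noteq> 0} \<times> {v. Q v \<noteq> 0}))"
    using assms by simp
  ultimately show ?thesis unfolding FA_carrier by (rule finite_subset)
qed

text \<open>Both sides are sums over the cuts of \<open>w\<close> into three pieces. On the left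
  \<open>j\<close> and \<open>i\<close> are the positions of the first and of the second cut; on the
  right \<open>i\<close> is counted from the first cut, which explains the shift by \<open>j\<close>
  in the reindexing.\<close>

lemma FA_assoc:
  fixes P Q S :: "'x list \<Rightarrow> 'r::comm_ring_1"
  shows "P \<otimes>\<^bsub>FA\<^esub> Q \<otimes>\<^bsub>FA\<^esub> S = P \<otimes>\<^bsub>FA\<^esub> (Q \<otimes>\<^bsub>FA\<^esub> S)"
proof
  fix w :: "'x list"
  let ?n = "length w"
  have "(P \<otimes>\<^bsub>FA\<^esub> Q \<otimes>\<^bsub>FA\<^esub> S) w
      = (\<Sum>i\<le>?n. \<Sum>j\<le>i. P (take j w) * Q (take (i - j) (drop j w)) * S (drop i w))"
    unfolding FA_mult sum_distrib_right
    by (intro sum.cong) (auto simp: drop_take min_absorb1 min_absorb2)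
  also have "\<dots> = (\<Sum>(i, j)\<in>(SIGMA i:{..?n}. {..i}). P (take j w) * Q (take (i - j) (drop j w)) * S (drop i w))"
    by (simp add: sum.Sigma)
  also have "\<dots> = (\<Sum>(j, i)\<in>(SIGMA j:{..?n}. {..?n - j}). P (take j w) * Q (take i (drop j w)) * S (drop (i + j) w))"
    by (rule sum.reindex_bij_witness[where i = "\<lambda>(j, i). (i + j, j)" and j = "\<lambda>(i, j). (j, i - j)"]) auto
  also have "\<dots> = (\<Sum>j\<le>?n. \<Sum>i\<le>?n - j. P (take j w) * Q (take i (drop j w)) * S (drop (i + j) w))"
    by (simp add: sum.Sigma)
  also have "\<dots> = (P \<otimes>\<^bsub>FA\<^esub> (Q \<otimes>\<^bsub>FA\<^esub> S)) w"
    by (simp add: FA_mult sum_distrib_left mult.assoc)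
  finally show "(P \<otimes>\<^bsub>FA\<^esub> Q \<otimes>\<^bsub>FA\<^esub> S) w = (P \<otimes>\<^bsub>FA\<^esub> (Q \<otimes>\<^bsub>FA\<^esub> S)) w" .
qed

lemma mon_carrier [simp]: "mon r u \<in> carrier FA"
  by (auto simp: mon_def intro: finite_subset[of _ "{u}"])

lemma mon_mult: "mon r u \<otimes>\<^bsub>FA\<^esub> mon s v = mon (r * s) (u @ v)"
  by (rule ext, subst FA_mult_sum[of "{u}" _ "{v}"]) (auto simp: mon_def)

lemma mon_Nil_mult: "mon r [] \<otimes>\<^bsub>FA\<^esub> P = (\<lambda>w. r * P w)" "P \<otimes>\<^bsub>FA\<^esub> mon r [] = (\<lambda>w. P w * r)"
proof -
  have "(\<Sum>i\<le>length w. mon r [] (take i w) * P (drop i w)) = (\<Sum>i\<le>length w. if i = 0 then r * P w else 0)" for w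
    by (intro sum.cong) (auto simp: mon_def)
  then show "mon r [] \<otimes>\<^bsub>FA\<^esub> P = (\<lambda>w. r * P w)"
    by (simp add: FA_mult sum.delta)
  have "(\<Sum>i\<le>length w. P (take i w) * mon r [] (drop i w)) = (\<Sum>i\<le>length w. if i = length w then P w * r else 0)" for w
    by (intro sum.cong) (auto simp: mon_def)
  then show "P \<otimes>\<^bsub>FA\<^esub> mon r [] = (\<lambda>w. P w * r)"
    by (simp add: FA_mult sum.delta)
qed

lemma FA_finite_add:
  fixes P Q :: "'x \<Rightarrow> 'r::comm_ring_1"
  assumes "finite {w. P w \<noteq> 0}" "finite {w. Q w \<noteq> 0}"
  shows "finite {w. P w + Q w \<noteq> 0}" "finite {w. P w - Q w \<noteq> 0}"
  by (rule finite_subset[of _ "{w. P w \<noteq> 0} \<union> {w. Q w \<noteq> 0}"]; use assms in auto)+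

lemma ring_FA: "ring (FA :: ('x list \<Rightarrow> 'r::comm_ring_1) ring)"
proof (rule ringI)
  show "abelian_group (FA :: ('x list \<Rightarrow> 'r) ring)"
  proof (rule abelian_groupI)
    fix P :: "'x list \<Rightarrow> 'r" assume "P \<in> carrier FA"
    then show "\<exists>Q\<in>carrier FA. Q \<oplus>\<^bsub>FA\<^esub> P = \<zero>\<^bsub>FA\<^esub>"
      by (intro bexI[of _ "\<lambda>w. - P w"]) (auto simp: FA_add FA_zero)
  qed (auto simp: FA_add FA_zero FA_finite_add add_ac)
  show "monoid (FA :: ('x list \<Rightarrow> 'r) ring)"
    by (rule monoidI) (simp_all add: FA_mult_closed FA_assoc FA_one mon_Nil_mult del: FA_carrier)
qed (auto simp: FA_mult FA_add sum.distrib distrib_left distrib_right)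

end

lemma FA_minus:
  fixes P Q :: "'x list \<Rightarrow> 'r::comm_ring_1"
  assumes "P \<in> carrier FA" "Q \<in> carrier FA"
  shows "P \<ominus>\<^bsub>FA\<^esub> Q = (\<lambda>w. P w - Q w)"
proof -
  interpret ring "FA :: ('x list \<Rightarrow> 'r) ring" by (rule ring_FA)
  have "(\<lambda>w. P w - Q w) \<oplus>\<^bsub>FA\<^esub> Q = P" by (simp add: FA_add)
  then show ?thesis
    using assms FA_finite_add(2)[of P Q] by (intro minus_solve[symmetric]) auto
qed

lemma free_gen_mon: "free_gen type_ring l = mon 1 [l]"
  and free_const_mon: "free_const type_ring r = mon r []"
  by (auto simp: free_gen_def free_const_def mon_def fun_eq_iff)

lemma mon_pow: "mon 1 u [^]\<^bsub>FA\<^esub> (n::nat) = mon 1 (concat (replicate n u))"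
proof -
  interpret ring FA by (rule ring_FA)
  have comm: "concat (replicate n u) @ u = u @ concat (replicate n u)" for n
    by (induction n) auto
  show ?thesis
    by (induction n) (simp_all add: FA_one mon_mult comm del: FA_carrier)
qed

lemma FA_induct:
  fixes P :: "'x list \<Rightarrow> 'r::comm_ring_1"
  assumes "P \<in> carrier FA"
  shows "P = (\<lambda>v. \<Sum>w\<in>{w. P w \<noteq> 0}. mon (P w) w v)"
proof
  fix v
  have "(\<Sum>w\<in>{w. P w \<noteq> 0}. mon (P w) w v) = (\<Sum>w\<in>{w. P w \<noteq> 0}. if w = v then P w else 0)"
    by (intro sum.cong) (auto simp: mon_def)
  then show "P v = (\<Sum>w\<in>{w. P w \<noteq> 0}. mon (P w) w v)"
    using assms by (simp add: sum.delta)
qed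

text \<open>
  The representation \<open>x e\<^sub>r = e\<^sub>r\<^sub>+\<^sub>1\<close> (with \<open>x e\<^bsub>p-1\<^esub> = s e\<^sub>0\<close>), \<open>y e\<^sub>r = \<alpha> \<zeta>\<^sup>r e\<^sub>r\<close>, where \<open>\<alpha>\<^sup>p = t\<close>.
  A word maps each basis vector to a multiple of a basis vector.
\<close>

fun letter_index :: "nat \<Rightarrow> letter \<Rightarrow> nat \<Rightarrow> nat" where
  "letter_index p X_letter r = (if Suc r = p then 0 else Suc r)"
| "letter_index p Y_letter r = r"

fun letter_coeff :: "nat \<Rightarrow> 'r::comm_ring_1 \<Rightarrow> 'r \<Rightarrow> 'r \<Rightarrow> letter \<Rightarrow> nat \<Rightarrow> 'r" where
  "letter_coeff p \<zeta> s \<alpha> X_letter r = (if Suc r = p then s else 1)"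
| "letter_coeff p \<zeta> s \<alpha> Y_letter r = \<alpha> * \<zeta> ^ r"

primrec word_index :: "nat \<Rightarrow> letter list \<Rightarrow> nat \<Rightarrow> nat" where
  "word_index p [] r = r"
| "word_index p (l # w) r = letter_index p l (word_index p w r)"

primrec word_coeff :: "nat \<Rightarrow> 'r::comm_ring_1 \<Rightarrow> 'r \<Rightarrow> 'r \<Rightarrow> letter list \<Rightarrow> nat \<Rightarrow> 'r" where
  "word_coeff p \<zeta> s \<alpha> [] r = 1"
| "word_coeff p \<zeta> s \<alpha> (l # w) r =
    letter_coeff p \<zeta> s \<alpha> l (word_index p w r) * word_coeff p \<zeta> s \<alpha> w r"

lemma word_append:
  "word_index p (u @ v) r = word_index p u (word_index p v r)"
  "word_coeff p \<zeta> s \<alpha> (u @ v) r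
    = word_coeff p \<zeta> s \<alpha> u (word_index p v r) * word_coeff p \<zeta> s \<alpha> v r"
  by (induction u) (simp_all add: mult_ac)

lemma word_index_less: "r < p \<Longrightarrow> word_index p w r < p"
proof (induction w)
  case (Cons l w)
  then show ?case by (cases l) auto
qed simp

text \<open>The matrix of the operator that \<open>P\<close> induces in the basis
  \<open>e_0, ..., e_(p-1)\<close>: a word contributes to column \<open>j\<close> in the single row
  to which it moves \<open>e_j\<close>.\<close>

definition word_eval ::
  "nat \<Rightarrow> 'r::comm_ring_1 \<Rightarrow> 'r \<Rightarrow> 'r \<Rightarrow> (letter list \<Rightarrow> 'r) \<Rightarrow> 'r matrix" where
  "word_eval p \<zeta> s \<alpha> P = (\<lambda>i\<in>{..<p}. \<lambda>j\<in>{..<p}.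
     \<Sum>w\<in>{w. P w \<noteq> 0}. if word_index p w j = i then P w * word_coeff p \<zeta> s \<alpha> w j else 0)"

lemma word_eval_closed: "word_eval p \<zeta> s \<alpha> P \<in> carrier (mat_alg p type_ring)"
  unfolding word_eval_def by (rule mat_closedI) simp

lemma word_eval_entry:
  assumes "finite W" "\<And>w. w \<notin> W \<Longrightarrow> P w = 0" "i < p" "j < p"
  shows "word_eval p \<zeta> s \<alpha> P i j
    = (\<Sum>w\<in>W. if word_index p w j = i then P w * word_coeff p \<zeta> s \<alpha> w j else 0)"
proof -
  have "(\<Sum>w\<in>{w. P w \<noteq> 0}. if word_index p w j = i then P w * word_coeff p \<zeta> s \<alpha> w j else 0)
      = (\<Sum>w\<in>W. if word_index p w j = i then P w * word_coeff p \<zeta> s \<alpha> w j else 0)"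
    using assms by (intro sum.mono_neutral_left) auto
  then show ?thesis using assms by (simp add: word_eval_def)
qed

lemma word_eval_add:
  fixes P Q :: "letter list \<Rightarrow> 'r::comm_ring_1"
  assumes "P \<in> carrier FA" "Q \<in> carrier FA"
  shows "word_eval p \<zeta> s \<alpha> (P \<oplus>\<^bsub>FA\<^esub> Q)
    = word_eval p \<zeta> s \<alpha> P \<oplus>\<^bsub>mat_alg p type_ring\<^esub> word_eval p \<zeta> s \<alpha> Q"
proof (rule mat_eqI)
  fix i j assume ij: "i < p" "j < p"
  let ?W = "{w. P w \<noteq> 0} \<union> {w. Q w \<noteq> 0}"
  have W: "finite ?W" using assms by simp
  have eP: "word_eval p \<zeta> s \<alpha> P i j
      = (\<Sum>w\<in>?W. if word_index p w j = i then P w * word_coeff p \<zeta> s \<alpha> w j else 0)"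
    by (rule word_eval_entry[OF W _ ij]) blast
  have eQ: "word_eval p \<zeta> s \<alpha> Q i j
      = (\<Sum>w\<in>?W. if word_index p w j = i then Q w * word_coeff p \<zeta> s \<alpha> w j else 0)"
    by (rule word_eval_entry[OF W _ ij]) blast
  have "word_eval p \<zeta> s \<alpha> (P \<oplus>\<^bsub>FA\<^esub> Q) i j
    = (\<Sum>w\<in>?W. if word_index p w j = i then (P w + Q w) * word_coeff p \<zeta> s \<alpha> w j else 0)"
    using word_eval_entry[of ?W "P \<oplus>\<^bsub>FA\<^esub> Q" i p j \<zeta> s \<alpha>] W ij unfolding FA_add by simp
  also have "\<dots> = (\<Sum>w\<in>?W. if word_index p w j = i then P w * word_coeff p \<zeta> s \<alpha> w j else 0)
      + (\<Sum>w\<in>?W. if word_index p w j = i then Q w * word_coeff p \<zeta> s \<alpha> w j else 0)"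
    unfolding sum.distrib[symmetric] by (intro sum.cong) (auto simp: distrib_right)
  also have "\<dots> = word_eval p \<zeta> s \<alpha> P i j + word_eval p \<zeta> s \<alpha> Q i j"
    unfolding eP eQ ..
  finally show "word_eval p \<zeta> s \<alpha> (P \<oplus>\<^bsub>FA\<^esub> Q) i j
      = (word_eval p \<zeta> s \<alpha> P \<oplus>\<^bsub>mat_alg p type_ring\<^esub> word_eval p \<zeta> s \<alpha> Q) i j"
    using ij by (simp add: mat_add_entry)
next
  show "word_eval p \<zeta> s \<alpha> P \<oplus>\<^bsub>mat_alg p type_ring\<^esub> word_eval p \<zeta> s \<alpha> Q \<in> carrier (mat_alg p type_ring)"
    using ring.mat_add_closed[OF cring.axioms(1)[OF cring_type_ring]] word_eval_closed by blast
qed (rule word_eval_closed)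

text \<open>A concatenation \<open>u @ v\<close> takes \<open>e_j\<close> through exactly one
  intermediate basis vector, that of index \<open>word_index p v j\<close>. Inserting a sum over all
  intermediate indices \<open>l\<close>, of which one term survives, produces the matrix
  product.\<close>

lemma word_eval_mult:
  fixes P Q :: "letter list \<Rightarrow> 'r::comm_ring_1"
  assumes "P \<in> carrier FA" "Q \<in> carrier FA"
  shows "word_eval p \<zeta> s \<alpha> (P \<otimes>\<^bsub>FA\<^esub> Q)
    = word_eval p \<zeta> s \<alpha> P \<otimes>\<^bsub>mat_alg p type_ring\<^esub> word_eval p \<zeta> s \<alpha> Q"
proof (rule mat_eqI)
  fix i j assume ij: "i < p" "j < p"
  let ?U = "{w. P w \<noteq> 0}" and ?V = "{w. Q w \<noteq> 0}"
  let ?W = "(\<lambda>(u, v). u @ v) ` (?U \<times> ?V)"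
  let ?f = "\<lambda>w. if word_index p w j = i then word_coeff p \<zeta> s \<alpha> w j else 0"
  have fin: "finite ?U" "finite ?V" "finite ?W" using assms by auto
  have PQ: "(P \<otimes>\<^bsub>FA\<^esub> Q) w = (\<Sum>u\<in>?U. \<Sum>v\<in>?V. if u @ v = w then P u * Q v else 0)" for w
    using fin by (intro FA_mult_sum) auto
  have 0: "(P \<otimes>\<^bsub>FA\<^esub> Q) w = 0" if "w \<notin> ?W" for w
    unfolding PQ using that by (intro sum.neutral ballI) (auto intro: rev_image_eqI)
  have "word_eval p \<zeta> s \<alpha> (P \<otimes>\<^bsub>FA\<^esub> Q) i j = (\<Sum>w\<in>?W. (P \<otimes>\<^bsub>FA\<^esub> Q) w * ?f w)"
    using word_eval_entry[of ?W "P \<otimes>\<^bsub>FA\<^esub> Q" i p j \<zeta> s \<alpha>] fin(3) 0 ij by (auto intro!: sum.cong)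
  also have "\<dots> = (\<Sum>w\<in>?W. \<Sum>u\<in>?U. \<Sum>v\<in>?V. if u @ v = w then P u * Q v * ?f w else 0)"
    unfolding PQ by (simp add: sum_distrib_right if_distrib[of "\<lambda>x. x * _"] cong: if_cong)
  also have "\<dots> = (\<Sum>u\<in>?U. \<Sum>w\<in>?W. \<Sum>v\<in>?V. if u @ v = w then P u * Q v * ?f w else 0)"
    by (rule sum.swap)
  also have "\<dots> = (\<Sum>u\<in>?U. \<Sum>v\<in>?V. \<Sum>w\<in>?W. if u @ v = w then P u * Q v * ?f w else 0)"
    by (intro sum.cong refl sum.swap)
  also have "\<dots> = (\<Sum>u\<in>?U. \<Sum>v\<in>?V. P u * Q v * ?f (u @ v))"
    using fin by (intro sum.cong refl) (subst sum.delta', auto intro: rev_image_eqI)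
  also have "\<dots> = (\<Sum>u\<in>?U. \<Sum>v\<in>?V. \<Sum>l<p. (if word_index p u l = i then P u * word_coeff p \<zeta> s \<alpha> u l else 0)
      * (if word_index p v j = l then Q v * word_coeff p \<zeta> s \<alpha> v j else 0))"
  proof (intro sum.cong refl)
    fix u v
    have "(\<Sum>l<p. (if word_index p u l = i then P u * word_coeff p \<zeta> s \<alpha> u l else 0)
      * (if word_index p v j = l then Q v * word_coeff p \<zeta> s \<alpha> v j else 0))
      = (\<Sum>l<p. if word_index p v j = l then (if word_index p u l = i then P u * word_coeff p \<zeta> s \<alpha> u l else 0)
        * (Q v * word_coeff p \<zeta> s \<alpha> v j) else 0)"
      by (intro sum.cong) auto
    also have "\<dots> = P u * Q v * ?f (u @ v)"
      using word_index_less[OF ij(2)] by (subst sum.delta') (auto simp: word_append mult_ac)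
    finally show "P u * Q v * ?f (u @ v) = (\<Sum>l<p. (if word_index p u l = i then P u * word_coeff p \<zeta> s \<alpha> u l else 0)
      * (if word_index p v j = l then Q v * word_coeff p \<zeta> s \<alpha> v j else 0))" ..
  qed
  also have "\<dots> = (\<Sum>u\<in>?U. \<Sum>l<p. \<Sum>v\<in>?V. (if word_index p u l = i then P u * word_coeff p \<zeta> s \<alpha> u l else 0)
      * (if word_index p v j = l then Q v * word_coeff p \<zeta> s \<alpha> v j else 0))"
    by (intro sum.cong refl sum.swap)
  also have "\<dots> = (\<Sum>l<p. \<Sum>u\<in>?U. \<Sum>v\<in>?V. (if word_index p u l = i then P u * word_coeff p \<zeta> s \<alpha> u l else 0)
      * (if word_index p v j = l then Q v * word_coeff p \<zeta> s \<alpha> v j else 0))"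
    by (rule sum.swap)
  also have "\<dots> = (\<Sum>l<p. word_eval p \<zeta> s \<alpha> P i l * word_eval p \<zeta> s \<alpha> Q l j)"
    using ij by (intro sum.cong refl) (simp add: word_eval_def sum_product)
  finally show "word_eval p \<zeta> s \<alpha> (P \<otimes>\<^bsub>FA\<^esub> Q) i j
      = (word_eval p \<zeta> s \<alpha> P \<otimes>\<^bsub>mat_alg p type_ring\<^esub> word_eval p \<zeta> s \<alpha> Q) i j"
    using ij by (simp add: mat_mult_entry)
next
  show "word_eval p \<zeta> s \<alpha> P \<otimes>\<^bsub>mat_alg p type_ring\<^esub> word_eval p \<zeta> s \<alpha> Q \<in> carrier (mat_alg p type_ring)"
    using ring.mat_mult_closed[OF cring.axioms(1)[OF cring_type_ring]] word_eval_closed by blast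
qed (rule word_eval_closed)

lemma word_eval_mon:
  "i < p \<Longrightarrow> j < p \<Longrightarrow> word_eval p \<zeta> s \<alpha> (mon r w) i j
    = (if word_index p w j = i then r * word_coeff p \<zeta> s \<alpha> w j else 0)"
  by (subst word_eval_entry[of "{w}"]) (auto simp: mon_def)

lemma word_eval_one: "word_eval p \<zeta> s \<alpha> \<one>\<^bsub>FA\<^esub> = \<one>\<^bsub>mat_alg p type_ring\<^esub>"
  by (rule mat_eqI[OF word_eval_closed ring.mat_one_closed[OF cring.axioms(1)[OF cring_type_ring]]])
    (auto simp: FA_one word_eval_mon mat_one_entry)

lemma word_eval_hom:
  "ring_hom_ring FA (mat_alg p type_ring) (word_eval p \<zeta> s \<alpha>)"
  using ring_FA ring.ring_mat_alg[OF cring.axioms(1)[OF cring_type_ring]]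
  by (intro ring_hom_ringI2)
    (auto simp: ring_hom_def word_eval_closed word_eval_add word_eval_mult word_eval_one simp del: FA_carrier)

lemma X_index: "i < p \<Longrightarrow> r < p \<Longrightarrow> word_index p (replicate i X_letter) r = (if r + i < p then r + i else r + i - p)"
  by (induction i) auto

lemma X_coeff: "i < p \<Longrightarrow> r < p \<Longrightarrow>
    word_coeff p \<zeta> s \<alpha> (replicate i X_letter) r = (if r + i < p then 1 else s)"
  by (induction i) (auto simp: X_index)

lemma X_pow: 
  assumes "r < p"
  shows "word_index p (replicate p X_letter) r = r" "word_coeff p \<zeta> s \<alpha> (replicate p X_letter) r = s"
proof -
  \<comment> \<open>\<open>X_index\<close> and \<open>X_coeff\<close> cover exponents below
    \<open>p\<close>; the last of the \<open>p\<close> letters is added by one step of the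
    recursion, which completes the cycle and contributes \<open>s\<close> exactly once.\<close>
  obtain q where p: "p = Suc q" using assms by (cases p) auto
  show "word_index p (replicate p X_letter) r = r" "word_coeff p \<zeta> s \<alpha> (replicate p X_letter) r = s"
    using X_index[of q p r] X_coeff[of q p r \<zeta> s \<alpha>] assms unfolding p by auto
qed

lemma Y_index: "word_index p (replicate j Y_letter) r = r"
  by (induction j) auto

lemma Y_coeff: "word_coeff p \<zeta> s \<alpha> (replicate j Y_letter) r = (\<alpha> * \<zeta> ^ r) ^ j"
  by (induction j) (auto simp: Y_index)


text \<open>The inverses are explicit parameters because a commutative ring has no division. The
  hypothesis \<open>orth\<close>, the orthogonality of the characters of the cyclic group of order
  \<open>p\<close>, stands in for the primitivity of the root of unity: together with the inverse of
  \<open>p\<close> it makes the discrete Fourier transform invertible, which primitivity alone does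
  not do over an arbitrary commutative ring.\<close>

locale symbol_split =
  fixes p :: nat and \<zeta> \<zeta>' \<alpha> \<alpha>' s s' t pinv :: "'r::comm_ring_1"
  assumes p: "p > 0" and z: "\<zeta> * \<zeta>' = 1" "\<zeta> ^ p = 1"
    and al: "\<alpha> * \<alpha>' = 1" "\<alpha> ^ p = t" and s: "s * s' = 1" and pinv: "of_nat p * pinv = 1"
    and orth: "\<And>b c. b < p \<Longrightarrow> c < p \<Longrightarrow>
      (\<Sum>j<p. (\<zeta> ^ b * \<zeta>' ^ c) ^ j) = (if b = c then of_nat p else 0)"
begin

abbreviation "E \<equiv> (FA :: (letter list \<Rightarrow> 'r) ring)"
abbreviation "I \<equiv> symbol_ideal type_ring p \<zeta> s t"
abbreviation "ev \<equiv> word_eval p \<zeta> s \<alpha>"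
abbreviation "Mp \<equiv> mat_alg p (type_ring :: 'r ring)"
abbreviation red :: "nat \<Rightarrow> nat \<Rightarrow> letter list" where
  "red i j \<equiv> replicate i X_letter @ replicate j Y_letter"

sublocale E: ring E by (rule ring_FA)
sublocale Mp: ring Mp by (rule ring.ring_mat_alg[OF cring.axioms(1)[OF cring_type_ring]])
sublocale ev: ring_hom_ring E Mp ev by (rule word_eval_hom)

section \<open>The ideal of relations and reduced words\<close>

lemma concat_single: "concat (replicate n [l]) = replicate n l"
  by (induction n) auto

abbreviation "gens \<equiv> {mon 1 (replicate p X_letter) \<ominus>\<^bsub>E\<^esub> mon s [],
  mon 1 (replicate p Y_letter) \<ominus>\<^bsub>E\<^esub> mon t [],
  mon 1 [Y_letter, X_letter] \<ominus>\<^bsub>E\<^esub> mon \<zeta> [X_letter, Y_letter]}"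

lemma I_eq: "I = genideal E gens"
  unfolding symbol_ideal_def Let_def free_gen_mon free_const_mon mon_pow mon_mult concat_single
  by simp

lemma gens_closed: "gens \<subseteq> carrier E"
  using mon_carrier by (auto intro!: E.minus_closed simp del: FA_carrier)

sublocale I: ideal I E
  unfolding I_eq by (rule E.genideal_ideal[OF gens_closed])

lemma gens_I: "gens \<subseteq> I"
  unfolding I_eq by (rule E.genideal_self[OF gens_closed])

text \<open>Congruence modulo the ideal is used as a rewriting relation on monomials: a two-sided
  ideal allows a congruence to be applied inside any word and with any coefficient.\<close>

lemma I_ctx:
  assumes "mon r u \<ominus>\<^bsub>E\<^esub> mon r' v \<in> I"
  shows "mon (c * r) (a @ u @ b) \<ominus>\<^bsub>E\<^esub> mon (c * r') (a @ v @ b) \<in> I"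
proof -
  have "mon c a \<otimes>\<^bsub>E\<^esub> (mon r u \<ominus>\<^bsub>E\<^esub> mon r' v) \<otimes>\<^bsub>E\<^esub> mon 1 b \<in> I"
    by (intro I.I_l_closed I.I_r_closed assms mon_carrier)
  also have "mon c a \<otimes>\<^bsub>E\<^esub> (mon r u \<ominus>\<^bsub>E\<^esub> mon r' v) \<otimes>\<^bsub>E\<^esub> mon 1 b
    = mon c a \<otimes>\<^bsub>E\<^esub> mon r u \<otimes>\<^bsub>E\<^esub> mon 1 b \<ominus>\<^bsub>E\<^esub> mon c a \<otimes>\<^bsub>E\<^esub> mon r' v \<otimes>\<^bsub>E\<^esub> mon 1 b"
    by (simp add: E.minus_eq E.l_distr E.r_distr E.l_minus E.r_minus E.m_closed mon_carrier E.a_inv_closed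
        del: FA_carrier)
  finally show ?thesis by (simp add: mon_mult)
qed

lemma I_trans:
  assumes "P \<ominus>\<^bsub>E\<^esub> Q \<in> I" "Q \<ominus>\<^bsub>E\<^esub> S \<in> I" "P \<in> carrier E" "Q \<in> carrier E" "S \<in> carrier E"
  shows "P \<ominus>\<^bsub>E\<^esub> S \<in> I"
proof -
  have "(P \<ominus>\<^bsub>E\<^esub> Q) \<oplus>\<^bsub>E\<^esub> (Q \<ominus>\<^bsub>E\<^esub> S) = P \<ominus>\<^bsub>E\<^esub> S"
    using assms(3-5) FA_finite_add(2)[of P Q] FA_finite_add(2)[of Q S] by (simp add: FA_minus FA_add)
  with I.a_closed[OF assms(1,2)] show ?thesis by simp
qed

lemma Y_X_swap:
  "mon 1 (Y_letter # replicate i X_letter) \<ominus>\<^bsub>E\<^esub> mon (\<zeta> ^ i) (replicate i X_letter @ [Y_letter]) \<in> I"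
proof (induction i)
  case 0
  have "mon 1 [Y_letter] \<ominus>\<^bsub>E\<^esub> mon 1 [Y_letter] = \<zero>\<^bsub>E\<^esub>"
    by (simp add: E.r_right_minus_eq del: FA_carrier)
  then show ?case by simp
next
  case (Suc i)
  have "mon 1 ([] @ [Y_letter, X_letter] @ replicate i X_letter)
      \<ominus>\<^bsub>E\<^esub> mon (1 * \<zeta>) ([] @ [X_letter, Y_letter] @ replicate i X_letter) \<in> I"
    using I_ctx[of 1 "[Y_letter, X_letter]" \<zeta> "[X_letter, Y_letter]" 1 "[]" "replicate i X_letter"] gens_I
    by simp
  then have 1: "mon 1 (Y_letter # replicate (Suc i) X_letter)
      \<ominus>\<^bsub>E\<^esub> mon \<zeta> (X_letter # Y_letter # replicate i X_letter) \<in> I" by simp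
  have "mon (\<zeta> * 1) ([X_letter] @ (Y_letter # replicate i X_letter) @ [])
      \<ominus>\<^bsub>E\<^esub> mon (\<zeta> * \<zeta> ^ i) ([X_letter] @ (replicate i X_letter @ [Y_letter]) @ []) \<in> I"
    by (rule I_ctx[OF Suc])
  then have 2: "mon \<zeta> (X_letter # Y_letter # replicate i X_letter)
      \<ominus>\<^bsub>E\<^esub> mon (\<zeta> ^ Suc i) (replicate (Suc i) X_letter @ [Y_letter]) \<in> I" by simp
  show ?case by (rule I_trans[OF 1 2 mon_carrier mon_carrier mon_carrier])
qed

text \<open>Letters are prepended one at a time to a reduced word \<open>x^i y^j\<close>. A letter
  \<open>x\<close> raises \<open>i\<close>, or, when the exponent reaches \<open>p\<close>, is
  absorbed into the factor \<open>s\<close>. A letter \<open>y\<close> is first moved past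
  \<open>x^i\<close> at the price of \<open>\<zeta>^i\<close>, and then raises \<open>j\<close> or
  is absorbed into the factor \<open>t\<close>.\<close>

lemma word_reduce:
  "\<exists>c i j. i < p \<and> j < p \<and> mon 1 w \<ominus>\<^bsub>E\<^esub> mon c (red i j) \<in> I"
proof (induction w)
  case Nil
  have "mon 1 [] \<ominus>\<^bsub>E\<^esub> mon 1 (red 0 0) = \<zero>\<^bsub>E\<^esub>"
    by (simp add: E.r_right_minus_eq del: FA_carrier)
  then have "mon 1 [] \<ominus>\<^bsub>E\<^esub> mon 1 (red 0 0) \<in> I" by simp
  then show ?case using p by blast
next
  case (Cons l w)
  then obtain c i j where ij: "i < p" "j < p" and c: "mon 1 w \<ominus>\<^bsub>E\<^esub> mon c (red i j) \<in> I" by blast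
  have l: "mon 1 (l # w) \<ominus>\<^bsub>E\<^esub> mon c (l # red i j) \<in> I"
    using I_ctx[OF c, of 1 "[l]" "[]"] by simp
  show ?case
  proof (cases l)
    case X_letter
    show ?thesis
    proof (cases "Suc i < p")
      case True
      have "mon 1 (l # w) \<ominus>\<^bsub>E\<^esub> mon c (red (Suc i) j) \<in> I" using l X_letter by simp
      with True ij show ?thesis by blast
    next
      case False
      then have i: "Suc i = p" using ij by simp
      have "mon c (replicate p X_letter @ replicate j Y_letter) \<ominus>\<^bsub>E\<^esub> mon (c * s) (replicate j Y_letter) \<in> I"
        using I_ctx[of 1 "replicate p X_letter" s "[]" c "[]" "replicate j Y_letter"] gens_I by simp
      moreover have "l # red i j = replicate p X_letter @ replicate j Y_letter"
        unfolding i[symmetric] using X_letter by simp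
      ultimately have "mon c (l # red i j) \<ominus>\<^bsub>E\<^esub> mon (c * s) (red 0 j) \<in> I"
        by (simp only: replicate_0 append.simps(1))
      then have "mon 1 (l # w) \<ominus>\<^bsub>E\<^esub> mon (c * s) (red 0 j) \<in> I"
        by (rule I_trans[OF l _ mon_carrier mon_carrier mon_carrier])
      with p ij show ?thesis by blast
    qed
  next
    case Y_letter
    have "mon (c * 1) ([] @ (Y_letter # replicate i X_letter) @ replicate j Y_letter) \<ominus>\<^bsub>E\<^esub>
        mon (c * \<zeta> ^ i) ([] @ (replicate i X_letter @ [Y_letter]) @ replicate j Y_letter) \<in> I"
      by (rule I_ctx[OF Y_X_swap])
    then have "mon c (l # red i j) \<ominus>\<^bsub>E\<^esub> mon (c * \<zeta> ^ i) (red i (Suc j)) \<in> I"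
      using Y_letter by simp
    then have l2: "mon 1 (l # w) \<ominus>\<^bsub>E\<^esub> mon (c * \<zeta> ^ i) (red i (Suc j)) \<in> I"
      by (rule I_trans[OF l _ mon_carrier mon_carrier mon_carrier])
    show ?thesis
    proof (cases "Suc j < p")
      case True
      with l2 ij show ?thesis by blast
    next
      case False
      then have j: "Suc j = p" using ij by simp
      have "mon (c * \<zeta> ^ i) (red i p) \<ominus>\<^bsub>E\<^esub> mon (c * \<zeta> ^ i * t) (replicate i X_letter) \<in> I"
        using I_ctx[of 1 "replicate p Y_letter" t "[]" "c * \<zeta> ^ i" "replicate i X_letter" "[]"] gens_I by simp
      then have "mon 1 (l # w) \<ominus>\<^bsub>E\<^esub> mon (c * \<zeta> ^ i * t) (red i 0) \<in> I"
        using l2 unfolding j by (intro I_trans[OF l2[unfolded j] _ mon_carrier mon_carrier mon_carrier]) simp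
      with p ij show ?thesis by blast
    qed
  qed
qed

lemma I_sum: "finite W \<Longrightarrow> (\<And>w. w \<in> W \<Longrightarrow> F w \<in> I) \<Longrightarrow> (\<lambda>v. \<Sum>w\<in>W. F w v) \<in> I"
proof (induction W rule: finite_induct)
  case empty
  then show ?case using I.zero_closed by (simp add: FA_zero)
next
  case (insert w W)
  then have "F w \<oplus>\<^bsub>E\<^esub> (\<lambda>v. \<Sum>w\<in>W. F w v) \<in> I" by (intro I.a_closed) auto
  with insert show ?case by (simp add: FA_add)
qed

text \<open>Bookkeeping for powers of \<open>x\<close>: \<open>x^i\<close> sends \<open>e_b\<close>
  to \<open>un i b\<close> times the basis vector of index \<open>sh i b\<close>, and
  \<open>un' i b\<close> is the inverse of \<open>un i b\<close>.\<close>

abbreviation sh :: "nat \<Rightarrow> nat \<Rightarrow> nat" where "sh i b \<equiv> (if b + i < p then b + i else b + i - p)"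
abbreviation un :: "nat \<Rightarrow> nat \<Rightarrow> 'r" where "un i b \<equiv> (if b + i < p then 1 else s)"
abbreviation un' :: "nat \<Rightarrow> nat \<Rightarrow> 'r" where "un' i b \<equiv> (if b + i < p then 1 else s')"

definition "RW = (\<lambda>(i, j). red i j) ` ({..<p} \<times> {..<p})"

lemma red_inj: "red i j = red i' j' \<longleftrightarrow> i = i' \<and> j = j'"
proof
  assume eq: "red i j = red i' j'"
  from arg_cong[OF eq, of "\<lambda>w. length (filter ((=) X_letter) w)"]
    arg_cong[OF eq, of "\<lambda>w. length (filter ((=) Y_letter) w)"]
  show "i = i' \<and> j = j'" by (simp add: filter_replicate)
qed simp

text \<open>For fixed \<open>b\<close> the index \<open>sh i' b\<close> determines
  \<open>i' < p\<close>. Hence in column \<open>b\<close> only the words \<open>x^i y^j\<close> with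
  this one \<open>i\<close> reach row \<open>sh i b\<close>, and up to a unit the entry is the
  Fourier transform, in the exponent \<open>j\<close>, of the coefficients scaled by
  \<open>\<alpha>^j\<close>.\<close>

lemma ev_red:
  assumes Q: "\<And>w. w \<notin> RW \<Longrightarrow> Q w = 0" and ib: "i < p" "b < p"
  shows "ev Q (sh i b) b = un i b * (\<Sum>j<p. Q (red i j) * \<alpha> ^ j * (\<zeta> ^ b) ^ j)"
proof -
  have inj: "inj_on (\<lambda>(i, j). red i j) ({..<p} \<times> {..<p})"
    by (auto simp: inj_on_def red_inj)
  have sh: "sh i' b = sh i b \<longleftrightarrow> i' = i" if "i' < p" for i'
    using that ib by auto
  have "ev Q (sh i b) b
      = (\<Sum>w\<in>RW. if word_index p w b = sh i b then Q w * word_coeff p \<zeta> s \<alpha> w b else 0)"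
    using Q ib by (intro word_eval_entry) (auto simp: RW_def)
  also have "\<dots> = (\<Sum>(i', j)\<in>{..<p} \<times> {..<p}. if word_index p (red i' j) b = sh i b
      then Q (red i' j) * word_coeff p \<zeta> s \<alpha> (red i' j) b else 0)"
    unfolding RW_def by (subst sum.reindex[OF inj]) (auto intro!: sum.cong)
  also have "\<dots> = (\<Sum>i'<p. \<Sum>j<p. if word_index p (red i' j) b = sh i b
      then Q (red i' j) * word_coeff p \<zeta> s \<alpha> (red i' j) b else 0)"
    by (simp add: sum.cartesian_product)
  also have "\<dots> = (\<Sum>i'<p. if i' = i then (\<Sum>j<p. Q (red i j) * (un i b * (\<alpha> * \<zeta> ^ b) ^ j)) else 0)"
  proof (intro sum.cong refl)
    fix i' assume i': "i' \<in> {..<p}"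
    have ix: "word_index p (red i' j) b = sh i' b" "word_coeff p \<zeta> s \<alpha> (red i' j) b = un i' b * (\<alpha> * \<zeta> ^ b) ^ j" for j
      using i' ib X_index[of i' p b] X_coeff[of i' p b \<zeta> s \<alpha>] by (simp_all add: word_append Y_index Y_coeff)
    show "(\<Sum>j<p. if word_index p (red i' j) b = sh i b
      then Q (red i' j) * word_coeff p \<zeta> s \<alpha> (red i' j) b else 0)
      = (if i' = i then (\<Sum>j<p. Q (red i j) * (un i b * (\<alpha> * \<zeta> ^ b) ^ j)) else 0)"
      unfolding ix using sh[of i'] i' by (cases "i' = i") simp_all
  qed
  also have "\<dots> = (\<Sum>j<p. Q (red i j) * (un i b * (\<alpha> * \<zeta> ^ b) ^ j))"
    using ib by simp
  also have "\<dots> = un i b * (\<Sum>j<p. Q (red i j) * \<alpha> ^ j * (\<zeta> ^ b) ^ j)"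
    by (simp add: sum_distrib_left power_mult_distrib mult_ac)
  finally show ?thesis .
qed

text \<open>Inverse discrete Fourier transform: after pairing with the conjugate character
  \<open>\<zeta>' ^ c\<close>, orthogonality leaves \<open>p\<close> times \<open>q c\<close>, and
  \<open>p\<close> is invertible.\<close>

lemma dft_zero:
  assumes "\<And>b. b < p \<Longrightarrow> (\<Sum>j<p. q j * (\<zeta> ^ b) ^ j) = 0" "c < p"
  shows "q c = 0"
proof -
  have "0 = (\<Sum>b<p. (\<zeta>' ^ c) ^ b * (\<Sum>j<p. q j * (\<zeta> ^ b) ^ j))" using assms(1) by simp
  also have "\<dots> = (\<Sum>b<p. \<Sum>j<p. q j * (\<zeta> ^ j * \<zeta>' ^ c) ^ b)"
    by (simp add: sum_distrib_left power_mult_distrib mult_ac flip: power_mult)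
  also have "\<dots> = (\<Sum>j<p. q j * (\<Sum>b<p. (\<zeta> ^ j * \<zeta>' ^ c) ^ b))"
    by (subst sum.swap) (simp add: sum_distrib_left)
  also have "\<dots> = (\<Sum>j<p. if j = c then q j * of_nat p else 0)"
    using assms(2) by (intro sum.cong refl) (simp add: orth)
  also have "\<dots> = q c * of_nat p" using assms(2) by simp
  finally have "q c * of_nat p * pinv = 0" by simp
  then show ?thesis using pinv by (simp add: mult.assoc)
qed

lemma unit_pow: "\<alpha> ^ j * \<alpha>' ^ j = 1"
  using al by (simp flip: power_mult_distrib)

lemma ev_gens: "ev x = \<zero>\<^bsub>Mp\<^esub>" if "x \<in> gens" for x
proof -
  have d: "ev (mon r u \<ominus>\<^bsub>E\<^esub> mon r' v) = \<zero>\<^bsub>Mp\<^esub>" if eq: "ev (mon r u) = ev (mon r' v)" for r u r' v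
    using eq ev.hom_closed[OF mon_carrier, of r' v]
    by (simp add: E.minus_eq ev.hom_add ev.hom_a_inv Mp.r_neg mon_carrier E.a_inv_closed del: FA_carrier)
  have eqI: "ev (mon r u) = ev (mon r' v)"
    if "\<And>j. j < p \<Longrightarrow> word_index p u j = word_index p v j"
      "\<And>j. j < p \<Longrightarrow> r * word_coeff p \<zeta> s \<alpha> u j = r' * word_coeff p \<zeta> s \<alpha> v j" for r u r' v
    by (rule mat_eqI[OF word_eval_closed word_eval_closed]) (simp add: word_eval_mon that)
  have Yp: "(\<alpha> * \<zeta> ^ j) ^ p = t" for j
    using al z by (simp add: power_mult_distrib) (simp add: power_mult[symmetric] mult.commute[of j] power_mult)
  have "ev (mon 1 (replicate p X_letter)) = ev (mon s [])"
    by (rule eqI) (simp_all add: X_pow)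
  moreover have "ev (mon 1 (replicate p Y_letter)) = ev (mon t [])"
    by (rule eqI) (simp_all add: Y_index Y_coeff Yp)
  moreover have "ev (mon 1 [Y_letter, X_letter]) = ev (mon \<zeta> [X_letter, Y_letter])"
  proof (rule eqI)
    fix j assume "j < p"
    show "1 * word_coeff p \<zeta> s \<alpha> [Y_letter, X_letter] j = \<zeta> * word_coeff p \<zeta> s \<alpha> [X_letter, Y_letter] j"
    proof (cases "Suc j = p")
      case True
      \<comment> \<open>Here \<open>x\<close> wraps around to \<open>e_0\<close>, on which
        \<open>y\<close> acts by \<open>\<alpha>\<close> alone. The other side carries
        \<open>\<zeta>\<close> times \<open>\<zeta> ^ (p - 1)\<close>, so the two agree because
        \<open>\<zeta> ^ p = 1\<close>.\<close>
      then have "\<zeta> * \<zeta> ^ j = 1" using z(2) by (metis power_Suc)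
      then show ?thesis using True by (simp add: mult_ac) (metis mult.assoc mult.commute mult.left_neutral)
    qed (simp add: mult_ac)
  qed simp
  ultimately show ?thesis using that d by blast
qed

text \<open>An element \<open>P\<close> of the kernel is congruent modulo the ideal to a combination
  \<open>Q\<close> of reduced words, and \<open>Q\<close> is again killed. Each entry of the matrix
  of \<open>Q\<close> is a unit times a Fourier transform of coefficients of \<open>Q\<close>, so
  all coefficients vanish and \<open>P\<close> lies in the ideal. Thus the three relations present
  the matrix algebra; no dimension count is available over a general ring.\<close>

lemma kernel_eq: "a_kernel E Mp ev = I"
proof
  have "gens \<subseteq> a_kernel E Mp ev"
    using gens_closed ev_gens unfolding a_kernel_def' by blast
  then show IK: "I \<subseteq> a_kernel E Mp ev"
    unfolding I_eq by (rule E.genideal_minimal[OF ev.kernel_is_ideal])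
  show "a_kernel E Mp ev \<subseteq> I"
  proof
    fix P assume "P \<in> a_kernel E Mp ev"
    then have P: "P \<in> carrier E" "ev P = \<zero>\<^bsub>Mp\<^esub>"
      unfolding a_kernel_def' by blast+
    obtain c i j where ij: "\<And>w. i w < p" "\<And>w. j w < p"
      and c: "\<And>w. mon 1 w \<ominus>\<^bsub>E\<^esub> mon (c w) (red (i w) (j w)) \<in> I"
      using word_reduce by metis
    let ?W = "{w. P w \<noteq> 0}"
    \<comment> \<open>Several words may reduce to the same \<open>red i j\<close>, so
      \<open>Q\<close> is defined as the sum of all reduced monomials and not by prescribing its
      coefficients.\<close>
    define Q where "Q = (\<lambda>v. \<Sum>w\<in>?W. mon (P w * c w) (red (i w) (j w)) v)"
    have fin: "finite ?W" using P by simp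
    have Q0: "Q v = 0" if "v \<notin> RW" for v
      unfolding Q_def using that ij by (intro sum.neutral) (auto simp: mon_def RW_def)
    then have "{v. Q v \<noteq> 0} \<subseteq> RW" by blast
    then have Qc: "Q \<in> carrier E" by (auto simp: RW_def intro: finite_subset)
    have "mon (P w * 1) ([] @ w @ []) \<ominus>\<^bsub>E\<^esub> mon (P w * c w) ([] @ red (i w) (j w) @ []) \<in> I" for w
      by (rule I_ctx[OF c])
    then have cw: "mon (P w) w \<ominus>\<^bsub>E\<^esub> mon (P w * c w) (red (i w) (j w)) \<in> I" for w by simp
    have "(\<lambda>v. \<Sum>w\<in>?W. (mon (P w) w \<ominus>\<^bsub>E\<^esub> mon (P w * c w) (red (i w) (j w))) v) \<in> I"
      by (rule I_sum[OF fin]) (rule cw)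
    also have "(\<lambda>v. \<Sum>w\<in>?W. (mon (P w) w \<ominus>\<^bsub>E\<^esub> mon (P w * c w) (red (i w) (j w))) v) = P \<ominus>\<^bsub>E\<^esub> Q"
    proof
      fix v
      have "(\<Sum>w\<in>?W. (mon (P w) w \<ominus>\<^bsub>E\<^esub> mon (P w * c w) (red (i w) (j w))) v)
          = (\<Sum>w\<in>?W. mon (P w) w v) - Q v"
        unfolding FA_minus[OF mon_carrier mon_carrier] sum_subtractf Q_def ..
      also have "(\<Sum>w\<in>?W. mon (P w) w v) = P v"
        by (rule fun_cong[OF FA_induct[OF P(1)], symmetric])
      finally show "(\<Sum>w\<in>?W. (mon (P w) w \<ominus>\<^bsub>E\<^esub> mon (P w * c w) (red (i w) (j w))) v)
          = (P \<ominus>\<^bsub>E\<^esub> Q) v"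
        unfolding FA_minus[OF P(1) Qc] .
    qed
    finally have PQ: "P \<ominus>\<^bsub>E\<^esub> Q \<in> I" .
    then have "ev (P \<ominus>\<^bsub>E\<^esub> Q) = \<zero>\<^bsub>Mp\<^esub>" using IK unfolding a_kernel_def' by blast
    then have evQ: "ev Q = \<zero>\<^bsub>Mp\<^esub>"
      using P Qc by (simp add: E.minus_eq ev.hom_add ev.hom_a_inv del: FA_carrier)
    have "Q (red i j) = 0" if ij: "i < p" "j < p" for i j
    proof -
      have "(\<Sum>j<p. Q (red i j) * \<alpha> ^ j * (\<zeta> ^ b) ^ j) = 0" if b: "b < p" for b
      proof -
        have shp: "sh i b < p" using ij b by auto
        have e: "ev Q (sh i b) b = un i b * (\<Sum>j<p. Q (red i j) * \<alpha> ^ j * (\<zeta> ^ b) ^ j)"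
          using Q0 ij(1) b by (rule ev_red)
        have "ev Q (sh i b) b = 0"
          unfolding evQ using mat_zero_entry[OF shp b, of "type_ring :: 'r ring"] by (simp only: type_ring_simps)
        then have "un i b * (\<Sum>j<p. Q (red i j) * \<alpha> ^ j * (\<zeta> ^ b) ^ j) = 0"
          unfolding e .
        then have "un' i b * un i b * (\<Sum>j<p. Q (red i j) * \<alpha> ^ j * (\<zeta> ^ b) ^ j) = 0"
          by (simp only: mult.assoc mult_zero_right)
        moreover have "un' i b * un i b = 1" using s by (simp add: mult.commute)
        ultimately show ?thesis by (simp only: mult_1)
      qed
      then have "Q (red i j) * \<alpha> ^ j = 0" by (rule dft_zero) (use ij in auto)
      then have "Q (red i j) * (\<alpha> ^ j * \<alpha>' ^ j) = 0" by (simp flip: mult.assoc)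
      then show ?thesis by (simp add: unit_pow)
    qed
    then have "Q v = 0" for v using Q0 by (cases "v \<in> RW") (auto simp: RW_def)
    then have "P \<ominus>\<^bsub>E\<^esub> Q = P" using P Qc by (simp add: FA_minus del: FA_carrier)
    with PQ show "P \<in> I" by simp
  qed
qed

lemma ev_surj: "ev ` carrier E = carrier Mp"
proof
  show "ev ` carrier E \<subseteq> carrier Mp" using word_eval_closed by blast
  show "carrier Mp \<subseteq> ev ` carrier E"
  proof
    fix M assume M: "M \<in> carrier Mp"
    \<comment> \<open>Inverse Fourier transform along the \<open>i\<close>-th cyclic diagonal of
      \<open>M\<close>: the factor \<open>un'\<close> undoes the coefficient picked up by
      \<open>x^i\<close>, the factor \<open>\<alpha>' ^ j\<close> the one picked up by
      \<open>y^j\<close>, and \<open>pinv\<close> normalizes the orthogonality relation.\<close>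
    define q where "q i j = pinv * \<alpha>' ^ j * (\<Sum>c<p. (\<zeta>' ^ c) ^ j * un' i c * M (sh i c) c)" for i j
    define Q where "Q w = (if w \<in> RW then q (length (filter ((=) X_letter) w)) (length (filter ((=) Y_letter) w)) else 0)" for w
    have "{v. Q v \<noteq> 0} \<subseteq> RW" by (auto simp: Q_def)
    then have Qc: "Q \<in> carrier E" by (auto simp: RW_def intro: finite_subset)
    have Qr: "Q (red i j) = q i j" if "i < p" "j < p" for i j
      using that by (auto simp: Q_def RW_def filter_replicate)
    have "ev Q a b = M a b" if ab: "a < p" "b < p" for a b
    proof -
      \<comment> \<open>The cyclic diagonal through the position \<open>(a, b)\<close>, that is,
        \<open>a - b\<close> modulo \<open>p\<close>.\<close>
      define i where "i = (if b \<le> a then a - b else a + p - b)"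
      have i: "i < p" "sh i b = a" using ab by (auto simp: i_def)
      have "(\<Sum>j<p. Q (red i j) * \<alpha> ^ j * (\<zeta> ^ b) ^ j)
          = (\<Sum>j<p. \<Sum>c<p. pinv * (un' i c * M (sh i c) c) * (\<zeta> ^ b * \<zeta>' ^ c) ^ j)"
      proof (intro sum.cong refl)
        fix j assume j: "j \<in> {..<p}"
        have "Q (red i j) * \<alpha> ^ j * (\<zeta> ^ b) ^ j
          = (\<alpha> ^ j * \<alpha>' ^ j) * (pinv * (\<Sum>c<p. (\<zeta>' ^ c) ^ j * un' i c * M (sh i c) c) * (\<zeta> ^ b) ^ j)"
          using i j by (simp add: Qr q_def mult_ac del: unit_pow)
        also have "\<dots> = (\<Sum>c<p. pinv * (un' i c * M (sh i c) c) * (\<zeta> ^ b * \<zeta>' ^ c) ^ j)"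
          unfolding unit_pow
          by (simp only: sum_distrib_left sum_distrib_right power_mult_distrib mult_ac mult_1)
        finally show "Q (red i j) * \<alpha> ^ j * (\<zeta> ^ b) ^ j
          = (\<Sum>c<p. pinv * (un' i c * M (sh i c) c) * (\<zeta> ^ b * \<zeta>' ^ c) ^ j)" .
      qed
      also have "\<dots> = (\<Sum>c<p. pinv * (un' i c * M (sh i c) c) * (\<Sum>j<p. (\<zeta> ^ b * \<zeta>' ^ c) ^ j))"
        by (subst sum.swap) (simp only: sum_distrib_left)
      also have "\<dots> = (\<Sum>c<p. if b = c then pinv * (un' i c * M (sh i c) c) * of_nat p else 0)"
        using ab by (intro sum.cong refl) (simp add: orth)
      also have "\<dots> = pinv * (un' i b * M a b) * of_nat p" using ab i by simp
      also have "\<dots> = un' i b * M a b"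
        using pinv by (metis mult.commute mult.left_commute mult_1)
      finally have "ev Q a b = un i b * un' i b * M a b"
        using ev_red[of Q i b] i ab by (simp add: Q_def mult.assoc)
      then show ?thesis using s by simp
    qed
    then have "ev Q = M" by (intro mat_eqI[OF word_eval_closed M]) auto
    then show "M \<in> ev ` carrier E" using Qc by blast
  qed
qed

text \<open>The first isomorphism theorem for \<open>ev\<close>, whose kernel and image have been
  determined. The scalar action of the quotient is multiplication by the class of a constant, and a
  constant evaluates to a scalar matrix, so the isomorphism is linear.\<close>

lemma symbol_algebra_split:
  "is_algebra type_ring (symbol_algebra type_ring p \<zeta> s t) \<and>
   alg_iso type_ring (symbol_algebra type_ring p \<zeta> s t) (mat_alg p type_ring) \<noteq> {}"
proof -
  let ?S = "symbol_algebra type_ring p \<zeta> s t" and ?Q = "E Quot I"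
  define \<phi> where "\<phi> = (\<lambda>Z. the_elem (ev ` Z))"
  have iso: "\<phi> \<in> ring_iso ?Q Mp"
    using ev.FactRing_iso_set[OF ev_surj] by (simp add: kernel_eq \<phi>_def)
  interpret Q: ring ?Q by (rule I.quotient_is_ring)
  have S: "carrier ?S = carrier ?Q" "x \<otimes>\<^bsub>?S\<^esub> y = x \<otimes>\<^bsub>?Q\<^esub> y" "x \<oplus>\<^bsub>?S\<^esub> y = x \<oplus>\<^bsub>?Q\<^esub> y"
    "\<one>\<^bsub>?S\<^esub> = \<one>\<^bsub>?Q\<^esub>" "\<zero>\<^bsub>?S\<^esub> = \<zero>\<^bsub>?Q\<^esub>"
    "r \<odot>\<^bsub>?S\<^esub> Z = (I +>\<^bsub>E\<^esub> free_const type_ring r) \<otimes>\<^bsub>?Q\<^esub> Z" for x y r Z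
    by (simp_all add: symbol_algebra_def Let_def ring.defs)
  have bij: "bij_betw \<phi> (carrier ?S) (carrier Mp)" using iso by (simp add: ring_iso_def S)
  have h: "\<phi> \<in> ring_hom ?Q Mp" using iso by (simp add: ring_iso_def)
  interpret h: ring_hom_ring ?Q Mp \<phi> by (rule ring_hom_ringI2[OF Q.ring_axioms Mp.ring_axioms h])
  have cr: "I +>\<^bsub>E\<^esub> free_const type_ring r \<in> carrier ?Q" for r
    using mon_carrier by (auto simp: FactRing_def A_RCOSETS_def' free_const_mon simp del: FA_carrier)
  have ec: "\<phi> (I +>\<^bsub>E\<^esub> free_const type_ring r) = r \<odot>\<^bsub>Mp\<^esub> \<one>\<^bsub>Mp\<^esub>" for r
  proof -
    have "ev w = ev (mon r [])" if w: "w \<in> I +>\<^bsub>E\<^esub> mon r []" for w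
    proof -
      obtain x where x: "x \<in> I" "w = x \<oplus>\<^bsub>E\<^esub> mon r []"
        using w by (auto simp: a_r_coset_def' )
      have "ev x = \<zero>\<^bsub>Mp\<^esub>" "x \<in> carrier E" using x(1) unfolding kernel_eq[symmetric] a_kernel_def' by auto
      then show ?thesis using x ev.hom_closed[OF mon_carrier, of r "[]"] mon_carrier[of r "[]"]
        by (simp add: ev.hom_add del: FA_carrier)
    qed
    moreover have "mon r [] \<in> I +>\<^bsub>E\<^esub> mon r []"
      by (rule I.a_rcos_self[OF mon_carrier])
    ultimately have "ev ` (I +>\<^bsub>E\<^esub> mon r []) = {ev (mon r [])}" by blast
    then have "\<phi> (I +>\<^bsub>E\<^esub> free_const type_ring r) = ev (mon r [])"
      by (simp add: \<phi>_def free_const_mon)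
    also have "\<dots> = r \<odot>\<^bsub>Mp\<^esub> \<one>\<^bsub>Mp\<^esub>"
      using ring.mat_smult_closed[OF cring.axioms(1)[OF cring_type_ring], of r "\<one>\<^bsub>Mp\<^esub>" p]
      by (intro mat_eqI[OF word_eval_closed]) (auto simp: word_eval_mon mat_entry)
    finally show ?thesis .
  qed
  have alg: "is_algebra type_ring Mp" by (rule cring.mat_is_algebra[OF cring_type_ring])
  have sm: "r \<odot>\<^bsub>?S\<^esub> Z \<in> carrier ?S \<and> \<phi> (r \<odot>\<^bsub>?S\<^esub> Z) = r \<odot>\<^bsub>Mp\<^esub> \<phi> Z" if "Z \<in> carrier ?S" for r Z
  proof -
    have "\<phi> ((I +>\<^bsub>E\<^esub> free_const type_ring r) \<otimes>\<^bsub>?Q\<^esub> Z) = (r \<odot>\<^bsub>Mp\<^esub> \<one>\<^bsub>Mp\<^esub>) \<otimes>\<^bsub>Mp\<^esub> \<phi> Z"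
      using that cr by (simp add: S(1) ec)
    also have "\<dots> = r \<odot>\<^bsub>Mp\<^esub> \<phi> Z"
      using alg that by (simp add: is_algebra_def S(1))
    finally show ?thesis using that cr by (simp add: S)
  qed
  have A: "is_algebra type_ring ?S"
    by (rule is_algebra_transport[OF alg bij]) (use sm in \<open>auto simp: S(1-5)\<close>)
  have "restrict \<phi> (carrier ?S) \<in> alg_iso type_ring ?S Mp"
  proof (intro alg_isoI alg_homI)
    show "bij_betw (restrict \<phi> (carrier ?S)) (carrier ?S) (carrier Mp)" using bij by simp
  qed (use sm in \<open>auto simp: S(1-5)\<close>)
  with A show ?thesis by blast
qed

end

section \<open>Coverings\<close>

abbreviation id_hom :: "('r, 'm) ring_scheme \<Rightarrow> 'r \<Rightarrow> 'r" where
  "id_hom T \<equiv> (\<lambda>t\<in>carrier T. t)"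

lemma id_hom: "algebra R T \<Longrightarrow> id_hom T \<in> alg_hom R T T"
  using algebraD[of R T] module.smult_closed[of R T]
  by (intro alg_homI) (auto simp: ring.ring_simprules)

lemma alg_hom_compose:
  assumes f: "f \<in> alg_hom R S T" and g: "g \<in> alg_hom R T T'"
    and S: "ring S" "module R S"
  shows "compose (carrier S) g f \<in> alg_hom R S T'"
proof -
  interpret S: ring S by fact
  interpret Sm: module R S by fact
  show ?thesis
    using alg_homD[OF f] alg_homD[OF g] by (intro alg_homI) (auto simp: compose_eq)
qed

lemma alg_hom_ring_hom: "f \<in> alg_hom R S T \<Longrightarrow> f \<in> ring_hom S T"
  by (simp add: alg_hom_def)

lemma alg_hom_zero:
  assumes "f \<in> alg_hom R S T" "ring S" "ring T"
  shows "f \<zero>\<^bsub>S\<^esub> = \<zero>\<^bsub>T\<^esub>"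
  using ring_hom_zero[OF alg_hom_ring_hom] assms by blast

lemma alg_hom_finsum:
  assumes f: "f \<in> alg_hom R S T" "ring S" "ring T" and "finite I" "\<And>i. i \<in> I \<Longrightarrow> F i \<in> carrier S"
  shows "f (\<Oplus>\<^bsub>S\<^esub>i\<in>I. F i) = (\<Oplus>\<^bsub>T\<^esub>i\<in>I. f (F i))"
proof -
  interpret S: ring S by fact
  interpret T: ring T by fact
  show ?thesis
    using assms(4,5)
    by (induction I rule: finite_induct)
      (simp_all add: alg_hom_zero[OF f] S.finsum_insert T.finsum_insert Pi_def alg_homD[OF f(1)] S.finsum_closed)
qed

lemma module_restrict_scalars:
  assumes T: "algebra R T" and T': "algebra R T'" and f: "f \<in> alg_hom R T T'"
  shows "module T (restrict_scalars f T')"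
proof -
  interpret T: cring T by (rule algebraD(2)[OF T])
  interpret T': cring T' by (rule algebraD(2)[OF T'])
  note f = alg_homD[OF f]
  have "abelian_group (restrict_scalars f T')"
    by (rule abelian_groupI)
      (auto simp: restrict_scalars_def T'.a_ac intro: T'.add.inv_closed T'.l_neg bexI[of _ "\<ominus>\<^bsub>T'\<^esub> x" for x])
  then show ?thesis
    by (intro moduleI T.is_cring)
      (auto simp: restrict_scalars_def f T'.l_distr T'.r_distr T'.m_assoc)
qed

lemma self_algebra_simps [simp]:
  "carrier (self_algebra R) = carrier R" "x \<otimes>\<^bsub>self_algebra R\<^esub> y = x \<otimes>\<^bsub>R\<^esub> y"
  "x \<oplus>\<^bsub>self_algebra R\<^esub> y = x \<oplus>\<^bsub>R\<^esub> y" "\<one>\<^bsub>self_algebra R\<^esub> = \<one>\<^bsub>R\<^esub>" "\<zero>\<^bsub>self_algebra R\<^esub> = \<zero>\<^bsub>R\<^esub>"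
  "r \<odot>\<^bsub>self_algebra R\<^esub> x = r \<otimes>\<^bsub>R\<^esub> x"
  by (simp_all add: self_algebra_def)

lemma (in cring) algebra_self: "algebra R (self_algebra R)"
proof (rule algebraI)
  show "cring (self_algebra R)"
  proof (rule cringI)
    show "abelian_group (self_algebra R)"
      by (rule abelian_groupI) (auto simp: a_ac intro: l_neg bexI[of _ "\<ominus> x" for x])
    show "Group.comm_monoid (self_algebra R)"
      by (rule comm_monoidI) (auto simp: m_ac)
  qed (auto simp: l_distr)
qed (auto simp: is_cring l_distr r_distr m_assoc)

text \<open>Every tensor is congruent to some \<open>m \<otimes> 1\<close>. The action map
  \<open>x \<otimes> t \<mapsto> t x\<close> into \<open>N\<close> respects the relations, so if the
  image of the tensor vanishes then \<open>h m = 0\<close>, and injectivity of \<open>h\<close>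
  gives \<open>m = 0\<close>.\<close>

lemma flat_id:
  fixes T :: "'r alg"
  assumes T: "algebra R T"
  shows "flat_hom T T (id_hom T)"
  unfolding flat_hom_def
proof (intro allI impI ballI)
  fix M N :: "'r alg" and h :: "'r \<Rightarrow> 'r" and z
  define S where "S = restrict_scalars (id_hom T) T"
  let ?F = "frag_extend (\<lambda>(x, t). frag_of (h x, t))"
  assume hyp: "module T M \<and> module T N \<and> h \<in> carrier M \<rightarrow> carrier N \<and> inj_on h (carrier M) \<and>
     (\<forall>x\<in>carrier M. \<forall>y\<in>carrier M. h (x \<oplus>\<^bsub>M\<^esub> y) = h x \<oplus>\<^bsub>N\<^esub> h y) \<and>
     (\<forall>t\<in>carrier T. \<forall>x\<in>carrier M. h (t \<odot>\<^bsub>M\<^esub> x) = t \<odot>\<^bsub>N\<^esub> h x)"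
    and z: "z \<in> carrier (tensor_free M (restrict_scalars (id_hom T) T))"
    and Fz: "?F z \<in> tensor_relations T N (restrict_scalars (id_hom T) T)"
  note z = z[folded S_def] and Fz = Fz[folded S_def]
  from hyp have h: "\<And>x. x \<in> carrier M \<Longrightarrow> h x \<in> carrier N" "inj_on h (carrier M)"
    "\<And>x y. x \<in> carrier M \<Longrightarrow> y \<in> carrier M \<Longrightarrow> h (x \<oplus>\<^bsub>M\<^esub> y) = h x \<oplus>\<^bsub>N\<^esub> h y"
    "\<And>t x. t \<in> carrier T \<Longrightarrow> x \<in> carrier M \<Longrightarrow> h (t \<odot>\<^bsub>M\<^esub> x) = t \<odot>\<^bsub>N\<^esub> h x" by auto
  interpret T: cring T by (rule algebraD(2)[OF T])
  have mT: "module T S" unfolding S_def by (rule module_restrict_scalars[OF T T id_hom[OF T]])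
  interpret A: two_modules T M S using hyp mT by (intro two_modules.intro) auto
  interpret B: two_modules T N S using hyp mT by (intro two_modules.intro) auto
  have rs [simp]: "carrier S = carrier T" "\<And>x y. x \<oplus>\<^bsub>S\<^esub> y = x \<oplus>\<^bsub>T\<^esub> y"
    "\<And>t x. t \<in> carrier T \<Longrightarrow> t \<odot>\<^bsub>S\<^esub> x = t \<otimes>\<^bsub>T\<^esub> x"
    by (simp_all add: S_def restrict_scalars_def)
  obtain g where g: "\<And>x y. x \<in> carrier N \<Longrightarrow> y \<in> carrier T \<Longrightarrow> g (frag_of (x, y)) = y \<odot>\<^bsub>N\<^esub> x"
    "\<And>z. z \<in> carrier B.TF \<Longrightarrow> g z \<in> carrier N"
    "\<And>z w. z \<in> carrier B.TF \<Longrightarrow> w \<in> carrier B.TF \<Longrightarrow> g (z + w) = g z \<oplus>\<^bsub>N\<^esub> g w"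
    by (rule B.balanced_hom[OF B.M.abelian_group_axioms, of "\<lambda>x y. y \<odot>\<^bsub>N\<^esub> x"]) auto
  have g_rel: "g w = \<zero>\<^bsub>N\<^esub>" if "w \<in> B.rel" for w
    using that
    by (intro B.balanced_rel[OF B.M.abelian_group_axioms, of g])
      (auto simp: g B.M.smult_r_distr B.M.smult_l_distr T.m_comm simp flip: B.M.smult_assoc1)
  have F: "?F w \<in> carrier B.TF" if "w \<in> carrier A.TF" for w
    using that by (induction w rule: A.TF_induct) (auto simp: frag_extend_diff h intro!: B.TF_closed)
  have gF_rel: "g (?F w) = \<zero>\<^bsub>N\<^esub>" if "w \<in> A.rel" for w
    using that
    by (intro A.balanced_rel[OF B.M.abelian_group_axioms, of "\<lambda>w. g (?F w)"])
      (auto simp: g F h frag_extend_add B.M.smult_r_distr B.M.smult_l_distr T.m_comm simp flip: B.M.smult_assoc1)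
  have "\<exists>c\<in>{()} \<rightarrow> carrier M. z - (\<Sum>s\<in>{()}. frag_of (c s, \<one>\<^bsub>T\<^esub>)) \<in> A.rel"
  proof (rule A.tensor_normal_form[OF _ _ _ z])
    fix y assume y: "y \<in> carrier S"
    show "\<exists>r\<in>{()} \<rightarrow> carrier T. y = (\<Oplus>\<^bsub>S\<^esub>s\<in>{()}. r s \<odot>\<^bsub>S\<^esub> \<one>\<^bsub>T\<^esub>)"
      using y A.N.finsum_insert[of "{}" "()" "\<lambda>_. y \<odot>\<^bsub>S\<^esub> \<one>\<^bsub>T\<^esub>"] A.N.r_zero[of y]
      by (intro bexI[of _ "\<lambda>_. y"]) auto
  qed auto
  then obtain m where m: "m \<in> carrier M" "z - frag_of (m, \<one>\<^bsub>T\<^esub>) \<in> A.rel" by auto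
  have mz: "z - frag_of (m, \<one>\<^bsub>T\<^esub>) \<in> carrier A.TF" using A.rel_carrier[OF m(2)] .
  have "?F z = ?F (z - frag_of (m, \<one>\<^bsub>T\<^esub>)) + frag_of (h m, \<one>\<^bsub>T\<^esub>)"
    by (simp add: frag_extend_diff)
  then have "g (?F z) = g (?F (z - frag_of (m, \<one>\<^bsub>T\<^esub>))) \<oplus>\<^bsub>N\<^esub> g (frag_of (h m, \<one>\<^bsub>T\<^esub>))"
    using F[OF mz] h(1)[OF m(1)] by (simp only:) (subst g(3), auto intro!: B.TF_closed)
  then have "h m = \<zero>\<^bsub>N\<^esub>"
    using gF_rel[OF m(2)] g_rel[OF Fz] m h by (simp add: g)
  moreover have "h \<zero>\<^bsub>M\<^esub> = \<zero>\<^bsub>N\<^esub>"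
    using h(3)[of "\<zero>\<^bsub>M\<^esub>" "\<zero>\<^bsub>M\<^esub>"] h(1)[of "\<zero>\<^bsub>M\<^esub>"] by (simp add: B.M.add.r_cancel_one')
  ultimately have "m = \<zero>\<^bsub>M\<^esub>" using h(2) m by (metis A.M.zero_closed inj_onD)
  then have "frag_of (m, \<one>\<^bsub>T\<^esub>) \<in> A.rel" using A.rel_zerol[of "\<one>\<^bsub>T\<^esub>"] by simp
  from A.rel_add[OF m(2) this] show "z \<in> tensor_relations T M (restrict_scalars (id_hom T) T)"
    by (simp add: S_def[symmetric])
qed

text \<open>A presentation with no variables and no relations. The ring
  \<open>mpoly_ring T 0\<close> consists of the constants, and since it is given as a bare record
  its ring laws are carried over from \<open>T\<close> along the map \<open>?c\<close> that forms
  constants.\<close>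

lemma finitely_presented_id:
  fixes T :: "'r alg"
  assumes T: "algebra R T"
  shows "finitely_presented T T (id_hom T)"
proof -
  interpret T: cring T by (rule algebraD(2)[OF T])
  let ?M = "mpoly_ring T 0"
  let ?c = "\<lambda>t m. if m = 0 then t else \<zero>\<^bsub>T\<^esub>"
  have car: "P \<in> carrier ?M \<longleftrightarrow> (\<exists>t\<in>carrier T. P = ?c t)" for P
  proof
    assume P: "P \<in> carrier ?M"
    then have "P m = \<zero>\<^bsub>T\<^esub>" if "m \<noteq> 0" for m
      using that by (auto simp: mpoly_ring_def)
    moreover have "P 0 \<in> carrier T" using P by (auto simp: mpoly_ring_def)
    ultimately show "\<exists>t\<in>carrier T. P = ?c t" by (intro bexI[of _ "P 0"] ext) auto
  next
    assume "\<exists>t\<in>carrier T. P = ?c t"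
    then show "P \<in> carrier ?M"
      by (auto simp: mpoly_ring_def intro: finite_subset[of _ "{0}"] split: if_splits)
  qed
  have split0: "{d :: (nat \<Rightarrow>\<^sub>0 nat) \<times> (nat \<Rightarrow>\<^sub>0 nat). fst d + snd d = 0} = {(0, 0)}"
  proof -
    have "a = 0 \<and> b = 0" if "a + b = 0" for a b :: "nat \<Rightarrow>\<^sub>0 nat"
    proof -
      have "Poly_Mapping.lookup a k + Poly_Mapping.lookup b k = 0" for k
        using arg_cong[OF that, of "\<lambda>c. Poly_Mapping.lookup c k"] by (simp add: lookup_add)
      then show ?thesis by (auto intro!: poly_mapping_eqI)
    qed
    then have "d = (0, 0)" if "fst d + snd d = 0" for d :: "(nat \<Rightarrow>\<^sub>0 nat) \<times> (nat \<Rightarrow>\<^sub>0 nat)"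
      using that by (metis prod.collapse)
    then show ?thesis by (intro equalityI subsetI) simp_all
  qed
  have mult: "?c a \<otimes>\<^bsub>?M\<^esub> ?c b = ?c (a \<otimes>\<^bsub>T\<^esub> b)" if "a \<in> carrier T" "b \<in> carrier T" for a b
  proof
    fix m :: "nat \<Rightarrow>\<^sub>0 nat"
    show "(?c a \<otimes>\<^bsub>?M\<^esub> ?c b) m = ?c (a \<otimes>\<^bsub>T\<^esub> b) m"
    proof (cases "m = 0")
      case True
      have "(\<Oplus>\<^bsub>T\<^esub>d\<in>{(0, 0)}. ?c a (fst d) \<otimes>\<^bsub>T\<^esub> ?c b (snd d)) = a \<otimes>\<^bsub>T\<^esub> b"
        using that by (subst T.finsum_insert) auto
      with True show ?thesis by (simp add: mpoly_ring_def split0)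
    next
      case False
      then have "(\<Oplus>\<^bsub>T\<^esub>d\<in>{d. fst d + snd d = m}. ?c a (fst d) \<otimes>\<^bsub>T\<^esub> ?c b (snd d)) = \<zero>\<^bsub>T\<^esub>"
        using that by (intro T.finsum_all_zero) auto
      with False show ?thesis by (simp add: mpoly_ring_def)
    qed
  qed
  have add: "?c a \<oplus>\<^bsub>?M\<^esub> ?c b = ?c (a \<oplus>\<^bsub>T\<^esub> b)" if "a \<in> carrier T" "b \<in> carrier T" for a b
    by (auto simp: mpoly_ring_def)
  have one: "\<one>\<^bsub>?M\<^esub> = ?c \<one>\<^bsub>T\<^esub>" and zero: "\<zero>\<^bsub>?M\<^esub> = ?c \<zero>\<^bsub>T\<^esub>" by (auto simp: mpoly_ring_def)
  have c0: "?c a = ?c b \<longleftrightarrow> a = b" for a b by (metis (mono_tags))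
  have iso: "?c \<in> ring_iso T ?M"
    by (auto simp: ring_iso_def ring_hom_def bij_betw_def inj_on_def car mult add one c0 image_iff)
  have "ring (?M\<lparr>zero := ?c \<zero>\<^bsub>T\<^esub>\<rparr>)" by (rule T.ring_iso_imp_img_ring[OF iso])
  \<comment> \<open>The transport lemma speaks about the image with its zero replaced by the image
    of zero; for constants this is the zero that \<open>?M\<close> already has.\<close>
  moreover have "?M\<lparr>zero := ?c \<zero>\<^bsub>T\<^esub>\<rparr> = ?M" by (simp add: mpoly_ring_def)
  ultimately interpret M: ring ?M by (simp only:)
  let ?\<phi> = "\<lambda>P :: (nat \<Rightarrow>\<^sub>0 nat) \<Rightarrow> 'r. P 0"
  have hom: "?\<phi> \<in> ring_hom ?M T"
    by (auto simp: ring_hom_def car mult add one)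
  have "genideal ?M {} = {\<zero>\<^bsub>?M\<^esub>}"
  proof
    show "genideal ?M {} \<subseteq> {\<zero>\<^bsub>?M\<^esub>}" by (rule M.genideal_minimal[OF M.zeroideal]) simp
    show "{\<zero>\<^bsub>?M\<^esub>} \<subseteq> genideal ?M {}"
      using additive_subgroup.zero_closed[OF ideal.axioms(1)[OF M.genideal_ideal[of "{}"]]] by simp
  qed
  moreover have "a_kernel ?M T ?\<phi> = {\<zero>\<^bsub>?M\<^esub>}"
    by (auto simp: a_kernel_def' car zero intro!: bexI[of _ "\<zero>\<^bsub>T\<^esub>"])
  ultimately have k: "a_kernel ?M T ?\<phi> = genideal ?M {}" by simp
  have surj: "?\<phi> ` carrier ?M = carrier T"
  proof
    show "?\<phi> ` carrier ?M \<subseteq> carrier T" using car by auto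
    show "carrier T \<subseteq> ?\<phi> ` carrier ?M"
    proof
      fix t assume "t \<in> carrier T"
      then show "t \<in> ?\<phi> ` carrier ?M" using car[of "?c t"] by (intro image_eqI[of _ _ "?c t"]) auto
    qed
  qed
  have all: "?\<phi> \<in> ring_hom ?M T \<and> ?\<phi> ` carrier ?M = carrier T \<and>
    (\<forall>t\<in>carrier T. ?\<phi> (?c t) = id_hom T t) \<and>
    finite ({} :: ((nat \<Rightarrow>\<^sub>0 nat) \<Rightarrow> 'r) set) \<and> {} \<subseteq> carrier ?M \<and> a_kernel ?M T ?\<phi> = genideal ?M {}"
    using hom surj k by (intro conjI) auto
  show ?thesis
    unfolding finitely_presented_def
    by (rule exI[of _ 0], rule exI[of _ ?\<phi>], rule exI[of _ "{}"], rule all)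
qed

lemma fppf_covering_id:
  assumes T: "algebra R T"
  shows "fppf_covering R T {(T, id_hom T)}"
proof -
  have "P = {t \<in> carrier T. id_hom T t \<in> P}" if "primeideal P T" for P
    using ideal.Icarr[OF primeideal.axioms(1)[OF that]] by auto
  then show ?thesis
    unfolding fppf_covering_def
    using T id_hom[OF T] flat_id[OF T] finitely_presented_id[OF T] by auto
qed

section \<open>Prime ideals, and faithfulness of coverings\<close>

lemma (in cring) exists_prime_above:
  assumes I: "ideal I R" and 1: "\<one> \<notin> I"
  shows "\<exists>P. primeideal P R \<and> I \<subseteq> P"
proof -
  define \<A> where "\<A> = {J. ideal J R \<and> I \<subseteq> J \<and> \<one> \<notin> J}"
  have "\<exists>M\<in>\<A>. \<forall>J\<in>\<A>. M \<subseteq> J \<longrightarrow> J = M"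
  proof (rule subset_Zorn_nonempty)
    show "\<A> \<noteq> {}" using I 1 by (auto simp: \<A>_def)
    fix \<C> assume ne: "\<C> \<noteq> {}" and chain: "subset.chain \<A> \<C>"
    then have C: "\<And>J. J \<in> \<C> \<Longrightarrow> ideal J R \<and> I \<subseteq> J \<and> \<one> \<notin> J"
      and tot: "\<And>J K. J \<in> \<C> \<Longrightarrow> K \<in> \<C> \<Longrightarrow> J \<subseteq> K \<or> K \<subseteq> J"
      by (auto simp: subset.chain_def \<A>_def subset_iff)
    obtain J0 where J0: "J0 \<in> \<C>" using ne by blast
    have "ideal (\<Union>\<C>) R"
    proof (rule idealI[OF ring_axioms])
      show "subgroup (\<Union>\<C>) (add_monoid R)"
      proof (rule add.subgroupI)
        show "\<Union>\<C> \<subseteq> carrier R"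
        proof
          fix x assume "x \<in> \<Union>\<C>"
          then obtain J where J: "x \<in> J" "J \<in> \<C>" by blast
          then show "x \<in> carrier R" using C[OF J(2)] ideal.Icarr by metis
        qed
        have "\<zero> \<in> J0"
          by (rule additive_subgroup.zero_closed[OF ideal.axioms(1)]) (use C[OF J0] in blast)
        then have "\<zero> \<in> \<Union>\<C>" by (rule UnionI[OF J0])
        then show "\<Union>\<C> \<noteq> {}" by (metis emptyE)
      next
        fix a assume "a \<in> \<Union>\<C>"
        then obtain J where J: "a \<in> J" "J \<in> \<C>" by blast
        have "\<ominus> a \<in> J"
          by (rule additive_subgroup.a_inv_closed[OF ideal.axioms(1) J(1)]) (use C[OF J(2)] in blast)
        then show "\<ominus> a \<in> \<Union>\<C>" by (rule UnionI[OF J(2)])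
      next
        fix a b assume "a \<in> \<Union>\<C>" "b \<in> \<Union>\<C>"
        then obtain J K where JK: "a \<in> J" "J \<in> \<C>" "b \<in> K" "K \<in> \<C>" by blast
        have cl: "a \<oplus> b \<in> L" if "a \<in> L" "b \<in> L" "L \<in> \<C>" for L
          by (rule additive_subgroup.a_closed[OF ideal.axioms(1) that(1,2)]) (use C[OF that(3)] in blast)
        show "a \<oplus> b \<in> \<Union>\<C>"
        proof (cases "J \<subseteq> K")
          case True
          then show ?thesis using UnionI[OF JK(4) cl[OF subsetD[OF True JK(1)] JK(3,4)]] by simp
        next
          case False
          then have "K \<subseteq> J" using tot[OF JK(2,4)] by blast
          then show ?thesis using UnionI[OF JK(2) cl[OF JK(1) subsetD[OF _ JK(3)] JK(2)]] by simp
        qed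
      qed
    next
      fix a x assume "a \<in> \<Union>\<C>" and x: "x \<in> carrier R"
      then obtain J where J: "a \<in> J" "J \<in> \<C>" by blast
      then have "x \<otimes> a \<in> J" "a \<otimes> x \<in> J"
        using C[OF J(2)] x ideal.I_l_closed[of J R a x] ideal.I_r_closed[of J R a x] by auto
      then show "x \<otimes> a \<in> \<Union>\<C>" "a \<otimes> x \<in> \<Union>\<C>" using UnionI[OF J(2)] by auto
    qed
    moreover have "I \<subseteq> \<Union>\<C>" using C[OF J0] Union_upper[OF J0] by (metis subset_trans)
    moreover have "\<one> \<notin> \<Union>\<C>" using C by (metis UnionE)
    ultimately show "\<Union>\<C> \<in> \<A>" by (simp add: \<A>_def)
  qed
  then obtain M where M: "ideal M R" "I \<subseteq> M" "\<one> \<notin> M"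
    and max: "\<And>J. ideal J R \<Longrightarrow> I \<subseteq> J \<Longrightarrow> \<one> \<notin> J \<Longrightarrow> M \<subseteq> J \<Longrightarrow> J = M"
    by (auto simp: \<A>_def)
  have "maximalideal M R"
  proof (rule maximalidealI[OF M(1)])
    show "carrier R \<noteq> M" using M(3) by auto
    fix J assume J: "ideal J R" "M \<subseteq> J" "J \<subseteq> carrier R"
    show "J = M \<or> J = carrier R"
      using max[of J] J M ideal.one_imp_carrier[OF J(1)] by blast
  qed
  then show ?thesis using maximalideal_prime M by blast
qed

lemma (in cring) annihilator_ideal:
  assumes t: "t \<in> carrier R"
  shows "ideal {a \<in> carrier R. a \<otimes> t = \<zero>} R"
proof (rule idealI[OF ring_axioms])
  show "subgroup {a \<in> carrier R. a \<otimes> t = \<zero>} (add_monoid R)"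
    by (rule add.subgroupI) (use t in \<open>auto simp: l_distr l_minus intro: exI[of _ \<zero>]\<close>)
next
  fix a x assume a: "a \<in> {a \<in> carrier R. a \<otimes> t = \<zero>}" and x: "x \<in> carrier R"
  have "x \<otimes> a \<otimes> t = x \<otimes> (a \<otimes> t)" using a x t by (intro m_assoc) auto
  moreover have "a \<otimes> x = x \<otimes> a" using a x by (intro m_comm) auto
  ultimately have "x \<otimes> a \<otimes> t = x \<otimes> (a \<otimes> t)" "a \<otimes> x \<otimes> t = x \<otimes> (a \<otimes> t)" by auto
  then show "x \<otimes> a \<in> {a \<in> carrier R. a \<otimes> t = \<zero>}" "a \<otimes> x \<in> {a \<in> carrier R. a \<otimes> t = \<zero>}"
    using a x by auto
qed

text \<open>
  Let \<open>P\<close> be a prime ideal containing the annihilator of \<open>t\<close> and \<open>Q\<close> a prime above it. By flatness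
  \<open>t T \<otimes> T' \<rightarrow> T'\<close> is injective, so if \<open>f t = 0\<close> then \<open>t \<otimes> 1 = 0\<close>; but \<open>a t \<otimes> y \<mapsto> f(a) y\<close> is a
  well-defined map to \<open>T'/Q\<close>, hence \<open>1 \<in> Q\<close>.
\<close>

lemma fppf_covering_zero:
  assumes T: "algebra R T" and C: "fppf_covering R T C"
    and t: "t \<in> carrier T" and 0: "\<And>T' f. (T', f) \<in> C \<Longrightarrow> f t = \<zero>\<^bsub>T'\<^esub>"
  shows "t = \<zero>\<^bsub>T\<^esub>"
proof (rule ccontr)
  assume nz: "t \<noteq> \<zero>\<^bsub>T\<^esub>"
  interpret T: cring T by (rule algebraD(2)[OF T])
  let ?Ann = "{a \<in> carrier T. a \<otimes>\<^bsub>T\<^esub> t = \<zero>\<^bsub>T\<^esub>}"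
  obtain P where P: "primeideal P T" "?Ann \<subseteq> P"
    using T.exists_prime_above[OF T.annihilator_ideal[OF t]] nz t by auto
  then obtain T' f Q where Tf: "(T', f) \<in> C" and Q: "primeideal Q T'" "P = {t \<in> carrier T. f t \<in> Q}"
    using C unfolding fppf_covering_def by blast
  have T': "algebra R T'" and f: "f \<in> alg_hom R T T'" and flat: "flat_hom T T' f"
    using C Tf unfolding fppf_covering_def by blast+
  interpret T': cring T' by (rule algebraD(2)[OF T'])
  interpret Q: primeideal Q T' by (rule Q(1))
  interpret QR: ring "T' Quot Q" by (rule Q.quotient_is_ring)
  note fh = alg_homD[OF f]
  have f0: "f \<zero>\<^bsub>T\<^esub> = \<zero>\<^bsub>T'\<^esub>" by (rule alg_hom_zero[OF f algebraD(3)[OF T] algebraD(3)[OF T']])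
  have fm: "f (a \<ominus>\<^bsub>T\<^esub> b) = f a \<ominus>\<^bsub>T'\<^esub> f b" if "a \<in> carrier T" "b \<in> carrier T" for a b
  proof -
    have "f (a \<ominus>\<^bsub>T\<^esub> b) \<oplus>\<^bsub>T'\<^esub> f b = f (a \<ominus>\<^bsub>T\<^esub> b \<oplus>\<^bsub>T\<^esub> b)" using that by (simp add: fh)
    also have "a \<ominus>\<^bsub>T\<^esub> b \<oplus>\<^bsub>T\<^esub> b = a" using that by (simp add: T.minus_eq T.a_assoc T.l_neg)
    finally show ?thesis using that by (intro T'.minus_solve) (auto simp: fh)
  qed
  \<comment> \<open>The principal ideal generated by \<open>t\<close>, viewed as a
    \<open>T\<close>-module. Flatness is applied to its inclusion into \<open>T\<close>.\<close>
  define M where "M = T\<lparr>carrier := (\<lambda>a. a \<otimes>\<^bsub>T\<^esub> t) ` carrier T, module.smult := monoid.mult T\<rparr>"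
  have Ms: "carrier M = (\<lambda>a. a \<otimes>\<^bsub>T\<^esub> t) ` carrier T" "\<And>x y. x \<oplus>\<^bsub>M\<^esub> y = x \<oplus>\<^bsub>T\<^esub> y"
    "\<And>x y. x \<odot>\<^bsub>M\<^esub> y = x \<otimes>\<^bsub>T\<^esub> y" "\<zero>\<^bsub>M\<^esub> = \<zero>\<^bsub>T\<^esub>" by (simp_all add: M_def)
  have Mc: "x \<in> carrier T" if "x \<in> carrier M" for x using that t by (auto simp: Ms)
  have Mi: "a \<otimes>\<^bsub>T\<^esub> t \<in> carrier M" if "a \<in> carrier T" for a using that by (auto simp: Ms)
  have M_add: "x \<oplus>\<^bsub>T\<^esub> y \<in> carrier M" if xy: "x \<in> carrier M" "y \<in> carrier M" for x y
  proof -
    obtain a b where "a \<in> carrier T" "b \<in> carrier T" "x = a \<otimes>\<^bsub>T\<^esub> t" "y = b \<otimes>\<^bsub>T\<^esub> t"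
      using xy by (auto simp: Ms)
    then show ?thesis using Mi[of "a \<oplus>\<^bsub>T\<^esub> b"] t by (simp add: T.l_distr)
  qed
  have M_mult: "r \<otimes>\<^bsub>T\<^esub> x \<in> carrier M" if "r \<in> carrier T" and x: "x \<in> carrier M" for r x
  proof -
    obtain a where "a \<in> carrier T" "x = a \<otimes>\<^bsub>T\<^esub> t" using x by (auto simp: Ms)
    then show ?thesis using Mi[of "r \<otimes>\<^bsub>T\<^esub> a"] t that by (simp add: T.m_assoc)
  qed
  have M_neg: "\<ominus>\<^bsub>T\<^esub> x \<in> carrier M" if "x \<in> carrier M" for x
    using M_mult[of "\<ominus>\<^bsub>T\<^esub> \<one>\<^bsub>T\<^esub>" x] Mc[OF that] that by (simp add: T.l_minus)
  have abM: "abelian_group M"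
  proof (rule abelian_groupI)
    show "\<zero>\<^bsub>M\<^esub> \<in> carrier M" using Mi[of "\<zero>\<^bsub>T\<^esub>"] t by (simp add: Ms(4))
    fix x assume x: "x \<in> carrier M"
    show "\<exists>y\<in>carrier M. y \<oplus>\<^bsub>M\<^esub> x = \<zero>\<^bsub>M\<^esub>"
      using M_neg[OF x] Mc[OF x] by (intro bexI[of _ "\<ominus>\<^bsub>T\<^esub> x"]) (auto simp: Ms(2,4) T.l_neg)
  qed (auto simp: Ms(2,4) M_add Mc T.a_ac)
  have mM: "module T M"
    by (rule moduleI[OF T.is_cring abM]) (auto simp: Ms(2,3) M_mult Mc T.l_distr T.r_distr T.m_assoc)
  have mN: "module T (self_algebra T)" by (rule algebraD(5)[OF T.algebra_self])
  let ?S = "restrict_scalars f T'"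
  have mS: "module T ?S" by (rule module_restrict_scalars[OF T T' f])
  have rs [simp]: "carrier ?S = carrier T'" "\<And>x y. x \<oplus>\<^bsub>?S\<^esub> y = x \<oplus>\<^bsub>T'\<^esub> y"
    "\<And>t x. t \<odot>\<^bsub>?S\<^esub> x = f t \<otimes>\<^bsub>T'\<^esub> x" "\<zero>\<^bsub>?S\<^esub> = \<zero>\<^bsub>T'\<^esub>"
    by (simp_all add: restrict_scalars_def)
  interpret A: two_modules T M ?S using mM mS by (intro two_modules.intro)
  interpret B: two_modules T "self_algebra T" ?S using mN mS by (intro two_modules.intro)
  have tM: "t \<in> carrier M" using Mi[of "\<one>\<^bsub>T\<^esub>"] t by simp
  \<comment> \<open>In the tensor product with \<open>T\<close> itself, \<open>t \<otimes> 1\<close>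
    equals \<open>1 \<otimes> f t\<close>, which is zero.\<close>
  have "frag_of (t, \<one>\<^bsub>T'\<^esub>) \<in> B.rel"
    using B.rel_add[OF B.rel_smult[of t "\<one>\<^bsub>T\<^esub>" "\<one>\<^bsub>T'\<^esub>"] B.rel_zeror[of "\<one>\<^bsub>T\<^esub>"]] t 0[OF Tf]
    by simp
  then have rel: "frag_of (t, \<one>\<^bsub>T'\<^esub>) \<in> A.rel"
    using flat[unfolded flat_hom_def, rule_format, of M "self_algebra T" "\<lambda>x. x" "frag_of (t, \<one>\<^bsub>T'\<^esub>)"]
      mM mN tM Mc A.TF_closed(4)[of t "\<one>\<^bsub>T'\<^esub>"] by (auto simp: Ms(2,3))
  \<comment> \<open>A chosen quotient of \<open>x\<close> by \<open>t\<close>. Two quotients differ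
    by an element of the annihilator, hence of \<open>P\<close>, and \<open>f\<close> sends
    \<open>P\<close> into \<open>Q\<close>; so \<open>\<psi>\<close>, which takes values modulo
    \<open>Q\<close>, is independent of the choice.\<close>
  define co where "co x = (SOME a. a \<in> carrier T \<and> x = a \<otimes>\<^bsub>T\<^esub> t)" for x
  have co: "co x \<in> carrier T" "co x \<otimes>\<^bsub>T\<^esub> t = x" if "x \<in> carrier M" for x
  proof -
    have "co x \<in> carrier T \<and> x = co x \<otimes>\<^bsub>T\<^esub> t"
      unfolding co_def by (rule someI_ex) (use that in \<open>auto simp: Ms\<close>)
    then show "co x \<in> carrier T" "co x \<otimes>\<^bsub>T\<^esub> t = x" by auto
  qed
  define \<psi> where "\<psi> x y = Q +>\<^bsub>T'\<^esub> (f (co x) \<otimes>\<^bsub>T'\<^esub> y)" for x y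
  have \<psi>: "\<psi> x y = Q +>\<^bsub>T'\<^esub> (f a \<otimes>\<^bsub>T'\<^esub> y)"
    if "x \<in> carrier M" "a \<in> carrier T" "x = a \<otimes>\<^bsub>T\<^esub> t" "y \<in> carrier T'" for x y a
  proof -
    have "(co x \<ominus>\<^bsub>T\<^esub> a) \<otimes>\<^bsub>T\<^esub> t = \<zero>\<^bsub>T\<^esub>"
      using co[OF that(1)] that t by (simp add: T.minus_eq T.l_distr T.l_minus T.r_neg)
    then have "co x \<ominus>\<^bsub>T\<^esub> a \<in> P" using P(2) co[OF that(1)] that by auto
    then have "f (co x) \<ominus>\<^bsub>T'\<^esub> f a \<in> Q" using Q(2) fm co[OF that(1)] that by auto
    then have "(f (co x) \<ominus>\<^bsub>T'\<^esub> f a) \<otimes>\<^bsub>T'\<^esub> y \<in> Q" using that by (intro Q.I_r_closed)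
    then have "f (co x) \<otimes>\<^bsub>T'\<^esub> y \<ominus>\<^bsub>T'\<^esub> f a \<otimes>\<^bsub>T'\<^esub> y \<in> Q"
      using co[OF that(1)] that by (simp add: T'.minus_eq T'.l_distr T'.l_minus fh)
    then show ?thesis
      using co[OF that(1)] that
      by (simp add: \<psi>_def fh flip: T'.quotient_eq_iff_same_a_r_cos[OF Q.ideal_axioms])
  qed
  have car: "Q +>\<^bsub>T'\<^esub> x \<in> carrier (T' Quot Q)" if "x \<in> carrier T'" for x
    using that by (auto simp: FactRing_def A_RCOSETS_def')
  have qadd: "(Q +>\<^bsub>T'\<^esub> x) \<oplus>\<^bsub>T' Quot Q\<^esub> (Q +>\<^bsub>T'\<^esub> y) = Q +>\<^bsub>T'\<^esub> (x \<oplus>\<^bsub>T'\<^esub> y)"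
    if "x \<in> carrier T'" "y \<in> carrier T'" for x y
    using Q.rcos_ring_hom that by (auto simp: ring_hom_def)
  obtain h where h: "\<And>x y. x \<in> carrier M \<Longrightarrow> y \<in> carrier T' \<Longrightarrow> h (frag_of (x, y)) = \<psi> x y"
    "\<And>z. z \<in> carrier A.TF \<Longrightarrow> h z \<in> carrier (T' Quot Q)"
    "\<And>z w. z \<in> carrier A.TF \<Longrightarrow> w \<in> carrier A.TF \<Longrightarrow> h (z + w) = h z \<oplus>\<^bsub>T' Quot Q\<^esub> h w"
    by (rule A.balanced_hom[OF QR.is_abelian_group, of \<psi>]) (auto simp: \<psi>_def car fh co)
  have "h (frag_of (t, \<one>\<^bsub>T'\<^esub>)) = \<zero>\<^bsub>T' Quot Q\<^esub>"
  proof (rule A.balanced_rel[OF QR.is_abelian_group h(2,3) _ _ _ rel])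
    fix x x' y assume c: "x \<in> carrier M" "x' \<in> carrier M" "y \<in> carrier ?S"
    have "\<psi> (x \<oplus>\<^bsub>T\<^esub> x') y = Q +>\<^bsub>T'\<^esub> (f (co x \<oplus>\<^bsub>T\<^esub> co x') \<otimes>\<^bsub>T'\<^esub> y)"
      using c co M_add t by (intro \<psi>) (auto simp: T.l_distr)
    then show "h (frag_of (x \<oplus>\<^bsub>M\<^esub> x', y)) = h (frag_of (x, y)) \<oplus>\<^bsub>T' Quot Q\<^esub> h (frag_of (x', y))"
      using c co M_add by (simp add: h Ms(2) fh \<psi>_def qadd T'.l_distr)
  next
    fix x y y' assume c: "x \<in> carrier M" "y \<in> carrier ?S" "y' \<in> carrier ?S"
    then show "h (frag_of (x, y \<oplus>\<^bsub>?S\<^esub> y')) = h (frag_of (x, y)) \<oplus>\<^bsub>T' Quot Q\<^esub> h (frag_of (x, y'))"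
      using co by (simp add: h \<psi>_def qadd T'.r_distr fh)
  next
    fix r x y assume c: "r \<in> carrier T" "x \<in> carrier M" "y \<in> carrier ?S"
    have "\<psi> (r \<otimes>\<^bsub>T\<^esub> x) y = Q +>\<^bsub>T'\<^esub> (f (r \<otimes>\<^bsub>T\<^esub> co x) \<otimes>\<^bsub>T'\<^esub> y)"
      using c co M_mult t by (intro \<psi>) (auto simp: T.m_assoc)
    then show "h (frag_of (r \<odot>\<^bsub>M\<^esub> x, y)) = h (frag_of (x, r \<odot>\<^bsub>?S\<^esub> y))"
      using c co M_mult by (simp add: h Ms(3) \<psi>_def fh T'.m_ac)
  qed
  moreover have "h (frag_of (t, \<one>\<^bsub>T'\<^esub>)) = Q +>\<^bsub>T'\<^esub> \<one>\<^bsub>T'\<^esub>"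
    using h(1)[OF tM, of "\<one>\<^bsub>T'\<^esub>"] \<psi>[OF tM, of "\<one>\<^bsub>T\<^esub>" "\<one>\<^bsub>T'\<^esub>"] t by (simp add: fh)
  ultimately have "Q +>\<^bsub>T'\<^esub> \<one>\<^bsub>T'\<^esub> = Q" by (simp add: FactRing_def)
  then have "\<one>\<^bsub>T'\<^esub> \<in> Q" using Q.a_rcos_self[of "\<one>\<^bsub>T'\<^esub>"] by simp
  then show False using Q.one_imp_carrier Q.I_notcarr by simp
qed


section \<open>Localization\<close>

lemma infinite_list_inj:
  assumes "infinite (UNIV :: 'a set)"
  shows "\<exists>e :: 'a list \<Rightarrow> 'a. inj e"
proof -
  have "|lists (UNIV :: 'a set)| =o |UNIV :: 'a set|" by (rule card_of_lists_infinite[OF assms])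
  then have "|UNIV :: 'a list set| \<le>o |UNIV :: 'a set|"
    by (simp add: lists_UNIV ordIso_imp_ordLeq)
  then show ?thesis by (auto simp flip: card_of_ordLeq)
qed

lemma algebra_via_hom:
  assumes T: "cring R" "cring T" and \<sigma>: "\<sigma> \<in> ring_hom R T"
    and sm: "\<And>r x. r \<odot>\<^bsub>T\<^esub> x = \<sigma> r \<otimes>\<^bsub>T\<^esub> x"
  shows "algebra R T"
proof -
  interpret T: cring T by (rule T)
  show ?thesis
    using ring_hom_memE[OF \<sigma>] T
    by (intro algebraI) (auto simp: sm T.l_distr T.r_distr T.m_assoc)
qed

text \<open>The action on \<open>T'\<close> is defined through \<open>f\<close> and the structure
  map of \<open>T\<close>, which makes \<open>f\<close> linear by construction. This suits the
  localization, which is first built as a ring only.\<close>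

lemma alg_hom_via_structure:
  assumes T: "algebra R T" and T': "cring T'" and f: "f \<in> ring_hom T T'"
    and sm: "\<And>r x. r \<odot>\<^bsub>T'\<^esub> x = f (r \<odot>\<^bsub>T\<^esub> \<one>\<^bsub>T\<^esub>) \<otimes>\<^bsub>T'\<^esub> x"
  shows "algebra R T'" "restrict f (carrier T) \<in> alg_hom R T T'"
proof -
  interpret T: cring T by (rule algebraD(2)[OF T])
  interpret Tm: module R T by (rule algebraD(5)[OF T])
  interpret T': cring T' by (rule T')
  note fh = ring_hom_memE[OF f]
  have s: "r \<odot>\<^bsub>T\<^esub> x = (r \<odot>\<^bsub>T\<^esub> \<one>\<^bsub>T\<^esub>) \<otimes>\<^bsub>T\<^esub> x" if "r \<in> carrier R" "x \<in> carrier T" for r x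
    using that algebra.smult_assoc2[OF T, of r "\<one>\<^bsub>T\<^esub>" x] by simp
  have "(\<lambda>r. f (r \<odot>\<^bsub>T\<^esub> \<one>\<^bsub>T\<^esub>)) \<in> ring_hom R T'"
  proof (rule ring_hom_memI)
    fix x y assume xy: "x \<in> carrier R" "y \<in> carrier R"
    show "f (x \<otimes>\<^bsub>R\<^esub> y \<odot>\<^bsub>T\<^esub> \<one>\<^bsub>T\<^esub>) = f (x \<odot>\<^bsub>T\<^esub> \<one>\<^bsub>T\<^esub>) \<otimes>\<^bsub>T'\<^esub> f (y \<odot>\<^bsub>T\<^esub> \<one>\<^bsub>T\<^esub>)"
      using xy s[of x "y \<odot>\<^bsub>T\<^esub> \<one>\<^bsub>T\<^esub>"] by (simp add: Tm.smult_assoc1 flip: fh(2))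
    show "f ((x \<oplus>\<^bsub>R\<^esub> y) \<odot>\<^bsub>T\<^esub> \<one>\<^bsub>T\<^esub>) = f (x \<odot>\<^bsub>T\<^esub> \<one>\<^bsub>T\<^esub>) \<oplus>\<^bsub>T'\<^esub> f (y \<odot>\<^bsub>T\<^esub> \<one>\<^bsub>T\<^esub>)"
      using xy by (simp add: Tm.smult_l_distr fh)
  qed (auto simp: fh)
  then show "algebra R T'"
    using algebraD(1)[OF T] T' sm by (intro algebra_via_hom)
  show "restrict f (carrier T) \<in> alg_hom R T T'"
  proof (rule alg_homI)
    fix r x assume rx: "r \<in> carrier R" "x \<in> carrier T"
    have "f (r \<odot>\<^bsub>T\<^esub> x) = f (r \<odot>\<^bsub>T\<^esub> \<one>\<^bsub>T\<^esub>) \<otimes>\<^bsub>T'\<^esub> f x"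
      unfolding s[OF rx] using rx by (intro fh(2)) auto
    then show "restrict f (carrier T) (r \<odot>\<^bsub>T\<^esub> x) = r \<odot>\<^bsub>T'\<^esub> restrict f (carrier T) x"
      using rx by (simp add: sm)
  qed (auto simp: fh)
qed

lemma UP_coeff: "q \<in> up T \<Longrightarrow> up_ring.coeff (UP T) q n = q n"
  by (simp add: UP_def)

text \<open>\<open>T[1/s]\<close> is \<open>T[X]/(sX - 1)\<close>; the constant \<open>t\<close> is divisible by \<open>sX - 1\<close> only if \<open>s\<^sup>N t = 0\<close> for some \<open>N\<close>.\<close>

lemma localization_UP:
  assumes T: "cring T" and s: "s \<in> carrier T"
  defines "P \<equiv> UP T"
  defines "g \<equiv> up_ring.monom P s 1 \<ominus>\<^bsub>P\<^esub> \<one>\<^bsub>P\<^esub>"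
  defines "J \<equiv> cgenideal P g"
  shows "ideal J P" "(\<lambda>t. J +>\<^bsub>P\<^esub> up_ring.monom P t 0) \<in> ring_hom T (P Quot J)"
    "J +>\<^bsub>P\<^esub> up_ring.monom P s 0 \<in> Units (P Quot J)"
    "t \<in> carrier T \<Longrightarrow> J +>\<^bsub>P\<^esub> up_ring.monom P t 0 = \<zero>\<^bsub>P Quot J\<^esub> \<Longrightarrow> \<exists>N. s [^]\<^bsub>T\<^esub> (N::nat) \<otimes>\<^bsub>T\<^esub> t = \<zero>\<^bsub>T\<^esub>"
proof -
  interpret T: cring T by (rule T)
  interpret UP_cring T P by unfold_locales (simp add: P_def)
  have m1: "up_ring.monom P s 1 \<in> carrier P" using s by simp
  have g: "g \<in> carrier P" using s by (simp add: g_def)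
  show J: "ideal J P" unfolding J_def by (rule P.cgenideal_ideal[OF g])
  interpret J: ideal J P by (rule J)
  interpret Q: cring "P Quot J" by (rule J.quotient_is_cring[OF P.is_cring])
  show hom: "(\<lambda>t. J +>\<^bsub>P\<^esub> up_ring.monom P t 0) \<in> ring_hom T (P Quot J)"
    using ring_hom_trans[OF const_ring_hom J.rcos_ring_hom] by (simp add: comp_def)
  have car: "J +>\<^bsub>P\<^esub> x \<in> carrier (P Quot J)" if "x \<in> carrier P" for x
    using that ring_hom_memE(1)[OF J.rcos_ring_hom] by blast
  have "g \<in> J" unfolding J_def by (rule P.cgenideal_self[OF g])
  then have "J +>\<^bsub>P\<^esub> up_ring.monom P s 1 = J +>\<^bsub>P\<^esub> \<one>\<^bsub>P\<^esub>"
    using P.quotient_eq_iff_same_a_r_cos[OF J m1 P.one_closed] by (simp add: g_def)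
  moreover have "(J +>\<^bsub>P\<^esub> up_ring.monom P s 0) \<otimes>\<^bsub>P Quot J\<^esub> (J +>\<^bsub>P\<^esub> up_ring.monom P \<one>\<^bsub>T\<^esub> 1) = J +>\<^bsub>P\<^esub> up_ring.monom P s 1"
    using s ring_hom_memE(2)[OF J.rcos_ring_hom, of "up_ring.monom P s 0" "up_ring.monom P \<one>\<^bsub>T\<^esub> 1"]
      monom_mult[of s "\<one>\<^bsub>T\<^esub>" 0 1] by simp
  moreover have "J +>\<^bsub>P\<^esub> \<one>\<^bsub>P\<^esub> = \<one>\<^bsub>P Quot J\<^esub>" by (simp add: FactRing_def)
  ultimately have u: "(J +>\<^bsub>P\<^esub> up_ring.monom P s 0) \<otimes>\<^bsub>P Quot J\<^esub> (J +>\<^bsub>P\<^esub> up_ring.monom P \<one>\<^bsub>T\<^esub> 1) = \<one>\<^bsub>P Quot J\<^esub>" by simp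
  show "J +>\<^bsub>P\<^esub> up_ring.monom P s 0 \<in> Units (P Quot J)"
    unfolding Units_def using u car s Q.m_comm[OF car car, of "up_ring.monom P s 0" "up_ring.monom P \<one>\<^bsub>T\<^esub> 1"]
    by (intro CollectI conjI bexI[of _ "J +>\<^bsub>P\<^esub> up_ring.monom P \<one>\<^bsub>T\<^esub> 1"]) auto
  show "\<exists>N. s [^]\<^bsub>T\<^esub> (N::nat) \<otimes>\<^bsub>T\<^esub> t = \<zero>\<^bsub>T\<^esub>"
    if t: "t \<in> carrier T" and 0: "J +>\<^bsub>P\<^esub> up_ring.monom P t 0 = \<zero>\<^bsub>P Quot J\<^esub>"
  proof -
    have "up_ring.monom P t 0 \<in> J +>\<^bsub>P\<^esub> up_ring.monom P t 0" using t by (intro J.a_rcos_self) simp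
    then have "up_ring.monom P t 0 \<in> J" using 0 by (simp add: FactRing_def)
    then obtain q where q: "q \<in> carrier P" "up_ring.monom P t 0 = q \<otimes>\<^bsub>P\<^esub> g"
      unfolding J_def cgenideal_def by blast
    have cq: "up_ring.coeff P q n \<in> carrier T" for n using q by simp
    have eq: "up_ring.monom P t 0 = q \<otimes>\<^bsub>P\<^esub> up_ring.monom P s 1 \<ominus>\<^bsub>P\<^esub> q"
      unfolding q(2) g_def using q(1) m1
      by (simp add: P.minus_eq P.r_distr P.r_minus)
    have cf: "up_ring.coeff P (up_ring.monom P t 0) n = up_ring.coeff P (q \<otimes>\<^bsub>P\<^esub> up_ring.monom P s 1) n \<ominus>\<^bsub>T\<^esub> up_ring.coeff P q n" for n
      unfolding eq using q(1) m1 by (simp add: P.minus_eq T.minus_eq del: coeff_mult)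
    have mc0: "up_ring.coeff P (q \<otimes>\<^bsub>P\<^esub> up_ring.monom P s 1) 0 = \<zero>\<^bsub>T\<^esub>"
      using q(1) m1 s cq by simp
    have mcS: "up_ring.coeff P (q \<otimes>\<^bsub>P\<^esub> up_ring.monom P s 1) (Suc n) = up_ring.coeff P q n \<otimes>\<^bsub>T\<^esub> s" for n
    proof -
      have "up_ring.coeff P (q \<otimes>\<^bsub>P\<^esub> up_ring.monom P s 1) (Suc n)
          = (\<Oplus>\<^bsub>T\<^esub>i\<in>{..Suc n}. if i = n then up_ring.coeff P q i \<otimes>\<^bsub>T\<^esub> s else \<zero>\<^bsub>T\<^esub>)"
        unfolding coeff_mult[OF q(1) m1] using s cq by (intro T.finsum_cong') auto
      also have "\<dots> = up_ring.coeff P q n \<otimes>\<^bsub>T\<^esub> s" using s cq by (subst T.finsum_delta) auto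
      finally show ?thesis .
    qed
    have z: "a \<ominus>\<^bsub>T\<^esub> b = \<zero>\<^bsub>T\<^esub> \<Longrightarrow> a \<in> carrier T \<Longrightarrow> b \<in> carrier T \<Longrightarrow> b = a" for a b
      by (simp add: T.r_right_minus_eq)
    \<comment> \<open>Compare coefficients in \<open>t = q (s X - 1)\<close>. The constant term
      starts a recursion in which each further coefficient of \<open>q\<close> is \<open>s\<close>
      times the previous one; beyond the bound of \<open>q\<close> this forces a power of
      \<open>s\<close> to kill \<open>t\<close>.\<close>
    have q0: "up_ring.coeff P q 0 = \<ominus>\<^bsub>T\<^esub> t"
      using cf[of 0] mc0 t cq[of 0] by (simp add: T.minus_eq del: coeff_mult) 
    have qS: "up_ring.coeff P q (Suc n) = up_ring.coeff P q n \<otimes>\<^bsub>T\<^esub> s" for n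
      by (rule z) (use cf[of "Suc n"] mcS[of n] t s cq in \<open>simp_all del: coeff_mult\<close>)
    have qn: "up_ring.coeff P q n = \<ominus>\<^bsub>T\<^esub> (s [^]\<^bsub>T\<^esub> n \<otimes>\<^bsub>T\<^esub> t)" for n
      by (induction n) (use s t in \<open>simp_all add: q0 qS T.l_minus T.r_minus T.m_ac\<close>)
    have "q \<in> up T" using q(1) by (simp add: P_def UP_def)
    then obtain n where n: "bound \<zero>\<^bsub>T\<^esub> n q" by blast
    have "up_ring.coeff P q (Suc n) = q (Suc n)"
      unfolding P_def by (rule UP_coeff[OF \<open>q \<in> up T\<close>])
    also have "\<dots> = \<zero>\<^bsub>T\<^esub>" by (rule bound.bound[OF n]) simp
    finally have "up_ring.coeff P q (Suc n) = \<zero>\<^bsub>T\<^esub>" .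
    then have "\<ominus>\<^bsub>T\<^esub> (s [^]\<^bsub>T\<^esub> Suc n \<otimes>\<^bsub>T\<^esub> t) = \<zero>\<^bsub>T\<^esub>" by (simp only: qn)
    then have "s [^]\<^bsub>T\<^esub> Suc n \<otimes>\<^bsub>T\<^esub> t = \<zero>\<^bsub>T\<^esub>"
      using T.minus_minus[of "s [^]\<^bsub>T\<^esub> Suc n \<otimes>\<^bsub>T\<^esub> t"] s t T.minus_zero by (metis T.m_closed T.nat_pow_closed)
    then show ?thesis by blast
  qed
qed

text \<open>Objects of the site have carriers inside the type \<open>'r\<close>, so the localization
  must be copied into it. A coset is encoded by the coefficient list of a chosen representative, and
  finite lists over an infinite type can be encoded by elements of that type.\<close>

lemma UP_Quot_embedding:
  fixes T :: "('r, 'm) ring_scheme"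
  assumes T: "cring T" and J: "ideal J (UP T)" and inf: "infinite (UNIV :: 'r set)"
  shows "\<exists>e :: (nat \<Rightarrow> 'r) set \<Rightarrow> 'r. inj_on e (carrier (UP T Quot J))"
proof -
  interpret T: cring T by (rule T)
  interpret UP_cring T "UP T" by unfold_locales
  interpret J: ideal J "UP T" by (rule J)
  obtain e :: "'r list \<Rightarrow> 'r" where e: "inj e" using infinite_list_inj[OF inf] by blast
  define rp where "rp U = (SOME q. q \<in> carrier (UP T) \<and> U = J +>\<^bsub>UP T\<^esub> q)" for U
  have rp: "rp U \<in> carrier (UP T) \<and> U = J +>\<^bsub>UP T\<^esub> rp U" if "U \<in> carrier (UP T Quot J)" for U
    unfolding rp_def
    by (rule someI_ex[of "\<lambda>q. q \<in> carrier (UP T) \<and> U = J +>\<^bsub>UP T\<^esub> q"])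
      (use that in \<open>auto simp: FactRing_def A_RCOSETS_def'\<close>)
  define bd where "bd q = (SOME n. bound \<zero>\<^bsub>T\<^esub> n q)" for q :: "nat \<Rightarrow> 'r"
  have bd: "bound \<zero>\<^bsub>T\<^esub> (bd q) q" if "q \<in> carrier (UP T)" for q
    unfolding bd_def by (rule someI_ex) (use that in \<open>auto simp: UP_def\<close>)
  let ?l = "\<lambda>q. map q [0..<Suc (bd q)]"
  \<comment> \<open>The length of the list records the chosen bound. Equal lists therefore have the
    same bound, beyond which both polynomials vanish.\<close>
  have linj: "q = q'" if "?l q = ?l q'" "q \<in> carrier (UP T)" "q' \<in> carrier (UP T)" for q q'
  proof
    fix n
    have len: "bd q = bd q'" using arg_cong[OF that(1), of length] by simp
    show "q n = q' n"
    proof (cases "n \<le> bd q")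
      case True
      then have "?l q ! n = q n" "?l q' ! n = q' n" using len by (simp_all del: upt_Suc)
      then show ?thesis using that(1) by simp
    next
      case False
      then show ?thesis using bd[OF that(2)] bd[OF that(3)] len by (simp add: bound.bound)
    qed
  qed
  have "inj_on (\<lambda>U. e (?l (rp U))) (carrier (UP T Quot J))"
  proof (rule inj_onI)
    fix U V assume UV: "U \<in> carrier (UP T Quot J)" "V \<in> carrier (UP T Quot J)"
      and "e (?l (rp U)) = e (?l (rp V))"
    then have "rp U = rp V" using linj rp injD[OF e] by blast
    then show "U = V" using rp UV by metis
  qed
  then show ?thesis by blast
qed

text \<open>The quotient of \<open>localization_UP\<close> is transported into the type of
  \<open>R\<close>. Of the universal property only two consequences are kept: \<open>s\<close>
  becomes a unit, and what dies in the localization is killed by a power of \<open>s\<close>. The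
  first allows conjugating matrices to be constructed, the second brings equations back to
  \<open>T\<close>.\<close>

lemma localization_exists:
  fixes T :: "'r alg"
  assumes T: "algebra R T" and s: "s \<in> carrier T" and inf: "infinite (UNIV :: 'r set)"
  shows "\<exists>(T' :: 'r alg) f. algebra R T' \<and> f \<in> alg_hom R T T' \<and> f s \<in> Units T' \<and>
    (\<forall>t\<in>carrier T. f t = \<zero>\<^bsub>T'\<^esub> \<longrightarrow> (\<exists>N. s [^]\<^bsub>T\<^esub> (N::nat) \<otimes>\<^bsub>T\<^esub> t = \<zero>\<^bsub>T\<^esub>))"
proof -
  define P where "P = UP T"
  define J where "J = cgenideal P (up_ring.monom P s 1 \<ominus>\<^bsub>P\<^esub> \<one>\<^bsub>P\<^esub>)"
  let ?Q = "P Quot J"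
  note cT = algebraD(2)[OF T]
  note L = localization_UP[OF cT s, folded P_def, folded J_def]
  interpret P: cring P using UP_cring.UP_cring[OF UP_cring.intro[OF cT]] by (simp add: P_def)
  interpret J: ideal J P by (rule L(1))
  interpret Q: cring ?Q by (rule J.quotient_is_cring[OF P.is_cring])
  obtain e :: "(nat \<Rightarrow> 'r) set \<Rightarrow> 'r" where e: "inj_on e (carrier ?Q)"
    using UP_Quot_embedding[OF cT L(1)[unfolded P_def] inf] by (auto simp: P_def)
  let ?E = "image_ring e ?Q"
  have iso: "e \<in> ring_iso ?Q ?E" by (rule inj_imp_image_ring_iso[OF e])
  define f where "f t = e (J +>\<^bsub>P\<^esub> up_ring.monom P t 0)" for t
  define T' :: "'r alg" where
    "T' = \<lparr>carrier = carrier ?E, monoid.mult = monoid.mult ?E, monoid.one = \<one>\<^bsub>?E\<^esub>,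
      ring.zero = \<zero>\<^bsub>?E\<^esub>, ring.add = ring.add ?E,
      module.smult = (\<lambda>r x. f (r \<odot>\<^bsub>T\<^esub> \<one>\<^bsub>T\<^esub>) \<otimes>\<^bsub>?E\<^esub> x)\<rparr>"
  have T's: "carrier T' = carrier ?E" "\<And>x y. x \<otimes>\<^bsub>T'\<^esub> y = x \<otimes>\<^bsub>?E\<^esub> y" "\<And>x y. x \<oplus>\<^bsub>T'\<^esub> y = x \<oplus>\<^bsub>?E\<^esub> y"
    "\<one>\<^bsub>T'\<^esub> = \<one>\<^bsub>?E\<^esub>" "\<zero>\<^bsub>T'\<^esub> = \<zero>\<^bsub>?E\<^esub>" "\<And>r x. r \<odot>\<^bsub>T'\<^esub> x = f (r \<odot>\<^bsub>T\<^esub> \<one>\<^bsub>T\<^esub>) \<otimes>\<^bsub>T'\<^esub> x"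
    by (simp_all add: T'_def)
  have isoT: "e \<in> ring_iso ?Q T'" using iso by (simp add: ring_iso_def ring_hom_def T's)
  have "T'\<lparr>zero := e \<zero>\<^bsub>?Q\<^esub>\<rparr> = T'"
    by (simp add: T'_def image_ring_zero)
  then interpret T': cring T' using Q.ring_iso_imp_img_cring[OF isoT] by simp
  have eh: "e \<in> ring_hom ?Q T'" using isoT by (simp add: ring_iso_def)
  have fh: "f \<in> ring_hom T T'"
    using ring_hom_trans[OF L(2) eh] by (simp add: comp_def f_def[abs_def])
  note A = alg_hom_via_structure[OF T T'.is_cring fh T's(6)]
  have e0: "e \<zero>\<^bsub>?Q\<^esub> = \<zero>\<^bsub>T'\<^esub>" by (rule ring_hom_zero[OF eh Q.ring_axioms T'.ring_axioms])
  have fu: "f s \<in> Units T'"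
  proof -
    obtain y where y: "y \<in> carrier ?Q" "y \<otimes>\<^bsub>?Q\<^esub> (J +>\<^bsub>P\<^esub> up_ring.monom P s 0) = \<one>\<^bsub>?Q\<^esub>"
      using L(3) by (auto simp: Units_def)
    have c: "J +>\<^bsub>P\<^esub> up_ring.monom P s 0 \<in> carrier ?Q" using L(3) by (rule Q.Units_closed)
    have "e y \<otimes>\<^bsub>T'\<^esub> f s = \<one>\<^bsub>T'\<^esub>"
      using ring_hom_memE(2)[OF eh y(1) c] ring_hom_memE(4)[OF eh] y by (simp add: f_def)
    moreover have "e y \<in> carrier T'" "f s \<in> carrier T'"
      using ring_hom_memE(1)[OF eh] y c by (auto simp: f_def)
    ultimately show ?thesis unfolding Units_def using T'.m_comm by force
  qed
  have "\<exists>N. s [^]\<^bsub>T\<^esub> (N::nat) \<otimes>\<^bsub>T\<^esub> t = \<zero>\<^bsub>T\<^esub>" if t: "t \<in> carrier T" "f t = \<zero>\<^bsub>T'\<^esub>" for t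
  proof -
    have "J +>\<^bsub>P\<^esub> up_ring.monom P t 0 \<in> carrier ?Q" using ring_hom_memE(1)[OF L(2) t(1)] .
    then have "J +>\<^bsub>P\<^esub> up_ring.monom P t 0 = \<zero>\<^bsub>?Q\<^esub>"
      using e t(2) e0 by (auto simp: f_def inj_on_def)
    then show ?thesis by (rule L(4)[OF t(1)])
  qed
  then have "algebra R T' \<and> restrict f (carrier T) \<in> alg_hom R T T' \<and> restrict f (carrier T) s \<in> Units T' \<and>
    (\<forall>t\<in>carrier T. restrict f (carrier T) t = \<zero>\<^bsub>T'\<^esub> \<longrightarrow> (\<exists>N. s [^]\<^bsub>T\<^esub> (N::nat) \<otimes>\<^bsub>T\<^esub> t = \<zero>\<^bsub>T\<^esub>))"
    using A fu s by simp
  then show ?thesis by blast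
qed

text \<open>If \<open>t\<close> were nonzero, a prime ideal would contain its annihilator, hence a
  power of every \<open>s k\<close>, hence every \<open>s k\<close> and finally \<open>1\<close>.
  This is the local nature of vanishing: an element that is zero on each open set of a cover by the
  \<open>s k\<close> is zero.\<close>

lemma (in cring) unimodular_annihilator:
  fixes s :: "nat \<Rightarrow> 'a"
  assumes s: "\<And>k. k < n \<Longrightarrow> s k \<in> carrier R" "\<And>k. k < n \<Longrightarrow> c k \<in> carrier R"
    and 1: "(\<Oplus>k\<in>{..<n}. c k \<otimes> s k) = \<one>"
    and t: "t \<in> carrier R" and 0: "\<And>k. k < n \<Longrightarrow> \<exists>N. s k [^] (N::nat) \<otimes> t = \<zero>"
  shows "t = \<zero>"
proof (rule ccontr)
  assume nz: "t \<noteq> \<zero>"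
  let ?Ann = "{a \<in> carrier R. a \<otimes> t = \<zero>}"
  obtain P where P: "primeideal P R" "?Ann \<subseteq> P"
    using exists_prime_above[OF annihilator_ideal[OF t]] nz t by auto
  interpret P: primeideal P R by (rule P(1))
  have "s k \<in> P" if k: "k < n" for k
  proof -
    obtain N where "s k [^] (N::nat) \<otimes> t = \<zero>" using 0[OF k] by blast
    then have "s k [^] N \<in> P" using P(2) s(1)[OF k] by auto
    then show ?thesis
    proof (induction N)
      case 0
      then show ?case using P.one_imp_carrier P.I_notcarr by simp
    next
      case (Suc N)
      then show ?case using P.I_prime[of "s k [^] N" "s k"] s(1)[OF k] by auto
    qed
  qed
  then have "c k \<otimes> s k \<in> P" if "k < n" for k using that s by (intro P.I_l_closed) auto
  then have "(\<Oplus>k\<in>A. c k \<otimes> s k) \<in> P" if "A \<subseteq> {..<n}" for A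
  proof -
    have "finite A" using that finite_subset by blast
    then show ?thesis using that
    proof (induction A rule: finite_induct)
      case (insert x F)
      then have "c x \<otimes> s x \<in> P" "(\<Oplus>k\<in>F. c k \<otimes> s k) \<in> P"
        using \<open>\<And>k. k < n \<Longrightarrow> c k \<otimes> s k \<in> P\<close> by auto
      then show ?case using insert s by (subst finsum_insert) (auto intro!: P.a_closed)
    qed (simp add: P.zero_closed)
  qed
  from this[of "{..<n}"] have "\<one> \<in> P" using 1 by simp
  then show False using P.one_imp_carrier P.I_notcarr by simp
qed

section \<open>Automorphisms of matrix algebras\<close>

lemma alg_isoD:
  "h \<in> alg_iso R A B \<Longrightarrow> h \<in> alg_hom R A B" "h \<in> alg_iso R A B \<Longrightarrow> bij_betw h (carrier A) (carrier B)"
  by (auto simp: alg_iso_def)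

lemma is_algebraD:
  "is_algebra R A \<Longrightarrow> ring A" "is_algebra R A \<Longrightarrow> module R A"
  by (auto simp: is_algebra_def)

lemma alg_iso_compose:
  assumes "f \<in> alg_iso R A B" "g \<in> alg_iso R B C" "is_algebra R A"
  shows "compose (carrier A) g f \<in> alg_iso R A C"
proof (rule alg_isoI)
  show "compose (carrier A) g f \<in> alg_hom R A C"
    using assms by (intro alg_hom_compose[of f R A B]) (auto simp: alg_iso_def is_algebra_def)
  show "bij_betw (compose (carrier A) g f) (carrier A) (carrier C)"
    using assms by (intro bij_betw_compose[of _ _ "carrier B"]) (auto simp: alg_iso_def)
qed

definition iso_inv :: "('a, 'm) ring_scheme \<Rightarrow> ('b, 'n) ring_scheme \<Rightarrow> ('a \<Rightarrow> 'b) \<Rightarrow> 'b \<Rightarrow> 'a" where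
  "iso_inv A B h = restrict (inv_into (carrier A) h) (carrier B)"

lemma iso_inv_cancel:
  assumes "h \<in> alg_iso R A B"
  shows "x \<in> carrier A \<Longrightarrow> iso_inv A B h (h x) = x"
    and "y \<in> carrier B \<Longrightarrow> h (iso_inv A B h y) = y"
    and "y \<in> carrier B \<Longrightarrow> iso_inv A B h y \<in> carrier A"
  using alg_isoD(2)[OF assms] alg_homD(1)[OF alg_isoD(1)[OF assms]]
  by (auto simp: iso_inv_def bij_betw_def f_inv_into_f inv_into_into)

lemma iso_inv_iso:
  assumes h: "h \<in> alg_iso R A B" and A: "is_algebra R A"
  shows "iso_inv A B h \<in> alg_iso R B A"
proof (rule alg_isoI)
  interpret A: ring A using A by (simp add: is_algebra_def)
  interpret Am: module R A using A by (simp add: is_algebra_def)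
  note hh = alg_homD[OF alg_isoD(1)[OF h]] and c = iso_inv_cancel[OF h]
  have eqI: "iso_inv A B h y = x" if "x \<in> carrier A" "y = h x" for x y
    using that c(1) by simp
  show "iso_inv A B h \<in> alg_hom R B A"
  proof (rule alg_homI)
    show "iso_inv A B h \<one>\<^bsub>B\<^esub> = \<one>\<^bsub>A\<^esub>" by (rule eqI) (auto simp: hh)
    show "iso_inv A B h \<in> extensional (carrier B)" by (simp add: iso_inv_def)
  qed (auto intro!: eqI simp: c hh)
  show "bij_betw (iso_inv A B h) (carrier B) (carrier A)"
    using bij_betw_inv_into[OF alg_isoD(2)[OF h]] by (simp add: iso_inv_def)
qed

lemma iso_inv_compose:
  assumes "h \<in> alg_iso R A B"
  shows "compose (carrier A) (iso_inv A B h) h = (\<lambda>x\<in>carrier A. x)"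
    and "compose (carrier B) h (iso_inv A B h) = (\<lambda>x\<in>carrier B. x)"
  using iso_inv_cancel[OF assms] by (auto simp: compose_def fun_eq_iff)

lemma alg_hom_eqI:
  assumes "g \<in> alg_hom R A B" "h \<in> alg_hom R A B'" "\<And>x. x \<in> carrier A \<Longrightarrow> g x = h x"
  shows "g = h"
  using assms by (intro extensionalityI[of _ "carrier A"]) (auto simp: alg_hom_def)

context cring
begin

abbreviation Mat :: "nat \<Rightarrow> ('a, 'a matrix) module" where "Mat n \<equiv> mat_alg n R"

lemma mat_hom_unique:
  assumes g: "g \<in> alg_hom R (Mat n) B" and h: "h \<in> alg_hom R (Mat n) B" and B: "ring B"
    and eq: "\<And>i j. i < n \<Longrightarrow> j < n \<Longrightarrow> g (mat_unit n R i j) = h (mat_unit n R i j)"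
  shows "g = h"
proof (rule alg_hom_eqI[OF g h])
  interpret M: ring "Mat n" by (rule ring_mat_alg)
  fix M assume M: "M \<in> carrier (Mat n)"
  have cl: "M i j \<odot>\<^bsub>Mat n\<^esub> mat_unit n R i j \<in> carrier (Mat n)" if "i < n" "j < n" for i j
    using M that by (intro mat_smult_closed) auto
  have k: "k M = (\<Oplus>\<^bsub>B\<^esub>i\<in>{..<n}. \<Oplus>\<^bsub>B\<^esub>j\<in>{..<n}. M i j \<odot>\<^bsub>B\<^esub> k (mat_unit n R i j))"
    if k: "k \<in> alg_hom R (Mat n) B" for k
  proof -
    interpret B: ring B by (rule B)
    have kc: "k (M i j \<odot>\<^bsub>Mat n\<^esub> mat_unit n R i j) = M i j \<odot>\<^bsub>B\<^esub> k (mat_unit n R i j)" if "i < n" "j < n" for i j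
      using M that by (intro alg_homD(5)[OF k]) auto
    have kcl: "M i j \<odot>\<^bsub>B\<^esub> k (mat_unit n R i j) \<in> carrier B" if "i < n" "j < n" for i j
      unfolding kc[OF that, symmetric] using cl that by (intro alg_homD(1)[OF k])
    have row: "(\<Oplus>\<^bsub>Mat n\<^esub>j\<in>{..<n}. M i j \<odot>\<^bsub>Mat n\<^esub> mat_unit n R i j) \<in> carrier (Mat n)" if "i < n" for i
      using cl that by (intro M.finsum_closed) auto
    have "k M = (\<Oplus>\<^bsub>B\<^esub>i\<in>{..<n}. k (\<Oplus>\<^bsub>Mat n\<^esub>j\<in>{..<n}. M i j \<odot>\<^bsub>Mat n\<^esub> mat_unit n R i j))"
      using row by (subst mat_expand[OF M], intro alg_hom_finsum[OF k M.ring_axioms B]) auto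
    also have "\<dots> = (\<Oplus>\<^bsub>B\<^esub>i\<in>{..<n}. \<Oplus>\<^bsub>B\<^esub>j\<in>{..<n}. k (M i j \<odot>\<^bsub>Mat n\<^esub> mat_unit n R i j))"
      using cl kcl kc
      by (intro B.finsum_cong' alg_hom_finsum[OF k M.ring_axioms B] refl) (auto intro!: B.finsum_closed)
    also have "\<dots> = (\<Oplus>\<^bsub>B\<^esub>i\<in>{..<n}. \<Oplus>\<^bsub>B\<^esub>j\<in>{..<n}. M i j \<odot>\<^bsub>B\<^esub> k (mat_unit n R i j))"
      using kc kcl by (intro B.finsum_cong' refl) (auto intro!: B.finsum_closed)
    finally show ?thesis .
  qed
  have "(\<Oplus>\<^bsub>B\<^esub>i\<in>{..<n}. \<Oplus>\<^bsub>B\<^esub>j\<in>{..<n}. M i j \<odot>\<^bsub>B\<^esub> g (mat_unit n R i j))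
      = (\<Oplus>\<^bsub>B\<^esub>i\<in>{..<n}. \<Oplus>\<^bsub>B\<^esub>j\<in>{..<n}. M i j \<odot>\<^bsub>B\<^esub> h (mat_unit n R i j))"
  proof -
    interpret B: ring B by (rule B)
    have "M i j \<odot>\<^bsub>B\<^esub> h (mat_unit n R i j) \<in> carrier B" if "i < n" "j < n" for i j
      using alg_homD(5)[OF h, of "M i j" "mat_unit n R i j"] alg_homD(1)[OF h cl[OF that]] M that by simp
    then show ?thesis by (intro B.finsum_cong' refl) (auto simp: eq intro!: B.finsum_closed)
  qed
  then show "g M = h M" unfolding k[OF g] k[OF h] .
qed

text \<open>The hypotheses say that the \<open>G i j\<close> form a system of matrix units in
  \<open>B\<close>. Such systems are the same as homomorphisms from the matrix algebra, because
  products of linear combinations of matrix units are governed by these relations. It is the tool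
  for constructing base changes of automorphisms.\<close>

lemma mat_lin_ext:
  assumes B: "is_algebra R B" and G: "\<And>i j. i < n \<Longrightarrow> j < n \<Longrightarrow> G i j \<in> carrier B"
    and mult: "\<And>i j k l. i < n \<Longrightarrow> j < n \<Longrightarrow> k < n \<Longrightarrow> l < n \<Longrightarrow>
      G i j \<otimes>\<^bsub>B\<^esub> G k l = (if j = k then G i l else \<zero>\<^bsub>B\<^esub>)"
    and one: "(\<Oplus>\<^bsub>B\<^esub>i\<in>{..<n}. G i i) = \<one>\<^bsub>B\<^esub>"
  defines "L \<equiv> \<lambda>M\<in>carrier (Mat n). \<Oplus>\<^bsub>B\<^esub>i\<in>{..<n}. \<Oplus>\<^bsub>B\<^esub>j\<in>{..<n}. M i j \<odot>\<^bsub>B\<^esub> G i j"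
  shows "L \<in> alg_hom R (Mat n) B"
proof -
  interpret B: ring B using B by (simp add: is_algebra_def)
  interpret Bm: module R B using B by (simp add: is_algebra_def)
  interpret M: ring "Mat n" by (rule ring_mat_alg)
  have sm: "(r \<odot>\<^bsub>B\<^esub> x) \<otimes>\<^bsub>B\<^esub> (s \<odot>\<^bsub>B\<^esub> y) = (r \<otimes> s) \<odot>\<^bsub>B\<^esub> (x \<otimes>\<^bsub>B\<^esub> y)"
    if "r \<in> carrier R" "s \<in> carrier R" "x \<in> carrier B" "y \<in> carrier B" for r s x y
    using B that Bm.smult_assoc1[of s r "x \<otimes>\<^bsub>B\<^esub> y"] by (simp add: is_algebra_def m_comm)
  have sfl: "(\<Oplus>i\<in>I. r i) \<odot>\<^bsub>B\<^esub> c = (\<Oplus>\<^bsub>B\<^esub>i\<in>I. r i \<odot>\<^bsub>B\<^esub> c)"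
    if "finite I" "\<And>i. i \<in> I \<Longrightarrow> r i \<in> carrier R" "c \<in> carrier B" for I :: "nat set" and r c
    using that by (induction I rule: finite_induct)
      (simp_all add: finsum_insert B.finsum_insert Bm.smult_l_distr Pi_def finsum_closed)
  have sfr: "c \<odot>\<^bsub>B\<^esub> (\<Oplus>\<^bsub>B\<^esub>i\<in>I. x i) = (\<Oplus>\<^bsub>B\<^esub>i\<in>I. c \<odot>\<^bsub>B\<^esub> x i)"
    if "finite I" "\<And>i. i \<in> I \<Longrightarrow> x i \<in> carrier B" "c \<in> carrier R" for I :: "nat set" and x c
    using that by (induction I rule: finite_induct)
      (simp_all add: B.finsum_insert Bm.smult_r_distr Pi_def B.finsum_closed)
  have cl: "M i j \<odot>\<^bsub>B\<^esub> G i j \<in> carrier B" if "M \<in> carrier (Mat n)" "i < n" "j < n" for M i j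
    using that G by auto
  have rcl: "(\<Oplus>\<^bsub>B\<^esub>j\<in>{..<n}. M i j \<odot>\<^bsub>B\<^esub> G i j) \<in> carrier B" if "M \<in> carrier (Mat n)" "i < n" for M i
    using that cl by (intro B.finsum_closed) auto
  have L_apply: "L M = (\<Oplus>\<^bsub>B\<^esub>i\<in>{..<n}. \<Oplus>\<^bsub>B\<^esub>j\<in>{..<n}. M i j \<odot>\<^bsub>B\<^esub> G i j)"
    if "M \<in> carrier (Mat n)" for M
    using that by (simp add: L_def)
  have Lc: "L M \<in> carrier B" if "M \<in> carrier (Mat n)" for M
    using that rcl by (auto simp: L_def intro!: B.finsum_closed)
  show ?thesis
  proof (rule alg_homI)
    show "L \<in> extensional (carrier (Mat n))" by (simp add: L_def)
    show "L M \<in> carrier B" if "M \<in> carrier (Mat n)" for M using that by (rule Lc)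
    show "L \<one>\<^bsub>Mat n\<^esub> = \<one>\<^bsub>B\<^esub>"
    proof -
      have "L \<one>\<^bsub>Mat n\<^esub> = (\<Oplus>\<^bsub>B\<^esub>i\<in>{..<n}. \<Oplus>\<^bsub>B\<^esub>j\<in>{..<n}. if i = j then G i j else \<zero>\<^bsub>B\<^esub>)"
        unfolding L_def using G mat_one_closed[of n]
        by (simp only: restrict_apply if_True)
          (intro B.finsum_cong', auto intro!: B.finsum_cong' B.finsum_closed simp: mat_one_entry)
      also have "\<dots> = (\<Oplus>\<^bsub>B\<^esub>i\<in>{..<n}. G i i)"
      proof (intro B.finsum_cong' refl)
        fix i assume "i \<in> {..<n}"
        then show "(\<Oplus>\<^bsub>B\<^esub>j\<in>{..<n}. if i = j then G i j else \<zero>\<^bsub>B\<^esub>) = G i i"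
          using G by (subst B.finsum_delta') auto
      qed (use G in auto)
      finally show ?thesis using one by simp
    qed
    fix M N assume M: "M \<in> carrier (Mat n)" and N: "N \<in> carrier (Mat n)"
    show "L (M \<oplus>\<^bsub>Mat n\<^esub> N) = L M \<oplus>\<^bsub>B\<^esub> L N"
    proof -
      have "L (M \<oplus>\<^bsub>Mat n\<^esub> N) = (\<Oplus>\<^bsub>B\<^esub>i\<in>{..<n}. \<Oplus>\<^bsub>B\<^esub>j\<in>{..<n}. (M i j \<odot>\<^bsub>B\<^esub> G i j) \<oplus>\<^bsub>B\<^esub> (N i j \<odot>\<^bsub>B\<^esub> G i j))"
        unfolding L_def using G M N mat_add_closed[OF M N]
        by (simp only: restrict_apply if_True)
          (intro B.finsum_cong', auto intro!: B.finsum_cong' B.finsum_closed simp: mat_add_entry Bm.smult_l_distr)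
      also have "\<dots> = (\<Oplus>\<^bsub>B\<^esub>i\<in>{..<n}. (\<Oplus>\<^bsub>B\<^esub>j\<in>{..<n}. M i j \<odot>\<^bsub>B\<^esub> G i j) \<oplus>\<^bsub>B\<^esub> (\<Oplus>\<^bsub>B\<^esub>j\<in>{..<n}. N i j \<odot>\<^bsub>B\<^esub> G i j))"
        using cl[OF M] cl[OF N] rcl[OF M] rcl[OF N]
        by (intro B.finsum_cong' B.finsum_addf refl) auto
      also have "\<dots> = L M \<oplus>\<^bsub>B\<^esub> L N"
        unfolding L_def using M N rcl by (simp only: restrict_apply if_True) (intro B.finsum_addf, auto)
      finally show ?thesis .
    qed
    show "L (M \<otimes>\<^bsub>Mat n\<^esub> N) = L M \<otimes>\<^bsub>B\<^esub> L N"
    proof -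
      have r1: "(\<Oplus>\<^bsub>B\<^esub>j\<in>{..<n}. M i j \<odot>\<^bsub>B\<^esub> G i j) \<otimes>\<^bsub>B\<^esub> (\<Oplus>\<^bsub>B\<^esub>l\<in>{..<n}. N k l \<odot>\<^bsub>B\<^esub> G k l)
          = (\<Oplus>\<^bsub>B\<^esub>l\<in>{..<n}. (M i k \<otimes> N k l) \<odot>\<^bsub>B\<^esub> G i l)" if ik: "i < n" "k < n" for i k
      proof -
        have "(\<Oplus>\<^bsub>B\<^esub>j\<in>{..<n}. M i j \<odot>\<^bsub>B\<^esub> G i j) \<otimes>\<^bsub>B\<^esub> (\<Oplus>\<^bsub>B\<^esub>l\<in>{..<n}. N k l \<odot>\<^bsub>B\<^esub> G k l)
          = (\<Oplus>\<^bsub>B\<^esub>l\<in>{..<n}. (\<Oplus>\<^bsub>B\<^esub>j\<in>{..<n}. M i j \<odot>\<^bsub>B\<^esub> G i j) \<otimes>\<^bsub>B\<^esub> (N k l \<odot>\<^bsub>B\<^esub> G k l))"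
          using cl[OF N ik(2)] rcl[OF M ik(1)] by (intro B.finsum_rdistr) auto
        also have "\<dots> = (\<Oplus>\<^bsub>B\<^esub>l\<in>{..<n}. \<Oplus>\<^bsub>B\<^esub>j\<in>{..<n}. (M i j \<odot>\<^bsub>B\<^esub> G i j) \<otimes>\<^bsub>B\<^esub> (N k l \<odot>\<^bsub>B\<^esub> G k l))"
          using cl[OF M ik(1)] cl[OF N ik(2)]
          by (intro B.finsum_cong' B.finsum_ldistr refl) (auto intro!: B.finsum_closed)
        also have "\<dots> = (\<Oplus>\<^bsub>B\<^esub>l\<in>{..<n}. \<Oplus>\<^bsub>B\<^esub>j\<in>{..<n}. if j = k then (M i j \<otimes> N k l) \<odot>\<^bsub>B\<^esub> G i l else \<zero>\<^bsub>B\<^esub>)"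
          using M N ik G
          by (intro B.finsum_cong' refl) (auto intro!: B.finsum_closed B.finsum_cong' simp: sm mult)
        also have "\<dots> = (\<Oplus>\<^bsub>B\<^esub>l\<in>{..<n}. (M i k \<otimes> N k l) \<odot>\<^bsub>B\<^esub> G i l)"
        proof (intro B.finsum_cong' refl)
          fix l assume "l \<in> {..<n}"
          then show "(\<Oplus>\<^bsub>B\<^esub>j\<in>{..<n}. if j = k then (M i j \<otimes> N k l) \<odot>\<^bsub>B\<^esub> G i l else \<zero>\<^bsub>B\<^esub>)
              = (M i k \<otimes> N k l) \<odot>\<^bsub>B\<^esub> G i l"
            using M N ik G by (subst B.finsum_delta) auto
        qed (use M N ik G in auto)
        finally show ?thesis .
      qed
      have "L M \<otimes>\<^bsub>B\<^esub> L N = (\<Oplus>\<^bsub>B\<^esub>i\<in>{..<n}. (\<Oplus>\<^bsub>B\<^esub>j\<in>{..<n}. M i j \<odot>\<^bsub>B\<^esub> G i j) \<otimes>\<^bsub>B\<^esub> L N)"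
        unfolding L_apply[OF M] using rcl[OF M] Lc[OF N] by (intro B.finsum_ldistr) auto
      also have "\<dots> = (\<Oplus>\<^bsub>B\<^esub>i\<in>{..<n}. \<Oplus>\<^bsub>B\<^esub>k\<in>{..<n}. \<Oplus>\<^bsub>B\<^esub>l\<in>{..<n}. (M i k \<otimes> N k l) \<odot>\<^bsub>B\<^esub> G i l)"
      proof (intro B.finsum_cong' refl)
        fix i assume i: "i \<in> {..<n}"
        have "(\<Oplus>\<^bsub>B\<^esub>j\<in>{..<n}. M i j \<odot>\<^bsub>B\<^esub> G i j) \<otimes>\<^bsub>B\<^esub> L N
          = (\<Oplus>\<^bsub>B\<^esub>k\<in>{..<n}. (\<Oplus>\<^bsub>B\<^esub>j\<in>{..<n}. M i j \<odot>\<^bsub>B\<^esub> G i j) \<otimes>\<^bsub>B\<^esub> (\<Oplus>\<^bsub>B\<^esub>l\<in>{..<n}. N k l \<odot>\<^bsub>B\<^esub> G k l))"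
          unfolding L_apply[OF N] using rcl[OF M] rcl[OF N] i by (intro B.finsum_rdistr) auto
        also have "\<dots> = (\<Oplus>\<^bsub>B\<^esub>k\<in>{..<n}. \<Oplus>\<^bsub>B\<^esub>l\<in>{..<n}. (M i k \<otimes> N k l) \<odot>\<^bsub>B\<^esub> G i l)"
          using i M N G by (intro B.finsum_cong' r1 refl) (auto intro!: B.finsum_closed)
        finally show "(\<Oplus>\<^bsub>B\<^esub>j\<in>{..<n}. M i j \<odot>\<^bsub>B\<^esub> G i j) \<otimes>\<^bsub>B\<^esub> L N = \<dots>" .
      qed (use M N G in \<open>auto intro!: B.finsum_closed\<close>)
      also have "\<dots> = (\<Oplus>\<^bsub>B\<^esub>i\<in>{..<n}. \<Oplus>\<^bsub>B\<^esub>l\<in>{..<n}. \<Oplus>\<^bsub>B\<^esub>k\<in>{..<n}. (M i k \<otimes> N k l) \<odot>\<^bsub>B\<^esub> G i l)"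
        using M N G by (intro B.finsum_cong' B.finsum_swap refl) (auto intro!: B.finsum_closed)
      also have "\<dots> = (\<Oplus>\<^bsub>B\<^esub>i\<in>{..<n}. \<Oplus>\<^bsub>B\<^esub>l\<in>{..<n}. (\<Oplus>k\<in>{..<n}. M i k \<otimes> N k l) \<odot>\<^bsub>B\<^esub> G i l)"
        using M N G by (intro B.finsum_cong' sfl[symmetric] refl) (auto intro!: B.finsum_closed finsum_closed)
      also have "\<dots> = (\<Oplus>\<^bsub>B\<^esub>i\<in>{..<n}. \<Oplus>\<^bsub>B\<^esub>l\<in>{..<n}. (M \<otimes>\<^bsub>Mat n\<^esub> N) i l \<odot>\<^bsub>B\<^esub> G i l)"
        using cl[OF mat_mult_closed[OF M N]]
        by (intro B.finsum_cong' refl) (auto intro!: B.finsum_closed simp: mat_mult_entry)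
      also have "\<dots> = L (M \<otimes>\<^bsub>Mat n\<^esub> N)"
        unfolding L_def restrict_apply using mat_mult_closed[OF M N] by (simp only: if_True)
      finally show ?thesis by (rule sym)
    qed
    fix r assume r: "r \<in> carrier R"
    have "r \<odot>\<^bsub>B\<^esub> L M = (\<Oplus>\<^bsub>B\<^esub>i\<in>{..<n}. r \<odot>\<^bsub>B\<^esub> (\<Oplus>\<^bsub>B\<^esub>j\<in>{..<n}. M i j \<odot>\<^bsub>B\<^esub> G i j))"
      unfolding L_def restrict_apply using M r rcl[OF M] by (simp only: if_True) (intro sfr, auto)
    also have "\<dots> = (\<Oplus>\<^bsub>B\<^esub>i\<in>{..<n}. \<Oplus>\<^bsub>B\<^esub>j\<in>{..<n}. r \<odot>\<^bsub>B\<^esub> (M i j \<odot>\<^bsub>B\<^esub> G i j))"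
      using r M cl[OF M] by (intro B.finsum_cong' sfr refl) (auto intro!: B.finsum_closed)
    also have "\<dots> = (\<Oplus>\<^bsub>B\<^esub>i\<in>{..<n}. \<Oplus>\<^bsub>B\<^esub>j\<in>{..<n}. (r \<odot>\<^bsub>Mat n\<^esub> M) i j \<odot>\<^bsub>B\<^esub> G i j)"
      using r M G by (intro B.finsum_cong' refl)
        (auto intro!: B.finsum_closed B.finsum_cong' simp: mat_smult_entry Bm.smult_assoc1)
    also have "\<dots> = L (r \<odot>\<^bsub>Mat n\<^esub> M)"
      unfolding L_def restrict_apply using mat_smult_closed[OF r M] by (simp only: if_True)
    finally show "L (r \<odot>\<^bsub>Mat n\<^esub> M) = r \<odot>\<^bsub>B\<^esub> L M" by (rule sym)
  qed
qed

end

section \<open>The presheaf \<open>PGL\<^sub>n\<close>\<close>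

lemma PGL_simps [simp]:
  "carrier (sect (PGL n) T) = alg_iso T (mat_alg n T) (mat_alg n T)"
  "g \<otimes>\<^bsub>sect (PGL n) T\<^esub> h = compose (carrier (mat_alg n T)) g h"
  "\<one>\<^bsub>sect (PGL n) T\<^esub> = (\<lambda>M\<in>carrier (mat_alg n T). M)"
  "gres (PGL n) = PGL_res n"
  by (simp_all add: PGL_def)

lemma group_PGL:
  fixes T :: "'r alg"
  assumes "cring T"
  shows "group (sect (PGL n) T)"
proof (rule groupI)
  interpret cring T by fact
  fix g h k assume c: "g \<in> carrier (sect (PGL n) T)" "h \<in> carrier (sect (PGL n) T)" "k \<in> carrier (sect (PGL n) T)"
  then show "g \<otimes>\<^bsub>sect (PGL n) T\<^esub> h \<in> carrier (sect (PGL n) T)"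
    using alg_iso_compose mat_is_algebra by fastforce
  have "k \<in> carrier (mat_alg n T) \<rightarrow> carrier (mat_alg n T)"
    using c(3) alg_homD(1)[OF alg_isoD(1)] by fastforce
  then show "g \<otimes>\<^bsub>sect (PGL n) T\<^esub> h \<otimes>\<^bsub>sect (PGL n) T\<^esub> k = g \<otimes>\<^bsub>sect (PGL n) T\<^esub> (h \<otimes>\<^bsub>sect (PGL n) T\<^esub> k)"
    by (auto simp: compose_def fun_eq_iff)
next
  interpret cring T by fact
  interpret M: ring "mat_alg n T" by (rule ring_mat_alg)
  show "\<one>\<^bsub>sect (PGL n) T\<^esub> \<in> carrier (sect (PGL n) T)"
    by (auto intro!: alg_isoI alg_homI simp: mat_closed bij_betw_def inj_on_def)
  fix g assume g: "g \<in> carrier (sect (PGL n) T)"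
  then have "g \<in> extensional (carrier (mat_alg n T))" "g \<in> carrier (mat_alg n T) \<rightarrow> carrier (mat_alg n T)"
    using alg_homD(1,6)[OF alg_isoD(1)] by fastforce+
  then show "\<one>\<^bsub>sect (PGL n) T\<^esub> \<otimes>\<^bsub>sect (PGL n) T\<^esub> g = g"
    by (auto simp: Id_compose)
  show "\<exists>h\<in>carrier (sect (PGL n) T). h \<otimes>\<^bsub>sect (PGL n) T\<^esub> g = \<one>\<^bsub>sect (PGL n) T\<^esub>"
    using g iso_inv_iso[OF _ mat_is_algebra] iso_inv_compose(1)
    by (intro bexI[of _ "iso_inv (mat_alg n T) (mat_alg n T) g"]) auto
qed

section \<open>Base change of matrices and of their automorphisms\<close>

locale base_hom =
  fixes R :: "('r, 'm) ring_scheme" and T T' :: "'r alg" and f :: "'r \<Rightarrow> 'r" and n :: nat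
  assumes T: "algebra R T" and T': "algebra R T'" and f: "f \<in> alg_hom R T T'"
begin

sublocale T: cring T by (rule algebraD(2)[OF T])
sublocale T': cring T' by (rule algebraD(2)[OF T'])
sublocale M: ring "mat_alg n T" by (rule T.ring_mat_alg)
sublocale M': ring "mat_alg n T'" by (rule T'.ring_mat_alg)

lemmas f_simps [simp] = alg_homD(1-4)[OF f]
lemma f_zero [simp]: "f \<zero>\<^bsub>T\<^esub> = \<zero>\<^bsub>T'\<^esub>"
  by (rule alg_hom_zero[OF f T.ring_axioms T'.ring_axioms])
lemmas f_finsum = alg_hom_finsum[OF f T.ring_axioms T'.ring_axioms]

lemma mm_closed [simp]: "M \<in> carrier (mat_alg n T) \<Longrightarrow> mat_map n f M \<in> carrier (mat_alg n T')"
  by (rule mat_map_closed) auto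

lemma mm_mult:
  assumes "M \<in> carrier (mat_alg n T)" "N \<in> carrier (mat_alg n T)"
  shows "mat_map n f (M \<otimes>\<^bsub>mat_alg n T\<^esub> N) = mat_map n f M \<otimes>\<^bsub>mat_alg n T'\<^esub> mat_map n f N"
proof (rule mat_eqI[of _ n T' _ T'])
  fix i j assume ij: "i < n" "j < n"
  have "f (\<Oplus>\<^bsub>T\<^esub>l\<in>{..<n}. M i l \<otimes>\<^bsub>T\<^esub> N l j) = (\<Oplus>\<^bsub>T'\<^esub>l\<in>{..<n}. f (M i l \<otimes>\<^bsub>T\<^esub> N l j))"
    using assms ij by (intro f_finsum) auto
  also have "\<dots> = (\<Oplus>\<^bsub>T'\<^esub>l\<in>{..<n}. mat_map n f M i l \<otimes>\<^bsub>T'\<^esub> mat_map n f N l j)"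
    using assms ij by (intro T'.finsum_cong') (auto simp: mat_map_entry)
  finally show "mat_map n f (M \<otimes>\<^bsub>mat_alg n T\<^esub> N) i j = (mat_map n f M \<otimes>\<^bsub>mat_alg n T'\<^esub> mat_map n f N) i j"
    using ij by (simp add: mat_map_entry mat_mult_entry)
qed (use assms in auto)

lemma mm_add:
  assumes "M \<in> carrier (mat_alg n T)" "N \<in> carrier (mat_alg n T)"
  shows "mat_map n f (M \<oplus>\<^bsub>mat_alg n T\<^esub> N) = mat_map n f M \<oplus>\<^bsub>mat_alg n T'\<^esub> mat_map n f N"
  using assms by (intro mat_eqI[of _ n T' _ T']) (auto simp: mat_map_entry mat_add_entry)

lemma mm_smult:
  assumes "t \<in> carrier T" "M \<in> carrier (mat_alg n T)"
  shows "mat_map n f (t \<odot>\<^bsub>mat_alg n T\<^esub> M) = f t \<odot>\<^bsub>mat_alg n T'\<^esub> mat_map n f M"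
  using assms by (intro mat_eqI[of _ n T' _ T']) (auto simp: mat_map_entry mat_smult_entry T.mat_closed T'.mat_closed)

lemma mm_one: "mat_map n f \<one>\<^bsub>mat_alg n T\<^esub> = \<one>\<^bsub>mat_alg n T'\<^esub>"
  by (intro mat_eqI[of _ n T' _ T']) (auto simp: mat_map_entry mat_one_entry)

lemma mm_zero: "mat_map n f \<zero>\<^bsub>mat_alg n T\<^esub> = \<zero>\<^bsub>mat_alg n T'\<^esub>"
  by (intro mat_eqI[of _ n T' _ T']) (auto simp: mat_map_entry mat_zero_entry)

lemma mm_unit: "mat_map n f (mat_unit n T i j) = mat_unit n T' i j"
  by (intro mat_eqI[of _ n T' _ T']) (auto simp: mat_map_entry)

lemma mm_finsum:
  assumes "finite I" "\<And>x. x \<in> I \<Longrightarrow> F x \<in> carrier (mat_alg n T)"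
  shows "mat_map n f (\<Oplus>\<^bsub>mat_alg n T\<^esub>x\<in>I. F x) = (\<Oplus>\<^bsub>mat_alg n T'\<^esub>x\<in>I. mat_map n f (F x))"
  using assms
  by (induction I rule: finite_induct)
    (simp_all add: mm_zero mm_add M.finsum_insert M'.finsum_insert Pi_def M.finsum_closed)

text \<open>The matrix units over \<open>T'\<close> are images of those over \<open>T\<close>, and
  over \<open>T'\<close> they span. So a \<open>T'\<close>-linear homomorphism is determined on the
  matrices that come from \<open>T\<close>.\<close>

lemma semilinear_unique:
  assumes g: "g \<in> alg_hom T' (mat_alg n T') B" and h: "h \<in> alg_hom T' (mat_alg n T') B" and B: "ring B"
    and "\<And>M. M \<in> carrier (mat_alg n T) \<Longrightarrow> g (mat_map n f M) = h (mat_map n f M)"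
  shows "g = h"
  by (rule T'.mat_hom_unique[OF g h B]) (metis T.mat_unit_closed assms(4) mm_unit)

text \<open>The images under \<open>f\<close> of the matrices \<open>g(E_ij)\<close> form a system
  of matrix units over \<open>T'\<close>, which defines the base change; expanding a matrix over
  \<open>T\<close> in matrix units shows the compatibility with \<open>g\<close>.\<close>

lemma res_hom_exists:
  assumes g: "g \<in> alg_hom T (mat_alg n T) (mat_alg n T)"
  shows "\<exists>g'\<in>alg_hom T' (mat_alg n T') (mat_alg n T').
    \<forall>M\<in>carrier (mat_alg n T). g' (mat_map n f M) = mat_map n f (g M)"
proof -
  note gh = alg_homD[OF g]
  let ?G = "\<lambda>i j. mat_map n f (g (mat_unit n T i j))"
  let ?B = "mat_alg n T'"
  let ?L = "\<lambda>M\<in>carrier (mat_alg n T'). \<Oplus>\<^bsub>?B\<^esub>i\<in>{..<n}. \<Oplus>\<^bsub>?B\<^esub>j\<in>{..<n}. M i j \<odot>\<^bsub>?B\<^esub> ?G i j"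
  have Gc: "?G i j \<in> carrier ?B" for i j by (simp add: gh)
  have g0: "g \<zero>\<^bsub>mat_alg n T\<^esub> = \<zero>\<^bsub>mat_alg n T\<^esub>" by (rule alg_hom_zero[OF g M.ring_axioms M.ring_axioms])
  have L: "?L \<in> alg_hom T' ?B ?B"
  proof (rule T'.mat_lin_ext[OF T'.mat_is_algebra Gc])
    fix i j k l assume "i < n" "j < n" "k < n" "l < n"
    then show "?G i j \<otimes>\<^bsub>?B\<^esub> ?G k l = (if j = k then ?G i l else \<zero>\<^bsub>?B\<^esub>)"
      by (simp add: gh g0 mm_zero T.mat_unit_mult flip: mm_mult gh(3))
  next
    have "(\<Oplus>\<^bsub>?B\<^esub>i\<in>{..<n}. ?G i i) = mat_map n f (\<Oplus>\<^bsub>mat_alg n T\<^esub>i\<in>{..<n}. g (mat_unit n T i i))"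
      by (rule mm_finsum[symmetric]) (auto simp: gh)
    also have "(\<Oplus>\<^bsub>mat_alg n T\<^esub>i\<in>{..<n}. g (mat_unit n T i i)) = g (\<Oplus>\<^bsub>mat_alg n T\<^esub>i\<in>{..<n}. mat_unit n T i i)"
      by (rule alg_hom_finsum[OF g M.ring_axioms M.ring_axioms, symmetric]) auto
    finally show "(\<Oplus>\<^bsub>?B\<^esub>i\<in>{..<n}. ?G i i) = \<one>\<^bsub>?B\<^esub>" by (simp add: T.mat_unit_sum_one gh mm_one)
  qed
  have "?L (mat_map n f M) = mat_map n f (g M)" if M: "M \<in> carrier (mat_alg n T)" for M
  proof -
    have c: "M i j \<odot>\<^bsub>mat_alg n T\<^esub> mat_unit n T i j \<in> carrier (mat_alg n T)" if "i < n" "j < n" for i j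
      using M that by (intro T.mat_smult_closed) auto
    have c2: "M i j \<odot>\<^bsub>mat_alg n T\<^esub> g (mat_unit n T i j) \<in> carrier (mat_alg n T)" if "i < n" "j < n" for i j
      using M that by (intro T.mat_smult_closed) (auto simp: gh)
    have c3: "mat_map n f M i j \<odot>\<^bsub>?B\<^esub> ?G i j \<in> carrier ?B" if "i < n" "j < n" for i j
      using mat_entry_closed[OF mm_closed[OF M] that] by (intro T'.mat_smult_closed) (auto simp: gh)
    have "g M = (\<Oplus>\<^bsub>mat_alg n T\<^esub>i\<in>{..<n}. g (\<Oplus>\<^bsub>mat_alg n T\<^esub>j\<in>{..<n}. M i j \<odot>\<^bsub>mat_alg n T\<^esub> mat_unit n T i j))"
      using c by (subst T.mat_expand[OF M], intro alg_hom_finsum[OF g M.ring_axioms M.ring_axioms])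
        (auto intro!: M.finsum_closed)
    also have "\<dots> = (\<Oplus>\<^bsub>mat_alg n T\<^esub>i\<in>{..<n}. \<Oplus>\<^bsub>mat_alg n T\<^esub>j\<in>{..<n}. g (M i j \<odot>\<^bsub>mat_alg n T\<^esub> mat_unit n T i j))"
      using c by (intro M.finsum_cong' alg_hom_finsum[OF g M.ring_axioms M.ring_axioms] refl)
        (auto intro!: M.finsum_closed gh(1))
    also have "\<dots> = (\<Oplus>\<^bsub>mat_alg n T\<^esub>i\<in>{..<n}. \<Oplus>\<^bsub>mat_alg n T\<^esub>j\<in>{..<n}. M i j \<odot>\<^bsub>mat_alg n T\<^esub> g (mat_unit n T i j))"
      using c2 M by (intro M.finsum_cong' refl) (auto intro!: M.finsum_closed M.finsum_cong' gh(5))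
    finally have "mat_map n f (g M) = mat_map n f \<dots>" by (rule arg_cong)
    also have "\<dots> = (\<Oplus>\<^bsub>?B\<^esub>i\<in>{..<n}. mat_map n f (\<Oplus>\<^bsub>mat_alg n T\<^esub>j\<in>{..<n}. M i j \<odot>\<^bsub>mat_alg n T\<^esub> g (mat_unit n T i j)))"
      using c2 by (intro mm_finsum) (auto intro!: M.finsum_closed)
    also have "\<dots> = (\<Oplus>\<^bsub>?B\<^esub>i\<in>{..<n}. \<Oplus>\<^bsub>?B\<^esub>j\<in>{..<n}. mat_map n f (M i j \<odot>\<^bsub>mat_alg n T\<^esub> g (mat_unit n T i j)))"
      using c2 by (intro M'.finsum_cong' mm_finsum refl) (auto intro!: M'.finsum_closed)
    also have "\<dots> = (\<Oplus>\<^bsub>?B\<^esub>i\<in>{..<n}. \<Oplus>\<^bsub>?B\<^esub>j\<in>{..<n}. mat_map n f M i j \<odot>\<^bsub>?B\<^esub> ?G i j)"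
      using c3 M by (intro M'.finsum_cong' refl)
        (auto intro!: M'.finsum_closed M'.finsum_cong' simp: mm_smult gh mat_map_entry)
    also have "\<dots> = ?L (mat_map n f M)" unfolding restrict_apply using M by (simp only: mm_closed if_True)
    finally show ?thesis by (rule sym)
  qed
  with L show ?thesis by (intro bexI[of _ ?L]) blast+
qed

text \<open>This justifies the \<open>THE\<close> in \<open>PGL_res\<close>. Bijectivity is obtained
  by also base changing the inverse of \<open>g\<close>: both composites fix all matrices that come
  from \<open>T\<close>, so they are the identity by uniqueness.\<close>

lemma res_iso_ex1:
  assumes g: "g \<in> alg_iso T (mat_alg n T) (mat_alg n T)"
  shows "\<exists>!g'. g' \<in> alg_iso T' (mat_alg n T') (mat_alg n T') \<and>
     (\<forall>M\<in>carrier (mat_alg n T). g' (mat_map n f M) = mat_map n f (g M))"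
proof -
  let ?M = "mat_alg n T" and ?M' = "mat_alg n T'"
  let ?k = "iso_inv ?M ?M g"
  have k: "?k \<in> alg_iso T ?M ?M" by (rule iso_inv_iso[OF g T.mat_is_algebra])
  note c = iso_inv_cancel[OF g]
  obtain g' where g': "g' \<in> alg_hom T' ?M' ?M'" "\<And>M. M \<in> carrier ?M \<Longrightarrow> g' (mat_map n f M) = mat_map n f (g M)"
    using res_hom_exists[OF alg_isoD(1)[OF g]] by blast
  obtain k' where k': "k' \<in> alg_hom T' ?M' ?M'" "\<And>M. M \<in> carrier ?M \<Longrightarrow> k' (mat_map n f M) = mat_map n f (?k M)"
    using res_hom_exists[OF alg_isoD(1)[OF k]] by blast
  have id: "(\<lambda>M\<in>carrier ?M'. M) \<in> alg_hom T' ?M' ?M'"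
    using group.is_monoid[OF group_PGL[OF T'.is_cring], of n] monoid.one_closed alg_isoD(1) by fastforce
  have mm': "ring ?M'" "module T' ?M'" using T'.mat_is_algebra by (auto simp: is_algebra_def)
  have 1: "compose (carrier ?M') k' g' = (\<lambda>M\<in>carrier ?M'. M)"
    by (rule semilinear_unique[OF alg_hom_compose[OF g'(1) k'(1) mm'] id mm'(1)])
      (use g' k' c alg_homD(1)[OF alg_isoD(1)[OF g]] in \<open>simp add: compose_eq\<close>)
  have 2: "compose (carrier ?M') g' k' = (\<lambda>M\<in>carrier ?M'. M)"
    by (rule semilinear_unique[OF alg_hom_compose[OF k'(1) g'(1) mm'] id mm'(1)])
      (use g' k' c alg_homD(1)[OF alg_isoD(1)[OF k]] in \<open>simp add: compose_eq\<close>)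
  have "bij_betw g' (carrier ?M') (carrier ?M')"
  proof (rule bij_betw_byWitness[where f' = k'])
    show "\<forall>M\<in>carrier ?M'. k' (g' M) = M"
    proof
      fix M assume "M \<in> carrier ?M'"
      then show "k' (g' M) = M" using fun_cong[OF 1, of M] by (simp add: compose_eq)
    qed
    show "\<forall>M\<in>carrier ?M'. g' (k' M) = M"
    proof
      fix M assume "M \<in> carrier ?M'"
      then show "g' (k' M) = M" using fun_cong[OF 2, of M] by (simp add: compose_eq)
    qed
  qed (use alg_homD(1)[OF g'(1)] alg_homD(1)[OF k'(1)] in auto)
  then have "g' \<in> alg_iso T' ?M' ?M'" using g' by (simp add: alg_isoI)
  moreover have "h = g'" if "h \<in> alg_iso T' ?M' ?M'" "\<forall>M\<in>carrier ?M. h (mat_map n f M) = mat_map n f (g M)" for h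
    using that g' by (intro semilinear_unique[OF _ _ mm'(1)]) (auto simp: alg_iso_def)
  ultimately show ?thesis using g'(2) by blast
qed

lemma PGL_res:
  assumes "g \<in> alg_iso T (mat_alg n T) (mat_alg n T)"
  shows "PGL_res n T T' f g \<in> alg_iso T' (mat_alg n T') (mat_alg n T')"
    and "M \<in> carrier (mat_alg n T) \<Longrightarrow> PGL_res n T T' f g (mat_map n f M) = mat_map n f (g M)"
  using theI'[OF res_iso_ex1[OF assms]] by (auto simp: PGL_res_def)

lemma PGL_res_eqI:
  assumes "g \<in> alg_iso T (mat_alg n T) (mat_alg n T)" "g' \<in> alg_iso T' (mat_alg n T') (mat_alg n T')"
    and "\<And>M. M \<in> carrier (mat_alg n T) \<Longrightarrow> g' (mat_map n f M) = mat_map n f (g M)"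
  shows "PGL_res n T T' f g = g'"
  using res_iso_ex1[OF assms(1)] PGL_res[OF assms(1)] assms(2,3) by blast

lemma PGL_res_compose:
  assumes g: "g \<in> alg_iso T (mat_alg n T) (mat_alg n T)" and h: "h \<in> alg_iso T (mat_alg n T) (mat_alg n T)"
  shows "PGL_res n T T' f (compose (carrier (mat_alg n T)) g h)
    = compose (carrier (mat_alg n T')) (PGL_res n T T' f g) (PGL_res n T T' f h)"
  using PGL_res[OF g] PGL_res[OF h] alg_homD(1)[OF alg_isoD(1)[OF h]]
  by (intro PGL_res_eqI alg_iso_compose[OF h g T.mat_is_algebra]
      alg_iso_compose[OF PGL_res(1)[OF h] PGL_res(1)[OF g] T'.mat_is_algebra])
    (auto simp: compose_eq)

lemma PGL_res_id:
  "PGL_res n T T' f (\<lambda>M\<in>carrier (mat_alg n T). M) = (\<lambda>M\<in>carrier (mat_alg n T'). M)"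
  using monoid.one_closed[OF group.is_monoid[OF group_PGL[OF T.is_cring], of n]]
    monoid.one_closed[OF group.is_monoid[OF group_PGL[OF T'.is_cring], of n]]
  by (intro PGL_res_eqI) auto

lemma PGL_res_inv:
  assumes g: "g \<in> alg_iso T (mat_alg n T) (mat_alg n T)"
  shows "PGL_res n T T' f (inv\<^bsub>sect (PGL n) T\<^esub> g) = inv\<^bsub>sect (PGL n) T'\<^esub> (PGL_res n T T' f g)"
proof -
  have k: "inv\<^bsub>sect (PGL n) T\<^esub> g \<in> alg_iso T (mat_alg n T) (mat_alg n T)"
    using group.inv_closed[OF group_PGL[OF T.is_cring], of g n] g by simp
  have "PGL_res n T T' f (inv\<^bsub>sect (PGL n) T\<^esub> g) \<otimes>\<^bsub>sect (PGL n) T'\<^esub> PGL_res n T T' f g = \<one>\<^bsub>sect (PGL n) T'\<^esub>"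
    using PGL_res_compose[OF k g] group.l_inv[OF group_PGL[OF T.is_cring], of g n] g PGL_res_id by simp
  then show ?thesis
    using PGL_res(1)[OF g] PGL_res(1)[OF k]
    by (intro group.inv_equality[OF group_PGL[OF T'.is_cring], symmetric]) simp_all
qed

end

lemma PGL_res_trans:
  assumes "base_hom R T T' f" "base_hom R T' T'' f'"
    and g: "g \<in> alg_iso T (mat_alg n T) (mat_alg n T)"
  shows "PGL_res n T' T'' f' (PGL_res n T T' f g) = PGL_res n T T'' (compose (carrier T) f' f) g"
proof -
  interpret A: base_hom R T T' f n by fact
  interpret B: base_hom R T' T'' f' n by fact
  have "compose (carrier T) f' f \<in> alg_hom R T T''"
    using alg_hom_compose[OF A.f B.f] algebraD[OF A.T] by blast
  then interpret C: base_hom R T T'' "compose (carrier T) f' f" n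
    using A.T B.T' by (simp add: base_hom_def)
  have m: "mat_map n (compose (carrier T) f' f) M = mat_map n f' (mat_map n f M)"
    if "M \<in> carrier (mat_alg n T)" for M
    using that by (intro mat_eqI[of _ n T'' _ T'']) (auto simp: mat_map_entry compose_eq)
  show ?thesis
    using A.PGL_res[OF g] B.PGL_res[OF A.PGL_res(1)[OF g]] alg_homD(1)[OF alg_isoD(1)[OF g]]
    by (intro C.PGL_res_eqI[OF g, symmetric]) (auto simp: m)
qed

section \<open>Inner automorphisms\<close>

lemma GL_simps [simp]:
  "carrier (sect (GL n) T) = Units (mat_alg n T)"
  "x \<otimes>\<^bsub>sect (GL n) T\<^esub> y = x \<otimes>\<^bsub>mat_alg n T\<^esub> y"
  "\<one>\<^bsub>sect (GL n) T\<^esub> = \<one>\<^bsub>mat_alg n T\<^esub>"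
  "gres (GL n) T T' f = mat_map n f"
  by (simp_all add: GL_def units_of_def)

context cring
begin

lemma mat_monoid: "monoid (Mat n)"
  using ring.is_monoid[OF ring_mat_alg] .

lemma mat_inv:
  assumes "c \<in> Units (Mat n)"
  shows "c \<in> carrier (Mat n)" "inv\<^bsub>Mat n\<^esub> c \<in> carrier (Mat n)" "inv\<^bsub>Mat n\<^esub> c \<in> Units (Mat n)"
    "c \<otimes>\<^bsub>Mat n\<^esub> inv\<^bsub>Mat n\<^esub> c = \<one>\<^bsub>Mat n\<^esub>" "inv\<^bsub>Mat n\<^esub> c \<otimes>\<^bsub>Mat n\<^esub> c = \<one>\<^bsub>Mat n\<^esub>"
    "inv\<^bsub>Mat n\<^esub> (inv\<^bsub>Mat n\<^esub> c) = c"
proof -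
  interpret M: monoid "Mat n" by (rule mat_monoid)
  show "c \<in> carrier (Mat n)" "inv\<^bsub>Mat n\<^esub> c \<in> carrier (Mat n)" "inv\<^bsub>Mat n\<^esub> c \<in> Units (Mat n)"
    "c \<otimes>\<^bsub>Mat n\<^esub> inv\<^bsub>Mat n\<^esub> c = \<one>\<^bsub>Mat n\<^esub>" "inv\<^bsub>Mat n\<^esub> c \<otimes>\<^bsub>Mat n\<^esub> c = \<one>\<^bsub>Mat n\<^esub>"
    "inv\<^bsub>Mat n\<^esub> (inv\<^bsub>Mat n\<^esub> c) = c"
    using assms by auto
qed

text \<open>The centre of a matrix algebra consists of scalars. Comparing entries of
  \<open>Z E_ij\<close> and \<open>E_ij Z\<close> makes the off-diagonal entries vanish and the
  diagonal entries equal.\<close>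

lemma mat_unit_commute:
  assumes Z: "Z \<in> carrier (Mat n)"
    and comm: "\<And>i j. i < n \<Longrightarrow> j < n \<Longrightarrow>
      Z \<otimes>\<^bsub>Mat n\<^esub> mat_unit n R i j = mat_unit n R i j \<otimes>\<^bsub>Mat n\<^esub> Z"
  shows "Z = Z 0 0 \<odot>\<^bsub>Mat n\<^esub> \<one>\<^bsub>Mat n\<^esub>"
proof (cases "n = 0")
  case True
  \<comment> \<open>Without rows both sides are the same empty matrix, whatever the value of
    \<open>Z 0 0\<close>.\<close>
  then show ?thesis
    by (intro mat_eqI[of _ n R _ R]) (use Z in \<open>auto simp: mat_carrier_iff mat_smult_eq\<close>)
next
  case False
  have XE: "(Z \<otimes>\<^bsub>Mat n\<^esub> mat_unit n R i j) a b = (if b = j then Z a i else \<zero>)"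
    if "a < n" "b < n" "i < n" "j < n" for i j a b
  proof -
    have "(Z \<otimes>\<^bsub>Mat n\<^esub> mat_unit n R i j) a b = (\<Oplus>l\<in>{..<n}. if l = i then (if b = j then Z a l else \<zero>) else \<zero>)"
      unfolding mat_mult_entry[OF that(1,2)] using Z that by (intro finsum_cong') auto
    then show ?thesis using Z that by (subst (asm) finsum_delta) auto
  qed
  have EX: "(mat_unit n R i j \<otimes>\<^bsub>Mat n\<^esub> Z) a b = (if a = i then Z j b else \<zero>)"
    if "a < n" "b < n" "i < n" "j < n" for i j a b
  proof -
    have "(mat_unit n R i j \<otimes>\<^bsub>Mat n\<^esub> Z) a b = (\<Oplus>l\<in>{..<n}. if l = j then (if a = i then Z l b else \<zero>) else \<zero>)"
      unfolding mat_mult_entry[OF that(1,2)] using Z that by (intro finsum_cong') auto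
    then show ?thesis using Z that by (subst (asm) finsum_delta) auto
  qed
  have e: "(if b = j then Z a i else \<zero>) = (if a = i then Z j b else \<zero>)"
    if "a < n" "b < n" "i < n" "j < n" for i j a b
    using XE[OF that] EX[OF that] comm[OF that(3,4)] by simp
  show ?thesis
  proof (rule mat_eqI[of _ n R _ R])
    fix a b assume ab: "a < n" "b < n"
    show "Z a b = (Z 0 0 \<odot>\<^bsub>Mat n\<^esub> \<one>\<^bsub>Mat n\<^esub>) a b"
      using e[of a 0 b 0] e[of a 0 0 a] e[of a b b b] e[of 0 a 0 a] ab Z False
      by (auto simp: mat_smult_entry mat_one_entry split: if_splits)
  qed (use Z False in \<open>auto intro!: mat_closed\<close>)
qed

end

lemma inner_aut_apply:
  "M \<in> carrier (mat_alg n T) \<Longrightarrow>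
    inner_aut n T c M = c \<otimes>\<^bsub>mat_alg n T\<^esub> M \<otimes>\<^bsub>mat_alg n T\<^esub> inv\<^bsub>mat_alg n T\<^esub> c"
  by (simp add: inner_aut_def)

section \<open>Conjugation by invertible matrices\<close>

context
  fixes T :: "'r alg" and n :: nat
  assumes T: "cring T"
begin

interpretation cring T by (rule T)
interpretation M: ring "mat_alg n T" by (rule ring_mat_alg)

lemma inv_mult_units:
  assumes "c \<in> Units (mat_alg n T)" "d \<in> Units (mat_alg n T)"
  shows "inv\<^bsub>mat_alg n T\<^esub> (c \<otimes>\<^bsub>mat_alg n T\<^esub> d) = inv\<^bsub>mat_alg n T\<^esub> d \<otimes>\<^bsub>mat_alg n T\<^esub> inv\<^bsub>mat_alg n T\<^esub> c"
  using assms group.inv_mult_group[OF M.units_group, of c d] M.Units_m_closed[OF assms]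
  by (simp add: M.units_of_inv units_of_carrier units_of_mult)

lemma inner_aut_mult:
  assumes c: "c \<in> Units (mat_alg n T)" "d \<in> Units (mat_alg n T)"
  shows "inner_aut n T (c \<otimes>\<^bsub>mat_alg n T\<^esub> d) = compose (carrier (mat_alg n T)) (inner_aut n T c) (inner_aut n T d)"
proof
  fix M
  show "inner_aut n T (c \<otimes>\<^bsub>mat_alg n T\<^esub> d) M
      = compose (carrier (mat_alg n T)) (inner_aut n T c) (inner_aut n T d) M"
    using mat_inv[OF c(1)] mat_inv[OF c(2)] inv_mult_units[OF c]
    by (cases "M \<in> carrier (mat_alg n T)")
      (simp_all add: inner_aut_def compose_def M.m_assoc)
qed

lemma inner_aut_scalar:
  assumes t: "t \<in> Units T"
  shows "t \<odot>\<^bsub>mat_alg n T\<^esub> \<one>\<^bsub>mat_alg n T\<^esub> \<in> Units (mat_alg n T)"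
    and "inner_aut n T (t \<odot>\<^bsub>mat_alg n T\<^esub> \<one>\<^bsub>mat_alg n T\<^esub>) = (\<lambda>M\<in>carrier (mat_alg n T). M)"
    and "inv\<^bsub>mat_alg n T\<^esub> (t \<odot>\<^bsub>mat_alg n T\<^esub> \<one>\<^bsub>mat_alg n T\<^esub>) = inv\<^bsub>T\<^esub> t \<odot>\<^bsub>mat_alg n T\<^esub> \<one>\<^bsub>mat_alg n T\<^esub>"
proof -
  note alg = mat_is_algebra[of n, unfolded is_algebra_def]
  interpret Mm: module T "mat_alg n T" using alg by blast
  let ?c = "t \<odot>\<^bsub>mat_alg n T\<^esub> \<one>\<^bsub>mat_alg n T\<^esub>" and ?d = "inv\<^bsub>T\<^esub> t \<odot>\<^bsub>mat_alg n T\<^esub> \<one>\<^bsub>mat_alg n T\<^esub>"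
  have tc: "t \<in> carrier T" "inv\<^bsub>T\<^esub> t \<in> carrier T" "t \<otimes>\<^bsub>T\<^esub> inv\<^bsub>T\<^esub> t = \<one>\<^bsub>T\<^esub>" using t by auto
  have sm: "(r \<odot>\<^bsub>mat_alg n T\<^esub> \<one>\<^bsub>mat_alg n T\<^esub>) \<otimes>\<^bsub>mat_alg n T\<^esub> M = r \<odot>\<^bsub>mat_alg n T\<^esub> M"
    "M \<otimes>\<^bsub>mat_alg n T\<^esub> (r \<odot>\<^bsub>mat_alg n T\<^esub> \<one>\<^bsub>mat_alg n T\<^esub>) = r \<odot>\<^bsub>mat_alg n T\<^esub> M"
    if "r \<in> carrier T" "M \<in> carrier (mat_alg n T)" for r M
    using alg that by auto
  have cd: "?c \<otimes>\<^bsub>mat_alg n T\<^esub> ?d = \<one>\<^bsub>mat_alg n T\<^esub>" "?d \<otimes>\<^bsub>mat_alg n T\<^esub> ?c = \<one>\<^bsub>mat_alg n T\<^esub>"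
    using tc by (simp_all add: sm flip: Mm.smult_assoc1) (simp add: m_comm)
  have cdc: "?c \<in> carrier (mat_alg n T)" "?d \<in> carrier (mat_alg n T)" using tc by auto
  show u: "?c \<in> Units (mat_alg n T)" unfolding Units_def using cd cdc by blast
  show i: "inv\<^bsub>mat_alg n T\<^esub> ?c = ?d" by (rule M.inv_char[OF cdc cd])
  show "inner_aut n T ?c = (\<lambda>M\<in>carrier (mat_alg n T). M)"
    unfolding inner_aut_def i using tc sm cdc
    by (intro restrict_ext) (simp flip: Mm.smult_assoc1 add: m_comm)
qed

lemma inner_aut_iso:
  assumes c: "c \<in> Units (mat_alg n T)"
  shows "inner_aut n T c \<in> alg_iso T (mat_alg n T) (mat_alg n T)"
    and "inner_aut n T (inv\<^bsub>mat_alg n T\<^esub> c) = inv\<^bsub>sect (PGL n) T\<^esub> (inner_aut n T c)"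
proof -
  note ci = mat_inv[OF c]
  note alg = mat_is_algebra[of n, unfolded is_algebra_def]
  interpret Mm: module T "mat_alg n T" using alg by blast
  have hom: "inner_aut n T d \<in> alg_hom T (mat_alg n T) (mat_alg n T)" if d: "d \<in> Units (mat_alg n T)" for d
  proof (rule alg_homI)
    note di = mat_inv[OF d]
    show "inner_aut n T d \<in> extensional (carrier (mat_alg n T))" by (simp add: inner_aut_def)
    show "inner_aut n T d \<one>\<^bsub>mat_alg n T\<^esub> = \<one>\<^bsub>mat_alg n T\<^esub>" using di by (simp add: inner_aut_apply)
    fix M N assume M: "M \<in> carrier (mat_alg n T)" and N: "N \<in> carrier (mat_alg n T)"
    show "inner_aut n T d M \<in> carrier (mat_alg n T)" using di M by (simp add: inner_aut_apply)
    show "inner_aut n T d (M \<oplus>\<^bsub>mat_alg n T\<^esub> N) = inner_aut n T d M \<oplus>\<^bsub>mat_alg n T\<^esub> inner_aut n T d N"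
      using di M N by (simp add: inner_aut_apply M.l_distr M.r_distr)
    have "inv\<^bsub>mat_alg n T\<^esub> d \<otimes>\<^bsub>mat_alg n T\<^esub> (d \<otimes>\<^bsub>mat_alg n T\<^esub> (N \<otimes>\<^bsub>mat_alg n T\<^esub> inv\<^bsub>mat_alg n T\<^esub> d))
        = N \<otimes>\<^bsub>mat_alg n T\<^esub> inv\<^bsub>mat_alg n T\<^esub> d"
      using di N M.m_assoc[of "inv\<^bsub>mat_alg n T\<^esub> d" d "N \<otimes>\<^bsub>mat_alg n T\<^esub> inv\<^bsub>mat_alg n T\<^esub> d"] by simp
    then show "inner_aut n T d (M \<otimes>\<^bsub>mat_alg n T\<^esub> N) = inner_aut n T d M \<otimes>\<^bsub>mat_alg n T\<^esub> inner_aut n T d N"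
      using di M N by (simp add: inner_aut_apply M.m_assoc)
    fix r assume r: "r \<in> carrier T"
    show "inner_aut n T d (r \<odot>\<^bsub>mat_alg n T\<^esub> M) = r \<odot>\<^bsub>mat_alg n T\<^esub> inner_aut n T d M"
      using di M r alg by (simp add: inner_aut_apply)
  qed
  have one: "inner_aut n T \<one>\<^bsub>mat_alg n T\<^esub> = (\<lambda>M\<in>carrier (mat_alg n T). M)"
    by (auto simp: inner_aut_def intro!: restrict_ext)
  have 1: "compose (carrier (mat_alg n T)) (inner_aut n T (inv\<^bsub>mat_alg n T\<^esub> c)) (inner_aut n T c) = (\<lambda>M\<in>carrier (mat_alg n T). M)"
    using inner_aut_mult[OF ci(3) c] ci one by simp
  have 2: "compose (carrier (mat_alg n T)) (inner_aut n T c) (inner_aut n T (inv\<^bsub>mat_alg n T\<^esub> c)) = (\<lambda>M\<in>carrier (mat_alg n T). M)"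
    using inner_aut_mult[OF c ci(3)] ci one by simp
  have iso: "inner_aut n T d \<in> alg_iso T (mat_alg n T) (mat_alg n T)"
    if d: "d \<in> Units (mat_alg n T)" "d' \<in> Units (mat_alg n T)"
      "compose (carrier (mat_alg n T)) (inner_aut n T d') (inner_aut n T d) = (\<lambda>M\<in>carrier (mat_alg n T). M)"
      "compose (carrier (mat_alg n T)) (inner_aut n T d) (inner_aut n T d') = (\<lambda>M\<in>carrier (mat_alg n T). M)" for d d'
  proof (rule alg_isoI[OF hom[OF d(1)]], rule bij_betw_byWitness[where f' = "inner_aut n T d'"])
    show "\<forall>M\<in>carrier (mat_alg n T). inner_aut n T d' (inner_aut n T d M) = M"
    proof
      fix M assume "M \<in> carrier (mat_alg n T)"
      then show "inner_aut n T d' (inner_aut n T d M) = M"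
        using fun_cong[OF d(3), of M] by (simp add: compose_eq)
    qed
    show "\<forall>M\<in>carrier (mat_alg n T). inner_aut n T d (inner_aut n T d' M) = M"
    proof
      fix M assume "M \<in> carrier (mat_alg n T)"
      then show "inner_aut n T d (inner_aut n T d' M) = M"
        using fun_cong[OF d(4), of M] by (simp add: compose_eq)
    qed
  qed (use alg_homD(1)[OF hom[OF d(1)]] alg_homD(1)[OF hom[OF d(2)]] in auto)
  show iso1: "inner_aut n T c \<in> alg_iso T (mat_alg n T) (mat_alg n T)"
    by (rule iso[OF c ci(3) 1 2])
  have iso2: "inner_aut n T (inv\<^bsub>mat_alg n T\<^esub> c) \<in> alg_iso T (mat_alg n T) (mat_alg n T)"
    by (rule iso[OF ci(3) c 2 1])
  show "inner_aut n T (inv\<^bsub>mat_alg n T\<^esub> c) = inv\<^bsub>sect (PGL n) T\<^esub> (inner_aut n T c)"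
    by (rule group.inv_equality[OF group_PGL[OF T], symmetric]) (use 1 iso1 iso2 in auto)
qed

text \<open>Such a matrix is central, hence scalar, and so is its inverse. The entries of the two at
  position \<open>(0, 0)\<close>, which exists because \<open>n > 0\<close>, are inverse to each
  other, so the scalar is a unit.\<close>

lemma inner_aut_id:
  assumes c: "c \<in> Units (mat_alg n T)" and n: "n > 0"
    and id: "inner_aut n T c = (\<lambda>M\<in>carrier (mat_alg n T). M)"
  shows "\<exists>t\<in>Units T. c = t \<odot>\<^bsub>mat_alg n T\<^esub> \<one>\<^bsub>mat_alg n T\<^esub>"
proof -
  note ci = mat_inv[OF c]
  have cM: "c \<otimes>\<^bsub>mat_alg n T\<^esub> M = M \<otimes>\<^bsub>mat_alg n T\<^esub> c" if M: "M \<in> carrier (mat_alg n T)" for M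
  proof -
    have "c \<otimes>\<^bsub>mat_alg n T\<^esub> M \<otimes>\<^bsub>mat_alg n T\<^esub> inv\<^bsub>mat_alg n T\<^esub> c \<otimes>\<^bsub>mat_alg n T\<^esub> c = M \<otimes>\<^bsub>mat_alg n T\<^esub> c"
      using fun_cong[OF id, of M] M by (simp add: inner_aut_def)
    then show ?thesis using ci M by (simp add: M.m_assoc)
  qed
  have dM: "inv\<^bsub>mat_alg n T\<^esub> c \<otimes>\<^bsub>mat_alg n T\<^esub> M = M \<otimes>\<^bsub>mat_alg n T\<^esub> inv\<^bsub>mat_alg n T\<^esub> c"
    if M: "M \<in> carrier (mat_alg n T)" for M
  proof -
    have "inv\<^bsub>mat_alg n T\<^esub> c \<otimes>\<^bsub>mat_alg n T\<^esub> (c \<otimes>\<^bsub>mat_alg n T\<^esub> M) \<otimes>\<^bsub>mat_alg n T\<^esub> inv\<^bsub>mat_alg n T\<^esub> c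
        = inv\<^bsub>mat_alg n T\<^esub> c \<otimes>\<^bsub>mat_alg n T\<^esub> (M \<otimes>\<^bsub>mat_alg n T\<^esub> c) \<otimes>\<^bsub>mat_alg n T\<^esub> inv\<^bsub>mat_alg n T\<^esub> c"
      using cM[OF M] by simp
    moreover have "inv\<^bsub>mat_alg n T\<^esub> c \<otimes>\<^bsub>mat_alg n T\<^esub> (c \<otimes>\<^bsub>mat_alg n T\<^esub> M) = M"
      using ci M M.m_assoc[of "inv\<^bsub>mat_alg n T\<^esub> c" c M] by simp
    ultimately show ?thesis using ci M by (simp add: M.m_assoc)
  qed
  have c1: "c = c 0 0 \<odot>\<^bsub>mat_alg n T\<^esub> \<one>\<^bsub>mat_alg n T\<^esub>"
    using ci(1) by (rule mat_unit_commute) (rule cM, simp)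
  have d1: "inv\<^bsub>mat_alg n T\<^esub> c = (inv\<^bsub>mat_alg n T\<^esub> c) 0 0 \<odot>\<^bsub>mat_alg n T\<^esub> \<one>\<^bsub>mat_alg n T\<^esub>"
    using ci(2) by (rule mat_unit_commute) (rule dM, simp)
  let ?d = "inv\<^bsub>mat_alg n T\<^esub> c"
  have cc: "c 0 0 \<in> carrier T" "?d 0 0 \<in> carrier T" using ci n by auto
  have off: "?d l 0 = \<zero>\<^bsub>T\<^esub>" if "l < n" "l \<noteq> 0" for l
  proof -
    have "?d l 0 = (?d 0 0 \<odot>\<^bsub>mat_alg n T\<^esub> \<one>\<^bsub>mat_alg n T\<^esub>) l 0"
      by (rule fun_cong[OF fun_cong[OF d1]])
    then show ?thesis using that n cc by (simp add: mat_smult_entry mat_one_entry)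
  qed
  have "(c \<otimes>\<^bsub>mat_alg n T\<^esub> ?d) 0 0 = (\<Oplus>\<^bsub>T\<^esub>l\<in>{..<n}. if l = 0 then c 0 l \<otimes>\<^bsub>T\<^esub> ?d 0 0 else \<zero>\<^bsub>T\<^esub>)"
    unfolding mat_mult_entry[OF n n] using ci n cc off by (intro finsum_cong') auto
  also have "\<dots> = c 0 0 \<otimes>\<^bsub>T\<^esub> ?d 0 0" using ci n cc by (subst finsum_delta) auto
  finally have "c 0 0 \<otimes>\<^bsub>T\<^esub> ?d 0 0 = \<one>\<^bsub>T\<^esub>" using ci n by (simp add: mat_one_entry)
  then have "c 0 0 \<in> Units T" using cc m_comm[OF cc] unfolding Units_def by force
  with c1 show ?thesis by blast
qed

text \<open>
  If a diagonal entry \<open>s = g(E\<^sub>0\<^sub>0)\<^sub>k\<^sub>k\<close> is a unit, then \<open>g\<close> is conjugation by the matrix with columns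
  \<open>g(E\<^sub>j\<^sub>0) e\<^sub>k\<close>, whose inverse has the rows \<open>s\<^sup>-\<^sup>1 e\<^sub>k\<^sup>T g(E\<^sub>0\<^sub>i)\<close>.
\<close>

lemma local_lift:
  assumes g: "g \<in> alg_iso T (mat_alg n T) (mat_alg n T)" and n: "n > 0" and k: "k < n"
    and s: "g (mat_unit n T 0 0) k k \<in> Units T"
  shows "\<exists>c\<in>Units (mat_alg n T). inner_aut n T c = g"
proof -
  let ?M = "mat_alg n T" and ?E = "mat_unit n T"
  define s where "s = g (?E 0 0) k k"
  define si where "si = inv\<^bsub>T\<^esub> s"
  have su: "s \<in> carrier T" "si \<in> carrier T" "si \<otimes>\<^bsub>T\<^esub> s = \<one>\<^bsub>T\<^esub>"
    using s by (auto simp: s_def si_def)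
  note gh = alg_homD[OF alg_isoD(1)[OF g]]
  have g0: "g \<zero>\<^bsub>?M\<^esub> = \<zero>\<^bsub>?M\<^esub>" by (rule alg_hom_zero[OF alg_isoD(1)[OF g] M.ring_axioms M.ring_axioms])
  have gc [simp]: "g M a b \<in> carrier T" if "M \<in> carrier ?M" "a < n" "b < n" for M a b
    using mat_entry_closed[OF gh(1)[OF that(1)] that(2,3)] .
  define c where "c = (\<lambda>i\<in>{..<n}. \<lambda>j\<in>{..<n}. g (?E j 0) i k)"
  define d where "d = (\<lambda>i\<in>{..<n}. \<lambda>j\<in>{..<n}. si \<otimes>\<^bsub>T\<^esub> g (?E 0 i) k j)"
  have cc: "c \<in> carrier ?M" unfolding c_def using k by (intro mat_closedI) auto
  have dc: "d \<in> carrier ?M" unfolding d_def using k su by (intro mat_closedI) auto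
  have ce: "c i j = g (?E j 0) i k" "d i j = si \<otimes>\<^bsub>T\<^esub> g (?E 0 i) k j" if "i < n" "j < n" for i j
    using that by (auto simp: c_def d_def)
  have EE: "g (?E a b) \<otimes>\<^bsub>?M\<^esub> g (?E a' b') = (if b = a' then g (?E a b') else \<zero>\<^bsub>?M\<^esub>)"
    if "a < n" "b < n" "a' < n" "b' < n" for a b a' b'
    using that g0 by (simp add: mat_unit_mult flip: gh(3))
  have dcone: "d \<otimes>\<^bsub>?M\<^esub> c = \<one>\<^bsub>?M\<^esub>"
  proof (rule mat_eqI[of _ n T _ T])
    fix i j assume ij: "i < n" "j < n"
    have "(d \<otimes>\<^bsub>?M\<^esub> c) i j = (\<Oplus>\<^bsub>T\<^esub>l\<in>{..<n}. si \<otimes>\<^bsub>T\<^esub> (g (?E 0 i) k l \<otimes>\<^bsub>T\<^esub> g (?E j 0) l k))"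
      unfolding mat_mult_entry[OF ij] using ij k su by (intro finsum_cong') (auto simp: ce m_assoc)
    also have "\<dots> = si \<otimes>\<^bsub>T\<^esub> (g (?E 0 i) \<otimes>\<^bsub>?M\<^esub> g (?E j 0)) k k"
      unfolding mat_mult_entry[OF k k] using ij k su by (intro finsum_rdistr[symmetric]) auto
    also have "\<dots> = \<one>\<^bsub>?M\<^esub> i j"
      using EE[OF n ij n] ij k su by (auto simp: mat_one_entry mat_zero_entry s_def)
    finally show "(d \<otimes>\<^bsub>?M\<^esub> c) i j = \<one>\<^bsub>?M\<^esub> i j" .
  qed (use cc dc in auto)
  have gM_E: "g (M \<otimes>\<^bsub>?M\<^esub> ?E j 0) a k = (\<Oplus>\<^bsub>T\<^esub>m\<in>{..<n}. M m j \<otimes>\<^bsub>T\<^esub> g (?E m 0) a k)"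
    if M: "M \<in> carrier ?M" and j: "j < n" and a: "a < n" for M j a
  proof -
    have cl: "M m j \<odot>\<^bsub>?M\<^esub> ?E m 0 \<in> carrier ?M" "M m j \<odot>\<^bsub>?M\<^esub> g (?E m 0) \<in> carrier ?M" if "m < n" for m
      using M j that by (auto intro!: mat_smult_closed gh(1))
    have "M \<otimes>\<^bsub>?M\<^esub> ?E j 0 = (\<Oplus>\<^bsub>?M\<^esub>m\<in>{..<n}. M m j \<odot>\<^bsub>?M\<^esub> ?E m 0)"
    proof (rule mat_eqI[of _ n T _ T])
      fix x y assume xy: "x < n" "y < n"
      have "(M \<otimes>\<^bsub>?M\<^esub> ?E j 0) x y = (\<Oplus>\<^bsub>T\<^esub>l\<in>{..<n}. if l = j then (if y = 0 then M x l else \<zero>\<^bsub>T\<^esub>) else \<zero>\<^bsub>T\<^esub>)"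
        unfolding mat_mult_entry[OF xy] using M xy by (intro finsum_cong') auto
      also have "\<dots> = (if y = 0 then M x j else \<zero>\<^bsub>T\<^esub>)" using M xy j by (subst finsum_delta) auto
      also have "\<dots> = (\<Oplus>\<^bsub>T\<^esub>m\<in>{..<n}. if m = x then (if y = 0 then M m j else \<zero>\<^bsub>T\<^esub>) else \<zero>\<^bsub>T\<^esub>)"
        using M xy j by (subst finsum_delta) auto
      also have "\<dots> = (\<Oplus>\<^bsub>T\<^esub>m\<in>{..<n}. (M m j \<odot>\<^bsub>?M\<^esub> ?E m 0) x y)"
        using M xy j by (intro finsum_cong') (auto simp: mat_smult_entry)
      also have "\<dots> = (\<Oplus>\<^bsub>?M\<^esub>m\<in>{..<n}. M m j \<odot>\<^bsub>?M\<^esub> ?E m 0) x y"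
        using cl xy by (intro mat_finsum_entry[symmetric]) auto
      finally show "(M \<otimes>\<^bsub>?M\<^esub> ?E j 0) x y = (\<Oplus>\<^bsub>?M\<^esub>m\<in>{..<n}. M m j \<odot>\<^bsub>?M\<^esub> ?E m 0) x y" .
    qed (use M cl in \<open>auto intro!: M.finsum_closed\<close>)
    then have "g (M \<otimes>\<^bsub>?M\<^esub> ?E j 0) = (\<Oplus>\<^bsub>?M\<^esub>m\<in>{..<n}. g (M m j \<odot>\<^bsub>?M\<^esub> ?E m 0))"
      using cl by (simp only:) (intro alg_hom_finsum[OF alg_isoD(1)[OF g] M.ring_axioms M.ring_axioms], auto)
    also have "\<dots> = (\<Oplus>\<^bsub>?M\<^esub>m\<in>{..<n}. M m j \<odot>\<^bsub>?M\<^esub> g (?E m 0))"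
      using cl M j by (intro M.finsum_cong' refl) (auto intro!: gh(5))
    finally have "g (M \<otimes>\<^bsub>?M\<^esub> ?E j 0) a k = (\<Oplus>\<^bsub>?M\<^esub>m\<in>{..<n}. M m j \<odot>\<^bsub>?M\<^esub> g (?E m 0)) a k" by (simp only:)
    also have "(\<Oplus>\<^bsub>?M\<^esub>m\<in>{..<n}. M m j \<odot>\<^bsub>?M\<^esub> g (?E m 0)) a k = (\<Oplus>\<^bsub>T\<^esub>m\<in>{..<n}. (M m j \<odot>\<^bsub>?M\<^esub> g (?E m 0)) a k)"
      using cl a k by (intro mat_finsum_entry) auto
    finally show ?thesis using a k by (simp only: mat_smult_entry)
  qed
  have gM_E': "g (?E 0 i \<otimes>\<^bsub>?M\<^esub> M) k a = (\<Oplus>\<^bsub>T\<^esub>m\<in>{..<n}. M i m \<otimes>\<^bsub>T\<^esub> g (?E 0 m) k a)"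
    if M: "M \<in> carrier ?M" and i: "i < n" and a: "a < n" for M i a
  proof -
    have cl: "M i m \<odot>\<^bsub>?M\<^esub> ?E 0 m \<in> carrier ?M" "M i m \<odot>\<^bsub>?M\<^esub> g (?E 0 m) \<in> carrier ?M" if "m < n" for m
      using M i that by (auto intro!: mat_smult_closed gh(1))
    have "?E 0 i \<otimes>\<^bsub>?M\<^esub> M = (\<Oplus>\<^bsub>?M\<^esub>m\<in>{..<n}. M i m \<odot>\<^bsub>?M\<^esub> ?E 0 m)"
    proof (rule mat_eqI[of _ n T _ T])
      fix x y assume xy: "x < n" "y < n"
      have "(?E 0 i \<otimes>\<^bsub>?M\<^esub> M) x y = (\<Oplus>\<^bsub>T\<^esub>l\<in>{..<n}. if l = i then (if x = 0 then M l y else \<zero>\<^bsub>T\<^esub>) else \<zero>\<^bsub>T\<^esub>)"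
        unfolding mat_mult_entry[OF xy] using M xy by (intro finsum_cong') auto
      also have "\<dots> = (if x = 0 then M i y else \<zero>\<^bsub>T\<^esub>)" using M xy i by (subst finsum_delta) auto
      also have "\<dots> = (\<Oplus>\<^bsub>T\<^esub>m\<in>{..<n}. if m = y then (if x = 0 then M i m else \<zero>\<^bsub>T\<^esub>) else \<zero>\<^bsub>T\<^esub>)"
        using M xy i by (subst finsum_delta) auto
      also have "\<dots> = (\<Oplus>\<^bsub>T\<^esub>m\<in>{..<n}. (M i m \<odot>\<^bsub>?M\<^esub> ?E 0 m) x y)"
        using M xy i by (intro finsum_cong') (auto simp: mat_smult_entry)
      also have "\<dots> = (\<Oplus>\<^bsub>?M\<^esub>m\<in>{..<n}. M i m \<odot>\<^bsub>?M\<^esub> ?E 0 m) x y"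
        using cl xy by (intro mat_finsum_entry[symmetric]) auto
      finally show "(?E 0 i \<otimes>\<^bsub>?M\<^esub> M) x y = (\<Oplus>\<^bsub>?M\<^esub>m\<in>{..<n}. M i m \<odot>\<^bsub>?M\<^esub> ?E 0 m) x y" .
    qed (use M cl in \<open>auto intro!: M.finsum_closed\<close>)
    then have "g (?E 0 i \<otimes>\<^bsub>?M\<^esub> M) = (\<Oplus>\<^bsub>?M\<^esub>m\<in>{..<n}. g (M i m \<odot>\<^bsub>?M\<^esub> ?E 0 m))"
      using cl by (simp only:) (intro alg_hom_finsum[OF alg_isoD(1)[OF g] M.ring_axioms M.ring_axioms], auto)
    also have "\<dots> = (\<Oplus>\<^bsub>?M\<^esub>m\<in>{..<n}. M i m \<odot>\<^bsub>?M\<^esub> g (?E 0 m))"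
      using cl M i by (intro M.finsum_cong' refl) (auto intro!: gh(5))
    finally have "g (?E 0 i \<otimes>\<^bsub>?M\<^esub> M) k a = (\<Oplus>\<^bsub>?M\<^esub>m\<in>{..<n}. M i m \<odot>\<^bsub>?M\<^esub> g (?E 0 m)) k a" by (simp only:)
    also have "(\<Oplus>\<^bsub>?M\<^esub>m\<in>{..<n}. M i m \<odot>\<^bsub>?M\<^esub> g (?E 0 m)) k a = (\<Oplus>\<^bsub>T\<^esub>m\<in>{..<n}. (M i m \<odot>\<^bsub>?M\<^esub> g (?E 0 m)) k a)"
      using cl a k by (intro mat_finsum_entry) auto
    finally show ?thesis using a k by (simp only: mat_smult_entry)
  qed
  have gc_c: "g M \<otimes>\<^bsub>?M\<^esub> c = c \<otimes>\<^bsub>?M\<^esub> M" if M: "M \<in> carrier ?M" for M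
  proof (rule mat_eqI[of _ n T _ T])
    fix i j assume ij: "i < n" "j < n"
    have "(g M \<otimes>\<^bsub>?M\<^esub> c) i j = (g M \<otimes>\<^bsub>?M\<^esub> g (?E j 0)) i k"
      unfolding mat_mult_entry[OF ij] mat_mult_entry[OF ij(1) k]
      using ij M k by (intro finsum_cong') (auto simp: ce)
    also have "\<dots> = (\<Oplus>\<^bsub>T\<^esub>m\<in>{..<n}. M m j \<otimes>\<^bsub>T\<^esub> g (?E m 0) i k)"
      using gM_E[OF M ij(2,1)] gh(3)[OF M, of "?E j 0"] by simp
    also have "\<dots> = (c \<otimes>\<^bsub>?M\<^esub> M) i j"
      unfolding mat_mult_entry[OF ij] using ij M k by (intro finsum_cong') (auto simp: ce m_comm)
    finally show "(g M \<otimes>\<^bsub>?M\<^esub> c) i j = (c \<otimes>\<^bsub>?M\<^esub> M) i j" .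
  qed (use M cc gh(1) in auto)
  have d_g: "d \<otimes>\<^bsub>?M\<^esub> g M = M \<otimes>\<^bsub>?M\<^esub> d" if M: "M \<in> carrier ?M" for M
  proof (rule mat_eqI[of _ n T _ T])
    fix i j assume ij: "i < n" "j < n"
    have "(d \<otimes>\<^bsub>?M\<^esub> g M) i j = (\<Oplus>\<^bsub>T\<^esub>l\<in>{..<n}. si \<otimes>\<^bsub>T\<^esub> (g (?E 0 i) k l \<otimes>\<^bsub>T\<^esub> g M l j))"
      unfolding mat_mult_entry[OF ij] using ij k su M by (intro finsum_cong') (auto simp: ce m_assoc)
    also have "\<dots> = si \<otimes>\<^bsub>T\<^esub> (g (?E 0 i) \<otimes>\<^bsub>?M\<^esub> g M) k j"
      unfolding mat_mult_entry[OF k ij(2)] using ij k su M by (intro finsum_rdistr[symmetric]) auto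
    also have "\<dots> = si \<otimes>\<^bsub>T\<^esub> (\<Oplus>\<^bsub>T\<^esub>m\<in>{..<n}. M i m \<otimes>\<^bsub>T\<^esub> g (?E 0 m) k j)"
      using gM_E'[OF M ij] gh(3)[of "?E 0 i" M] M by simp
    also have "\<dots> = (\<Oplus>\<^bsub>T\<^esub>m\<in>{..<n}. si \<otimes>\<^bsub>T\<^esub> (M i m \<otimes>\<^bsub>T\<^esub> g (?E 0 m) k j))"
      using ij k su M by (intro finsum_rdistr) auto
    also have "\<dots> = (M \<otimes>\<^bsub>?M\<^esub> d) i j"
      unfolding mat_mult_entry[OF ij] using ij M k su by (intro finsum_cong') (auto simp: ce m_lcomm)
    finally show "(d \<otimes>\<^bsub>?M\<^esub> g M) i j = (M \<otimes>\<^bsub>?M\<^esub> d) i j" .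
  qed (use M dc gh(1) in auto)
  \<comment> \<open>So far \<open>d\<close> is only a left inverse of \<open>c\<close>. The product
    \<open>?X\<close> commutes with the image of \<open>g\<close>, which is everything, so it is a
    scalar; this scalar fixes \<open>c\<close>, and cancelling \<open>c\<close> by its left inverse
    shows that it acts as the identity. This avoids determinants.\<close>
  let ?X = "c \<otimes>\<^bsub>?M\<^esub> d"
  have Xg: "?X \<otimes>\<^bsub>?M\<^esub> g M = g M \<otimes>\<^bsub>?M\<^esub> ?X" if M: "M \<in> carrier ?M" for M
    using d_g[OF M] gc_c[OF M] cc dc gh(1)[OF M] M
    by (metis M.m_assoc)
  have "?X \<otimes>\<^bsub>?M\<^esub> ?E i j = ?E i j \<otimes>\<^bsub>?M\<^esub> ?X" for i j
    using Xg[of "iso_inv ?M ?M g (?E i j)"] iso_inv_cancel[OF g] by simp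
  then have X: "?X = ?X 0 0 \<odot>\<^bsub>?M\<^esub> \<one>\<^bsub>?M\<^esub>"
    using cc dc by (intro mat_unit_commute) auto
  have "?X \<otimes>\<^bsub>?M\<^esub> c = c" using dcone cc dc by (simp add: M.m_assoc)
  note alg = mat_is_algebra[of n, unfolded is_algebra_def]
  define x where "x = ?X 0 0"
  have xc: "x \<in> carrier T" unfolding x_def using M.m_closed[OF cc dc] n by simp
  have "x \<odot>\<^bsub>?M\<^esub> c = c"
    using \<open>?X \<otimes>\<^bsub>?M\<^esub> c = c\<close> X xc cc alg unfolding x_def[symmetric] by auto
  then have "x \<odot>\<^bsub>?M\<^esub> \<one>\<^bsub>?M\<^esub> = \<one>\<^bsub>?M\<^esub>"
    using dcone xc cc dc alg by metis
  then have cdone: "?X = \<one>\<^bsub>?M\<^esub>" using X unfolding x_def[symmetric] by simp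
  have u: "c \<in> Units ?M" unfolding Units_def using cc dc dcone cdone by blast
  have inv: "inv\<^bsub>?M\<^esub> c = d" by (rule M.inv_char[OF cc dc cdone dcone])
  have "inner_aut n T c = g"
  proof (rule alg_hom_eqI[OF alg_isoD(1)[OF inner_aut_iso(1)[OF u]] alg_isoD(1)[OF g]])
    fix M assume M: "M \<in> carrier ?M"
    have "c \<otimes>\<^bsub>?M\<^esub> M \<otimes>\<^bsub>?M\<^esub> d = g M \<otimes>\<^bsub>?M\<^esub> c \<otimes>\<^bsub>?M\<^esub> d" using gc_c[OF M] by simp
    also have "\<dots> = g M" using cdone cc dc gh(1)[OF M] by (simp add: M.m_assoc)
    finally show "inner_aut n T c M = g M" using M by (simp add: inner_aut_apply inv)
  qed
  with u show ?thesis by blast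
qed

lemma trace_comm:
  assumes "M \<in> carrier (mat_alg n T)" "N \<in> carrier (mat_alg n T)"
  shows "(\<Oplus>\<^bsub>T\<^esub>k\<in>{..<n}. (M \<otimes>\<^bsub>mat_alg n T\<^esub> N) k k) = (\<Oplus>\<^bsub>T\<^esub>k\<in>{..<n}. (N \<otimes>\<^bsub>mat_alg n T\<^esub> M) k k)"
proof -
  have "(\<Oplus>\<^bsub>T\<^esub>k\<in>{..<n}. (M \<otimes>\<^bsub>mat_alg n T\<^esub> N) k k) = (\<Oplus>\<^bsub>T\<^esub>k\<in>{..<n}. \<Oplus>\<^bsub>T\<^esub>l\<in>{..<n}. M k l \<otimes>\<^bsub>T\<^esub> N l k)"
    using assms by (intro finsum_cong') (auto simp: mat_mult_entry intro!: finsum_closed)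
  also have "\<dots> = (\<Oplus>\<^bsub>T\<^esub>l\<in>{..<n}. \<Oplus>\<^bsub>T\<^esub>k\<in>{..<n}. M k l \<otimes>\<^bsub>T\<^esub> N l k)"
    using assms by (intro finsum_swap) auto
  also have "\<dots> = (\<Oplus>\<^bsub>T\<^esub>k\<in>{..<n}. (N \<otimes>\<^bsub>mat_alg n T\<^esub> M) k k)"
    using assms by (intro finsum_cong') (auto simp: mat_mult_entry m_comm intro!: finsum_closed finsum_cong')
  finally show ?thesis .
qed

text \<open>All \<open>g(E_ii)\<close> have the same trace, because \<open>E_ii\<close> and
  \<open>E_00\<close> are the two products of \<open>E_i0\<close> and \<open>E_0i\<close>. Their sum
  is the identity matrix, whose trace is \<open>n\<close>, so \<open>n\<close> times the common
  trace equals \<open>n\<close>; cancel \<open>n\<close>.\<close>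

lemma trace_PGL:
  assumes g: "g \<in> alg_iso T (mat_alg n T) (mat_alg n T)" and n: "n > 0"
    and u: "(\<Oplus>\<^bsub>T\<^esub>i\<in>{..<n}. \<one>\<^bsub>T\<^esub>) \<in> Units T"
  shows "(\<Oplus>\<^bsub>T\<^esub>k\<in>{..<n}. g (mat_unit n T 0 0) k k) = \<one>\<^bsub>T\<^esub>"
proof -
  let ?M = "mat_alg n T" and ?E = "mat_unit n T"
  note gh = alg_homD[OF alg_isoD(1)[OF g]]
  let ?t = "\<lambda>N. \<Oplus>\<^bsub>T\<^esub>k\<in>{..<n}. N k k"
  have tc: "?t N \<in> carrier T" if "N \<in> carrier ?M" for N
    using that by (intro finsum_closed) auto
  have t: "?t (g (?E i i)) = ?t (g (?E 0 0))" if i: "i < n" for i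
  proof -
    have "g (?E i i) = g (?E i 0) \<otimes>\<^bsub>?M\<^esub> g (?E 0 i)" "g (?E 0 0) = g (?E 0 i) \<otimes>\<^bsub>?M\<^esub> g (?E i 0)"
      using i n by (simp_all add: mat_unit_mult flip: gh(3))
    then show ?thesis using trace_comm[of "g (?E i 0)" "g (?E 0 i)"] gh(1) by simp
  qed
  have gE: "g (?E i i) k k \<in> carrier T" if "k < n" for i k
    by (rule mat_entry_closed[OF gh(1) that that]) simp
  have tE: "?t (g (?E 0 0)) \<in> carrier T" by (rule tc, rule gh(1)) simp
  have "(\<Oplus>\<^bsub>T\<^esub>i\<in>{..<n}. \<one>\<^bsub>T\<^esub>) \<otimes>\<^bsub>T\<^esub> ?t (g (?E 0 0)) = (\<Oplus>\<^bsub>T\<^esub>i\<in>{..<n}. \<one>\<^bsub>T\<^esub> \<otimes>\<^bsub>T\<^esub> ?t (g (?E 0 0)))"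
    by (rule finsum_ldistr) (simp_all add: tE)
  also have "\<dots> = (\<Oplus>\<^bsub>T\<^esub>i\<in>{..<n}. \<Oplus>\<^bsub>T\<^esub>k\<in>{..<n}. g (?E i i) k k)"
  proof (intro finsum_cong' refl)
    fix i assume "i \<in> {..<n}"
    then show "\<one>\<^bsub>T\<^esub> \<otimes>\<^bsub>T\<^esub> ?t (g (?E 0 0)) = ?t (g (?E i i))" using t[of i] tE by simp
  qed (use tc[OF gh(1)] in auto)
  also have "\<dots> = (\<Oplus>\<^bsub>T\<^esub>k\<in>{..<n}. \<Oplus>\<^bsub>T\<^esub>i\<in>{..<n}. g (?E i i) k k)"
    by (rule finsum_swap) (auto intro!: gE)
  also have "\<dots> = (\<Oplus>\<^bsub>T\<^esub>k\<in>{..<n}. (\<Oplus>\<^bsub>?M\<^esub>i\<in>{..<n}. g (?E i i)) k k)"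
  proof (intro finsum_cong' refl)
    fix k assume "k \<in> {..<n}"
    then show "(\<Oplus>\<^bsub>T\<^esub>i\<in>{..<n}. g (?E i i) k k) = (\<Oplus>\<^bsub>?M\<^esub>i\<in>{..<n}. g (?E i i)) k k"
      by (intro mat_finsum_entry[symmetric]) (auto intro!: gh(1))
  next
    show "(\<lambda>k. (\<Oplus>\<^bsub>?M\<^esub>i\<in>{..<n}. g (?E i i)) k k) \<in> {..<n} \<rightarrow> carrier T"
    proof (rule Pi_I)
      fix k assume "k \<in> {..<n}"
      moreover have "(\<Oplus>\<^bsub>?M\<^esub>i\<in>{..<n}. g (?E i i)) \<in> carrier ?M"
        by (rule M.finsum_closed) (auto intro!: gh(1))
      ultimately show "(\<Oplus>\<^bsub>?M\<^esub>i\<in>{..<n}. g (?E i i)) k k \<in> carrier T" by simp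
    qed
  qed
  also have "(\<Oplus>\<^bsub>?M\<^esub>i\<in>{..<n}. g (?E i i)) = g (\<Oplus>\<^bsub>?M\<^esub>i\<in>{..<n}. ?E i i)"
    by (rule alg_hom_finsum[OF alg_isoD(1)[OF g] M.ring_axioms M.ring_axioms, symmetric]) auto
  also have "\<dots> = \<one>\<^bsub>?M\<^esub>" by (simp add: mat_unit_sum_one gh)
  also have "(\<Oplus>\<^bsub>T\<^esub>k\<in>{..<n}. \<one>\<^bsub>?M\<^esub> k k) = (\<Oplus>\<^bsub>T\<^esub>i\<in>{..<n}. \<one>\<^bsub>T\<^esub>)"
    by (intro finsum_cong') (auto simp: mat_one_entry)
  finally have "(\<Oplus>\<^bsub>T\<^esub>i\<in>{..<n}. \<one>\<^bsub>T\<^esub>) \<otimes>\<^bsub>T\<^esub> ?t (g (?E 0 0)) = (\<Oplus>\<^bsub>T\<^esub>i\<in>{..<n}. \<one>\<^bsub>T\<^esub>) \<otimes>\<^bsub>T\<^esub> \<one>\<^bsub>T\<^esub>"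
    by (simp add: finsum_closed)
  then show ?thesis using Units_l_cancel[OF u tc[OF gh(1)] one_closed] by simp
qed

end

context base_hom
begin

lemma mm_Units:
  assumes c: "c \<in> Units (mat_alg n T)"
  shows "mat_map n f c \<in> Units (mat_alg n T')"
    and "inv\<^bsub>mat_alg n T'\<^esub> (mat_map n f c) = mat_map n f (inv\<^bsub>mat_alg n T\<^esub> c)"
    and "PGL_res n T T' f (inner_aut n T c) = inner_aut n T' (mat_map n f c)"
proof -
  note ci = T.mat_inv[OF c]
  have 1: "mat_map n f c \<otimes>\<^bsub>mat_alg n T'\<^esub> mat_map n f (inv\<^bsub>mat_alg n T\<^esub> c) = \<one>\<^bsub>mat_alg n T'\<^esub>"
    and 2: "mat_map n f (inv\<^bsub>mat_alg n T\<^esub> c) \<otimes>\<^bsub>mat_alg n T'\<^esub> mat_map n f c = \<one>\<^bsub>mat_alg n T'\<^esub>"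
    using ci by (simp_all add: mm_one flip: mm_mult)
  have cl: "mat_map n f c \<in> carrier (mat_alg n T')" "mat_map n f (inv\<^bsub>mat_alg n T\<^esub> c) \<in> carrier (mat_alg n T')"
    using ci by auto
  show u: "mat_map n f c \<in> Units (mat_alg n T')" unfolding Units_def using 1 2 cl by blast
  show i: "inv\<^bsub>mat_alg n T'\<^esub> (mat_map n f c) = mat_map n f (inv\<^bsub>mat_alg n T\<^esub> c)"
    by (rule M'.inv_char[OF cl 1 2])
  show "PGL_res n T T' f (inner_aut n T c) = inner_aut n T' (mat_map n f c)"
    using inner_aut_iso(1)[OF T.is_cring c] inner_aut_iso(1)[OF T'.is_cring u] ci
    by (intro PGL_res_eqI) (auto simp: inner_aut_apply i mm_mult)
qed

end

section \<open>The Segre cone\<close>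

text \<open>Vanishing of the 2 by 2 minors of \<open>z\<close>, read as a \<open>p\<close> by
  \<open>p\<close> matrix with row index the quotient and column index the remainder by
  \<open>p\<close>.\<close>

definition segre_minors :: "nat \<Rightarrow> ('t, 'm) ring_scheme \<Rightarrow> (nat \<Rightarrow> 't) \<Rightarrow> bool" where
  "segre_minors p T z \<longleftrightarrow> (\<forall>a<p. \<forall>a'<p. \<forall>b<p. \<forall>b'<p.
    z (a * p + b) \<otimes>\<^bsub>T\<^esub> z (a' * p + b') = z (a * p + b') \<otimes>\<^bsub>T\<^esub> z (a' * p + b))"

lemma segre_minorsD:
  "segre_minors p T z \<Longrightarrow> a < p \<Longrightarrow> a' < p \<Longrightarrow> b < p \<Longrightarrow> b' < p \<Longrightarrow>
    z (a * p + b) \<otimes>\<^bsub>T\<^esub> z (a' * p + b') = z (a * p + b') \<otimes>\<^bsub>T\<^esub> z (a' * p + b)"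
  by (simp add: segre_minors_def)

lemma segre_index [simp]:
  fixes a b p :: nat
  assumes "a < p" "b < p"
  shows "a * p + b < p * p" "(a * p + b) div p = a" "(a * p + b) mod p = b"
proof -
  have "a * p + b < (a + 1) * p" using assms by simp
  also have "\<dots> \<le> p * p" using assms by (intro mult_right_mono) auto
  finally show "a * p + b < p * p" .
qed (use assms in auto)

lemma segre_index_div [simp]:
  fixes l p :: nat
  assumes "l < p * p"
  shows "l div p < p" "l mod p < p" "(l div p) * p + l mod p = l"
proof -
  have "p > 0" using assms by (cases p) auto
  then show "l div p < p" "l mod p < p" using assms by (auto simp: less_mult_imp_div_less)
qed auto

lemma segre_minors_cong:
  "(\<And>i. i < p * p \<Longrightarrow> z i = z' i) \<Longrightarrow> segre_minors p T z = segre_minors p T z'"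
  by (simp add: segre_minors_def)

lemma segre_minors_eq:
  "segre_minors p T z' \<Longrightarrow> (\<And>i. i < p * p \<Longrightarrow> z i = z' i) \<Longrightarrow> segre_minors p T z"
  using segre_minors_cong by blast

text \<open>The matrix \<open>z e_j^T\<close>. An automorphism of the matrix algebra acts on
  matrices and not on vectors, so the vector \<open>z\<close> is placed in one column.\<close>

definition col_mat :: "nat \<Rightarrow> ('t, 'm) ring_scheme \<Rightarrow> nat \<Rightarrow> (nat \<Rightarrow> 't) \<Rightarrow> 't matrix" where
  "col_mat n T j z = (\<lambda>i\<in>{..<n}. \<lambda>l\<in>{..<n}. if l = j then z i else \<zero>\<^bsub>T\<^esub>)"

lemma col_mat_entry [simp]:
  "i < n \<Longrightarrow> l < n \<Longrightarrow> col_mat n T j z i l = (if l = j then z i else \<zero>\<^bsub>T\<^esub>)"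
  by (simp add: col_mat_def)

context cring
begin

lemma col_mat_closed [simp]: "(\<And>i. i < n \<Longrightarrow> z i \<in> carrier R) \<Longrightarrow> col_mat n R j z \<in> carrier (Mat n)"
  unfolding col_mat_def by (intro mat_closedI) auto

text \<open>Minors are quadratic: scaling a vector by \<open>s k\<close> multiplies both terms of a
  minor by the square of \<open>s k\<close>. Squares of a unimodular family can be cancelled by
  \<open>unimodular_annihilator\<close>, with exponent 2.\<close>

lemma unimodular_cancel:
  fixes s :: "nat \<Rightarrow> 'a"
  assumes s: "\<And>k. k < n \<Longrightarrow> s k \<in> carrier R" "\<And>k. k < n \<Longrightarrow> c k \<in> carrier R"
    and 1: "(\<Oplus>k\<in>{..<n}. c k \<otimes> s k) = \<one>"
    and t: "t \<in> carrier R" "t' \<in> carrier R"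
    and eq: "\<And>k. k < n \<Longrightarrow> s k \<otimes> s k \<otimes> t = s k \<otimes> s k \<otimes> t'"
  shows "t = t'"
proof -
  have "t \<ominus> t' = \<zero>"
  proof (rule unimodular_annihilator[OF s 1])
    fix k assume k: "k < n"
    have "s k [^] (2::nat) \<otimes> (t \<ominus> t') = s k \<otimes> s k \<otimes> t \<ominus> s k \<otimes> s k \<otimes> t'"
      using s k t by (simp add: numeral_2_eq_2 r_distr minus_eq r_minus)
    also have "\<dots> = \<zero>" using eq[OF k] s k t by simp
    finally show "\<exists>N. s k [^] (N::nat) \<otimes> (t \<ominus> t') = \<zero>" by blast
  qed (use t in auto)
  then show ?thesis using t by simp
qed

lemma mult_four:
  assumes "x \<in> carrier R" "y \<in> carrier R" "u \<in> carrier R" "v \<in> carrier R"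
  shows "(x \<otimes> y) \<otimes> (u \<otimes> v) = (x \<otimes> u) \<otimes> (y \<otimes> v)"
  using assms by (simp add: m_assoc m_lcomm[of y u])

text \<open>This trades the existential local condition for equations. In one direction the minors
  of a pure tensor vanish and the local factors are cancelled. In the other \<open>z\<close> itself
  is the unimodular family: by the minor equations \<open>z i\<close> times \<open>z\<close> is a
  pure tensor for every \<open>i\<close>.\<close>

lemma segre_cone_iff:
  "z \<in> segre_cone p R \<longleftrightarrow> unimodular R (p * p) z \<and> segre_minors p R z"
proof
  assume z: "z \<in> segre_cone p R"
  then obtain m s v w where zu: "unimodular R (p * p) z" and su: "unimodular R m s"
    and vw: "\<And>i. i < m \<Longrightarrow> v i \<in> {..<p} \<rightarrow> carrier R" "\<And>i. i < m \<Longrightarrow> w i \<in> {..<p} \<rightarrow> carrier R"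
      "\<And>i l. i < m \<Longrightarrow> l < p * p \<Longrightarrow> s i \<otimes> z l = v i (l div p) \<otimes> w i (l mod p)"
    unfolding segre_cone_def by blast
  have zc: "z l \<in> carrier R" if "l < p * p" for l
    using zu that unfolding unimodular_def by auto
  have sc: "s i \<in> carrier R" if "i < m" for i
    using su that unfolding unimodular_def by auto
  obtain c where c: "\<And>i. i < m \<Longrightarrow> c i \<in> carrier R" "(\<Oplus>i\<in>{..<m}. c i \<otimes> s i) = \<one>"
    using su unfolding unimodular_def by (auto simp: Pi_def)
  have "segre_minors p R z"
    unfolding segre_minors_def
  proof (intro allI impI)
    fix a a' b b' assume ab: "a < p" "a' < p" "b < p" "b' < p"
    show "z (a * p + b) \<otimes> z (a' * p + b') = z (a * p + b') \<otimes> z (a' * p + b)"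
    proof (rule unimodular_cancel[OF sc c])
      fix i assume i: "i < m"
      have vc: "v i x \<in> carrier R" "w i x \<in> carrier R" if "x < p" for x
        using vw(1,2)[OF i] that by auto
      have "s i \<otimes> s i \<otimes> (z (a * p + b) \<otimes> z (a' * p + b'))
          = (v i a \<otimes> w i b) \<otimes> (v i a' \<otimes> w i b')"
        using ab i vw(3)[OF i, of "a * p + b"] vw(3)[OF i, of "a' * p + b'"]
        by (subst mult_four) (auto intro!: sc zc)
      also have "\<dots> = (v i a \<otimes> w i b') \<otimes> (v i a' \<otimes> w i b)"
        using ab vc by (simp add: m_ac)
      also have "\<dots> = s i \<otimes> s i \<otimes> (z (a * p + b') \<otimes> z (a' * p + b))"
        using ab i vw(3)[OF i, of "a * p + b'"] vw(3)[OF i, of "a' * p + b"]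
        by (subst mult_four) (auto intro!: sc zc)
      finally show "s i \<otimes> s i \<otimes> (z (a * p + b) \<otimes> z (a' * p + b'))
        = s i \<otimes> s i \<otimes> (z (a * p + b') \<otimes> z (a' * p + b))" .
    qed (use ab zc in auto)
  qed
  with zu show "unimodular R (p * p) z \<and> segre_minors p R z" by blast
next
  assume z: "unimodular R (p * p) z \<and> segre_minors p R z"
  have zc: "z l \<in> carrier R" if "l < p * p" for l
    using z that unfolding unimodular_def by auto
  have "z i \<otimes> z l = z ((l div p) * p + i mod p) \<otimes> z ((i div p) * p + l mod p)"
    if "i < p * p" "l < p * p" for i l
    using segre_minorsD[OF conjunct2[OF z], of "i div p" "l div p" "i mod p" "l mod p"] that
      m_comm[OF zc zc, of "(i div p) * p + l mod p" "(l div p) * p + i mod p"]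
    by simp
  note quad = this
  \<comment> \<open>In the \<open>p\<close> by \<open>p\<close> matrix formed by \<open>z\<close>,
    these are the column and the row through the position with index \<open>i\<close>.\<close>
  let ?v = "\<lambda>i a. z (a * p + i mod p)" and ?w = "\<lambda>i b. z ((i div p) * p + b)"
  have "\<forall>i<p * p. ?v i \<in> {..<p} \<rightarrow> carrier R \<and> ?w i \<in> {..<p} \<rightarrow> carrier R \<and>
      (\<forall>l<p * p. z i \<otimes> z l = ?v i (l div p) \<otimes> ?w i (l mod p))"
  proof (intro allI impI conjI Pi_I)
    fix i assume i: "i < p * p"
    show "?v i x \<in> carrier R" "?w i x \<in> carrier R" if "x \<in> {..<p}" for x
      using i that by (auto intro!: zc)
    show "z i \<otimes> z l = ?v i (l div p) \<otimes> ?w i (l mod p)" if "l < p * p" for l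
      by (rule quad[OF i that])
  qed
  note vw = this
  show "z \<in> segre_cone p R"
    unfolding segre_cone_def
    by (rule CollectI, rule conjI[OF conjunct1[OF z]], rule exI[of _ "p * p"], rule exI[of _ z],
        rule exI[of _ ?v], rule exI[of _ ?w], rule conjI[OF conjunct1[OF z] vw])
qed

lemma segre_minors_mult:
  assumes "segre_minors p R z" "\<And>i. i < p * p \<Longrightarrow> z i \<in> carrier R" "u \<in> carrier R"
  shows "segre_minors p R (\<lambda>i. z i \<otimes> u)"
  unfolding segre_minors_def
  using assms(2,3) segre_minorsD[OF assms(1)] by (simp add: mult_four[of _ u])

lemma segre_minors_cancel:
  assumes z: "\<And>i. i < p * p \<Longrightarrow> z i \<in> carrier R"
    and u: "\<And>k. k < (n::nat) \<Longrightarrow> u k \<in> carrier R" "\<And>k. k < n \<Longrightarrow> c k \<in> carrier R"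
    and 1: "(\<Oplus>k\<in>{..<n}. c k \<otimes> u k) = \<one>"
    and m: "\<And>k. k < n \<Longrightarrow> segre_minors p R (\<lambda>i. u k \<otimes> z i)"
  shows "segre_minors p R z"
  unfolding segre_minors_def
proof (intro allI impI)
  fix a a' b b' assume ab: "a < p" "a' < p" "b < p" "b' < p"
  show "z (a * p + b) \<otimes> z (a' * p + b') = z (a * p + b') \<otimes> z (a' * p + b)"
  proof (rule unimodular_cancel[OF u 1])
    fix k assume k: "k < n"
    show "u k \<otimes> u k \<otimes> (z (a * p + b) \<otimes> z (a' * p + b')) = u k \<otimes> u k \<otimes> (z (a * p + b') \<otimes> z (a' * p + b))"
      using segre_minorsD[OF m[OF k] ab] ab u k z by (simp add: mult_four[of "u k"])
  qed (use ab z in auto)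
qed

lemma mat_vec_entry: "i < n \<Longrightarrow> mat_vec R n M z i = (\<Oplus>j\<in>{..<n}. M i j \<otimes> z j)"
  by (simp add: mat_vec_def)

lemma mat_vec_closed:
  assumes "M \<in> carrier (Mat n)" "\<And>i. i < n \<Longrightarrow> z i \<in> carrier R"
  shows "mat_vec R n M z \<in> {..<n} \<rightarrow>\<^sub>E carrier R"
    and "i < n \<Longrightarrow> mat_vec R n M z i \<in> carrier R"
  using assms by (auto simp: mat_vec_def intro!: finsum_closed)

lemma mat_vec_one:
  assumes z: "z \<in> {..<n} \<rightarrow>\<^sub>E carrier R"
  shows "mat_vec R n \<one>\<^bsub>Mat n\<^esub> z = z"
proof (rule extensionalityI[of _ "{..<n}"])
  fix i assume "i \<in> {..<n}"
  then have i: "i < n" by simp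
  have zc: "z j \<in> carrier R" if "j < n" for j using PiE_mem[OF z] that by simp
  have "mat_vec R n \<one>\<^bsub>Mat n\<^esub> z i = (\<Oplus>j\<in>{..<n}. if j = i then z j else \<zero>)"
    unfolding mat_vec_entry[OF i] using i zc
    by (intro finsum_cong') (auto simp: mat_one_entry)
  also have "\<dots> = z i" using i zc by (subst finsum_delta) auto
  finally show "mat_vec R n \<one>\<^bsub>Mat n\<^esub> z i = z i" .
qed (use z in \<open>auto simp: mat_vec_def PiE_def\<close>)

lemma mat_vec_mult:
  assumes M: "M \<in> carrier (Mat n)" "N \<in> carrier (Mat n)" and z: "\<And>i. i < n \<Longrightarrow> z i \<in> carrier R"
  shows "mat_vec R n (M \<otimes>\<^bsub>Mat n\<^esub> N) z = mat_vec R n M (mat_vec R n N z)"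
proof
  fix i
  show "mat_vec R n (M \<otimes>\<^bsub>Mat n\<^esub> N) z i = mat_vec R n M (mat_vec R n N z) i"
  proof (cases "i < n")
    case True
    have "mat_vec R n (M \<otimes>\<^bsub>Mat n\<^esub> N) z i = (\<Oplus>j\<in>{..<n}. \<Oplus>l\<in>{..<n}. M i l \<otimes> N l j \<otimes> z j)"
      unfolding mat_vec_entry[OF True] using M z True
      by (intro finsum_cong') (auto simp: mat_mult_entry finsum_ldistr intro!: finsum_closed)
    also have "\<dots> = (\<Oplus>l\<in>{..<n}. \<Oplus>j\<in>{..<n}. M i l \<otimes> N l j \<otimes> z j)"
      using M z True by (intro finsum_swap) auto
    also have "\<dots> = (\<Oplus>l\<in>{..<n}. M i l \<otimes> mat_vec R n N z l)"
      using M z True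
      by (intro finsum_cong')
        (auto simp: mat_vec_entry finsum_rdistr m_assoc intro!: finsum_closed finsum_cong')
    finally show ?thesis using True by (simp add: mat_vec_entry)
  qed (auto simp: mat_vec_def)
qed

text \<open>If \<open>k\<close> is a row of coefficients pairing with \<open>z\<close> to
  \<open>1\<close>, then \<open>k\<close> multiplied by the inverse of \<open>c\<close> pairs with
  \<open>c z\<close> to \<open>1\<close>.\<close>

lemma mat_vec_unimodular:
  assumes z: "unimodular R n z" and c: "c \<in> Units (Mat n)"
  shows "unimodular R n (mat_vec R n c z)"
proof -
  note ci = mat_inv[OF c]
  let ?d = "inv\<^bsub>Mat n\<^esub> c"
  have zc: "z i \<in> carrier R" if "i < n" for i using z that by (auto simp: unimodular_def)
  obtain k where k: "\<And>i. i < n \<Longrightarrow> k i \<in> carrier R" "(\<Oplus>i\<in>{..<n}. k i \<otimes> z i) = \<one>"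
    using z by (auto simp: unimodular_def Pi_def)
  let ?y = "mat_vec R n c z"
  have y: "?y i \<in> carrier R" if "i < n" for i using mat_vec_closed(2)[OF ci(1) zc that] .
  have dy: "mat_vec R n ?d ?y = z"
    using mat_vec_mult[OF ci(2,1), of z, OF zc] mat_vec_one[of z n] z
    by (simp add: ci unimodular_def)
  have "(\<Oplus>l\<in>{..<n}. (\<Oplus>i\<in>{..<n}. k i \<otimes> ?d i l) \<otimes> ?y l) = (\<Oplus>l\<in>{..<n}. \<Oplus>i\<in>{..<n}. k i \<otimes> ?d i l \<otimes> ?y l)"
    using ci k y by (intro finsum_cong' finsum_ldistr refl) (auto intro!: finsum_closed)
  also have "\<dots> = (\<Oplus>i\<in>{..<n}. \<Oplus>l\<in>{..<n}. k i \<otimes> ?d i l \<otimes> ?y l)"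
    using ci k y by (intro finsum_swap) auto
  also have "\<dots> = (\<Oplus>i\<in>{..<n}. k i \<otimes> mat_vec R n ?d ?y i)"
    using ci k y by (intro finsum_cong')
        (auto simp: mat_vec_entry finsum_rdistr m_assoc intro!: finsum_closed finsum_cong')
  finally have "(\<Oplus>l\<in>{..<n}. (\<Oplus>i\<in>{..<n}. k i \<otimes> ?d i l) \<otimes> ?y l) = \<one>" using dy k by simp
  then show ?thesis
    unfolding unimodular_def using mat_vec_closed(1)[OF ci(1) zc] ci k
    by (intro conjI bexI[of _ "\<lambda>l. \<Oplus>i\<in>{..<n}. k i \<otimes> ?d i l"]) (auto intro!: finsum_closed)
qed

lemma col_mat_conj:
  assumes c: "c \<in> carrier (Mat n)" "d \<in> carrier (Mat n)" and z: "\<And>i. i < n \<Longrightarrow> z i \<in> carrier R"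
    and il: "i < n" "l < n" "j < n"
  shows "(c \<otimes>\<^bsub>Mat n\<^esub> col_mat n R j z \<otimes>\<^bsub>Mat n\<^esub> d) i l = mat_vec R n c z i \<otimes> d j l"
proof -
  have cl: "c \<otimes>\<^bsub>Mat n\<^esub> col_mat n R j z \<in> carrier (Mat n)"
    using c z by (intro mat_mult_closed) auto
  have e: "(c \<otimes>\<^bsub>Mat n\<^esub> col_mat n R j z) i m = (if m = j then mat_vec R n c z i else \<zero>)" if m: "m < n" for m
  proof (cases "m = j")
    case True
    then show ?thesis using il m c z
      by (auto simp: mat_mult_entry mat_vec_entry intro!: finsum_cong')
  next
    case False
    then show ?thesis using il m c z
      by (auto simp: mat_mult_entry intro!: finsum_all_zero)
  qed
  have "(c \<otimes>\<^bsub>Mat n\<^esub> col_mat n R j z \<otimes>\<^bsub>Mat n\<^esub> d) i l = (\<Oplus>m\<in>{..<n}. if m = j then mat_vec R n c z i \<otimes> d m l else \<zero>)"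
    unfolding mat_mult_entry[OF il(1,2)] using il c mat_vec_closed(2)[OF c(1) z]
    by (intro finsum_cong') (auto simp: e)
  also have "\<dots> = mat_vec R n c z i \<otimes> d j l"
    using il c mat_vec_closed(2)[OF c(1) z] by (subst finsum_delta) auto
  finally show ?thesis .
qed

text \<open>The last hypothesis says that a quadratic form in \<open>v\<close> vanishes at all \<open>e\<^sub>a + e\<^sub>a\<^sub>'\<close>.\<close>

lemma polarization:
  assumes two: "\<one> \<oplus> \<one> \<in> Units R"
    and y: "\<And>a. a < m \<Longrightarrow> y1 a \<in> carrier R" "\<And>a. a < m \<Longrightarrow> y2 a \<in> carrier R"
      "\<And>a. a < m \<Longrightarrow> y3 a \<in> carrier R" "\<And>a. a < m \<Longrightarrow> y4 a \<in> carrier R"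
    and v: "\<And>a. a < m \<Longrightarrow> v a \<in> carrier R"
    and eq: "\<And>a a'. a < m \<Longrightarrow> a' < m \<Longrightarrow>
      (y1 a \<oplus> y1 a') \<otimes> (y2 a \<oplus> y2 a') = (y3 a \<oplus> y3 a') \<otimes> (y4 a \<oplus> y4 a')"
  shows "(\<Oplus>a\<in>{..<m}. v a \<otimes> y1 a) \<otimes> (\<Oplus>a\<in>{..<m}. v a \<otimes> y2 a)
    = (\<Oplus>a\<in>{..<m}. v a \<otimes> y3 a) \<otimes> (\<Oplus>a\<in>{..<m::nat}. v a \<otimes> y4 a)"
proof -
  let ?t = "\<one> \<oplus> \<one>"
  have t2: "x \<oplus> x = ?t \<otimes> x" if "x \<in> carrier R" for x using that by (simp add: l_distr)
  have tc: "x = y" if "?t \<otimes> x = ?t \<otimes> y" "x \<in> carrier R" "y \<in> carrier R" for x y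
    using Units_l_cancel[OF two that(2,3)] that(1) by simp
  have diag: "y1 a \<otimes> y2 a = y3 a \<otimes> y4 a" if a: "a < m" for a
  \<comment> \<open>For \<open>a = a'\<close> both sides of the hypothesis carry the factor 4, so 2
    is cancelled twice.\<close>
  proof (rule tc, rule tc)
    have "?t \<otimes> (?t \<otimes> (y1 a \<otimes> y2 a)) = (y1 a \<oplus> y1 a) \<otimes> (y2 a \<oplus> y2 a)"
      using y[OF a] by (simp only: t2) (simp add: m_ac)
    also have "\<dots> = (y3 a \<oplus> y3 a) \<otimes> (y4 a \<oplus> y4 a)" by (rule eq[OF a a])
    also have "\<dots> = ?t \<otimes> (?t \<otimes> (y3 a \<otimes> y4 a))"
      using y[OF a] by (simp only: t2) (simp add: m_ac)
    finally show "?t \<otimes> (?t \<otimes> (y1 a \<otimes> y2 a)) = ?t \<otimes> (?t \<otimes> (y3 a \<otimes> y4 a))" .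
  qed (use y[OF a] in auto)
  have expand: "(x \<oplus> x') \<otimes> (z \<oplus> z') = (x \<otimes> z \<oplus> x' \<otimes> z') \<oplus> (x \<otimes> z' \<oplus> x' \<otimes> z)"
    if "x \<in> carrier R" "x' \<in> carrier R" "z \<in> carrier R" "z' \<in> carrier R" for x x' z z'
    using that by (simp add: l_distr r_distr a_ac)
  have off: "y1 a \<otimes> y2 b \<oplus> y1 b \<otimes> y2 a = y3 a \<otimes> y4 b \<oplus> y3 b \<otimes> y4 a" if ab: "a < m" "b < m" for a b
    using eq[OF ab] diag[OF ab(1)] diag[OF ab(2)] y[OF ab(1)] y[OF ab(2)]
    by (simp add: expand)
  \<comment> \<open>The hypotheses control only expressions symmetric in \<open>a\<close> and
    \<open>b\<close>. Doubling the product of the two sums gives a sum of such expressions: the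
    second copy is taken with the roles of \<open>a\<close> and \<open>b\<close> exchanged.\<close>
  have prod: "?t \<otimes> ((\<Oplus>a\<in>{..<m}. v a \<otimes> z a) \<otimes> (\<Oplus>a\<in>{..<m}. v a \<otimes> z' a))
      = (\<Oplus>a\<in>{..<m}. \<Oplus>b\<in>{..<m}. v a \<otimes> v b \<otimes> (z a \<otimes> z' b \<oplus> z b \<otimes> z' a))"
    if z: "\<And>a. a < m \<Longrightarrow> z a \<in> carrier R" "\<And>a. a < m \<Longrightarrow> z' a \<in> carrier R" for z z'
  proof -
    let ?P = "(\<Oplus>a\<in>{..<m}. v a \<otimes> z a) \<otimes> (\<Oplus>a\<in>{..<m}. v a \<otimes> z' a)"
    have P: "?P = (\<Oplus>a\<in>{..<m}. \<Oplus>b\<in>{..<m}. (v a \<otimes> z a) \<otimes> (v b \<otimes> z' b))"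
    proof -
      have "?P = (\<Oplus>a\<in>{..<m}. (v a \<otimes> z a) \<otimes> (\<Oplus>b\<in>{..<m}. v b \<otimes> z' b))"
        using v z by (intro finsum_ldistr) (auto intro!: finsum_closed)
      also have "\<dots> = (\<Oplus>a\<in>{..<m}. \<Oplus>b\<in>{..<m}. (v a \<otimes> z a) \<otimes> (v b \<otimes> z' b))"
        using v z by (intro finsum_cong' finsum_rdistr refl) (auto intro!: finsum_closed)
      finally show ?thesis .
    qed
    have P': "?P = (\<Oplus>a\<in>{..<m}. \<Oplus>b\<in>{..<m}. (v b \<otimes> z b) \<otimes> (v a \<otimes> z' a))"
      unfolding P using v z by (intro finsum_swap) auto
    have Pc: "?P \<in> carrier R" using v z by (auto intro!: finsum_closed)
    have "?t \<otimes> ?P = ?P \<oplus> ?P" using t2[OF Pc] by simp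
    also have "\<dots> = (\<Oplus>a\<in>{..<m}. \<Oplus>b\<in>{..<m}. (v a \<otimes> z a) \<otimes> (v b \<otimes> z' b))
        \<oplus> (\<Oplus>a\<in>{..<m}. \<Oplus>b\<in>{..<m}. (v b \<otimes> z b) \<otimes> (v a \<otimes> z' a))"
      using P P' by simp
    also have "\<dots> = (\<Oplus>a\<in>{..<m}. (\<Oplus>b\<in>{..<m}. (v a \<otimes> z a) \<otimes> (v b \<otimes> z' b))
        \<oplus> (\<Oplus>b\<in>{..<m}. (v b \<otimes> z b) \<otimes> (v a \<otimes> z' a)))"
      using v z by (intro finsum_addf[symmetric]) (auto intro!: finsum_closed)
    also have "\<dots> = (\<Oplus>a\<in>{..<m}. \<Oplus>b\<in>{..<m}. (v a \<otimes> z a) \<otimes> (v b \<otimes> z' b) \<oplus> (v b \<otimes> z b) \<otimes> (v a \<otimes> z' a))"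
      using v z by (intro finsum_cong' finsum_addf[symmetric] refl) (auto intro!: finsum_closed)
    also have "\<dots> = (\<Oplus>a\<in>{..<m}. \<Oplus>b\<in>{..<m}. v a \<otimes> v b \<otimes> (z a \<otimes> z' b \<oplus> z b \<otimes> z' a))"
      using v z
      by (intro finsum_cong' refl) (auto intro!: finsum_closed finsum_cong' simp: r_distr m_ac)
    finally show ?thesis .
  qed
  show ?thesis
  proof (rule tc)
    have "?t \<otimes> ((\<Oplus>a\<in>{..<m}. v a \<otimes> y1 a) \<otimes> (\<Oplus>a\<in>{..<m}. v a \<otimes> y2 a))
        = (\<Oplus>a\<in>{..<m}. \<Oplus>b\<in>{..<m}. v a \<otimes> v b \<otimes> (y1 a \<otimes> y2 b \<oplus> y1 b \<otimes> y2 a))"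
      by (rule prod) (rule y, assumption)+
    also have "\<dots> = (\<Oplus>a\<in>{..<m}. \<Oplus>b\<in>{..<m}. v a \<otimes> v b \<otimes> (y3 a \<otimes> y4 b \<oplus> y3 b \<otimes> y4 a))"
      using v y off by (intro finsum_cong' refl) (auto intro!: finsum_closed finsum_cong')
    also have "\<dots> = ?t \<otimes> ((\<Oplus>a\<in>{..<m}. v a \<otimes> y3 a) \<otimes> (\<Oplus>a\<in>{..<m}. v a \<otimes> y4 a))"
      by (rule prod[symmetric]) (rule y, assumption)+
    finally show "?t \<otimes> ((\<Oplus>a\<in>{..<m}. v a \<otimes> y1 a) \<otimes> (\<Oplus>a\<in>{..<m}. v a \<otimes> y2 a))
      = ?t \<otimes> ((\<Oplus>a\<in>{..<m}. v a \<otimes> y3 a) \<otimes> (\<Oplus>a\<in>{..<m}. v a \<otimes> y4 a))" .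
  qed (use v y in \<open>auto intro!: finsum_closed\<close>)
qed

end

section \<open>The stabilizer of the Segre variety\<close>

text \<open>The vector \<open>e_a + e_a'\<close>. For \<open>a = a'\<close> it is
  \<open>2 e_a\<close>, so the diagonal values of a quadratic form are tested as well, up to a
  factor 4.\<close>

definition unit_pair :: "('t, 'm) ring_scheme \<Rightarrow> nat \<Rightarrow> nat \<Rightarrow> nat \<Rightarrow> 't" where
  "unit_pair T a a' = (\<lambda>i. (if i = a then \<one>\<^bsub>T\<^esub> else \<zero>\<^bsub>T\<^esub>) \<oplus>\<^bsub>T\<^esub> (if i = a' then \<one>\<^bsub>T\<^esub> else \<zero>\<^bsub>T\<^esub>))"

definition pure_tensor ::
  "nat \<Rightarrow> ('t, 'm) ring_scheme \<Rightarrow> (nat \<Rightarrow> 't) \<Rightarrow> (nat \<Rightarrow> 't) \<Rightarrow> nat \<Rightarrow> 't" where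
  "pure_tensor p T v w = (\<lambda>l. v (l div p) \<otimes>\<^bsub>T\<^esub> w (l mod p))"

definition segre_test ::
  "nat \<Rightarrow> ('t, 'm) ring_scheme \<Rightarrow> ('t matrix \<Rightarrow> 't matrix) \<Rightarrow> (nat \<Rightarrow> 't) \<Rightarrow> (nat \<Rightarrow> 't) \<Rightarrow> bool" where
  "segre_test p T g v w \<longleftrightarrow> (\<forall>j<p * p. \<forall>l<p * p.
    segre_minors p T (\<lambda>i. g (col_mat (p * p) T j (pure_tensor p T v w)) i l))"

text \<open>
  If \<open>g\<close> is conjugation by \<open>c\<close>, then the columns of \<open>g\<close> applied to the matrix with the single
  column \<open>z\<close> are multiples of \<open>c z\<close>. Hence the following expresses, by equations in the entries of
  \<open>g\<close> over \<open>T\<close> itself, that \<open>c\<close> preserves the cone over the Segre variety. Because of the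
  polarization identity, finitely many test vectors suffice, which makes the condition stable under
  base change; being a system of equations, it descends along coverings.
\<close>

definition preserves_segre ::
  "nat \<Rightarrow> ('t, 'm) ring_scheme \<Rightarrow> ('t matrix \<Rightarrow> 't matrix) \<Rightarrow> bool" where
  "preserves_segre p T g \<longleftrightarrow> (\<forall>a<p. \<forall>a'<p. \<forall>b<p. \<forall>b'<p.
    segre_test p T g (unit_pair T a a') (unit_pair T b b'))"

lemma col_mat_cong: "(\<And>i. i < n \<Longrightarrow> z i = z' i) \<Longrightarrow> col_mat n T j z = col_mat n T j z'"
  by (auto simp: col_mat_def fun_eq_iff restrict_def)

context cring
begin

lemma unit_pair_closed [simp]: "unit_pair R a a' i \<in> carrier R"
  by (simp add: unit_pair_def)

lemma pure_tensor_closed: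
  "(\<And>a. a < p \<Longrightarrow> v a \<in> carrier R) \<Longrightarrow> (\<And>a. a < p \<Longrightarrow> w a \<in> carrier R) \<Longrightarrow> l < p * p \<Longrightarrow>
    pure_tensor p R v w l \<in> carrier R"
  by (simp add: pure_tensor_def)

lemma pure_tensor_minors:
  assumes "\<And>a. a < p \<Longrightarrow> v a \<in> carrier R" "\<And>a. a < p \<Longrightarrow> w a \<in> carrier R"
  shows "segre_minors p R (pure_tensor p R v w)"
  unfolding segre_minors_def pure_tensor_def using assms by (auto simp: m_ac)

lemma alg_hom_col_mat:
  assumes g: "g \<in> alg_hom R (Mat n) (Mat n)" and il: "i < n" "l < n" and j: "j < n"
    and u: "\<And>a i. a < m \<Longrightarrow> i < n \<Longrightarrow> u a i \<in> carrier R" and v: "\<And>a. a < m \<Longrightarrow> v a \<in> carrier R"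
    and z: "\<And>i. i < n \<Longrightarrow> z i = (\<Oplus>a\<in>{..<m::nat}. v a \<otimes> u a i)"
  shows "g (col_mat n R j z) i l = (\<Oplus>a\<in>{..<m}. v a \<otimes> g (col_mat n R j (u a)) i l)"
proof -
  interpret M: ring "Mat n" by (rule ring_mat_alg)
  note gh = alg_homD[OF g]
  let ?U = "\<lambda>a. col_mat n R j (u a)"
  have U: "?U a \<in> carrier (Mat n)" if "a < m" for a using u[OF that] by simp
  have vU: "v a \<odot>\<^bsub>Mat n\<^esub> ?U a \<in> carrier (Mat n)" if "a < m" for a
    using U[OF that] v[OF that] by (intro mat_smult_closed)
  have vgU: "v a \<odot>\<^bsub>Mat n\<^esub> g (?U a) \<in> carrier (Mat n)" if "a < m" for a
    using U[OF that] v[OF that] gh(1) by (intro mat_smult_closed)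
  have zc: "z i \<in> carrier R" if "i < n" for i
    unfolding z[OF that] using u v that by (intro finsum_closed) auto
  have "col_mat n R j z = (\<Oplus>\<^bsub>Mat n\<^esub>a\<in>{..<m}. v a \<odot>\<^bsub>Mat n\<^esub> ?U a)"
  proof (rule mat_eqI[of _ n R _ R])
    fix x y assume xy: "x < n" "y < n"
    have "(\<Oplus>\<^bsub>Mat n\<^esub>a\<in>{..<m}. v a \<odot>\<^bsub>Mat n\<^esub> ?U a) x y = (\<Oplus>a\<in>{..<m}. (v a \<odot>\<^bsub>Mat n\<^esub> ?U a) x y)"
      using vU xy by (intro mat_finsum_entry) auto
    also have "\<dots> = (\<Oplus>a\<in>{..<m}. if y = j then v a \<otimes> u a x else \<zero>)"
      using xy u v by (intro finsum_cong') (auto simp: mat_smult_entry)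
    also have "\<dots> = col_mat n R j z x y"
      using xy by (cases "y = j") (simp_all add: z finsum_all_zero)
    finally show "col_mat n R j z x y = (\<Oplus>\<^bsub>Mat n\<^esub>a\<in>{..<m}. v a \<odot>\<^bsub>Mat n\<^esub> ?U a) x y" by (rule sym)
  qed (use zc vU in \<open>auto intro!: M.finsum_closed\<close>)
  then have "g (col_mat n R j z) = (\<Oplus>\<^bsub>Mat n\<^esub>a\<in>{..<m}. g (v a \<odot>\<^bsub>Mat n\<^esub> ?U a))"
    using vU by (simp only:) (intro alg_hom_finsum[OF g M.ring_axioms M.ring_axioms], auto)
  also have "\<dots> = (\<Oplus>\<^bsub>Mat n\<^esub>a\<in>{..<m}. v a \<odot>\<^bsub>Mat n\<^esub> g (?U a))"
    using vgU U v by (intro M.finsum_cong' refl) (auto intro!: gh(5))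
  finally have "g (col_mat n R j z) i l = (\<Oplus>\<^bsub>Mat n\<^esub>a\<in>{..<m}. v a \<odot>\<^bsub>Mat n\<^esub> g (?U a)) i l" by (simp only:)
  also have "\<dots> = (\<Oplus>a\<in>{..<m}. (v a \<odot>\<^bsub>Mat n\<^esub> g (?U a)) i l)"
    using vgU il by (intro mat_finsum_entry) auto
  finally show ?thesis using il by (simp only: mat_smult_entry)
qed

text \<open>By linearity of \<open>g\<close> each entry of the column is a linear form in the
  coefficients \<open>v\<close>, so each minor is a difference of two products of linear forms. The
  hypothesis evaluates it at all sums of two basis vectors, which is what
  \<open>polarization\<close> asks for.\<close>

lemma segre_minors_extend:
  assumes g: "g \<in> alg_hom R (Mat n) (Mat n)" and n: "n = p * p" and l: "l < n" "j < n"
    and two: "\<one> \<oplus> \<one> \<in> Units R"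
    and u: "\<And>a i. a < m \<Longrightarrow> i < n \<Longrightarrow> u a i \<in> carrier R" and v: "\<And>a. a < m \<Longrightarrow> v a \<in> carrier R"
    and z: "\<And>i. i < n \<Longrightarrow> z i = (\<Oplus>a\<in>{..<m::nat}. v a \<otimes> u a i)"
    and test: "\<And>a a'. a < m \<Longrightarrow> a' < m \<Longrightarrow>
      segre_minors p R (\<lambda>i. g (col_mat n R j (\<lambda>i. u a i \<oplus> u a' i)) i l)"
  shows "segre_minors p R (\<lambda>i. g (col_mat n R j z) i l)"
  unfolding segre_minors_def
proof (intro allI impI)
  fix x x' y y' assume xy: "x < p" "x' < p" "y < p" "y' < p"
  note gh = alg_homD[OF g]
  let ?y = "\<lambda>i a. g (col_mat n R j (u a)) i l"
  have yc: "?y i a \<in> carrier R" if "i < n" "a < m" for i a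
  proof -
    have "g (col_mat n R j (u a)) \<in> carrier (Mat n)" using u that by (intro gh(1)) simp
    then show ?thesis using that l by simp
  qed
  have add: "g (col_mat n R j (\<lambda>i. u a i \<oplus> u a' i)) i l = ?y i a \<oplus> ?y i a'"
    if a: "a < m" "a' < m" and i: "i < n" for a a' i
  proof -
    have U: "col_mat n R j (u a) \<in> carrier (Mat n)" "col_mat n R j (u a') \<in> carrier (Mat n)"
      using u a by simp_all
    have "col_mat n R j (\<lambda>i. u a i \<oplus> u a' i) = col_mat n R j (u a) \<oplus>\<^bsub>Mat n\<^esub> col_mat n R j (u a')"
      using u a U by (intro mat_eqI[of _ n R _ R]) (auto simp: mat_add_entry intro!: mat_add_closed)
    then show ?thesis using gh(2)[OF U] i l by (simp add: mat_add_entry)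
  qed
  have idx: "x * p + y < n" "x' * p + y' < n" "x * p + y' < n" "x' * p + y < n"
    using xy n by simp_all
  have e: "g (col_mat n R j z) i l = (\<Oplus>a\<in>{..<m}. v a \<otimes> ?y i a)" if "i < n" for i
    by (rule alg_hom_col_mat[OF g that l u v z])
  show "g (col_mat n R j z) (x * p + y) l \<otimes> g (col_mat n R j z) (x' * p + y') l
      = g (col_mat n R j z) (x * p + y') l \<otimes> g (col_mat n R j z) (x' * p + y) l"
    unfolding e[OF idx(1)] e[OF idx(2)] e[OF idx(3)] e[OF idx(4)]
  proof (rule polarization[OF two])
    fix a a' assume a: "a < m" "a' < m"
    show "(?y (x * p + y) a \<oplus> ?y (x * p + y) a') \<otimes> (?y (x' * p + y') a \<oplus> ?y (x' * p + y') a')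
        = (?y (x * p + y') a \<oplus> ?y (x * p + y') a') \<otimes> (?y (x' * p + y) a \<oplus> ?y (x' * p + y) a')"
      using segre_minorsD[OF test[OF a] xy] by (simp only: add[OF a] idx)
  qed (use yc idx v in auto)
qed

text \<open>A pure tensor is linear in each factor separately, so polarization is used twice: first
  to replace the second factor by an arbitrary \<open>w\<close> while the first is still a test
  vector, then to replace the first factor by \<open>v\<close>.\<close>

lemma preserves_segre_test:
  assumes g: "g \<in> alg_hom R (Mat (p * p)) (Mat (p * p))" and two: "\<one> \<oplus> \<one> \<in> Units R"
    and pres: "preserves_segre p R g"
    and v: "\<And>a. a < p \<Longrightarrow> v a \<in> carrier R" and w: "\<And>a. a < p \<Longrightarrow> w a \<in> carrier R"
  shows "segre_test p R g v w"
proof -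
  let ?n = "p * p"
  let ?e = "\<lambda>a i. if i = a then \<one> else \<zero>"
  have 1: "segre_test p R g (unit_pair R a a') w" if a: "a < p" "a' < p" for a a'
    unfolding segre_test_def
  proof (intro allI impI)
    fix j l assume jl: "j < ?n" "l < ?n"
    show "segre_minors p R (\<lambda>i. g (col_mat ?n R j (pure_tensor p R (unit_pair R a a') w)) i l)"
    proof (rule segre_minors_extend[OF g refl jl(2,1) two, where v = w
          and u = "\<lambda>b. pure_tensor p R (unit_pair R a a') (?e b)"])
      fix b b' assume b: "b < p" "b' < p"
      have "col_mat ?n R j (\<lambda>i. pure_tensor p R (unit_pair R a a') (?e b) i \<oplus> pure_tensor p R (unit_pair R a a') (?e b') i)
        = col_mat ?n R j (pure_tensor p R (unit_pair R a a') (unit_pair R b b'))"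
        by (rule col_mat_cong) (simp add: pure_tensor_def unit_pair_def[of _ b] r_distr)
      then show "segre_minors p R (\<lambda>i. g (col_mat ?n R j (\<lambda>i. pure_tensor p R (unit_pair R a a') (?e b) i
          \<oplus> pure_tensor p R (unit_pair R a a') (?e b') i)) i l)"
        using pres a b jl unfolding preserves_segre_def segre_test_def by simp
    next
      fix i assume i: "i < ?n"
      have "(\<Oplus>b\<in>{..<p}. w b \<otimes> pure_tensor p R (unit_pair R a a') (?e b) i)
        = (\<Oplus>b\<in>{..<p}. if b = i mod p then unit_pair R a a' (i div p) \<otimes> w b else \<zero>)"
        using i w by (intro finsum_cong') (auto simp: pure_tensor_def m_comm)
      also have "\<dots> = pure_tensor p R (unit_pair R a a') w i"
        using i w by (subst finsum_delta) (auto simp: pure_tensor_def)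
      finally show "pure_tensor p R (unit_pair R a a') w i
        = (\<Oplus>b\<in>{..<p}. w b \<otimes> pure_tensor p R (unit_pair R a a') (?e b) i)" by (rule sym)
    qed (use w in \<open>auto intro!: pure_tensor_closed\<close>)
  qed
  show ?thesis
    unfolding segre_test_def
  proof (intro allI impI)
    fix j l assume jl: "j < ?n" "l < ?n"
    show "segre_minors p R (\<lambda>i. g (col_mat ?n R j (pure_tensor p R v w)) i l)"
    proof (rule segre_minors_extend[OF g refl jl(2,1) two, where v = v
          and u = "\<lambda>a. pure_tensor p R (?e a) w"])
      fix a a' assume a: "a < p" "a' < p"
      have "col_mat ?n R j (\<lambda>i. pure_tensor p R (?e a) w i \<oplus> pure_tensor p R (?e a') w i)
        = col_mat ?n R j (pure_tensor p R (unit_pair R a a') w)"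
        by (rule col_mat_cong) (simp add: pure_tensor_def unit_pair_def w l_distr)
      then show "segre_minors p R (\<lambda>i. g (col_mat ?n R j (\<lambda>i. pure_tensor p R (?e a) w i
          \<oplus> pure_tensor p R (?e a') w i)) i l)"
        using 1[OF a] jl unfolding segre_test_def by simp
    next
      fix i assume i: "i < ?n"
      have "(\<Oplus>a\<in>{..<p}. v a \<otimes> pure_tensor p R (?e a) w i)
        = (\<Oplus>a\<in>{..<p}. if a = i div p then v a \<otimes> w (i mod p) else \<zero>)"
        using i v w by (intro finsum_cong') (auto simp: pure_tensor_def)
      also have "\<dots> = pure_tensor p R v w i"
        using i v w by (subst finsum_delta) (auto simp: pure_tensor_def)
      finally show "pure_tensor p R v w i = (\<Oplus>a\<in>{..<p}. v a \<otimes> pure_tensor p R (?e a) w i)" by (rule sym)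
    qed (use v w in \<open>auto intro!: pure_tensor_closed\<close>)
  qed
qed

lemma mat_vec_smult:
  assumes "M \<in> carrier (Mat n)" "\<And>i. i < n \<Longrightarrow> z i \<in> carrier R" "t \<in> carrier R" "i < n"
  shows "mat_vec R n M (\<lambda>i. t \<otimes> z i) i = t \<otimes> mat_vec R n M z i"
  using assms by (auto simp: mat_vec_entry finsum_rdistr m_lcomm intro!: finsum_cong')

end

lemma inner_aut_col_mat:
  fixes T :: "'r alg"
  assumes T: "cring T" and c: "c \<in> Units (mat_alg n T)" and z: "\<And>i. i < n \<Longrightarrow> z i \<in> carrier T"
    and il: "i < n" "l < n" "j < n"
  shows "inner_aut n T c (col_mat n T j z) i l = mat_vec T n c z i \<otimes>\<^bsub>T\<^esub> (inv\<^bsub>mat_alg n T\<^esub> c) j l"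
proof -
  interpret cring T by (rule T)
  show ?thesis using col_mat_conj[OF mat_inv(1,2)[OF c] z il] z by (simp add: inner_aut_apply)
qed

text \<open>A vector \<open>z\<close> of the cone need not be a pure tensor globally, but
  \<open>z m\<close> times \<open>z\<close> is one for every \<open>m\<close>. The test for this
  pure tensor says that \<open>c z\<close>, multiplied by \<open>z m\<close> and by an entry of the
  inverse of \<open>c\<close>, satisfies the minor equations. Both kinds of factors form unimodular
  families, so they are cancelled one after the other.\<close>

lemma preserves_segre_lift:
  fixes T :: "'r alg"
  assumes T: "cring T" and two: "\<one>\<^bsub>T\<^esub> \<oplus>\<^bsub>T\<^esub> \<one>\<^bsub>T\<^esub> \<in> Units T" and p: "p > 0"
    and c: "c \<in> Units (mat_alg (p * p) T)" and pres: "preserves_segre p T (inner_aut (p * p) T c)"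
    and z: "z \<in> segre_cone p T"
  shows "mat_vec T (p * p) c z \<in> segre_cone p T"
proof -
  interpret cring T by (rule T)
  let ?n = "p * p"
  let ?d = "inv\<^bsub>mat_alg ?n T\<^esub> c"
  note ci = mat_inv[OF c]
  have zu: "unimodular T ?n z" and zm: "segre_minors p T z" using z by (simp_all add: segre_cone_iff)
  have zc: "z i \<in> carrier T" if "i < ?n" for i using zu that by (auto simp: unimodular_def)
  obtain k where k: "\<And>i. i < ?n \<Longrightarrow> k i \<in> carrier T" "(\<Oplus>\<^bsub>T\<^esub>i\<in>{..<?n}. k i \<otimes>\<^bsub>T\<^esub> z i) = \<one>\<^bsub>T\<^esub>"
    using zu by (auto simp: unimodular_def Pi_def)
  let ?y = "mat_vec T ?n c z"
  have yc: "?y i \<in> carrier T" if "i < ?n" for i using mat_vec_closed(2)[OF ci(1) zc that] .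
  have n0: "0 < ?n" using p by simp
  \<comment> \<open>The row with index 0 of the inverse is unimodular: paired with the column of
    \<open>c\<close> with index 0 it gives the \<open>(0, 0)\<close> entry of the identity.\<close>
  have dc: "(\<Oplus>\<^bsub>T\<^esub>l\<in>{..<?n}. c l 0 \<otimes>\<^bsub>T\<^esub> ?d 0 l) = \<one>\<^bsub>T\<^esub>"
  proof -
    have "(\<Oplus>\<^bsub>T\<^esub>l\<in>{..<?n}. c l 0 \<otimes>\<^bsub>T\<^esub> ?d 0 l) = (?d \<otimes>\<^bsub>mat_alg ?n T\<^esub> c) 0 0"
      unfolding mat_mult_entry[OF n0 n0] using ci n0 by (intro finsum_cong') (auto simp: m_comm)
    then show ?thesis using ci n0 by (simp add: mat_one_entry)
  qed
  have "segre_minors p T ?y"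
  proof (rule segre_minors_cancel[OF yc zc k])
    fix m assume m: "m < ?n"
    show "segre_minors p T (\<lambda>i. z m \<otimes>\<^bsub>T\<^esub> ?y i)"
    proof (rule segre_minors_cancel[OF _ _ _ dc])
      fix l assume l: "l < ?n"
      let ?v = "\<lambda>a. z (a * p + m mod p)" and ?w = "\<lambda>b. z ((m div p) * p + b)"
      have "segre_test p T (inner_aut ?n T c) ?v ?w"
        using m by (intro preserves_segre_test[OF alg_isoD(1)[OF inner_aut_iso(1)[OF T c]] two pres] zc) auto
      then have "segre_minors p T (\<lambda>i. inner_aut ?n T c (col_mat ?n T 0 (pure_tensor p T ?v ?w)) i l)"
        using l n0 by (simp add: segre_test_def)
      moreover have "col_mat ?n T 0 (pure_tensor p T ?v ?w) = col_mat ?n T 0 (\<lambda>i. z m \<otimes>\<^bsub>T\<^esub> z i)"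
      proof (rule col_mat_cong)
        fix i assume i: "i < ?n"
        show "pure_tensor p T ?v ?w i = z m \<otimes>\<^bsub>T\<^esub> z i"
          using segre_minorsD[OF zm, of "m div p" "i div p" "m mod p" "i mod p"] i m
            m_comm[OF zc zc, of "(m div p) * p + i mod p" "(i div p) * p + m mod p"]
          by (simp add: pure_tensor_def)
      qed
      ultimately have "segre_minors p T (\<lambda>i. inner_aut ?n T c (col_mat ?n T 0 (\<lambda>i. z m \<otimes>\<^bsub>T\<^esub> z i)) i l)"
        by simp
      moreover have "inner_aut ?n T c (col_mat ?n T 0 (\<lambda>i. z m \<otimes>\<^bsub>T\<^esub> z i)) i l = ?d 0 l \<otimes>\<^bsub>T\<^esub> (z m \<otimes>\<^bsub>T\<^esub> ?y i)"
        if i: "i < ?n" for i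
      proof -
        have "inner_aut ?n T c (col_mat ?n T 0 (\<lambda>i. z m \<otimes>\<^bsub>T\<^esub> z i)) i l = z m \<otimes>\<^bsub>T\<^esub> ?y i \<otimes>\<^bsub>T\<^esub> ?d 0 l"
          using inner_aut_col_mat[OF T c, of "\<lambda>i. z m \<otimes>\<^bsub>T\<^esub> z i", OF _ i l n0]
            mat_vec_smult[OF ci(1) zc zc[OF m] i] zc m by simp
        also have "\<dots> = ?d 0 l \<otimes>\<^bsub>T\<^esub> (z m \<otimes>\<^bsub>T\<^esub> ?y i)"
          using mat_entry_closed[OF ci(2) n0 l] zc[OF m] yc[OF i] by (intro m_comm) auto
        finally show ?thesis .
      qed
      ultimately show "segre_minors p T (\<lambda>i. ?d 0 l \<otimes>\<^bsub>T\<^esub> (z m \<otimes>\<^bsub>T\<^esub> ?y i))"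
        by (rule segre_minors_eq[OF _ sym])
    qed (use m zc yc mat_entry_closed[OF ci(2) n0] mat_entry_closed[OF ci(1) _ n0] in auto)
  qed
  then show ?thesis using mat_vec_unimodular[OF zu c] by (simp add: segre_cone_iff)
qed

section \<open>Base change of the Segre conditions\<close>

context base_hom
begin

lemma mm_col_mat:
  assumes "\<And>i. i < n \<Longrightarrow> z i \<in> carrier T"
  shows "mat_map n f (col_mat n T j z) = col_mat n T' j (\<lambda>i. f (z i))"
  using assms by (intro mat_eqI[of _ n T' _ T']) (auto simp: mat_map_entry)

lemma f_minus:
  assumes "x \<in> carrier T" "y \<in> carrier T"
  shows "f (x \<ominus>\<^bsub>T\<^esub> y) = f x \<ominus>\<^bsub>T'\<^esub> f y"
proof -
  have "f (\<ominus>\<^bsub>T\<^esub> y) = \<ominus>\<^bsub>T'\<^esub> f y"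
    by (rule ring_hom_cring.hom_a_inv[OF ring_hom_cringI[OF T.is_cring T'.is_cring alg_hom_ring_hom[OF f]] assms(2)])
  then show ?thesis using assms by (simp add: a_minus_def)
qed

lemma f_unit_pair: "f (unit_pair T a a' i) = unit_pair T' a a' i"
  by (simp add: unit_pair_def)

lemma f_pure_tensor:
  assumes "\<And>a. a < p \<Longrightarrow> v a \<in> carrier T" "\<And>a. a < p \<Longrightarrow> w a \<in> carrier T" "l < p * p"
  shows "f (pure_tensor p T v w l) = pure_tensor p T' (\<lambda>i. f (v i)) (\<lambda>i. f (w i)) l"
  using assms by (simp add: pure_tensor_def)

lemma f_segre_minors:
  assumes "segre_minors p T z" "\<And>i. i < p * p \<Longrightarrow> z i \<in> carrier T"
  shows "segre_minors p T' (\<lambda>i. f (z i))"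
  using assms(1) unfolding segre_minors_def by (simp add: assms(2) flip: f_simps(3))

lemma f_unimodular:
  assumes "unimodular T m z"
  shows "unimodular T' m (\<lambda>i\<in>{..<m}. f (z i))"
proof -
  obtain k where k: "\<And>i. i < m \<Longrightarrow> k i \<in> carrier T" "(\<Oplus>\<^bsub>T\<^esub>i\<in>{..<m}. k i \<otimes>\<^bsub>T\<^esub> z i) = \<one>\<^bsub>T\<^esub>"
    and z: "\<And>i. i < m \<Longrightarrow> z i \<in> carrier T"
    using assms by (auto simp: unimodular_def Pi_def PiE_def)
  have "(\<Oplus>\<^bsub>T'\<^esub>i\<in>{..<m}. f (k i) \<otimes>\<^bsub>T'\<^esub> (\<lambda>i\<in>{..<m}. f (z i)) i) = (\<Oplus>\<^bsub>T'\<^esub>i\<in>{..<m}. f (k i \<otimes>\<^bsub>T\<^esub> z i))"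
    using k z by (intro T'.finsum_cong') auto
  also have "\<dots> = f (\<Oplus>\<^bsub>T\<^esub>i\<in>{..<m}. k i \<otimes>\<^bsub>T\<^esub> z i)"
    using k z by (intro f_finsum[symmetric]) auto
  also have "\<dots> = \<one>\<^bsub>T'\<^esub>" using k by simp
  finally show ?thesis
    unfolding unimodular_def using k z by (intro conjI bexI[of _ "\<lambda>i. f (k i)"]) auto
qed

lemma f_mat_vec:
  assumes "M \<in> carrier (mat_alg n T)" "\<And>i. i < n \<Longrightarrow> z i \<in> carrier T" "i < n"
  shows "mat_vec T' n (mat_map n f M) (\<lambda>i\<in>{..<n}. f (z i)) i = f (mat_vec T n M z i)"
proof -
  have "f (mat_vec T n M z i) = (\<Oplus>\<^bsub>T'\<^esub>j\<in>{..<n}. f (M i j \<otimes>\<^bsub>T\<^esub> z j))"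
    unfolding T.mat_vec_entry[OF assms(3)] using assms by (intro f_finsum) auto
  also have "\<dots> = mat_vec T' n (mat_map n f M) (\<lambda>i\<in>{..<n}. f (z i)) i"
    unfolding T'.mat_vec_entry[OF assms(3)] using assms by (intro T'.finsum_cong') (auto simp: mat_map_entry)
  finally show ?thesis by (rule sym)
qed

lemma f_segre_cone:
  assumes z: "z \<in> segre_cone p T"
  shows "(\<lambda>i\<in>{..<p * p}. f (z i)) \<in> segre_cone p T'"
proof -
  have zc: "z i \<in> carrier T" if "i < p * p" for i
    using z that by (auto simp: T.segre_cone_iff unimodular_def)
  have "segre_minors p T' (\<lambda>i. f (z i))"
    using z zc by (intro f_segre_minors) (auto simp: T.segre_cone_iff)
  then have "segre_minors p T' (\<lambda>i\<in>{..<p * p}. f (z i))"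
    by (rule segre_minors_eq) simp
  then show ?thesis using z f_unimodular by (simp add: T.segre_cone_iff T'.segre_cone_iff)
qed

lemma res_col_mat:
  assumes g: "g \<in> alg_iso T (mat_alg n T) (mat_alg n T)" and z: "\<And>i. i < n \<Longrightarrow> z i \<in> carrier T"
    and il: "i < n" "l < n"
  shows "PGL_res n T T' f g (col_mat n T' j (\<lambda>i. f (z i))) i l = f (g (col_mat n T j z) i l)"
  using PGL_res(2)[OF g, of "col_mat n T j z"] z il by (simp add: mm_col_mat mat_map_entry)

text \<open>The test vectors have entries built from \<open>0\<close> and \<open>1\<close>, so
  \<open>f\<close> maps those over \<open>T\<close> to those over \<open>T'\<close>, and it
  preserves equations between entries of the transformed matrices.\<close>

lemma preserves_segre_res:
  assumes g: "g \<in> alg_iso T (mat_alg n T) (mat_alg n T)" and n: "n = p * p"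
    and pres: "preserves_segre p T g"
  shows "preserves_segre p T' (PGL_res n T T' f g)"
  unfolding preserves_segre_def segre_test_def
proof (intro allI impI)
  fix a a' b b' j l assume ab: "a < p" "a' < p" "b < p" "b' < p" and jl: "j < p * p" "l < p * p"
  note gh = alg_homD[OF alg_isoD(1)[OF g]]
  let ?z = "pure_tensor p T (unit_pair T a a') (unit_pair T b b')"
  have zc: "?z i \<in> carrier T" if "i < n" for i using that n by (intro T.pure_tensor_closed) auto
  have "segre_minors p T (\<lambda>i. g (col_mat n T j ?z) i l)"
    using pres ab jl n by (simp add: preserves_segre_def segre_test_def)
  moreover have Z: "col_mat n T j ?z \<in> carrier (mat_alg n T)" using zc by simp
  ultimately have "segre_minors p T' (\<lambda>i. f (g (col_mat n T j ?z) i l))"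
    using mat_entry_closed[OF gh(1)[OF Z]] jl n by (intro f_segre_minors) auto
  moreover have "PGL_res n T T' f g (col_mat (p * p) T' j (pure_tensor p T' (unit_pair T' a a') (unit_pair T' b b'))) i l
      = f (g (col_mat n T j ?z) i l)" if "i < p * p" for i
  proof -
    have "col_mat (p * p) T' j (pure_tensor p T' (unit_pair T' a a') (unit_pair T' b b'))
        = col_mat n T' j (\<lambda>i. f (?z i))"
      unfolding n by (rule col_mat_cong) (simp add: f_pure_tensor f_unit_pair)
    then show ?thesis using res_col_mat[OF g, of ?z, OF zc] that jl n by simp
  qed
  ultimately show "segre_minors p T' (\<lambda>i. PGL_res n T T' f g
      (col_mat (p * p) T' j (pure_tensor p T' (unit_pair T' a a') (unit_pair T' b b'))) i l)"
    by (rule segre_minors_eq)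
qed

end

text \<open>A finite sum of ones is the image of an integer in the ring, here of \<open>2\<close> or
  \<open>p * p\<close>. Structure maps preserve these images and their inverses, so invertibility
  has to be assumed over \<open>R\<close> only.\<close>

lemma algebra_scalar_unit:
  fixes T :: "'r alg"
  assumes T: "algebra R T" and m: "(\<Oplus>\<^bsub>R\<^esub>i\<in>I. \<one>\<^bsub>R\<^esub>) \<in> Units R" and I: "finite I"
  shows "(\<Oplus>\<^bsub>T\<^esub>i\<in>I. \<one>\<^bsub>T\<^esub>) \<in> Units T"
proof -
  interpret T: cring T by (rule algebraD(2)[OF T])
  interpret R: cring R by (rule algebraD(1)[OF T])
  interpret algebra R T by (rule T)
  let ?m = "\<Oplus>\<^bsub>R\<^esub>i\<in>I. \<one>\<^bsub>R\<^esub>"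
  have sum: "(\<Oplus>\<^bsub>R\<^esub>i\<in>J. \<one>\<^bsub>R\<^esub>) \<odot>\<^bsub>T\<^esub> \<one>\<^bsub>T\<^esub> = (\<Oplus>\<^bsub>T\<^esub>i\<in>J. \<one>\<^bsub>T\<^esub>)" if "finite J" for J :: "'c set"
    using that by (induction J rule: finite_induct)
      (simp_all add: R.finsum_insert T.finsum_insert smult_l_distr R.finsum_closed)
  have mc: "?m \<in> carrier R" "inv\<^bsub>R\<^esub> ?m \<in> carrier R" "?m \<otimes>\<^bsub>R\<^esub> inv\<^bsub>R\<^esub> ?m = \<one>\<^bsub>R\<^esub>" using m by auto
  have "(?m \<odot>\<^bsub>T\<^esub> \<one>\<^bsub>T\<^esub>) \<otimes>\<^bsub>T\<^esub> (inv\<^bsub>R\<^esub> ?m \<odot>\<^bsub>T\<^esub> \<one>\<^bsub>T\<^esub>) = ?m \<odot>\<^bsub>T\<^esub> (inv\<^bsub>R\<^esub> ?m \<odot>\<^bsub>T\<^esub> \<one>\<^bsub>T\<^esub>)"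
    using mc smult_assoc2[of ?m "\<one>\<^bsub>T\<^esub>" "inv\<^bsub>R\<^esub> ?m \<odot>\<^bsub>T\<^esub> \<one>\<^bsub>T\<^esub>"] by simp
  also have "\<dots> = \<one>\<^bsub>T\<^esub>" using mc smult_assoc1[of ?m "inv\<^bsub>R\<^esub> ?m" "\<one>\<^bsub>T\<^esub>"] by simp
  finally have "(?m \<odot>\<^bsub>T\<^esub> \<one>\<^bsub>T\<^esub>) \<otimes>\<^bsub>T\<^esub> (inv\<^bsub>R\<^esub> ?m \<odot>\<^bsub>T\<^esub> \<one>\<^bsub>T\<^esub>) = \<one>\<^bsub>T\<^esub>" .
  then have "?m \<odot>\<^bsub>T\<^esub> \<one>\<^bsub>T\<^esub> \<in> Units T"
    using mc T.unit_factor[of "?m \<odot>\<^bsub>T\<^esub> \<one>\<^bsub>T\<^esub>" "inv\<^bsub>R\<^esub> ?m \<odot>\<^bsub>T\<^esub> \<one>\<^bsub>T\<^esub>"] by (simp only: T.Units_one_closed smult_closed T.one_closed)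
  then show ?thesis by (simp add: sum[OF I])
qed

text \<open>
  The diagonal entries of \<open>g(E\<^sub>0\<^sub>0)\<close> have the sum \<open>1\<close>, so the open sets on which they are invertible
  cover \<open>Spec T\<close>; on each of them \<open>g\<close> is inner.
\<close>

lemma PGL_local_lift:
  fixes T :: "'r alg"
  assumes T: "algebra R T" and g: "g \<in> alg_iso T (mat_alg n T) (mat_alg n T)" and n: "n > 0"
    and u: "(\<Oplus>\<^bsub>T\<^esub>i\<in>{..<n}. \<one>\<^bsub>T\<^esub>) \<in> Units T" and inf: "infinite (UNIV :: 'r set)"
    and x: "x \<in> carrier T"
    and 0: "\<And>(T' :: 'r alg) f c. algebra R T' \<Longrightarrow> f \<in> alg_hom R T T' \<Longrightarrow> c \<in> Units (mat_alg n T') \<Longrightarrow>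
      inner_aut n T' c = PGL_res n T T' f g \<Longrightarrow> f x = \<zero>\<^bsub>T'\<^esub>"
  shows "x = \<zero>\<^bsub>T\<^esub>"
proof -
  interpret T: cring T by (rule algebraD(2)[OF T])
  note gh = alg_homD[OF alg_isoD(1)[OF g]]
  let ?s = "\<lambda>k. g (mat_unit n T 0 0) k k"
  have s: "?s k \<in> carrier T" if "k < n" for k
    by (rule mat_entry_closed[OF gh(1) that that]) simp
  show ?thesis
  proof (rule T.unimodular_annihilator[of n ?s "\<lambda>_. \<one>\<^bsub>T\<^esub>"])
    have "(\<Oplus>\<^bsub>T\<^esub>k\<in>{..<n}. \<one>\<^bsub>T\<^esub> \<otimes>\<^bsub>T\<^esub> ?s k) = (\<Oplus>\<^bsub>T\<^esub>k\<in>{..<n}. ?s k)"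
      using s by (intro T.finsum_cong') auto
    then show "(\<Oplus>\<^bsub>T\<^esub>k\<in>{..<n}. \<one>\<^bsub>T\<^esub> \<otimes>\<^bsub>T\<^esub> ?s k) = \<one>\<^bsub>T\<^esub>"
      using trace_PGL[OF T.is_cring g n u] by simp
    fix k assume k: "k < n"
    obtain T' :: "'r alg" and f where loc': "algebra R T'" "f \<in> alg_hom R T T'" "f (?s k) \<in> Units T'"
      and loc: "\<And>t. t \<in> carrier T \<Longrightarrow> f t = \<zero>\<^bsub>T'\<^esub> \<Longrightarrow> \<exists>N. ?s k [^]\<^bsub>T\<^esub> (N::nat) \<otimes>\<^bsub>T\<^esub> t = \<zero>\<^bsub>T\<^esub>"
      using localization_exists[OF T s[OF k] inf] by blast
    interpret base_hom R T T' f n using T loc' by (simp add: base_hom_def)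
    have "PGL_res n T T' f g (mat_unit n T' 0 0) k k = f (?s k)"
      using PGL_res(2)[OF g T.mat_unit_closed, of 0 0] k by (simp add: mm_unit mat_map_entry)
    then obtain c where "c \<in> Units (mat_alg n T')" "inner_aut n T' c = PGL_res n T T' f g"
      using local_lift[OF T'.is_cring PGL_res(1)[OF g] n k] loc'(3) by auto
    then show "\<exists>N. ?s k [^]\<^bsub>T\<^esub> (N::nat) \<otimes>\<^bsub>T\<^esub> x = \<zero>\<^bsub>T\<^esub>"
      by (intro loc[OF x] 0[OF loc'(1,2)])
  qed (use s x in auto)
qed

text \<open>Each hypothesis has its own purpose: the inverse of \<open>2\<close> serves
  polarization, the inverse of \<open>p * p\<close> serves the trace argument by which automorphisms
  are locally inner, and the infinite type accommodates the localizations.\<close>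

locale segre_group =
  fixes R :: "('r, 'm) ring_scheme" and p :: nat
  assumes base_ring: "cring R" and p_pos: "p > 0" and infinite_type: "infinite (UNIV :: 'r set)"
    and two_unit: "(\<Oplus>\<^bsub>R\<^esub>i\<in>{..<2::nat}. \<one>\<^bsub>R\<^esub>) \<in> Units R"
    and pp_unit: "(\<Oplus>\<^bsub>R\<^esub>i\<in>{..<p * p}. \<one>\<^bsub>R\<^esub>) \<in> Units R"
begin

abbreviation n where "n \<equiv> p * p"

lemma n_pos: "n > 0" using p_pos by simp

lemma two_unit_alg:
  fixes T :: "'r alg"
  assumes T: "algebra R T"
  shows "\<one>\<^bsub>T\<^esub> \<oplus>\<^bsub>T\<^esub> \<one>\<^bsub>T\<^esub> \<in> Units T"
proof -
  interpret T: cring T by (rule algebraD(2)[OF T])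
  have "(\<Oplus>\<^bsub>T\<^esub>i\<in>{..<2::nat}. \<one>\<^bsub>T\<^esub>) = \<one>\<^bsub>T\<^esub> \<oplus>\<^bsub>T\<^esub> \<one>\<^bsub>T\<^esub>"
    by (simp add: lessThan_Suc numeral_2_eq_2)
  then show ?thesis using algebra_scalar_unit[OF T two_unit] by simp
qed

lemmas pp_unit_alg = algebra_scalar_unit[OF _ pp_unit finite_lessThan]

lemma base_homI:
  "algebra R T \<Longrightarrow> algebra R T' \<Longrightarrow> f \<in> alg_hom R T T' \<Longrightarrow> base_hom R T T' f"
  by (simp add: base_hom_def)

abbreviation G where "G T \<equiv> carrier (sect (G_pp R p) T)"

lemma G_iff:
  "g \<in> G T \<longleftrightarrow> g \<in> alg_iso T (mat_alg n T) (mat_alg n T) \<and>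
    (\<forall>T' f c. algebra R T' \<and> f \<in> alg_hom R T T' \<and> c \<in> Units (mat_alg n T') \<and>
      inner_aut n T' c = PGL_res n T T' f g \<longrightarrow> mat_vec T' n c ` segre_cone p T' = segre_cone p T')"
  by (simp add: G_pp_def)

lemma G_simps [simp]:
  "g \<otimes>\<^bsub>sect (G_pp R p) T\<^esub> h = compose (carrier (mat_alg n T)) g h"
  "\<one>\<^bsub>sect (G_pp R p) T\<^esub> = (\<lambda>M\<in>carrier (mat_alg n T). M)"
  "gres (G_pp R p) = PGL_res n"
  by (simp_all add: G_pp_def PGL_def)

lemma G_iso: "g \<in> G T \<Longrightarrow> g \<in> alg_iso T (mat_alg n T) (mat_alg n T)"
  by (simp add: G_iff)

lemma G_lift:
  assumes "g \<in> G T" "algebra R T'" "f \<in> alg_hom R T T'" "c \<in> Units (mat_alg n T')"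
    "inner_aut n T' c = PGL_res n T T' f g" "z \<in> segre_cone p T'"
  shows "mat_vec T' n c z \<in> segre_cone p T'"
  using assms unfolding G_iff by blast

lemma segre_cone_image:
  fixes T :: "'r alg"
  assumes T: "algebra R T" and c: "c \<in> Units (mat_alg n T)"
    and 1: "\<And>z. z \<in> segre_cone p T \<Longrightarrow> mat_vec T n c z \<in> segre_cone p T"
    and 2: "\<And>z. z \<in> segre_cone p T \<Longrightarrow> mat_vec T n (inv\<^bsub>mat_alg n T\<^esub> c) z \<in> segre_cone p T"
  shows "mat_vec T n c ` segre_cone p T = segre_cone p T"
proof
  interpret T: cring T by (rule algebraD(2)[OF T])
  note ci = T.mat_inv[OF c]
  show "segre_cone p T \<subseteq> mat_vec T n c ` segre_cone p T"
  proof
    fix z assume z: "z \<in> segre_cone p T"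
    then have zE: "z \<in> {..<n} \<rightarrow>\<^sub>E carrier T" by (simp add: T.segre_cone_iff unimodular_def)
    have "mat_vec T n c (mat_vec T n (inv\<^bsub>mat_alg n T\<^esub> c) z) = z"
      using T.mat_vec_mult[OF ci(1,2), of z] PiE_mem[OF zE] T.mat_vec_one[OF zE] by (simp add: ci)
    then show "z \<in> mat_vec T n c ` segre_cone p T" using 2[OF z] by (metis imageI)
  qed
qed (use 1 in blast)

lemma inv_PGL:
  fixes T :: "'r alg"
  assumes T: "algebra R T" and g: "g \<in> alg_iso T (mat_alg n T) (mat_alg n T)"
  shows "inv\<^bsub>sect (PGL n) T\<^esub> g \<in> alg_iso T (mat_alg n T) (mat_alg n T)"
    "inv\<^bsub>sect (PGL n) T\<^esub> (inv\<^bsub>sect (PGL n) T\<^esub> g) = g"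
  using group.inv_closed[OF group_PGL[OF algebraD(2)[OF T]], of g n]
    group.inv_inv[OF group_PGL[OF algebraD(2)[OF T]], of g n] g by simp_all

lemma inverse_lift:
  fixes T T' :: "'r alg"
  assumes T: "algebra R T" and T': "algebra R T'" and f: "f \<in> alg_hom R T T'"
    and g: "g \<in> alg_iso T (mat_alg n T) (mat_alg n T)"
    and c: "c \<in> Units (mat_alg n T')" "inner_aut n T' c = PGL_res n T T' f g"
  shows "inner_aut n T' (inv\<^bsub>mat_alg n T'\<^esub> c) = PGL_res n T T' f (inv\<^bsub>sect (PGL n) T\<^esub> g)"
  using base_hom.PGL_res_inv[OF base_homI[OF T T' f] g] inner_aut_iso(2)[OF algebraD(2)[OF T'] c(1)] c(2)
  by simp

text \<open>The definition asks that a lift map the cone onto itself. Inverses of lifts of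
  \<open>g\<close> are lifts of the inverse of \<open>g\<close>, so equality of the two sets amounts
  to two inclusions of the same form, one for \<open>g\<close> and one for its inverse.\<close>

lemma G_I:
  fixes T :: "'r alg"
  assumes T: "algebra R T" and g: "g \<in> alg_iso T (mat_alg n T) (mat_alg n T)"
    and 1: "\<And>(T' :: 'r alg) f c z. algebra R T' \<Longrightarrow> f \<in> alg_hom R T T' \<Longrightarrow> c \<in> Units (mat_alg n T') \<Longrightarrow>
      inner_aut n T' c = PGL_res n T T' f g \<Longrightarrow> z \<in> segre_cone p T' \<Longrightarrow> mat_vec T' n c z \<in> segre_cone p T'"
    and 2: "\<And>(T' :: 'r alg) f c z. algebra R T' \<Longrightarrow> f \<in> alg_hom R T T' \<Longrightarrow> c \<in> Units (mat_alg n T') \<Longrightarrow>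
      inner_aut n T' c = PGL_res n T T' f (inv\<^bsub>sect (PGL n) T\<^esub> g) \<Longrightarrow> z \<in> segre_cone p T' \<Longrightarrow>
      mat_vec T' n c z \<in> segre_cone p T'"
  shows "g \<in> G T"
  unfolding G_iff
proof (intro conjI allI impI g)
  fix T' :: "'r alg" and f c
  assume c: "algebra R T' \<and> f \<in> alg_hom R T T' \<and> c \<in> Units (mat_alg n T') \<and>
      inner_aut n T' c = PGL_res n T T' f g"
  interpret T': cring T' using c algebraD(2) by blast
  have "inner_aut n T' (inv\<^bsub>mat_alg n T'\<^esub> c) = PGL_res n T T' f (inv\<^bsub>sect (PGL n) T\<^esub> g)"
    using inverse_lift[OF T _ _ g] c by blast
  moreover have "inv\<^bsub>mat_alg n T'\<^esub> c \<in> Units (mat_alg n T')" using c T'.mat_inv(3) by blast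
  ultimately show "mat_vec T' n c ` segre_cone p T' = segre_cone p T'"
    using c 1 2 by (intro segre_cone_image) blast+
qed

text \<open>If \<open>c\<close> lifts the inverse of \<open>g\<close>, then the inverse of
  \<open>c\<close> lifts \<open>g\<close> and maps the cone onto itself. So a given \<open>z\<close>
  in the cone is the image of some \<open>y\<close> in the cone, and \<open>c z\<close> is that
  \<open>y\<close>.\<close>

lemma G_inv:
  fixes T :: "'r alg"
  assumes T: "algebra R T" and g: "g \<in> G T"
  shows "inv\<^bsub>sect (PGL n) T\<^esub> g \<in> G T"
proof (rule G_I[OF T inv_PGL(1)[OF T G_iso[OF g]]])
  note gi = inv_PGL[OF T G_iso[OF g]]
  fix T' :: "'r alg" and f c z assume T': "algebra R T'" "f \<in> alg_hom R T T'" and c: "c \<in> Units (mat_alg n T')"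
    and z: "z \<in> segre_cone p T'"
  interpret T': cring T' by (rule algebraD(2)[OF T'(1)])
  note ci = T'.mat_inv[OF c]
  show "mat_vec T' n c z \<in> segre_cone p T'" if "inner_aut n T' c = PGL_res n T T' f (inv\<^bsub>sect (PGL n) T\<^esub> (inv\<^bsub>sect (PGL n) T\<^esub> g))"
    using G_lift[OF g T' c _ z] that gi(2) by simp
  assume lift: "inner_aut n T' c = PGL_res n T T' f (inv\<^bsub>sect (PGL n) T\<^esub> g)"
  have "inner_aut n T' (inv\<^bsub>mat_alg n T'\<^esub> c) = PGL_res n T T' f g"
    using inverse_lift[OF T T' gi(1) c lift] gi(2) by simp
  then have "mat_vec T' n (inv\<^bsub>mat_alg n T'\<^esub> c) ` segre_cone p T' = segre_cone p T'"
    using g T' ci(3) unfolding G_iff by blast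
  then obtain y where y: "y \<in> segre_cone p T'" "z = mat_vec T' n (inv\<^bsub>mat_alg n T'\<^esub> c) y" using z by blast
  then have yE: "y \<in> {..<n} \<rightarrow>\<^sub>E carrier T'" by (simp add: T'.segre_cone_iff unimodular_def)
  have "mat_vec T' n c z = y"
    unfolding y(2) using T'.mat_vec_mult[OF ci(1,2), of y] PiE_mem[OF yE] T'.mat_vec_one[OF yE] by (simp add: ci)
  then show "mat_vec T' n c z \<in> segre_cone p T'" using y by simp
qed


end

section \<open>Equations for the stabilizer, its group structure and descent\<close>

context segre_group
begin

text \<open>The entry at position \<open>(a, b)\<close> is a product of two factors equal to
  \<open>1\<close> or \<open>2\<close>, hence a unit, which makes the vector unimodular.\<close>

lemma test_vector_segre_cone:
  fixes T :: "'r alg"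
  assumes T: "algebra R T" and ab: "a < p" "a' < p" "b < p" "b' < p"
  shows "(\<lambda>i\<in>{..<n}. pure_tensor p T (unit_pair T a a') (unit_pair T b b') i) \<in> segre_cone p T"
proof -
  interpret T: cring T by (rule algebraD(2)[OF T])
  let ?z = "pure_tensor p T (unit_pair T a a') (unit_pair T b b')"
  have zc: "?z i \<in> carrier T" if "i < n" for i using that by (intro T.pure_tensor_closed) auto
  have pair: "unit_pair T c c' c \<in> Units T" for c c'
    using two_unit_alg[OF T] by (simp add: unit_pair_def)
  have e: "?z (a * p + b) = unit_pair T a a' a \<otimes>\<^bsub>T\<^esub> unit_pair T b b' b"
    using ab by (simp add: pure_tensor_def)
  have u: "?z (a * p + b) \<in> Units T" unfolding e using pair by (intro T.Units_m_closed)
  have i: "a * p + b < n" using ab by simp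
  have "(\<Oplus>\<^bsub>T\<^esub>i\<in>{..<n}. (if i = a * p + b then inv\<^bsub>T\<^esub> ?z i else \<zero>\<^bsub>T\<^esub>) \<otimes>\<^bsub>T\<^esub> (\<lambda>i\<in>{..<n}. ?z i) i)
      = (\<Oplus>\<^bsub>T\<^esub>i\<in>{..<n}. if i = a * p + b then \<one>\<^bsub>T\<^esub> else \<zero>\<^bsub>T\<^esub>)"
    using zc u by (intro T.finsum_cong') auto
  also have "\<dots> = \<one>\<^bsub>T\<^esub>" using i by (subst T.finsum_delta) auto
  finally have "unimodular T n (\<lambda>i\<in>{..<n}. ?z i)"
    unfolding unimodular_def using zc u
    by (intro conjI bexI[of _ "\<lambda>i. if i = a * p + b then inv\<^bsub>T\<^esub> ?z i else \<zero>\<^bsub>T\<^esub>"]) auto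
  moreover have "segre_minors p T ?z" by (rule T.pure_tensor_minors) auto
  then have "segre_minors p T (\<lambda>i\<in>{..<n}. ?z i)" by (rule segre_minors_eq) simp
  ultimately show ?thesis by (simp add: T.segre_cone_iff)
qed

text \<open>The equations live over \<open>T\<close>, where \<open>g\<close> may have no lift. By
  \<open>PGL_local_lift\<close> it suffices that the difference of the two sides of a minor equation
  vanishes where a lift \<open>d\<close> exists; there the column in question is \<open>d\<close>
  applied to a test vector of the cone, times a scalar.\<close>

lemma G_preserves:
  fixes T :: "'r alg"
  assumes T: "algebra R T" and g: "g \<in> G T"
  shows "preserves_segre p T g"
  unfolding preserves_segre_def segre_test_def segre_minors_def
proof (intro allI impI)
  fix a a' b b' j l x x' y y'
  assume ab: "a < p" "a' < p" "b < p" "b' < p" and jl: "j < n" "l < n"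
    and xy: "x < p" "x' < p" "y < p" "y' < p"
  interpret T: cring T by (rule algebraD(2)[OF T])
  note gi = G_iso[OF g]
  note gh = alg_homD[OF alg_isoD(1)[OF gi]]
  define z where "z = pure_tensor p T (unit_pair T a a') (unit_pair T b b')"
  have zc: "z i \<in> carrier T" if "i < n" for i
    using that unfolding z_def by (intro T.pure_tensor_closed) auto
  define q where "q = (\<lambda>i. g (col_mat n T j z) i l)"
  have Z: "col_mat n T j z \<in> carrier (mat_alg n T)" using zc by simp
  have qc: "q i \<in> carrier T" if "i < n" for i
    unfolding q_def using mat_entry_closed[OF gh(1)[OF Z]] that jl by simp
  have idx: "x * p + y < n" "x' * p + y' < n" "x * p + y' < n" "x' * p + y < n"
    using xy by simp_all
  note c = qc[OF idx(1)] qc[OF idx(2)] qc[OF idx(3)] qc[OF idx(4)]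
  let ?l = "q (x * p + y) \<otimes>\<^bsub>T\<^esub> q (x' * p + y')" and ?r = "q (x * p + y') \<otimes>\<^bsub>T\<^esub> q (x' * p + y)"
  have "?l \<ominus>\<^bsub>T\<^esub> ?r = \<zero>\<^bsub>T\<^esub>"
  proof (rule PGL_local_lift[OF T gi n_pos pp_unit_alg[OF T] infinite_type])
    fix S :: "'r alg" and f d
    assume S: "algebra R S" and f: "f \<in> alg_hom R T S" and d: "d \<in> Units (mat_alg n S)"
      and lift: "inner_aut n S d = PGL_res n T S f g"
    interpret base_hom R T S f n by (rule base_homI[OF T S f])
    note di = T'.mat_inv[OF d]
    let ?w = "\<lambda>i\<in>{..<n}. pure_tensor p S (unit_pair S a a') (unit_pair S b b') i"
    have w: "?w \<in> segre_cone p S" by (rule test_vector_segre_cone[OF S ab])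
    have wc: "?w i \<in> carrier S" if "i < n" for i
      using w that PiE_mem[of ?w "{..<n}" "\<lambda>_. carrier S" i] by (simp add: T'.segre_cone_iff unimodular_def)
    have dw: "mat_vec S n d ?w \<in> segre_cone p S" by (rule G_lift[OF g S f d lift w])
    have dwc: "mat_vec S n d ?w i \<in> carrier S" if "i < n" for i
      by (rule T'.mat_vec_closed(2)[OF di(1) wc that])
    have fq: "f (q i) = mat_vec S n d ?w i \<otimes>\<^bsub>S\<^esub> (inv\<^bsub>mat_alg n S\<^esub> d) j l" if i: "i < n" for i
    proof -
      have "f (q i) = PGL_res n T S f g (col_mat n S j (\<lambda>i. f (z i))) i l"
        unfolding q_def using res_col_mat[where z = z, OF gi zc i jl(2)] by simp
      also have "col_mat n S j (\<lambda>i. f (z i)) = col_mat n S j ?w"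
        unfolding z_def by (rule col_mat_cong) (simp add: f_pure_tensor f_unit_pair)
      also have "PGL_res n T S f g (col_mat n S j ?w) i l = mat_vec S n d ?w i \<otimes>\<^bsub>S\<^esub> (inv\<^bsub>mat_alg n S\<^esub> d) j l"
        unfolding lift[symmetric] by (rule inner_aut_col_mat[OF T'.is_cring d wc i jl(2,1)])
      finally show ?thesis .
    qed
    have "segre_minors p S (\<lambda>i. mat_vec S n d ?w i \<otimes>\<^bsub>S\<^esub> (inv\<^bsub>mat_alg n S\<^esub> d) j l)"
      using dw dwc mat_entry_closed[OF di(2) jl]
      by (intro T'.segre_minors_mult) (auto simp: T'.segre_cone_iff)
    then have "segre_minors p S (\<lambda>i. f (q i))" by (rule segre_minors_eq) (rule fq)
    from segre_minorsD[OF this xy] show "f (?l \<ominus>\<^bsub>T\<^esub> ?r) = \<zero>\<^bsub>S\<^esub>"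
      using c by (simp add: f_minus)
  qed (use c in simp)
  then have "?l = ?r" using c by simp
  then show "g (col_mat n T j (pure_tensor p T (unit_pair T a a') (unit_pair T b b'))) (x * p + y) l \<otimes>\<^bsub>T\<^esub>
      g (col_mat n T j (pure_tensor p T (unit_pair T a a') (unit_pair T b b'))) (x' * p + y') l
    = g (col_mat n T j (pure_tensor p T (unit_pair T a a') (unit_pair T b b'))) (x * p + y') l \<otimes>\<^bsub>T\<^esub>
      g (col_mat n T j (pure_tensor p T (unit_pair T a a') (unit_pair T b b'))) (x' * p + y) l"
    by (simp only: q_def z_def)
qed

text \<open>With \<open>G_preserves\<close> this characterizes \<open>G_pp\<close> by equations over
  \<open>T\<close> itself. The inverse enters with its own equations, because lifts are required to
  map the cone onto itself and not merely into itself.\<close>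

lemma preserves_segre_G:
  fixes T :: "'r alg"
  assumes T: "algebra R T" and g: "g \<in> alg_iso T (mat_alg n T) (mat_alg n T)"
    and 1: "preserves_segre p T g" and 2: "preserves_segre p T (inv\<^bsub>sect (PGL n) T\<^esub> g)"
  shows "g \<in> G T"
proof (rule G_I[OF T g])
  have lift: "mat_vec S n c z \<in> segre_cone p S"
    if h: "h \<in> alg_iso T (mat_alg n T) (mat_alg n T)" "preserves_segre p T h"
      and S: "algebra R S" "f \<in> alg_hom R T S" and c: "c \<in> Units (mat_alg n S)"
      "inner_aut n S c = PGL_res n T S f h" "z \<in> segre_cone p S" for S :: "'r alg" and f c h z
    using base_hom.preserves_segre_res[OF base_homI[OF T S] h(1) refl h(2)] c
      preserves_segre_lift[OF algebraD(2)[OF S(1)] two_unit_alg[OF S(1)] p_pos c(1) _ c(3)] by simp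
  show "mat_vec S n c z \<in> segre_cone p S" if "algebra R S" "f \<in> alg_hom R T S" "c \<in> Units (mat_alg n S)"
      "inner_aut n S c = PGL_res n T S f g" "z \<in> segre_cone p S" for S :: "'r alg" and f c z
    by (rule lift[OF g 1 that])
  show "mat_vec S n c z \<in> segre_cone p S" if "algebra R S" "f \<in> alg_hom R T S" "c \<in> Units (mat_alg n S)"
      "inner_aut n S c = PGL_res n T S f (inv\<^bsub>sect (PGL n) T\<^esub> g)" "z \<in> segre_cone p S" for S :: "'r alg" and f c z
    by (rule lift[OF inv_PGL(1)[OF T g] 2 that])
qed

text \<open>A lift \<open>c\<close> of the product need not factor over \<open>S\<close> into lifts
  of \<open>g\<close> and \<open>h\<close>. Where \<open>h\<close> has a lift \<open>d\<close>,
  however, \<open>c\<close> times the inverse of \<open>d\<close> is a lift of \<open>g\<close>, so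
  \<open>c z\<close> is obtained from \<open>z\<close> by two matrices that preserve the cone. The
  resulting minor equations hold locally, hence over \<open>S\<close>.\<close>

lemma G_mult_lift:
  fixes T S :: "'r alg"
  assumes T: "algebra R T" and g: "g \<in> G T" and h: "h \<in> G T"
    and S: "algebra R S" and f: "f \<in> alg_hom R T S" and c: "c \<in> Units (mat_alg n S)"
    and lift: "inner_aut n S c = PGL_res n T S f (compose (carrier (mat_alg n T)) g h)"
    and z: "z \<in> segre_cone p S"
  shows "mat_vec S n c z \<in> segre_cone p S"
proof -
  interpret B: base_hom R T S f n by (rule base_homI[OF T S f])
  note gi = G_iso[OF g] and hi = G_iso[OF h]
  note ci = B.T'.mat_inv[OF c]
  have zu: "unimodular S n z" using z by (simp add: B.T'.segre_cone_iff)
  have zc: "z i \<in> carrier S" if "i < n" for i using zu that by (auto simp: unimodular_def)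
  let ?q = "mat_vec S n c z"
  have qc: "?q i \<in> carrier S" if "i < n" for i by (rule B.T'.mat_vec_closed(2)[OF ci(1) zc that])
  have "segre_minors p S ?q"
    unfolding segre_minors_def
  proof (intro allI impI)
    fix x x' y y' assume xy: "x < p" "x' < p" "y < p" "y' < p"
    have idx: "x * p + y < n" "x' * p + y' < n" "x * p + y' < n" "x' * p + y < n"
      using xy by simp_all
    note cl = qc[OF idx(1)] qc[OF idx(2)] qc[OF idx(3)] qc[OF idx(4)]
    let ?l = "?q (x * p + y) \<otimes>\<^bsub>S\<^esub> ?q (x' * p + y')" and ?r = "?q (x * p + y') \<otimes>\<^bsub>S\<^esub> ?q (x' * p + y)"
    have "?l \<ominus>\<^bsub>S\<^esub> ?r = \<zero>\<^bsub>S\<^esub>"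
    proof (rule PGL_local_lift[OF S B.PGL_res(1)[OF hi] n_pos pp_unit_alg[OF S] infinite_type])
      fix S' :: "'r alg" and f' d
      assume S': "algebra R S'" and f': "f' \<in> alg_hom R S S'" and d: "d \<in> Units (mat_alg n S')"
        and dlift: "inner_aut n S' d = PGL_res n S S' f' (PGL_res n T S f h)"
      interpret C: base_hom R S S' f' n by (rule base_homI[OF S S' f'])
      have ff: "compose (carrier T) f' f \<in> alg_hom R T S'"
        using alg_hom_compose[OF f f'] algebraD(3,5)[OF T] by blast
      note tr = PGL_res_trans[OF base_homI[OF T S f] base_homI[OF S S' f']]
      note di = C.T'.mat_inv[OF d]
      let ?fc = "mat_map n f' c" and ?fz = "\<lambda>i\<in>{..<n}. f' (z i)"
      note fc = C.mm_Units[OF c]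
      note fci = C.T'.mat_inv[OF fc(1)]
      have fz: "?fz \<in> segre_cone p S'" by (rule C.f_segre_cone[OF z])
      have fzE: "?fz \<in> {..<n} \<rightarrow>\<^sub>E carrier S'" using zc by auto
      have dz: "mat_vec S' n d ?fz \<in> segre_cone p S'"
        using G_lift[OF h S' ff d _ fz] dlift tr[OF hi] by simp
      let ?e = "?fc \<otimes>\<^bsub>mat_alg n S'\<^esub> inv\<^bsub>mat_alg n S'\<^esub> d"
      have eu: "?e \<in> Units (mat_alg n S')" by (rule monoid.Units_m_closed[OF C.T'.mat_monoid fc(1) di(3)])
      have "inner_aut n S' ?e = compose (carrier (mat_alg n S')) (inner_aut n S' ?fc) (inner_aut n S' (inv\<^bsub>mat_alg n S'\<^esub> d))"
        by (rule inner_aut_mult[OF C.T'.is_cring fc(1) di(3)])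
      also have "inner_aut n S' ?fc = compose (carrier (mat_alg n S')) (PGL_res n T S' (compose (carrier T) f' f) g)
          (inner_aut n S' d)"
        using fc(3) lift B.PGL_res_compose[OF gi hi]
          C.PGL_res_compose[OF B.PGL_res(1)[OF gi] B.PGL_res(1)[OF hi]] tr[OF gi] dlift by simp
      also have "compose (carrier (mat_alg n S')) (compose (carrier (mat_alg n S'))
          (PGL_res n T S' (compose (carrier T) f' f) g) (inner_aut n S' d)) (inner_aut n S' (inv\<^bsub>mat_alg n S'\<^esub> d))
        = PGL_res n T S' (compose (carrier T) f' f) g"
      proof -
        interpret P: group "sect (PGL n) S'" by (rule group_PGL[OF C.T'.is_cring])
        have gc: "PGL_res n T S' (compose (carrier T) f' f) g \<in> carrier (sect (PGL n) S')"
          using base_hom.PGL_res(1)[OF base_homI[OF T S' ff] gi] by simp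
        have dc: "inner_aut n S' d \<in> carrier (sect (PGL n) S')" using inner_aut_iso(1)[OF C.T'.is_cring d] by simp
        show ?thesis
          using P.m_assoc[OF gc dc P.inv_closed[OF dc]] P.r_inv[OF dc] P.r_one[OF gc]
            inner_aut_iso(2)[OF C.T'.is_cring d] by simp
      qed
      finally have elift: "inner_aut n S' ?e = PGL_res n T S' (compose (carrier T) f' f) g" .
      have "mat_vec S' n ?e (mat_vec S' n d ?fz) = mat_vec S' n ?fc ?fz"
      proof -
        have "?e \<otimes>\<^bsub>mat_alg n S'\<^esub> d = ?fc"
          using fci di monoid.m_assoc[OF C.T'.mat_monoid fci(1) di(2,1)]
            monoid.r_one[OF C.T'.mat_monoid fci(1)] by simp
        moreover have "?e \<in> carrier (mat_alg n S')"
          using monoid.m_closed[OF C.T'.mat_monoid fci(1) di(2)] .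
        ultimately show ?thesis
          using C.T'.mat_vec_mult[OF _ di(1), of ?e ?fz] PiE_mem[OF fzE] by simp
      qed
      then have "mat_vec S' n ?fc ?fz \<in> segre_cone p S'"
        using G_lift[OF g S' ff eu elift dz] by simp
      then have "segre_minors p S' (mat_vec S' n ?fc ?fz)" by (simp add: C.T'.segre_cone_iff)
      then have "segre_minors p S' (\<lambda>i. f' (?q i))"
        by (rule segre_minors_eq) (rule C.f_mat_vec[OF ci(1) zc, symmetric])
      from segre_minorsD[OF this xy] show "f' (?l \<ominus>\<^bsub>S\<^esub> ?r) = \<zero>\<^bsub>S'\<^esub>"
        using cl by (simp add: C.f_minus)
    qed (use cl in simp)
    then show "?l = ?r" using cl by simp
  qed
  then show ?thesis using B.T'.mat_vec_unimodular[OF zu c] by (simp add: B.T'.segre_cone_iff)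
qed

lemma G_mult:
  fixes T :: "'r alg"
  assumes T: "algebra R T" and g: "g \<in> G T" and h: "h \<in> G T"
  shows "compose (carrier (mat_alg n T)) g h \<in> G T"
proof (rule G_I[OF T])
  interpret T: cring T by (rule algebraD(2)[OF T])
  interpret P: group "sect (PGL n) T" by (rule group_PGL[OF T.is_cring])
  note gi = G_iso[OF g] and hi = G_iso[OF h]
  show "compose (carrier (mat_alg n T)) g h \<in> alg_iso T (mat_alg n T) (mat_alg n T)"
    using P.m_closed[of g h] gi hi by simp
  have inv: "inv\<^bsub>sect (PGL n) T\<^esub> (compose (carrier (mat_alg n T)) g h)
      = compose (carrier (mat_alg n T)) (inv\<^bsub>sect (PGL n) T\<^esub> h) (inv\<^bsub>sect (PGL n) T\<^esub> g)"
    using P.inv_mult_group[of g h] gi hi by simp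
  fix S :: "'r alg" and f c z
  assume S: "algebra R S" "f \<in> alg_hom R T S" and c: "c \<in> Units (mat_alg n S)" and z: "z \<in> segre_cone p S"
  show "mat_vec S n c z \<in> segre_cone p S"
    if "inner_aut n S c = PGL_res n T S f (compose (carrier (mat_alg n T)) g h)"
    by (rule G_mult_lift[OF T g h S c that z])
  show "mat_vec S n c z \<in> segre_cone p S"
    if "inner_aut n S c = PGL_res n T S f (inv\<^bsub>sect (PGL n) T\<^esub> (compose (carrier (mat_alg n T)) g h))"
    using that unfolding inv by (rule G_mult_lift[OF T G_inv[OF T h] G_inv[OF T g] S c _ z])
qed

lemma G_one:
  fixes T :: "'r alg"
  assumes T: "algebra R T"
  shows "(\<lambda>M\<in>carrier (mat_alg n T). M) \<in> G T"
proof -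
  interpret T: cring T by (rule algebraD(2)[OF T])
  interpret P: group "sect (PGL n) T" by (rule group_PGL[OF T.is_cring])
  let ?i = "\<lambda>M\<in>carrier (mat_alg n T). M"
  have "preserves_segre p T ?i"
    unfolding preserves_segre_def segre_test_def
  proof (intro allI impI)
    fix a a' b b' j l assume "a < p" "a' < p" "b < p" "b' < p" and jl: "j < n" "l < n"
    let ?z = "pure_tensor p T (unit_pair T a a') (unit_pair T b b')"
    have zc: "?z i \<in> carrier T" if "i < n" for i using that by (intro T.pure_tensor_closed) auto
    then have Z: "col_mat n T j ?z \<in> carrier (mat_alg n T)" by simp
    \<comment> \<open>Column \<open>l\<close> of the test matrix is the test vector itself for
      \<open>l = j\<close> and zero otherwise.\<close>
    have "segre_minors p T (\<lambda>i. ?z i \<otimes>\<^bsub>T\<^esub> (if l = j then \<one>\<^bsub>T\<^esub> else \<zero>\<^bsub>T\<^esub>))"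
      using zc by (intro T.segre_minors_mult T.pure_tensor_minors) auto
    then show "segre_minors p T (\<lambda>i. ?i (col_mat n T j ?z) i l)"
      by (rule segre_minors_eq) (use Z zc jl in auto)
  qed
  then show ?thesis using P.one_closed P.inv_one by (intro preserves_segre_G[OF T]) auto
qed

lemma group_G:
  fixes T :: "'r alg"
  assumes T: "algebra R T"
  shows "subgroup (G T) (sect (PGL n) T)" "group (sect (G_pp R p) T)"
    and "g \<in> G T \<Longrightarrow> inv\<^bsub>sect (G_pp R p) T\<^esub> g = inv\<^bsub>sect (PGL n) T\<^esub> g"
proof -
  interpret P: group "sect (PGL n) T" by (rule group_PGL[OF algebraD(2)[OF T]])
  show sub: "subgroup (G T) (sect (PGL n) T)"
  proof (rule P.subgroupI)
    show "G T \<subseteq> carrier (sect (PGL n) T)" using G_iso by auto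
    show "G T \<noteq> {}" using G_one[OF T] by blast
  qed (use G_inv[OF T] G_mult[OF T] in auto)
  have e: "sect (G_pp R p) T = (sect (PGL n) T)\<lparr>carrier := G T\<rparr>" by (simp add: G_pp_def)
  show "group (sect (G_pp R p) T)" using subgroup.subgroup_is_group[OF sub P.is_group] e by simp
  show "inv\<^bsub>sect (G_pp R p) T\<^esub> g = inv\<^bsub>sect (PGL n) T\<^esub> g" if "g \<in> G T"
    using P.m_inv_consistent[OF sub that] e by simp
qed

lemma G_res:
  fixes T T' :: "'r alg"
  assumes T: "algebra R T" "algebra R T'" "f \<in> alg_hom R T T'" and g: "g \<in> G T"
  shows "PGL_res n T T' f g \<in> G T'"
proof -
  interpret base_hom R T T' f n by (rule base_homI[OF assms(1-3)])
  note gi = G_iso[OF g]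
  show ?thesis
    using preserves_segre_res[OF gi refl G_preserves[OF assms(1) g]]
      preserves_segre_res[OF G_iso[OF G_inv[OF assms(1) g]] refl G_preserves[OF assms(1) G_inv[OF assms(1) g]]]
      PGL_res_inv[OF gi] PGL_res(1)[OF gi]
    by (intro preserves_segre_G[OF assms(2)]) auto
qed

text \<open>Each equation says that one element of \<open>T\<close> is zero. Restriction commutes
  with forming the equation, since the test vectors are compatible with base change, and
  \<open>fppf_covering_zero\<close> detects zero on a covering.\<close>

lemma preserves_segre_descent:
  fixes T :: "'r alg"
  assumes T: "algebra R T" and g: "g \<in> alg_iso T (mat_alg n T) (mat_alg n T)"
    and C: "fppf_covering R T C"
    and loc: "\<And>T' f. (T', f) \<in> C \<Longrightarrow> preserves_segre p T' (PGL_res n T T' f g)"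
  shows "preserves_segre p T g"
  unfolding preserves_segre_def segre_test_def segre_minors_def
proof (intro allI impI)
  fix a a' b b' j l x x' y y'
  assume ab: "a < p" "a' < p" "b < p" "b' < p" and jl: "j < n" "l < n"
    and xy: "x < p" "x' < p" "y < p" "y' < p"
  interpret T: cring T by (rule algebraD(2)[OF T])
  note gh = alg_homD[OF alg_isoD(1)[OF g]]
  define z where "z = pure_tensor p T (unit_pair T a a') (unit_pair T b b')"
  have zc: "z i \<in> carrier T" if "i < n" for i
    using that unfolding z_def by (intro T.pure_tensor_closed) auto
  define q where "q = (\<lambda>i. g (col_mat n T j z) i l)"
  have Z: "col_mat n T j z \<in> carrier (mat_alg n T)" using zc by simp
  have qc: "q i \<in> carrier T" if "i < n" for i
    unfolding q_def using mat_entry_closed[OF gh(1)[OF Z]] that jl by simp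
  have idx: "x * p + y < n" "x' * p + y' < n" "x * p + y' < n" "x' * p + y < n"
    using xy by simp_all
  note c = qc[OF idx(1)] qc[OF idx(2)] qc[OF idx(3)] qc[OF idx(4)]
  let ?l = "q (x * p + y) \<otimes>\<^bsub>T\<^esub> q (x' * p + y')" and ?r = "q (x * p + y') \<otimes>\<^bsub>T\<^esub> q (x' * p + y)"
  have "?l \<ominus>\<^bsub>T\<^esub> ?r = \<zero>\<^bsub>T\<^esub>"
  proof (rule fppf_covering_zero[OF T C])
    fix S f assume Sf: "(S, f) \<in> C"
    then have S: "algebra R S" and f: "f \<in> alg_hom R T S" using C unfolding fppf_covering_def by blast+
    interpret base_hom R T S f n by (rule base_homI[OF T S f])
    let ?w = "pure_tensor p S (unit_pair S a a') (unit_pair S b b')"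
    have "col_mat n S j (\<lambda>i. f (z i)) = col_mat n S j ?w"
      unfolding z_def by (rule col_mat_cong) (simp add: f_pure_tensor f_unit_pair)
    then have fq: "f (q i) = PGL_res n T S f g (col_mat n S j ?w) i l" if "i < n" for i
      using res_col_mat[where z = z and j = j, OF g zc that jl(2)] unfolding q_def by metis
    have "segre_minors p S (\<lambda>i. PGL_res n T S f g (col_mat n S j ?w) i l)"
      using loc[OF Sf] ab jl unfolding preserves_segre_def segre_test_def by simp
    then have "segre_minors p S (\<lambda>i. f (q i))" by (rule segre_minors_eq) (rule fq)
    from segre_minorsD[OF this xy] show "f (?l \<ominus>\<^bsub>T\<^esub> ?r) = \<zero>\<^bsub>S\<^esub>"
      using c by (simp add: f_minus)
  qed (use c in simp)
  then have "?l = ?r" using c by simp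
  then show "g (col_mat n T j (pure_tensor p T (unit_pair T a a') (unit_pair T b b'))) (x * p + y) l \<otimes>\<^bsub>T\<^esub>
      g (col_mat n T j (pure_tensor p T (unit_pair T a a') (unit_pair T b b'))) (x' * p + y') l
    = g (col_mat n T j (pure_tensor p T (unit_pair T a a') (unit_pair T b b'))) (x * p + y') l \<otimes>\<^bsub>T\<^esub>
      g (col_mat n T j (pure_tensor p T (unit_pair T a a') (unit_pair T b b'))) (x' * p + y) l"
    by (simp only: q_def z_def)
qed

lemma G_descent:
  fixes T :: "'r alg"
  assumes T: "algebra R T" and g: "g \<in> alg_iso T (mat_alg n T) (mat_alg n T)"
    and C: "fppf_covering R T C" and loc: "\<And>T' f. (T', f) \<in> C \<Longrightarrow> PGL_res n T T' f g \<in> G T'"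
  shows "g \<in> G T"
proof (rule preserves_segre_G[OF T g])
  have alg: "algebra R T'" "f \<in> alg_hom R T T'" if "(T', f) \<in> C" for T' f
    using C that unfolding fppf_covering_def by blast+
  show "preserves_segre p T g"
    using G_preserves[OF alg(1) loc] by (intro preserves_segre_descent[OF T g C])
  have "preserves_segre p T' (PGL_res n T T' f (inv\<^bsub>sect (PGL n) T\<^esub> g))" if Tf: "(T', f) \<in> C" for T' f
    using G_preserves[OF alg(1)[OF Tf] G_inv[OF alg(1)[OF Tf] loc[OF Tf]]]
      base_hom.PGL_res_inv[OF base_homI[OF T alg[OF Tf]] g] by simp
  then show "preserves_segre p T (inv\<^bsub>sect (PGL n) T\<^esub> g)"
    by (intro preserves_segre_descent[OF T inv_PGL(1)[OF T g] C])
qed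

end

section \<open>Torsors of split algebras\<close>

locale split_torsor =
  fixes R :: "('r, 'm) ring_scheme" and n :: nat and A :: "('r, 'a) module" and \<phi> :: "'a \<Rightarrow> 'r matrix"
  assumes base_ring: "cring R" and A: "is_algebra R A" and \<phi>: "\<phi> \<in> alg_iso R A (mat_alg n R)"
begin

abbreviation \<Psi> where "\<Psi> T \<equiv> base_change_mat R n \<phi> A T"

text \<open>The splitting makes \<open>P(A)\<close> the trivial torsor: composing with the
  trivialization turns its points into automorphisms of the matrix algebra, compatibly with the
  action by composition on the right.\<close>

definition to_PGL :: "'r alg \<Rightarrow> ('r, 'a) triv \<Rightarrow> 'r matrix \<Rightarrow> 'r matrix" where
  "to_PGL T \<theta> = compose (carrier (mat_alg n T)) (\<Psi> T) \<theta>"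

definition from_PGL :: "'r alg \<Rightarrow> ('r matrix \<Rightarrow> 'r matrix) \<Rightarrow> ('r, 'a) triv" where
  "from_PGL T g = compose (carrier (mat_alg n T)) (iso_inv (base_change R T A) (mat_alg n T) (\<Psi> T)) g"

lemma to_PGL:
  assumes T: "algebra R T" and \<theta>: "\<theta> \<in> torsor R n A T"
  shows "to_PGL T \<theta> \<in> alg_iso T (mat_alg n T) (mat_alg n T)"
  unfolding to_PGL_def
  using \<theta> base_change_mat_iso[OF A \<phi> T] cring.mat_is_algebra[OF algebraD(2)[OF T]]
  by (intro alg_iso_compose) (auto simp: torsor_def)

lemma from_PGL:
  assumes T: "algebra R T" and g: "g \<in> alg_iso T (mat_alg n T) (mat_alg n T)"
  shows "from_PGL T g \<in> torsor R n A T"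
  unfolding from_PGL_def torsor_def
  by (rule alg_iso_compose[OF g iso_inv_iso[OF base_change_mat_iso[OF A \<phi> T] base_change_algebra[OF A \<phi> T]]
        cring.mat_is_algebra[OF algebraD(2)[OF T]]])

lemma from_to_PGL:
  assumes T: "algebra R T" and \<theta>: "\<theta> \<in> torsor R n A T"
  shows "from_PGL T (to_PGL T \<theta>) = \<theta>"
proof -
  have t: "\<theta> \<in> alg_hom T (mat_alg n T) (base_change R T A)" using \<theta> by (simp add: torsor_def alg_iso_def)
  show ?thesis
  proof (rule alg_hom_eqI[OF alg_isoD(1) t])
    show "from_PGL T (to_PGL T \<theta>) \<in> alg_iso T (mat_alg n T) (base_change R T A)"
      using from_PGL[OF T to_PGL[OF T \<theta>]] by (simp add: torsor_def)
    show "from_PGL T (to_PGL T \<theta>) M = \<theta> M" if "M \<in> carrier (mat_alg n T)" for M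
      using that iso_inv_cancel(1)[OF base_change_mat_iso[OF A \<phi> T]] alg_homD(1)[OF t]
      by (simp add: from_PGL_def to_PGL_def compose_eq)
  qed
qed

lemma to_from_PGL:
  assumes T: "algebra R T" and g: "g \<in> alg_iso T (mat_alg n T) (mat_alg n T)"
  shows "to_PGL T (from_PGL T g) = g"
proof (rule alg_hom_eqI[OF alg_isoD(1)[OF to_PGL[OF T from_PGL[OF T g]]] alg_isoD(1)[OF g]])
  show "to_PGL T (from_PGL T g) M = g M" if "M \<in> carrier (mat_alg n T)" for M
    using that iso_inv_cancel(2)[OF base_change_mat_iso[OF A \<phi> T]] alg_homD(1)[OF alg_isoD(1)[OF g]]
    by (simp add: from_PGL_def to_PGL_def compose_eq)
qed

lemma to_PGL_inj:
  assumes "algebra R T" "\<theta> \<in> torsor R n A T" "\<theta>' \<in> torsor R n A T" "to_PGL T \<theta> = to_PGL T \<theta>'"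
  shows "\<theta> = \<theta>'"
  using from_to_PGL assms by metis

lemma torsor_compose:
  assumes T: "algebra R T" and \<theta>: "\<theta> \<in> torsor R n A T" and g: "g \<in> alg_iso T (mat_alg n T) (mat_alg n T)"
  shows "compose (carrier (mat_alg n T)) \<theta> g \<in> torsor R n A T"
    and "to_PGL T (compose (carrier (mat_alg n T)) \<theta> g) = compose (carrier (mat_alg n T)) (to_PGL T \<theta>) g"
proof -
  show "compose (carrier (mat_alg n T)) \<theta> g \<in> torsor R n A T"
    using \<theta> g cring.mat_is_algebra[OF algebraD(2)[OF T]] unfolding torsor_def by (intro alg_iso_compose)
  show "to_PGL T (compose (carrier (mat_alg n T)) \<theta> g) = compose (carrier (mat_alg n T)) (to_PGL T \<theta>) g"
    using alg_homD(1)[OF alg_isoD(1)[OF g]] by (auto simp: to_PGL_def compose_def fun_eq_iff)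
qed

text \<open>The restriction of a point is specified by a \<open>THE\<close>. Its existence is
  inherited from \<open>PGL_res\<close> through the naturality of the trivializations, its
  uniqueness from \<open>semilinear_unique\<close>.\<close>

lemma torsor_res:
  assumes T: "algebra R T" "algebra R T'" "f \<in> alg_hom R T T'" and \<theta>: "\<theta> \<in> torsor R n A T"
  shows "torsor_res R n A T T' f \<theta> \<in> torsor R n A T'"
    and "to_PGL T' (torsor_res R n A T T' f \<theta>) = PGL_res n T T' f (to_PGL T \<theta>)"
proof -
  interpret B: base_hom R T T' f n using assms by (simp add: base_hom_def)
  note toP = to_PGL[OF T(1) \<theta>]
  note res = B.PGL_res[OF toP]
  define \<theta>' where "\<theta>' = from_PGL T' (PGL_res n T T' f (to_PGL T \<theta>))"
  have t': "\<theta>' \<in> torsor R n A T'" unfolding \<theta>'_def by (rule from_PGL[OF T(2) res(1)])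
  have t: "\<theta> \<in> alg_hom T (mat_alg n T) (base_change R T A)" using \<theta> by (simp add: torsor_def alg_iso_def)
  have nat': "\<theta>' (mat_map n f M) = base_change_map R T' A f (\<theta> M)" if M: "M \<in> carrier (mat_alg n T)" for M
  proof -
    note bc = base_change_mat_natural[OF A \<phi> T alg_homD(1)[OF t M]]
    have "\<theta>' (mat_map n f M) = iso_inv (base_change R T' A) (mat_alg n T') (\<Psi> T') (mat_map n f (\<Psi> T (\<theta> M)))"
      using M res(2)[OF M] by (simp add: \<theta>'_def from_PGL_def to_PGL_def compose_eq)
    then show ?thesis
      using iso_inv_cancel(1)[OF base_change_mat_iso[OF A \<phi> T(2)] bc(1)] bc(2) by simp
  qed
  have uniq: "\<theta>'' = \<theta>'" if "\<theta>'' \<in> torsor R n A T'"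
      "\<forall>M\<in>carrier (mat_alg n T). \<theta>'' (mat_map n f M) = base_change_map R T' A f (\<theta> M)" for \<theta>''
    using that t' nat' is_algebraD(1)[OF base_change_algebra[OF A \<phi> T(2)]]
    by (intro B.semilinear_unique[of \<theta>'' "base_change R T' A" \<theta>']) (auto simp: torsor_def alg_iso_def)
  have e: "torsor_res R n A T T' f \<theta> = \<theta>'"
    unfolding torsor_res_def by (rule the_equality) (use t' nat' uniq in blast)+
  show "torsor_res R n A T T' f \<theta> \<in> torsor R n A T'" using e t' by simp
  show "to_PGL T' (torsor_res R n A T T' f \<theta>) = PGL_res n T T' f (to_PGL T \<theta>)"
    unfolding e \<theta>'_def by (rule to_from_PGL[OF T(2) res(1)])
qed

abbreviation X0 :: "'r alg" where "X0 \<equiv> self_algebra R"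
abbreviation id_PGL :: "'r alg \<Rightarrow> 'r matrix \<Rightarrow> 'r matrix" where
  "id_PGL T \<equiv> (\<lambda>M\<in>carrier (mat_alg n T). M)"

lemma algebra_X0: "algebra R X0"
  by (rule cring.algebra_self[OF base_ring])

lemma id_PGL: "algebra R T \<Longrightarrow> id_PGL T \<in> alg_iso T (mat_alg n T) (mat_alg n T)"
  using monoid.one_closed[OF group.is_monoid[OF group_PGL[OF algebraD(2)]], of R T n] by simp

lemma azumaya_split: "azumaya R n A"
proof -
  have "torsor R n A X0 \<noteq> {}" using from_PGL[OF algebra_X0 id_PGL[OF algebra_X0]] by blast
  then show ?thesis
    unfolding azumaya_def using A fppf_covering_id[OF algebra_X0] by blast
qed

end

locale split_segre = segre_group R p + split_torsor R "p * p" A \<phi>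
  for R :: "('r, 'm) ring_scheme" and p and A :: "('r, 'a) module" and \<phi>
begin

definition subsystem :: "'r alg \<Rightarrow> ('r, 'a) triv set" where
  "subsystem T = {\<theta> \<in> torsor R n A T. to_PGL T \<theta> \<in> G T}"

text \<open>Through \<open>to_PGL\<close> the conditions become facts about \<open>G_pp\<close>:
  stability under restriction is base change, the sheaf condition is descent, and the action is
  closure under products. Simple transitivity uses the inverse of \<open>to_PGL T \<theta>\<close>
  times \<open>to_PGL T \<theta>'\<close>, and the point corresponding to the identity lies over the
  base itself.\<close>

lemma subsystem_structure: "is_subsystem_structure R p A subsystem"
  unfolding is_subsystem_structure_def
proof (intro conjI allI impI)
  fix T :: "'r alg" assume T: "algebra R T"
  interpret P: group "sect (PGL n) T" by (rule group_PGL[OF algebraD(2)[OF T]])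
  have PI: "to_PGL T \<theta> \<in> carrier (sect (PGL n) T)" if "\<theta> \<in> subsystem T" for \<theta>
    using that to_PGL[OF T] by (simp add: subsystem_def)
  show "subsystem T \<subseteq> torsor R n A T" by (auto simp: subsystem_def)
  show "torsor_res R n A T T' f \<in> subsystem T \<rightarrow> subsystem T'"
    if "algebra R T' \<and> f \<in> alg_hom R T T'" for T' f
    using that torsor_res[OF T, of T' f] G_res[OF T, of T' f] by (auto simp: subsystem_def)
  show "\<forall>\<theta>\<in>torsor R n A T. \<forall>C. fppf_covering R T C \<and>
      (\<forall>(T', f)\<in>C. torsor_res R n A T T' f \<theta> \<in> subsystem T') \<longrightarrow> \<theta> \<in> subsystem T"
  proof (intro ballI allI impI)
    fix \<theta> C assume \<theta>: "\<theta> \<in> torsor R n A T"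
      and C: "fppf_covering R T C \<and> (\<forall>(T', f)\<in>C. torsor_res R n A T T' f \<theta> \<in> subsystem T')"
    have "PGL_res n T T' f (to_PGL T \<theta>) \<in> G T'" if Tf: "(T', f) \<in> C" for T' f
    proof -
      have "algebra R T'" "f \<in> alg_hom R T T'" using C Tf unfolding fppf_covering_def by blast+
      moreover have "to_PGL T' (torsor_res R n A T T' f \<theta>) \<in> G T'" using C Tf unfolding subsystem_def by blast
      ultimately show ?thesis using torsor_res(2)[OF T _ _ \<theta>] by simp
    qed
    then have "to_PGL T \<theta> \<in> G T" using C by (intro G_descent[OF T to_PGL[OF T \<theta>]]) auto
    then show "\<theta> \<in> subsystem T" using \<theta> by (simp add: subsystem_def)
  qed
  show "\<forall>\<theta>\<in>subsystem T. \<forall>g\<in>G T. compose (carrier (mat_alg n T)) \<theta> g \<in> subsystem T"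
  proof (intro ballI)
    fix \<theta> g assume \<theta>: "\<theta> \<in> subsystem T" and g: "g \<in> G T"
    then show "compose (carrier (mat_alg n T)) \<theta> g \<in> subsystem T"
      using torsor_compose[OF T _ G_iso[OF g], of \<theta>] G_mult[OF T _ g, of "to_PGL T \<theta>"]
      by (simp add: subsystem_def)
  qed
  show "\<forall>\<theta>\<in>subsystem T. \<forall>\<theta>'\<in>subsystem T. \<exists>!g. g \<in> G T \<and> \<theta>' = compose (carrier (mat_alg n T)) \<theta> g"
  proof (intro ballI)
    fix \<theta> \<theta>' assume t: "\<theta> \<in> subsystem T" "\<theta>' \<in> subsystem T"
    then have \<theta>: "\<theta> \<in> torsor R n A T" "to_PGL T \<theta> \<in> G T" and \<theta>': "\<theta>' \<in> torsor R n A T" "to_PGL T \<theta>' \<in> G T"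
      by (auto simp: subsystem_def)
    define g where "g = compose (carrier (mat_alg n T)) (inv\<^bsub>sect (PGL n) T\<^esub> (to_PGL T \<theta>)) (to_PGL T \<theta>')"
    have g: "g \<in> G T" unfolding g_def by (rule G_mult[OF T G_inv[OF T \<theta>(2)] \<theta>'(2)])
    have iff: "\<theta>' = compose (carrier (mat_alg n T)) \<theta> h \<longleftrightarrow> h = g" if h: "h \<in> G T" for h
    proof -
      have hP: "h \<in> carrier (sect (PGL n) T)" using G_iso[OF h] by simp
      have "\<theta>' = compose (carrier (mat_alg n T)) \<theta> h \<longleftrightarrow> to_PGL T \<theta>' = compose (carrier (mat_alg n T)) (to_PGL T \<theta>) h"
        using torsor_compose[OF T \<theta>(1) G_iso[OF h]] to_PGL_inj[OF T \<theta>'(1)] by metis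
      also have "\<dots> \<longleftrightarrow> h = g"
        using P.inv_solve_left[OF hP PI[OF t(1)] PI[OF t(2)]] by (auto simp: g_def)
      finally show ?thesis .
    qed
    then show "\<exists>!g. g \<in> G T \<and> \<theta>' = compose (carrier (mat_alg n T)) \<theta> g" using g by blast
  qed
next
  have "from_PGL X0 (id_PGL X0) \<in> subsystem X0"
    using from_PGL[OF algebra_X0 id_PGL[OF algebra_X0]] to_from_PGL[OF algebra_X0 id_PGL[OF algebra_X0]]
      G_one[OF algebra_X0] by (simp add: subsystem_def)
  then show "\<exists>C. fppf_covering R X0 C \<and> (\<forall>(T, f)\<in>C. subsystem T \<noteq> {})"
    using fppf_covering_id[OF algebra_X0] by blast
qed

end

section \<open>Cohomology classes of split algebras\<close>

lemma H1_equiv_props: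
  "(x, x) \<in> H1_equiv R G"
  "(x, y) \<in> H1_step R G \<Longrightarrow> (x, y) \<in> H1_equiv R G"
  "(x, y) \<in> H1_equiv R G \<Longrightarrow> (y, x) \<in> H1_equiv R G"
  "(x, y) \<in> H1_equiv R G \<Longrightarrow> (y, z) \<in> H1_equiv R G \<Longrightarrow> (x, z) \<in> H1_equiv R G"
proof -
  show "(x, y) \<in> H1_equiv R G \<Longrightarrow> (y, x) \<in> H1_equiv R G"
    unfolding H1_equiv_def by (rule symD[OF sym_rtrancl]) (auto simp: sym_def)
qed (auto simp: H1_equiv_def intro: rtrancl_trans)

context split_torsor
begin

abbreviation triv :: "('r, 'r matrix \<Rightarrow> 'r matrix) cochain1" where
  "triv \<equiv> (\<lambda>T x y. id_PGL T)"

text \<open>\<open>R\<close> is initial among \<open>R\<close>-algebras. For the trivial covering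
  all vertices over a given \<open>T\<close> therefore coincide, which makes its Cech data
  constant.\<close>

lemma hom_X0:
  fixes T :: "'r alg"
  assumes "x \<in> alg_hom R X0 T"
  shows "x = (\<lambda>r\<in>carrier R. r \<odot>\<^bsub>T\<^esub> \<one>\<^bsub>T\<^esub>)"
proof (rule extensionalityI[of _ "carrier R"])
  interpret R: cring R by (rule base_ring)
  note xh = alg_homD[OF assms]
  show "x \<in> extensional (carrier R)" using xh(6) by simp
  fix r assume r: "r \<in> carrier R"
  have "x r = x (r \<odot>\<^bsub>X0\<^esub> \<one>\<^bsub>R\<^esub>)" using r by simp
  also have "\<dots> = r \<odot>\<^bsub>T\<^esub> \<one>\<^bsub>T\<^esub>" using xh(4) xh(5)[of r "\<one>\<^bsub>R\<^esub>"] r by simp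
  finally show "x r = (\<lambda>r\<in>carrier R. r \<odot>\<^bsub>T\<^esub> \<one>\<^bsub>T\<^esub>) r" using r by simp
qed simp

lemma structure_hom:
  fixes T :: "'r alg"
  assumes T: "algebra R T"
  shows "(\<lambda>r\<in>carrier R. r \<odot>\<^bsub>T\<^esub> \<one>\<^bsub>T\<^esub>) \<in> alg_hom R X0 T"
proof -
  interpret T: cring T by (rule algebraD(2)[OF T])
  interpret R: cring R by (rule base_ring)
  interpret algebra R T by (rule T)
  show ?thesis
  proof (rule alg_homI)
    fix r s assume rs: "r \<in> carrier X0" "s \<in> carrier X0"
    have "(r \<odot>\<^bsub>T\<^esub> \<one>\<^bsub>T\<^esub>) \<otimes>\<^bsub>T\<^esub> (s \<odot>\<^bsub>T\<^esub> \<one>\<^bsub>T\<^esub>) = (r \<otimes>\<^bsub>R\<^esub> s) \<odot>\<^bsub>T\<^esub> \<one>\<^bsub>T\<^esub>"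
      using rs smult_assoc2[of r "\<one>\<^bsub>T\<^esub>" "s \<odot>\<^bsub>T\<^esub> \<one>\<^bsub>T\<^esub>"] by (simp add: smult_assoc1)
    then show "(\<lambda>r\<in>carrier R. r \<odot>\<^bsub>T\<^esub> \<one>\<^bsub>T\<^esub>) (r \<otimes>\<^bsub>X0\<^esub> s)
        = (\<lambda>r\<in>carrier R. r \<odot>\<^bsub>T\<^esub> \<one>\<^bsub>T\<^esub>) r \<otimes>\<^bsub>T\<^esub> (\<lambda>r\<in>carrier R. r \<odot>\<^bsub>T\<^esub> \<one>\<^bsub>T\<^esub>) s"
      using rs by simp
  qed (auto simp: smult_l_distr smult_assoc1)
qed

lemma cover_X0: "cover_alg R X0"
  unfolding cover_alg_def using fppf_covering_id[OF algebra_X0] by blast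

lemma PGL_res_id_PGL:
  assumes "algebra R T" "algebra R T'" "f \<in> alg_hom R T T'"
  shows "PGL_res n T T' f (id_PGL T) = id_PGL T'"
  using base_hom.PGL_res_id[of R T T' f n] assms by (simp add: base_hom_def)

lemma id_PGL_compose:
  "algebra R T \<Longrightarrow> compose (carrier (mat_alg n T)) (id_PGL T) (id_PGL T) = id_PGL T"
  by (auto simp: compose_def fun_eq_iff)

lemma triv_Z1: "(X0, triv) \<in> Z1 R (PGL n)"
  unfolding Z1_def using cover_X0 id_PGL PGL_res_id_PGL id_PGL_compose by auto

text \<open>A point of \<open>P(A)\<close> over \<open>S\<close> corresponds to an automorphism
  \<open>t\<close> of the matrix algebra over \<open>S\<close>, and the cocycle it defines is the
  coboundary of the pullbacks of \<open>t\<close>. So every admissible cocycle is cohomologous to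
  the trivial one on the trivial covering, which is itself admissible.\<close>

lemma trivial_torsor_class: "torsor_class R n A = H1_equiv R (PGL n) `` {(X0, triv)}"
proof -
  let ?Y = "{(S, g) \<in> Z1 R (PGL n). \<exists>\<theta>\<in>torsor R n A S. \<forall>T. algebra R T \<longrightarrow>
       (\<forall>x\<in>alg_hom R S T. \<forall>y\<in>alg_hom R S T. \<forall>M\<in>carrier (mat_alg n T).
          torsor_res R n A S T x \<theta> (g T x y M) = torsor_res R n A S T y \<theta> M)}"
  have in_Y: "(X0, triv) \<in> ?Y"
  proof -
    have "torsor_res R n A X0 T x \<theta> (triv T x y M) = torsor_res R n A X0 T y \<theta> M"
      if "x \<in> alg_hom R X0 T" "y \<in> alg_hom R X0 T" "M \<in> carrier (mat_alg n T)" for T x y M \<theta>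
      using hom_X0[OF that(1)] hom_X0[OF that(2)] that(3) by simp
    then show ?thesis
      using triv_Z1 from_PGL[OF algebra_X0 id_PGL[OF algebra_X0]] by blast
  qed
  have Y_sub: "((X0, triv), (S, g)) \<in> H1_step R (PGL n)" if Sg: "(S, g) \<in> ?Y" for S g
  proof -
    have Z: "(S, g) \<in> Z1 R (PGL n)" using Sg by blast
    obtain \<theta> where \<theta>: "\<theta> \<in> torsor R n A S" and eq: "\<And>T x y M. algebra R T \<Longrightarrow> x \<in> alg_hom R S T \<Longrightarrow>
        y \<in> alg_hom R S T \<Longrightarrow> M \<in> carrier (mat_alg n T) \<Longrightarrow>
        torsor_res R n A S T x \<theta> (g T x y M) = torsor_res R n A S T y \<theta> M"
      using Sg by blast
    have S: "algebra R S" using Z unfolding Z1_def cover_alg_def fppf_covering_def by blast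
    define t where "t = to_PGL S \<theta>"
    have t: "t \<in> alg_iso S (mat_alg n S) (mat_alg n S)" unfolding t_def by (rule to_PGL[OF S \<theta>])
    define b where "b = (\<lambda>T x. PGL_res n S T x t)"
    have b: "b T x \<in> alg_iso T (mat_alg n T) (mat_alg n T)" if "algebra R T" "x \<in> alg_hom R S T" for T x
      unfolding b_def using base_hom.PGL_res(1)[of R S T x t n] S that t by (simp add: base_hom_def)
    have b_res: "PGL_res n T T' f (b T x) = b T' (compose (carrier S) f x)"
      if "algebra R T" "x \<in> alg_hom R S T" "algebra R T'" "f \<in> alg_hom R T T'" for T T' x f
      unfolding b_def using PGL_res_trans[of R S T x T' f t n] S that t by (simp add: base_hom_def)
    have cochain: "is_cochain0 R (PGL n) S b"
      unfolding is_cochain0_def using b b_res by simp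
    \<comment> \<open>The arbitrary \<open>u\<close> and \<open>v\<close> stand for the composites
      with the structure map of \<open>S\<close> that occur in \<open>H1_step\<close>;
      \<open>triv\<close> does not depend on them.\<close>
    have gb: "g T x y = inv\<^bsub>sect (PGL n) T\<^esub> (b T x) \<otimes>\<^bsub>sect (PGL n) T\<^esub> triv T u v \<otimes>\<^bsub>sect (PGL n) T\<^esub> b T y"
      if T: "algebra R T" and x: "x \<in> alg_hom R S T" and y: "y \<in> alg_hom R S T" for T x y and u v :: "'r \<Rightarrow> 'r"
    proof -
      interpret P: group "sect (PGL n) T" by (rule group_PGL[OF algebraD(2)[OF T]])
      have g: "g T x y \<in> carrier (sect (PGL n) T)" using Z T x y unfolding Z1_def by blast
      have bx: "b T x \<in> carrier (sect (PGL n) T)" and b_y: "b T y \<in> carrier (sect (PGL n) T)"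
        using b T x y by simp_all
      have tx: "to_PGL T (torsor_res R n A S T x \<theta>) = b T x" "to_PGL T (torsor_res R n A S T y \<theta>) = b T y"
        using torsor_res(2)[OF S T _ \<theta>] x y by (simp_all add: b_def t_def)
      have "compose (carrier (mat_alg n T)) (torsor_res R n A S T x \<theta>) (g T x y) = torsor_res R n A S T y \<theta>"
      proof -
        have "torsor_res R n A S T y \<theta> \<in> extensional (carrier (mat_alg n T))"
          using torsor_res(1)[OF S T y \<theta>] alg_homD(6)[OF alg_isoD(1)] by (simp add: torsor_def)
        then show ?thesis
          using eq[OF T x y] by (intro extensionalityI[of _ "carrier (mat_alg n T)"]) (auto simp: compose_eq)
      qed
      then have "b T x \<otimes>\<^bsub>sect (PGL n) T\<^esub> g T x y = b T y"
        using torsor_compose(2)[OF T torsor_res(1)[OF S T x \<theta>], of "g T x y"] g tx by simp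
      then have "g T x y = inv\<^bsub>sect (PGL n) T\<^esub> (b T x) \<otimes>\<^bsub>sect (PGL n) T\<^esub> b T y"
        using P.inv_solve_left[OF g bx b_y] by simp
      moreover have "inv\<^bsub>sect (PGL n) T\<^esub> (b T x) \<otimes>\<^bsub>sect (PGL n) T\<^esub> triv T u v = inv\<^bsub>sect (PGL n) T\<^esub> (b T x)"
        using P.r_one[OF P.inv_closed[OF bx]] by simp
      ultimately show ?thesis by simp
    qed
    show ?thesis
      unfolding H1_step_def using triv_Z1 Z structure_hom[OF S] cochain gb by blast
  qed
  have "torsor_class R n A = H1_equiv R (PGL n) `` ?Y" by (simp add: torsor_class_def)
  also have "\<dots> = H1_equiv R (PGL n) `` {(X0, triv)}"
  proof
    show "H1_equiv R (PGL n) `` {(X0, triv)} \<subseteq> H1_equiv R (PGL n) `` ?Y" using in_Y by blast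
    show "H1_equiv R (PGL n) `` ?Y \<subseteq> H1_equiv R (PGL n) `` {(X0, triv)}"
    proof
      fix z assume "z \<in> H1_equiv R (PGL n) `` ?Y"
      then obtain S g where "(S, g) \<in> ?Y" and z: "((S, g), z) \<in> H1_equiv R (PGL n)" by blast
      then show "z \<in> H1_equiv R (PGL n) `` {(X0, triv)}"
        using H1_equiv_props(4)[OF H1_equiv_props(2)[OF Y_sub] z] by blast
    qed
  qed
  finally show ?thesis .
qed

text \<open>The hypercovering of lifts of the trivial cocycle. Its edges are the lifts of the
  identity, that is, the invertible scalar matrices.\<close>

abbreviation K where "K \<equiv> lift_hypercover n X0 triv"

lemma K_simps [simp]:
  "verts K = X0" "eres K = (\<lambda>T T' f. mat_map n f)"
  "a \<in> edges K T x y \<longleftrightarrow> a \<in> Units (mat_alg n T) \<and> inner_aut n T a = id_PGL T"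
  by (auto simp: lift_hypercover_def fun_eq_iff)

text \<open>Conjugation by an edge is the identity, so the edge is a scalar matrix. Reading off the
  entry at \<open>(0, 0)\<close> identifies edges with units and turns the matrix cocycle into
  arithmetic in \<open>T\<close>.\<close>

lemma K_edge:
  assumes n: "n > 0" and T: "algebra R T" and a: "a \<in> edges K T x y"
  shows "a 0 0 \<in> Units T" "a = a 0 0 \<odot>\<^bsub>mat_alg n T\<^esub> \<one>\<^bsub>mat_alg n T\<^esub>"
proof -
  interpret T: cring T by (rule algebraD(2)[OF T])
  obtain t where t: "t \<in> Units T" "a = t \<odot>\<^bsub>mat_alg n T\<^esub> \<one>\<^bsub>mat_alg n T\<^esub>"
    using inner_aut_id[OF T.is_cring _ n, of a] a by auto
  moreover have "a 0 0 = t" using t n by (simp add: mat_smult_entry mat_one_entry T.Units_closed)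
  ultimately show "a 0 0 \<in> Units T" "a = a 0 0 \<odot>\<^bsub>mat_alg n T\<^esub> \<one>\<^bsub>mat_alg n T\<^esub>" by simp_all
qed

lemma K_edge_res:
  assumes n: "n > 0" and T: "algebra R T" "algebra R T'" "f \<in> alg_hom R T T'" and a: "a \<in> edges K T x y"
  shows "mat_map n f a \<in> edges K T' x' y'" "mat_map n f a 0 0 = f (a 0 0)"
  using base_hom.mm_Units[of R T T' f a n] PGL_res_id_PGL[OF T] T a n
  by (simp_all add: base_hom_def mat_map_entry)

text \<open>The three edges are scalar matrices, so the matrix \<open>a b c^-1\<close> is scalar
  with the indicated factor. Comparison of entries at \<open>(0, 0)\<close> shows that no other unit
  satisfies the description in \<open>lift_cocycle\<close>.\<close>

lemma lift_cocycle_K: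
  assumes n: "n > 0" and T: "algebra R T" and a: "a \<in> edges K T x y" and b: "b \<in> edges K T y z"
    and c: "c \<in> edges K T x z"
  shows "lift_cocycle n T x y z a b c = a 0 0 \<otimes>\<^bsub>T\<^esub> b 0 0 \<otimes>\<^bsub>T\<^esub> inv\<^bsub>T\<^esub> c 0 0"
proof -
  interpret T: cring T by (rule algebraD(2)[OF T])
  interpret M: ring "mat_alg n T" by (rule T.ring_mat_alg)
  note alg = T.mat_is_algebra[of n]
  interpret Mm: module T "mat_alg n T" by (rule is_algebraD(2)[OF alg])
  note e = K_edge[OF n T a] K_edge[OF n T b] K_edge[OF n T c]
  let ?t = "a 0 0 \<otimes>\<^bsub>T\<^esub> b 0 0 \<otimes>\<^bsub>T\<^esub> inv\<^bsub>T\<^esub> c 0 0"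
  have sc: "(r \<odot>\<^bsub>mat_alg n T\<^esub> \<one>\<^bsub>mat_alg n T\<^esub>) \<otimes>\<^bsub>mat_alg n T\<^esub> (s \<odot>\<^bsub>mat_alg n T\<^esub> \<one>\<^bsub>mat_alg n T\<^esub>)
      = (r \<otimes>\<^bsub>T\<^esub> s) \<odot>\<^bsub>mat_alg n T\<^esub> \<one>\<^bsub>mat_alg n T\<^esub>" if "r \<in> carrier T" "s \<in> carrier T" for r s
    using alg that by (simp add: is_algebra_def T.m_comm flip: Mm.smult_assoc1)
  have u: "a 0 0 \<in> carrier T" "b 0 0 \<in> carrier T" "inv\<^bsub>T\<^esub> c 0 0 \<in> carrier T" using e by auto
  have ic: "inv\<^bsub>sect (GL n) T\<^esub> c = inv\<^bsub>T\<^esub> c 0 0 \<odot>\<^bsub>mat_alg n T\<^esub> \<one>\<^bsub>mat_alg n T\<^esub>"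
  proof -
    have "inv\<^bsub>sect (GL n) T\<^esub> c = inv\<^bsub>mat_alg n T\<^esub> c"
      using M.units_of_inv[of c] c by (simp add: GL_def)
    then show ?thesis using inner_aut_scalar(3)[OF T.is_cring e(5), of n] e(6) by simp
  qed
  have t: "?t \<in> Units T" using e by (intro T.Units_m_closed T.Units_inv_Units)
  have prod: "?t \<odot>\<^bsub>mat_alg n T\<^esub> \<one>\<^bsub>mat_alg n T\<^esub>
      = a \<otimes>\<^bsub>sect (GL n) T\<^esub> b \<otimes>\<^bsub>sect (GL n) T\<^esub> inv\<^bsub>sect (GL n) T\<^esub> c"
    unfolding ic using e(2,4) u by (metis GL_simps(2) T.m_closed sc)
  have uniq: "s = ?t" if s: "s \<in> Units T"
      "s \<odot>\<^bsub>mat_alg n T\<^esub> \<one>\<^bsub>mat_alg n T\<^esub> = ?t \<odot>\<^bsub>mat_alg n T\<^esub> \<one>\<^bsub>mat_alg n T\<^esub>" for s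
    using fun_cong[OF fun_cong[OF s(2)], of 0 0] n s(1) t
    by (simp add: mat_smult_entry mat_one_entry T.Units_closed)
  show ?thesis
    unfolding lift_cocycle_def prod[symmetric]
    by (rule the_equality) (use t uniq in \<open>auto simp: Gm_def units_of_def\<close>)
qed

lemma Gm_simps [simp]:
  "carrier (sect Gm T) = Units T" "x \<otimes>\<^bsub>sect Gm T\<^esub> y = x \<otimes>\<^bsub>T\<^esub> y" "gres Gm T T' f = f"
  by (simp_all add: Gm_def units_of_def)

lemma alg_hom_Units:
  fixes T T' :: "'r alg"
  assumes T: "algebra R T" "algebra R T'" "f \<in> alg_hom R T T'" and t: "t \<in> Units T"
  shows "f t \<in> Units T'" "inv\<^bsub>T'\<^esub> f t = f (inv\<^bsub>T\<^esub> t)"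
proof -
  interpret base_hom R T T' f by (simp add: base_hom_def T)
  have c: "t \<in> carrier T" "inv\<^bsub>T\<^esub> t \<in> carrier T" "t \<otimes>\<^bsub>T\<^esub> inv\<^bsub>T\<^esub> t = \<one>\<^bsub>T\<^esub>" using t by auto
  then have 1: "f t \<otimes>\<^bsub>T'\<^esub> f (inv\<^bsub>T\<^esub> t) = \<one>\<^bsub>T'\<^esub>" by (simp flip: f_simps(3))
  then have 2: "f (inv\<^bsub>T\<^esub> t) \<otimes>\<^bsub>T'\<^esub> f t = \<one>\<^bsub>T'\<^esub>" using T'.m_comm[of "f t" "f (inv\<^bsub>T\<^esub> t)"] c by simp
  show "f t \<in> Units T'" unfolding Units_def using 1 2 f_simps(1)[OF c(1)] f_simps(1)[OF c(2)] by blast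
  show "inv\<^bsub>T'\<^esub> f t = f (inv\<^bsub>T\<^esub> t)" using T'.inv_char[OF _ _ 1 2] c by simp
qed

lemma K_hypercover:
  assumes n: "n > 0"
  shows "is_hypercover R K"
  unfolding is_hypercover_def
proof (intro conjI allI impI ballI)
  show "cover_alg R (verts K)" using cover_X0 by simp
  fix T :: "'r alg" and x y assume T: "algebra R T"
  show "eres K T T' f \<in> edges K T x y \<rightarrow> edges K T' (vert_res K f x) (vert_res K f y)"
    if "algebra R T' \<and> f \<in> alg_hom R T T'" for T' f
    using K_edge_res(1)[OF n T, of T' f _ x y] that by (simp del: K_simps(3))
  interpret T: cring T by (rule algebraD(2)[OF T])
  show "eres K T T (id_hom T) e = e" if "e \<in> edges K T x y" for e
    using that T.mat_inv(1)[of e n] by (intro mat_eqI[of _ n T _ T] ) (auto simp: mat_map_entry intro!: mat_map_closed)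
  show "eres K T' T'' f' (eres K T T' f e) = eres K T T'' (compose (carrier T) f' f) e"
    if e: "e \<in> edges K T x y" and h: "algebra R T' \<and> f \<in> alg_hom R T T' \<and> algebra R T'' \<and> f' \<in> alg_hom R T' T''"
    for e T' f T'' f'
  proof -
    have "e \<in> carrier (mat_alg n T)" using e T.mat_inv(1)[of e n] by simp
    then show ?thesis
      unfolding K_simps(2) mat_map_def by (intro restrict_ext) (simp add: compose_eq)
  qed
  \<comment> \<open>The identity matrix is an edge between any two vertices, so local surjectivity
    holds already on the trivial covering.\<close>
  have "\<one>\<^bsub>mat_alg n T\<^esub> \<in> edges K T x' y'" for x' y'
  proof -
    interpret M: ring "mat_alg n T" by (rule T.ring_mat_alg)
    show ?thesis by (auto simp: inner_aut_def intro!: restrict_ext)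
  qed
  then show "\<exists>C. fppf_covering R T C \<and>
      (\<forall>(T', f)\<in>C. edges K T' (vert_res K f x) (vert_res K f y) \<noteq> {})"
    using fppf_covering_id[OF T] by (intro exI[of _ "{(T, id_hom T)}"]) blast
qed

text \<open>An edge, regarded as a unit, is a tautological 1-cochain, and its coboundary is the
  cocycle \<open>a b c^-1\<close>.\<close>

lemma K_coboundary:
  assumes n: "n > 0"
  shows "is_coboundary2 R Gm K (lift_cocycle n)"
  unfolding is_coboundary2_def
proof (intro exI[of _ "\<lambda>T x y a. a 0 0"] conjI)
  show "is_ecochain1 R Gm K (\<lambda>T x y a. a 0 0)"
    unfolding is_ecochain1_def
  proof (intro allI impI ballI conjI)
    fix T x y a assume T: "algebra R T" and a: "a \<in> edges K T x y"
    show "a 0 0 \<in> carrier (sect Gm T)" unfolding Gm_simps by (rule K_edge(1)[OF n T a])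
    show "gres Gm T T' f (a 0 0) = eres K T T' f a 0 0" if "algebra R T' \<and> f \<in> alg_hom R T T'" for T' f
      unfolding Gm_simps K_simps(2)
      by (rule K_edge_res(2)[OF n T conjunct1[OF that] conjunct2[OF that] a, symmetric])
  qed
  show "\<forall>(T, x, y, z, a, b, c)\<in>triangles R K. lift_cocycle n T x y z a b c
      = b 0 0 \<otimes>\<^bsub>sect Gm T\<^esub> inv\<^bsub>sect Gm T\<^esub> (c 0 0) \<otimes>\<^bsub>sect Gm T\<^esub> a 0 0"
  proof clarify
    fix T x y z a b c assume t: "(T, x, y, z, a, b, c) \<in> triangles R K"
    then have T: "algebra R T" and e: "a \<in> edges K T x y" "b \<in> edges K T y z" "c \<in> edges K T x z"
      unfolding triangles_def by blast+
    interpret T: cring T by (rule algebraD(2)[OF T])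
    note u = K_edge(1)[OF n T e(1)] K_edge(1)[OF n T e(2)] K_edge(1)[OF n T e(3)]
    have i: "inv\<^bsub>sect Gm T\<^esub> (c 0 0) = inv\<^bsub>T\<^esub> c 0 0" using T.units_of_inv[OF u(3)] by (simp add: Gm_def)
    have "a 0 0 \<otimes>\<^bsub>T\<^esub> b 0 0 \<otimes>\<^bsub>T\<^esub> inv\<^bsub>T\<^esub> c 0 0 = b 0 0 \<otimes>\<^bsub>T\<^esub> inv\<^bsub>T\<^esub> c 0 0 \<otimes>\<^bsub>T\<^esub> a 0 0"
      using u by (simp add: T.m_ac T.Units_closed)
    then show "lift_cocycle n T x y z a b c = b 0 0 \<otimes>\<^bsub>sect Gm T\<^esub> inv\<^bsub>sect Gm T\<^esub> (c 0 0) \<otimes>\<^bsub>sect Gm T\<^esub> a 0 0"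
      unfolding i lift_cocycle_K[OF n T e] by simp
  qed
qed

lemma K_cocycle:
  assumes n: "n > 0"
  shows "(K, lift_cocycle n) \<in> Z2 R Gm"
proof -
  have w: "lift_cocycle n T x y z a b c = a 0 0 \<otimes>\<^bsub>T\<^esub> b 0 0 \<otimes>\<^bsub>T\<^esub> inv\<^bsub>T\<^esub> c 0 0"
    "algebra R T" "a 0 0 \<in> Units T" "b 0 0 \<in> Units T" "c 0 0 \<in> Units T"
    if "(T, x, y, z, a, b, c) \<in> triangles R K" for T x y z a b c
  proof -
    have T: "algebra R T" and e: "a \<in> edges K T x y" "b \<in> edges K T y z" "c \<in> edges K T x z"
      using that unfolding triangles_def by blast+
    show "lift_cocycle n T x y z a b c = a 0 0 \<otimes>\<^bsub>T\<^esub> b 0 0 \<otimes>\<^bsub>T\<^esub> inv\<^bsub>T\<^esub> c 0 0" by (rule lift_cocycle_K[OF n T e])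
    show "algebra R T" by (rule T)
    show "a 0 0 \<in> Units T" "b 0 0 \<in> Units T" "c 0 0 \<in> Units T"
      using K_edge(1)[OF n T] e by blast+
  qed
  have 1: "lift_cocycle n T x y z a b c \<in> Units T \<and>
      (\<forall>T' f. algebra R T' \<and> f \<in> alg_hom R T T' \<longrightarrow>
          f (lift_cocycle n T x y z a b c)
            = lift_cocycle n T' (vert_res K f x) (vert_res K f y) (vert_res K f z)
                (mat_map n f a) (mat_map n f b) (mat_map n f c))"
    if t: "(T, x, y, z, a, b, c) \<in> triangles R K" for T x y z a b c
  proof (intro conjI allI impI)
    have T: "algebra R T" and e: "a \<in> edges K T x y" "b \<in> edges K T y z" "c \<in> edges K T x z"
      using t unfolding triangles_def by blast+
    interpret T: cring T by (rule algebraD(2)[OF T])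
    note u = w(3-5)[OF t]
    show "lift_cocycle n T x y z a b c \<in> Units T"
      unfolding w(1)[OF t] using u by (intro T.Units_m_closed T.Units_inv_Units)
    fix T' :: "'r alg" and f assume T': "algebra R T' \<and> f \<in> alg_hom R T T'"
    note T' = conjunct1[OF T'] conjunct2[OF T']
    note r1 = K_edge_res[OF n T T' e(1)] and r2 = K_edge_res[OF n T T' e(2)] and r3 = K_edge_res[OF n T T' e(3)]
    have "f (a 0 0 \<otimes>\<^bsub>T\<^esub> b 0 0 \<otimes>\<^bsub>T\<^esub> inv\<^bsub>T\<^esub> c 0 0) = f (a 0 0) \<otimes>\<^bsub>T'\<^esub> f (b 0 0) \<otimes>\<^bsub>T'\<^esub> inv\<^bsub>T'\<^esub> f (c 0 0)"
      using u alg_hom_Units(2)[OF T T' u(3)] alg_homD(3)[OF T'(2)] by (simp add: T.Units_closed)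
    then show "f (lift_cocycle n T x y z a b c)
        = lift_cocycle n T' (vert_res K f x) (vert_res K f y) (vert_res K f z)
            (mat_map n f a) (mat_map n f b) (mat_map n f c)"
      unfolding w(1)[OF t] lift_cocycle_K[OF n T'(1) r1(1) r2(1) r3(1)] r1(2) r2(2) r3(2) .
  qed
  have 2: "lift_cocycle n T x1 x2 x3 e12 e23 e13 \<otimes>\<^bsub>T\<^esub> lift_cocycle n T x0 x1 x3 e01 e13 e03
      = lift_cocycle n T x0 x2 x3 e02 e23 e03 \<otimes>\<^bsub>T\<^esub> lift_cocycle n T x0 x1 x2 e01 e12 e02"
    if t: "(T, x0, x1, x2, e01, e12, e02) \<in> triangles R K" "(T, x0, x1, x3, e01, e13, e03) \<in> triangles R K"
      "(T, x0, x2, x3, e02, e23, e03) \<in> triangles R K" "(T, x1, x2, x3, e12, e23, e13) \<in> triangles R K"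
    for T x0 x1 x2 x3 e01 e02 e03 e12 e13 e23
  proof -
    interpret T: cring T by (rule algebraD(2)[OF w(2)[OF t(1)]])
    note u = w(3-5)[OF t(1)] w(3-5)[OF t(2)] w(3-5)[OF t(3)] w(3-5)[OF t(4)]
    note c = u[THEN T.Units_closed] u[THEN T.Units_inv_closed]
    \<comment> \<open>Removes the edge that occurs in both factors of a side of the cocycle
      identity: \<open>e13\<close> on the left, \<open>e02\<close> on the right.\<close>
    have cancel: "\<lbrakk>p \<in> Units T; q \<in> carrier T; r \<in> carrier T; s \<in> carrier T; t \<in> carrier T\<rbrakk> \<Longrightarrow>
        (q \<otimes>\<^bsub>T\<^esub> r \<otimes>\<^bsub>T\<^esub> inv\<^bsub>T\<^esub> p) \<otimes>\<^bsub>T\<^esub> (s \<otimes>\<^bsub>T\<^esub> p \<otimes>\<^bsub>T\<^esub> t) = q \<otimes>\<^bsub>T\<^esub> (r \<otimes>\<^bsub>T\<^esub> (s \<otimes>\<^bsub>T\<^esub> t))" for p q r s t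
    proof -
      assume a: "p \<in> Units T" "q \<in> carrier T" "r \<in> carrier T" "s \<in> carrier T" "t \<in> carrier T"
      have pc: "p \<in> carrier T" "inv\<^bsub>T\<^esub> p \<in> carrier T" using a by auto
      have "(q \<otimes>\<^bsub>T\<^esub> r \<otimes>\<^bsub>T\<^esub> inv\<^bsub>T\<^esub> p) \<otimes>\<^bsub>T\<^esub> (s \<otimes>\<^bsub>T\<^esub> p \<otimes>\<^bsub>T\<^esub> t)
          = (inv\<^bsub>T\<^esub> p \<otimes>\<^bsub>T\<^esub> p) \<otimes>\<^bsub>T\<^esub> (q \<otimes>\<^bsub>T\<^esub> (r \<otimes>\<^bsub>T\<^esub> (s \<otimes>\<^bsub>T\<^esub> t)))"
        using a(2-5) pc by (simp add: T.m_ac)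
      then show ?thesis using a by (simp add: T.Units_l_inv)
    qed
    have "lift_cocycle n T x1 x2 x3 e12 e23 e13 \<otimes>\<^bsub>T\<^esub> lift_cocycle n T x0 x1 x3 e01 e13 e03
        = e12 0 0 \<otimes>\<^bsub>T\<^esub> (e23 0 0 \<otimes>\<^bsub>T\<^esub> (e01 0 0 \<otimes>\<^bsub>T\<^esub> inv\<^bsub>T\<^esub> e03 0 0))"
      unfolding w(1)[OF t(4)] w(1)[OF t(2)] by (rule cancel[OF u(12)]) (use c in auto)
    moreover have "lift_cocycle n T x0 x2 x3 e02 e23 e03 \<otimes>\<^bsub>T\<^esub> lift_cocycle n T x0 x1 x2 e01 e12 e02
        = e01 0 0 \<otimes>\<^bsub>T\<^esub> (e12 0 0 \<otimes>\<^bsub>T\<^esub> (e23 0 0 \<otimes>\<^bsub>T\<^esub> inv\<^bsub>T\<^esub> e03 0 0))"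
    proof -
      have "lift_cocycle n T x0 x2 x3 e02 e23 e03 \<otimes>\<^bsub>T\<^esub> lift_cocycle n T x0 x1 x2 e01 e12 e02
          = (e01 0 0 \<otimes>\<^bsub>T\<^esub> e12 0 0 \<otimes>\<^bsub>T\<^esub> inv\<^bsub>T\<^esub> e02 0 0) \<otimes>\<^bsub>T\<^esub> (e23 0 0 \<otimes>\<^bsub>T\<^esub> e02 0 0 \<otimes>\<^bsub>T\<^esub> inv\<^bsub>T\<^esub> e03 0 0)"
        unfolding w(1)[OF t(3)] w(1)[OF t(1)] using c by (simp add: T.m_comm)
      also have "\<dots> = e01 0 0 \<otimes>\<^bsub>T\<^esub> (e12 0 0 \<otimes>\<^bsub>T\<^esub> (e23 0 0 \<otimes>\<^bsub>T\<^esub> inv\<^bsub>T\<^esub> e03 0 0))"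
        by (rule cancel[OF u(3)]) (use c in auto)
      finally show ?thesis .
    qed
    ultimately show ?thesis using c(1-12) c(18) by (simp add: T.m_lcomm)
  qed
  have 3: "is_hypercover R K" by (rule K_hypercover[OF n])
  have "\<forall>(T, x, y, z, a, b, c)\<in>triangles R K. lift_cocycle n T x y z a b c \<in> carrier (sect Gm T) \<and>
       (\<forall>T' f. algebra R T' \<and> f \<in> alg_hom R T T' \<longrightarrow>
          gres Gm T T' f (lift_cocycle n T x y z a b c)
            = lift_cocycle n T' (vert_res K f x) (vert_res K f y) (vert_res K f z)
                (eres K T T' f a) (eres K T T' f b) (eres K T T' f c))"
    unfolding Gm_simps K_simps(2) using 1 by (intro ballI) (clarify, blast)
  then show ?thesis
    unfolding Z2_def using 2 3 by (simp only: mem_Collect_eq prod.case Gm_simps) blast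
qed

end

section \<open>The group presented by 2-cocycles and its unit class\<close>

lemma subgroup_H2_relations: "subgroup (H2_relations R F) (H2_free R F)"
  unfolding H2_relations_def
proof (rule group.generate_is_subgroup)
  show "group (H2_free R F)" by (simp add: H2_free_def)
  have diff: "x - y \<in> carrier (H2_free R F)" if "x \<in> carrier (H2_free R F)" "y \<in> carrier (H2_free R F)" for x y
    using that keys_diff[of x y] by (auto simp: H2_free_def carrier_free_Abelian_group_iff)
  have single: "frag_of x \<in> carrier (H2_free R F)" if "x \<in> Z2 R F" for x
    using that by (simp add: H2_free_def carrier_free_Abelian_group_iff)
  show "{frag_of (K, w'') - frag_of (K, w) - frag_of (K, w') | K w w' w''.
        (K, w) \<in> Z2 R F \<and> (K, w') \<in> Z2 R F \<and> (K, w'') \<in> Z2 R F \<and>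
        (\<forall>(T, x, y, z, a, b, c)\<in>triangles R K.
           w'' T x y z a b c = w T x y z a b c \<otimes>\<^bsub>sect F T\<^esub> w' T x y z a b c)} \<union>
     {frag_of (K, w) | K w. (K, w) \<in> Z2 R F \<and> is_coboundary2 R F K w} \<union>
     {frag_of (K', w') - frag_of (K, w) | K w K' w'.
        (K, w) \<in> Z2 R F \<and> (K', w') \<in> Z2 R F \<and> is_pullback2 R K w K' w'}
    \<subseteq> carrier (H2_free R F)"
    by (auto intro!: diff single)
qed

lemma group_H2: "group (H2 R F)"
proof -
  interpret comm_group "H2_free R F" by (simp add: H2_free_def abelian_free_Abelian_group)
  show ?thesis
    unfolding H2_def
    by (rule normal.factorgroup_is_group[OF subgroup_imp_normal[OF subgroup_H2_relations]])
qed

lemma H2_class_coboundary: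
  assumes "(K, w) \<in> Z2 R F" "is_coboundary2 R F K w"
  shows "H2_class R F K w = \<one>\<^bsub>H2 R F\<^esub>"
proof -
  interpret group "H2_free R F" by (simp add: H2_free_def)
  have "frag_of (K, w) \<in> H2_relations R F"
    unfolding H2_relations_def using assms by (intro generate.incl) blast
  then show ?thesis
    unfolding H2_class_def H2_def using subgroup.rcos_const[OF subgroup_H2_relations is_group]
    by (simp add: FactGroup_def)
qed

lemma one_Br:
  "\<one>\<^bsub>H2 R Gm\<^esub> \<in> carrier (Br R)" "\<one>\<^bsub>H2 R Gm\<^esub> \<in> Br_tors R m"
proof -
  interpret group "H2 R Gm" by (rule group_H2)
  have "\<one>\<^bsub>H2 R Gm\<^esub> [^]\<^bsub>H2 R Gm\<^esub> (1::nat) = \<one>\<^bsub>H2 R Gm\<^esub>" by (rule nat_pow_one)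
  then show 1: "\<one>\<^bsub>H2 R Gm\<^esub> \<in> carrier (Br R)" by (auto simp: Br_def)
  show "\<one>\<^bsub>H2 R Gm\<^esub> \<in> Br_tors R m"
    using 1 nat_pow_one[of m] unfolding Br_tors_def Br_def
    by (simp flip: nat_pow_consistent)
qed

context split_segre
begin

lemma Z1_G_pp: "x \<in> Z1 R (G_pp R p) \<Longrightarrow> x \<in> Z1 R (PGL n)"
  unfolding Z1_def by (auto simp: G_iso)

lemma H1_step_G_pp:
  assumes "z \<in> H1_step R (G_pp R p)"
  shows "z \<in> H1_step R (PGL n)"
proof -
  obtain S g S' g' h b where z: "z = ((S, g), (S', g'))" "(S, g) \<in> Z1 R (G_pp R p)" "(S', g') \<in> Z1 R (G_pp R p)"
    and h: "h \<in> alg_hom R S S'" "is_cochain0 R (G_pp R p) S' b"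
    and eq: "\<forall>T. algebra R T \<longrightarrow> (\<forall>x\<in>alg_hom R S' T. \<forall>y\<in>alg_hom R S' T.
         g' T x y = inv\<^bsub>sect (G_pp R p) T\<^esub> (b T x) \<otimes>\<^bsub>sect (G_pp R p) T\<^esub>
           g T (compose (carrier S) x h) (compose (carrier S) y h) \<otimes>\<^bsub>sect (G_pp R p) T\<^esub> b T y)"
    using assms unfolding H1_step_def by blast
  have bG: "b T x \<in> G T" if "algebra R T" "x \<in> alg_hom R S' T" for T x
    using h(2) that unfolding is_cochain0_def by blast
  have "is_cochain0 R (PGL n) S' b"
    using h(2) unfolding is_cochain0_def by (auto simp: G_iso)
  moreover have "\<forall>T. algebra R T \<longrightarrow> (\<forall>x\<in>alg_hom R S' T. \<forall>y\<in>alg_hom R S' T.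
         g' T x y = inv\<^bsub>sect (PGL n) T\<^esub> (b T x) \<otimes>\<^bsub>sect (PGL n) T\<^esub>
           g T (compose (carrier S) x h) (compose (carrier S) y h) \<otimes>\<^bsub>sect (PGL n) T\<^esub> b T y)"
    using eq group_G(3)[OF _ bG] by simp
  ultimately show ?thesis
    unfolding H1_step_def z(1) using Z1_G_pp z(2,3) h(1) by blast
qed

lemma H1_equiv_G_pp:
  assumes "(x, y) \<in> H1_equiv R (G_pp R p)"
  shows "(x, y) \<in> H1_equiv R (PGL n)"
proof -
  have "H1_step R (G_pp R p) \<union> (H1_step R (G_pp R p))\<inverse> \<subseteq> H1_step R (PGL n) \<union> (H1_step R (PGL n))\<inverse>"
    using H1_step_G_pp by auto
  then show ?thesis using assms unfolding H1_equiv_def by (meson rtrancl_mono subsetD)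
qed

lemma triv_Z1_G_pp: "(X0, triv) \<in> Z1 R (G_pp R p)"
  unfolding Z1_def using cover_X0 G_one PGL_res_id_PGL id_PGL_compose by auto

text \<open>The trivial cocycle represents the class, and its cocycle of lifts is a coboundary, so
  the connecting map takes the unit as a value there.\<close>

lemma connecting: "is_connecting R n (H1_equiv R (PGL n) `` {(X0, triv)}) \<one>\<^bsub>H2 R Gm\<^esub>"
  unfolding is_connecting_def
proof (intro conjI)
  show "H1_equiv R (PGL n) `` {(X0, triv)} \<in> H1 R (PGL n)"
    unfolding H1_def by (rule quotientI[OF triv_Z1])
  show "\<one>\<^bsub>H2 R Gm\<^esub> \<in> carrier (H2 R Gm)" by (rule monoid.one_closed[OF group.is_monoid[OF group_H2]])
  show "\<exists>(S, g)\<in>H1_equiv R (PGL n) `` {(X0, triv)}.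
      \<one>\<^bsub>H2 R Gm\<^esub> = H2_class R Gm (lift_hypercover n S g) (lift_cocycle n)"
    using H2_class_coboundary[OF K_cocycle[OF n_pos] K_coboundary[OF n_pos]] H1_equiv_props(1)
    by (intro bexI[of _ "(X0, triv)"]) auto
qed

text \<open>The trivial cocycle takes values in \<open>G_pp\<close>. Its class for that group maps
  to its class for \<open>PGL\<close>, because relations between \<open>G_pp\<close>-cocycles remain
  relations between \<open>PGL\<close>-cocycles; this class is also the class of
  \<open>P(A)\<close>.\<close>

lemma split_brauer_class:
  "is_brauer_class R n A \<one>\<^bsub>H2 R Gm\<^esub>" "\<one>\<^bsub>H2 R Gm\<^esub> \<in> Br_pp R p"
proof -
  show "is_brauer_class R n A \<one>\<^bsub>H2 R Gm\<^esub>"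
    unfolding is_brauer_class_def trivial_torsor_class by (rule connecting)
  let ?\<xi> = "H1_equiv R (G_pp R p) `` {(X0, triv)}"
  have \<xi>: "?\<xi> \<in> H1 R (G_pp R p)" unfolding H1_def by (rule quotientI[OF triv_Z1_G_pp])
  have "H1_incl R (PGL n) ?\<xi> = H1_equiv R (PGL n) `` {(X0, triv)}"
    unfolding H1_incl_def
  proof
    show "H1_equiv R (PGL n) `` ?\<xi> \<subseteq> H1_equiv R (PGL n) `` {(X0, triv)}"
    proof
      fix z assume "z \<in> H1_equiv R (PGL n) `` ?\<xi>"
      then obtain y where "((X0, triv), y) \<in> H1_equiv R (G_pp R p)" "(y, z) \<in> H1_equiv R (PGL n)" by blast
      then show "z \<in> H1_equiv R (PGL n) `` {(X0, triv)}"
        using H1_equiv_props(4)[OF H1_equiv_G_pp] by blast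
    qed
    show "H1_equiv R (PGL n) `` {(X0, triv)} \<subseteq> H1_equiv R (PGL n) `` ?\<xi>"
      using H1_equiv_props(1) by blast
  qed
  then show "\<one>\<^bsub>H2 R Gm\<^esub> \<in> Br_pp R p"
    unfolding Br_pp_def using one_Br(1) connecting by (auto intro!: bexI[OF _ \<xi>])
qed

end

section \<open>The two-dimensional torus\<close>

lemma laurent_const_simps [simp]:
  "laurent_const x * laurent_const y = laurent_const (x * y)" "laurent_const x + laurent_const y = laurent_const (x + y)"
  "laurent_const 1 = 1" "laurent_const 0 = 0"
  by (simp_all add: laurent_const_def mult_single single_add)

lemma laurent_const_power [simp]: "laurent_const x ^ m = laurent_const (x ^ m)"
  by (induction m) simp_all

lemma laurent_const_of_nat: "of_nat m = laurent_const (of_nat m)"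
  by (simp add: laurent_const_def)

lemma laurent_const_sum: "(\<Sum>i\<in>I. laurent_const (f i)) = laurent_const (\<Sum>i\<in>I. f i)"
  by (induction I rule: infinite_finite_induct) simp_all

text \<open>For \<open>b\<close> different from \<open>c\<close> the summand is a power of a
  \<open>p\<close>-th root of unity other than \<open>1\<close>, since the powers of
  \<open>\<zeta>\<close> with exponents below \<open>p\<close> are distinct; the geometric sum then
  vanishes.\<close>

lemma root_of_unity_sum:
  fixes \<zeta> :: "'k::field"
  assumes z: "\<zeta> ^ p = 1" "\<forall>m. 0 < m \<and> m < p \<longrightarrow> \<zeta> ^ m \<noteq> 1" and bc: "b < p" "c < p"
  shows "(\<Sum>j<p. (\<zeta> ^ b * inverse \<zeta> ^ c) ^ j) = (if b = c then of_nat p else 0)"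
proof -
  have nz: "\<zeta> \<noteq> 0" using z(1) bc by (cases "\<zeta> = 0") (auto simp: power_0_left)
  let ?x = "\<zeta> ^ b * inverse \<zeta> ^ c"
  show ?thesis
  proof (cases "b = c")
    case True
    then have "?x = 1" using nz by (simp add: power_inverse)
    then show ?thesis using True by simp
  next
    case False
    have inj: "\<zeta> ^ i \<noteq> \<zeta> ^ j" if "i < j" "j < p" for i j
    proof
      assume "\<zeta> ^ i = \<zeta> ^ j"
      also have "\<dots> = \<zeta> ^ i * \<zeta> ^ (j - i)" using that by (simp flip: power_add)
      finally have "\<zeta> ^ (j - i) = 1" using nz by simp
      then show False using z(2) that by simp
    qed
    have x1: "?x \<noteq> 1"
    proof
      assume "?x = 1"
      then have "\<zeta> ^ b = \<zeta> ^ c" using nz by (simp add: power_inverse field_simps)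
      then show False using inj[of b c] inj[of c b] bc False by (cases b c rule: linorder_cases) auto
    qed
    have "?x ^ p = (\<zeta> ^ p) ^ b * inverse ((\<zeta> ^ p) ^ c)"
      by (simp add: power_mult_distrib power_inverse mult.commute flip: power_mult)
    then have "?x ^ p = 1" using z by simp
    then have "(\<Sum>j<p. ?x ^ j) = 0" using geometric_sum[OF x1, of p] by simp
    then show ?thesis using False by simp
  qed
qed

lemma symbol_split_torus:
  fixes \<zeta> t :: "'k :: {alg_closed_field, field_char_0}"
  assumes p: "p > 0" and z: "\<zeta> ^ p = 1" "\<forall>m. 0 < m \<and> m < p \<longrightarrow> \<zeta> ^ m \<noteq> 1" and t: "t \<noteq> 0"
    and s: "s * s' = (1 :: 'k laurent2)"
  shows "is_algebra torus (symbol_algebra torus p (laurent_const \<zeta>) s (laurent_const t)) \<and>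
    alg_iso torus (symbol_algebra torus p (laurent_const \<zeta>) s (laurent_const t)) (mat_alg p torus) \<noteq> {}"
proof -
  \<comment> \<open>Algebraic closedness of \<open>k\<close> enters here: the \<open>p\<close>-th
    root of \<open>t\<close> makes \<open>y\<close> act by a diagonal matrix, so the symbol algebra
    splits without adjoining a root of the coordinate \<open>s\<close>.\<close>
  obtain \<alpha> where \<alpha>: "\<alpha> ^ p = t" using nth_root_exists[OF p, of t] by blast
  have nz: "\<alpha> \<noteq> 0" "\<zeta> \<noteq> 0" using \<alpha> t z p by (auto simp: power_0_left)
  interpret symbol_split p "laurent_const \<zeta>" "laurent_const (inverse \<zeta>)" "laurent_const \<alpha>"
    "laurent_const (inverse \<alpha>)" s s' "laurent_const t" "laurent_const (inverse (of_nat p))"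
    using nz z s p \<alpha> root_of_unity_sum[OF z]
    by unfold_locales (auto simp: laurent_const_of_nat laurent_const_sum)
  show ?thesis using symbol_algebra_split by (simp add: torus_def)
qed

lemma laurent_const_Units:
  fixes x :: "'k::field"
  assumes "x \<noteq> 0"
  shows "laurent_const x \<in> Units torus"
  unfolding Units_def using assms
  by (auto simp: torus_def intro!: exI[of _ "laurent_const (inverse x)"])

theorem proposition4p16:
  fixes p :: nat and a b \<zeta> :: "'k :: {alg_closed_field, field_char_0}"
  defines "R \<equiv> (torus :: 'k laurent2 ring)"
  defines "A_u \<equiv> symbol_algebra R p (laurent_const \<zeta>) coord_u (laurent_const a)"
  defines "A_v \<equiv> symbol_algebra R p (laurent_const \<zeta>) coord_v (laurent_const b)"
  defines "A \<equiv> tensor_algebra R A_u A_v"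
  assumes "Factorial_Ring.prime p" and "a \<noteq> 0" and "b \<noteq> 0"
    and "\<zeta> ^ p = 1" and "\<forall>m. 0 < m \<and> m < p \<longrightarrow> \<zeta> ^ m \<noteq> 1"
  shows "azumaya R (p\<^sup>2) A \<and>
    (\<exists>Q. is_subsystem_structure R p A Q) \<and>
    (\<exists>\<beta>. is_brauer_class R (p\<^sup>2) A \<beta> \<and> \<beta> \<in> Br_tors R p \<and> \<beta> \<in> Br_pp R p)"
proof -
  have p: "p > 0" using assms(5) by (rule prime_gt_0_nat)
  \<comment> \<open>The coordinates are invertible functions on the torus; their inverses are the
    monomials with exponent \<open>-1\<close>.\<close>
  have inv: "coord_u * Poly_Mapping.single (- 1, 0) 1 = (1 :: 'k laurent2)"
    "coord_v * Poly_Mapping.single (0, - 1) 1 = (1 :: 'k laurent2)"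
    by (simp_all add: coord_u_def coord_v_def mult_single zero_prod_def flip: single_one)
  have u: "is_algebra R A_u" "alg_iso R A_u (mat_alg p R) \<noteq> {}"
    and v: "is_algebra R A_v" "alg_iso R A_v (mat_alg p R) \<noteq> {}"
    using symbol_split_torus[OF p assms(8,9) \<open>a \<noteq> 0\<close> inv(1)] symbol_split_torus[OF p assms(8,9) \<open>b \<noteq> 0\<close> inv(2)]
    by (simp_all add: R_def A_u_def A_v_def)
  obtain \<phi>u \<phi>v where "\<phi>u \<in> alg_iso R A_u (mat_alg p R)" "\<phi>v \<in> alg_iso R A_v (mat_alg p R)"
    using u v by blast
  from tensor_algebra_split[OF u(1) this(1) v(1) this(2)]
  obtain \<phi> where A: "is_algebra R A" "\<phi> \<in> alg_iso R A (mat_alg (p * p) R)" by (auto simp: A_def)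
  have cR: "cring R" by (simp add: R_def torus_def cring_type_ring)
  \<comment> \<open>In characteristic 0 every positive integer is invertible in \<open>k\<close>,
    hence in \<open>R\<close>. This is needed for \<open>2\<close> and for
    \<open>p * p\<close>.\<close>
  have unit: "(\<Oplus>\<^bsub>R\<^esub>i\<in>{..<m}. \<one>\<^bsub>R\<^esub>) \<in> Units R" if "m > 0" for m :: nat
    using laurent_const_Units[of "of_nat m :: 'k"] that
    by (simp add: R_def torus_def laurent_const_of_nat)
  \<comment> \<open>The constants already make the type infinite, since a field of characteristic 0
    contains the integers.\<close>
  have "inj (laurent_const :: 'k \<Rightarrow> 'k laurent2)" by (simp add: laurent_const_def[abs_def])
  then have inf: "infinite (UNIV :: 'k laurent2 set)"
    using infinite_UNIV_char_0[where 'a = 'k] finite_imageD[of laurent_const UNIV] finite_subset[OF subset_UNIV]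
    by blast
  interpret split_segre R p A \<phi>
    using cR p inf unit A by (intro split_segre.intro segre_group.intro split_torsor.intro) simp_all
  show ?thesis
    unfolding power2_eq_square
    using azumaya_split subsystem_structure split_brauer_class one_Br(2)[of R p] by blast
qed

end
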